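(* Let $\mathbf{L}$ be an invertible $(D\times D)$ MDO, $\|\cdot\|_{\mathcal{Z}}$ a monotone norm on $\mathbb{R}^D$ with dual norm $\|\cdot\|_{\mathcal{Z}'}$, $\|\cdot\|_{\mathcal{Y}}$ a norm on $\mathbb{R}^N$ with dual norm $\|\cdot\|_{\mathcal{Y}'}$, where $N=\dim\mathcal{N}_{\mathbf{L}}$, and $(\mathbf{p},\boldsymbol{\phi})$ an $\mathbf{L}$-admissible system. Then the following hold. 1. $\mathcal{M}_{\mathbf{L}}(\mathbb{R},\mathbb{R}^D)$ is a Banach space for the norm $$\|\mathbf{f}\|_{\mathcal{M}_{\mathbf{L}}}=\|\mathbf{L}\{\mathbf{f}\}\|_{\mathcal{Z}',\mathcal{M}}+\big\|(\langle\mathbf{f},\boldsymbol{\phi}_n\rangle)_{n=1}^N\big\|_{\mathcal{Y}'},$$ and likewise for the norm obtained by replacing $\|\cdot\|_{\mathcal{Z}',\mathcal{M}}$ by $\|\cdot\|_{\mathcal{M},\mathcal{Z}'}$. 2. $\mathcal{M}_{\mathbf{L}}(\mathbb{R},\mathbb{R}^D)$ admits the predual $\mathcal{C}_{\mathbf{L}}(\mathbb{R},\mathbb{R}^D)$: it is the topological dual of $\mathcal{C}_{\mathbf{L}}(\mathbb{R},\mathbb{R}^D)$, where $\mathcal{C}_{\mathbf{L}}$ carries the norm $\max(\|\mathbf{v}\|_{\mathcal{Z},\infty},\|\mathbf{a}\|_{\mathcal{Y}})$ (respectively $\max(\|\mathbf{v}\|_{\infty,\mathcal{Z}},\|\mathbf{a}\|_{\mathcal{Y}})$)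 when $\mathcal{M}_{\mathbf{L}}$ carries the first (respectively the second) norm of item 1. 3. All seminorms on $\mathcal{M}_{\mathbf{L}}(\mathbb{R},\mathbb{R}^D)$ of the form $\|\mathbf{L}\{\cdot\}\|_{\mathcal{M},\mathcal{Z}'}$ or $\|\mathbf{L}\{\cdot\}\|_{\mathcal{Z}',\mathcal{M}}$ (for possibly different choices of the monotone norm) are equivalent. Moreover, the seminorms $\|\mathbf{L}\{\cdot\}\|_{1,\mathcal{M}}$ and $\|\mathbf{L}\{\cdot\}\|_{\mathcal{M},1}$ are equal. 4. The extreme points of the ball $\{[\mathbf{f}]\in\mathcal{M}_{\mathbf{L}}(\mathbb{R},\mathbb{R}^D)/\mathcal{N}_{\mathbf{L}}:\ \|\mathbf{L}\{\mathbf{f}\}\|_{\mathcal{M},\mathcal{Z}'}\le1\}$ are all of the form $$[\mathbf{e}]=\mathbf{G}_{\mathbf{L}}\ast(\mathbf{w}\odot\boldsymbol{\delta}_{\mathbf{x}})+\mathcal{N}_{\mathbf{L}},\qquad \mathbf{x}\in\mathbb{R}^D,$$ where $\mathbf{w}$, with $\|\mathbf{w}\|_{\mathcal{Z}'}=1$, is an extreme point of the centered unit ball of $\mathcal{Z}'$. Correspondingly, if $\mathbf{f}=\sum_{k=1}^K\mathbf{G}_{\mathbf{L}}\ast(\mathbf{a}_k\odot\boldsymbol{\delta}_{\mathbf{x}_k})+\mathbf{q}$ with $\mathbf{a}_k,\mathbf{x}_k\in\mathbb{R}^D$, $\mathbf{q}\in\mathcal{N}_{\mathbf{L}}$, and $[\mathbf{x}_k]_d\neq[\mathbf{x}_{k'}]_d$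 for all $d$ and all $k\ne k'$, then $$\|\mathbf{L}\{\mathbf{f}\}\|_{\mathcal{M},\mathcal{Z}'}=\Big\|\Big(\sum_{k=1}^K|[\mathbf{a}_k]_d|\Big)_{d=1}^D\Big\|_{\mathcal{Z}'}.$$ 5. The extreme points of the ball $\{[\mathbf{f}]\in\mathcal{M}_{\mathbf{L}}(\mathbb{R},\mathbb{R}^D)/\mathcal{N}_{\mathbf{L}}:\ \|\mathbf{L}\{\mathbf{f}\}\|_{\mathcal{Z}',\mathcal{M}}\le1\}$ are all of the form $$[\mathbf{e}]=\mathbf{G}_{\mathbf{L}}\ast(\mathbf{w}\,\delta_{x})+\mathcal{N}_{\mathbf{L}},\qquad x\in\mathbb{R},$$ where $\mathbf{w}$, with $\|\mathbf{w}\|_{\mathcal{Z}'}=1$, is an extreme point of the centered unit ball of $\mathcal{Z}'$. Correspondingly, if $\mathbf{f}=\sum_{k=1}^K\mathbf{G}_{\mathbf{L}}\ast(\mathbf{a}_k\delta_{x_k})+\mathbf{q}$ with $\mathbf{a}_k\in\mathbb{R}^D$, $x_k\in\mathbb{R}$, $\mathbf{q}\in\mathcal{N}_{\mathbf{L}}$, and $x_k\ne x_{k'}$ for $k\neq k'$, then $$\|\mathbf{L}\{\mathbf{f}\}\|_{\mathcal{Z}',\mathcal{M}}=\sum_{k=1}^K\|\mathbf{a}_k\|_{\mathcal{Z}'}.$$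
   Context: Operators. An ordinary differential operator (ODO) is $\sum_{n}a_n\mathrm{D}^n$ (finite sum, real constants $a_n$) acting on $\mathcal{D}'(\mathbb{R})$. A $(D\times D)$ MDO is a matrix $\mathbf{L}=(\mathrm{L}_{r,c})$ of ODOs acting by $[\mathbf{L}\{\mathbf{f}\}]_r=\sum_d\mathrm{L}_{r,d}\{f_d\}$ (column by column on matrices). Its determinant $\det(\mathbf{L})$ is the ODO obtained from the Leibniz formula with products replaced by compositions; $\mathbf{L}$ is invertible if $\det(\mathbf{L})\neq0$. The adjoint has entries $[\mathbf{L}^\star]_{r,c}=\mathrm{L}_{c,r}^\star$, $(\mathrm{D}^n)^\star=(-1)^n\mathrm{D}^n$. For an invertible MDO, $\mathbf{G}_{\mathbf{L}}$ is its unique causal (supported in $[0,\infty)$) Green's matrix: $\mathbf{G}_{\mathbf{L}}\in\mathcal{D}'(\mathbb{R},\mathbb{R}^{D\times D})$, $\mathbf{L}\{\mathbf{G}_{\mathbf{L}}\}=\mathbf{I}\delta$. The null space is $\mathcal{N}_{\mathbf{L}}=\{\mathbf{q}\in\mathcal{D}'(\mathbb{R},\mathbb{R}^D):\mathbf{L}\{\mathbf{q}\}=\mathbf{0}\}$, of dimension $N=\deg(\det(\mathbf{L}))$ as a polynomial in $\mathrm{D}$. Measures. $\mathcal{M}(\mathbb{R})$ is the space of finite signed Radon measures with total-variation norm $\|\cdot\|_{\mathcal{M}}$, and $\mathcal{M}(\mathbb{R},\mathbb{R}^D)=\mathcal{M}(\mathbb{R})^D$. Outer norm: $\|\boldsymbol{\mu}\|_{\mathcal{M},\mathcal{Z}'}=\|(\|[\boldsymbol{\mu}]_d\|_{\mathcal{M}})_{d=1}^D\|_{\mathcal{Z}'}$.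 Inner norm: $\|\boldsymbol{\mu}\|_{\mathcal{Z}',\mathcal{M}}=\sup_\pi\sum_{E\in\pi}\|\boldsymbol{\mu}(E)\|_{\mathcal{Z}'}$, supremum over finite (measurable) partitions $\pi$ of $\mathbb{R}$. For $\|\cdot\|_{\mathcal{Z}'}=\|\cdot\|_1$ these are written $\|\cdot\|_{\mathcal{M},1}$ and $\|\cdot\|_{1,\mathcal{M}}$. A norm on $\mathbb{R}^D$ is monotone if $|w_d|\le|v_d|$ for all $d$ implies $\|\mathbf{w}\|\le\|\mathbf{v}\|$ (the dual of a monotone norm is monotone). $\mathcal{Z}'=(\mathbb{R}^D,\|\cdot\|_{\mathcal{Z}'})$. $\odot$ is the componentwise product, and $[\boldsymbol{\delta}_{\mathbf{x}}]_d=\delta(\cdot-[\mathbf{x}]_d)$. Native space. $\mathcal{M}_{\mathbf{L}}(\mathbb{R},\mathbb{R}^D)=\{\mathbf{f}\in\mathcal{D}'(\mathbb{R},\mathbb{R}^D):\mathbf{L}\{\mathbf{f}\}\in\mathcal{M}(\mathbb{R},\mathbb{R}^D)\}$. An $\mathbf{L}$-admissible system $(\mathbf{p},\boldsymbol{\phi})$ consists of a basis $(\mathbf{p}_n)_{n=1}^N$ of $\mathcal{N}_{\mathbf{L}}$ and functions $\boldsymbol{\phi}_n\in\mathcal{D}(\mathbb{R},\mathbb{R}^D)$ (smooth, compactly supported) with $\langle\mathbf{p}_n,\boldsymbol{\phi}_m\rangle=\delta_{m,n}$ and all components supported in $[0,\phi^+]$ for a common $\phi^+\ge0$. Predual. $\mathcal{C}_0(\mathbb{R},\mathbb{R}^D)$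 is the space of continuous functions vanishing at infinity, with the norms $\|\mathbf{g}\|_{\mathcal{Z},\infty}=\sup_x\|\mathbf{g}(x)\|_{\mathcal{Z}}$ and $\|\mathbf{g}\|_{\infty,\mathcal{Z}}=\|(\sup_x|[\mathbf{g}(x)]_d|)_{d=1}^D\|_{\mathcal{Z}}$. $\mathcal{C}_{\mathbf{L}}(\mathbb{R},\mathbb{R}^D)=\{\mathbf{L}^\star\{\mathbf{v}\}+\sum_{n=1}^Na_n\boldsymbol{\phi}_n:\mathbf{v}\in\mathcal{C}_0(\mathbb{R},\mathbb{R}^D),\ \mathbf{a}=(a_n)\in\mathbb{R}^N\}$, in which each element determines $(\mathbf{v},\mathbf{a})$ uniquely.
   Formalization: Item 2 is proved with elements of C_L read as functionals on M_L (L*{v} acting as f ↦ ⟨L{f},v⟩), and for C_L as a space of distributions only when each element determines (v,a); that uniqueness fails e.g. for L = D+1, where the stated norm on C_L is undefined. *)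

theory Defs
  imports "HOL-Analysis.Analysis" "HOL-Computational_Algebra.Polynomial"
begin

section \<open>Test functions\<close>

definition smooth_fun :: "(real \<Rightarrow> real) \<Rightarrow> bool" where
  "smooth_fun f \<longleftrightarrow> (\<forall>k x. (deriv ^^ k) f field_differentiable at x)"

definition support :: "(real \<Rightarrow> real) \<Rightarrow> real set" where
  "support f = closure {x. f x \<noteq> 0}"

lemma smooth_fun_DERIV:
  "smooth_fun f \<Longrightarrow> ((deriv ^^ k) f has_field_derivative (deriv ^^ Suc k) f x) (at x)"
  by (simp add: smooth_fun_def DERIV_deriv_iff_field_differentiable)

lemma smooth_fun_continuous: "smooth_fun f \<Longrightarrow> continuous_on A ((deriv ^^ k) f)"
  by (meson DERIV_continuous_on has_field_derivative_at_within smooth_fun_DERIV)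

lemma smooth_fun_lincomb:
  assumes "smooth_fun f" "smooth_fun g"
  shows "(deriv ^^ k) (\<lambda>x. a * f x + b * g x) = (\<lambda>x. a * (deriv ^^ k) f x + b * (deriv ^^ k) g x)"
    and "smooth_fun (\<lambda>x. a * f x + b * g x)"
proof -
  have D: "((\<lambda>x. a * (deriv ^^ k) f x + b * (deriv ^^ k) g x) has_field_derivative
      a * (deriv ^^ Suc k) f x + b * (deriv ^^ Suc k) g x) (at x)" for k x
    by (intro DERIV_add DERIV_cmult smooth_fun_DERIV assms)
  have *: "(deriv ^^ k) (\<lambda>x. a * f x + b * g x) = (\<lambda>x. a * (deriv ^^ k) f x + b * (deriv ^^ k) g x)" for k
  proof (induction k)
    case (Suc k)
    show ?case
      by (rule ext) (simp only: funpow.simps o_apply Suc DERIV_imp_deriv[OF D[of k, unfolded funpow.simps o_apply]])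
  qed simp
  show "(deriv ^^ k) (\<lambda>x. a * f x + b * g x) = (\<lambda>x. a * (deriv ^^ k) f x + b * (deriv ^^ k) g x)"
    by (rule *)
  show "smooth_fun (\<lambda>x. a * f x + b * g x)"
    unfolding smooth_fun_def * using D field_differentiable_def by blast
qed

lemma smooth_fun_shift:
  assumes "smooth_fun f"
  shows "(deriv ^^ k) (\<lambda>x. f (x + h)) = (\<lambda>x. (deriv ^^ k) f (x + h))"
    and "smooth_fun (\<lambda>x. f (x + h))"
proof -
  have D: "((\<lambda>x. (deriv ^^ k) f (x + h)) has_field_derivative (deriv ^^ Suc k) f (x + h)) (at x)" for k x
    using smooth_fun_DERIV[OF assms, of k "x + h"] by (simp add: DERIV_shift)
  have *: "(deriv ^^ k) (\<lambda>x. f (x + h)) = (\<lambda>x. (deriv ^^ k) f (x + h))" for k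
  proof (induction k)
    case (Suc k)
    show ?case
      by (rule ext) (simp only: funpow.simps o_apply Suc DERIV_imp_deriv[OF D[of k, unfolded funpow.simps o_apply]])
  qed simp
  show "(deriv ^^ k) (\<lambda>x. f (x + h)) = (\<lambda>x. (deriv ^^ k) f (x + h))" by (rule *)
  show "smooth_fun (\<lambda>x. f (x + h))"
    unfolding smooth_fun_def * using D field_differentiable_def by blast
qed

lemma support_lincomb: "support (\<lambda>x. a * f x + b * g x) \<subseteq> support f \<union> support g"
  unfolding support_def closure_Un[symmetric] by (rule closure_mono) auto

lemma compact_support_mono: "compact K \<Longrightarrow> support f \<subseteq> K \<Longrightarrow> compact (support f)"
  unfolding support_def compact_closure
  by (meson bounded_subset closure_subset compact_imp_bounded)

lemma support_deriv: "support (deriv f) \<subseteq> support f"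
proof -
  have "deriv f x = 0" if "x \<notin> support f" for x
  proof -
    have "open (- support f)" by (simp add: support_def open_Compl)
    moreover have "f y = 0" if "y \<in> - support f" for y
      using that closure_subset[of "{x. f x \<noteq> 0}"] by (auto simp: support_def)
    ultimately have "eventually (\<lambda>y. f y = 0) (nhds x)"
      using \<open>x \<notin> support f\<close> by (auto simp: eventually_nhds)
    then show ?thesis
      using deriv_cong_ev[of f "\<lambda>_. 0" x x] by simp
  qed
  then have "{x. deriv f x \<noteq> 0} \<subseteq> support f" by auto
  then show ?thesis
    unfolding support_def by (metis closure_closure closure_mono)
qed

lemma support_shift: "support (\<lambda>x. f (x + h)) = (\<lambda>x. x - h) ` support f"
proof -
  have "{x. f (x + h) \<noteq> 0} = (\<lambda>x. - h + x) ` {x. f x \<noteq> 0}"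
    by (force simp: image_iff intro: exI[of _ "_ + h"])
  then show ?thesis
    unfolding support_def by (simp only: closure_translation) simp
qed

lemma smooth_compact_zero: "(\<lambda>_. 0) \<in> {f. smooth_fun f \<and> compact (support f)}"
proof -
  have "(deriv ^^ k) (\<lambda>_. 0) = (\<lambda>_. 0 :: real)" for k by (induction k) auto
  then show ?thesis by (simp add: smooth_fun_def support_def)
qed

typedef test = "{f. smooth_fun f \<and> compact (support f)}" morphisms tapply Abs_test
  using smooth_compact_zero by blast

setup_lifting type_definition_test

lemma test_smooth: "smooth_fun (tapply \<phi>)" and test_compact: "compact (support (tapply \<phi>))"
  using tapply[of \<phi>] by auto

lemma compact_lincomb:
  assumes "compact (support f)" "compact (support g)"
  shows "compact (support (\<lambda>x. a * f x + b * g x))"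
  using compact_support_mono[OF compact_Un[OF assms] support_lincomb] .

instantiation test :: real_vector
begin

lift_definition zero_test :: test is "\<lambda>_. 0"
  using smooth_compact_zero by simp
lift_definition plus_test :: "test \<Rightarrow> test \<Rightarrow> test" is "\<lambda>f g x. f x + g x"
  using smooth_fun_lincomb(2)[where a = 1 and b = 1] compact_lincomb[where a = 1 and b = 1] by simp
lift_definition minus_test :: "test \<Rightarrow> test \<Rightarrow> test" is "\<lambda>f g x. f x - g x"
  using smooth_fun_lincomb(2)[where a = 1 and b = "-1"] compact_lincomb[where a = 1 and b = "-1"] by simp
lift_definition uminus_test :: "test \<Rightarrow> test" is "\<lambda>f x. - f x"
  using smooth_fun_lincomb(2)[where a = "-1" and b = 0] compact_lincomb[where a = "-1" and b = 0]
  by fastforce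
lift_definition scaleR_test :: "real \<Rightarrow> test \<Rightarrow> test" is "\<lambda>c f x. c * f x"
  using smooth_fun_lincomb(2)[where b = 0] compact_lincomb[where b = 0] by fastforce

instance
  by standard (transfer; simp add: algebra_simps fun_eq_iff)+

end

lift_definition tdiff :: "test \<Rightarrow> test" is deriv
proof clarify
  fix f :: "real \<Rightarrow> real" assume f: "smooth_fun f" "compact (support f)"
  have "(deriv ^^ k) (deriv f) field_differentiable at x" for k x
    using f(1) unfolding smooth_fun_def by (metis funpow_simps_right(2) o_apply)
  moreover have "compact (support (deriv f))"
    by (rule compact_support_mono[OF f(2) support_deriv])
  ultimately show "smooth_fun (deriv f) \<and> compact (support (deriv f))"
    by (simp add: smooth_fun_def)
qed

lift_definition tshift :: "real \<Rightarrow> test \<Rightarrow> test" is "\<lambda>h f x. f (x + h)"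
proof clarify
  fix h and f :: "real \<Rightarrow> real" assume f: "smooth_fun f" "compact (support f)"
  then show "smooth_fun (\<lambda>x. f (x + h)) \<and> compact (support (\<lambda>x. f (x + h)))"
    using compact_translation_subtract by (simp add: smooth_fun_shift support_shift)
qed

definition test_null :: "(nat \<Rightarrow> test) \<Rightarrow> bool" where
  "test_null \<phi> \<longleftrightarrow> (\<exists>K. compact K \<and> (\<forall>n. support (tapply (\<phi> n)) \<subseteq> K)) \<and>
     (\<forall>k. uniform_limit UNIV (\<lambda>n. (deriv ^^ k) (tapply (\<phi> n))) (\<lambda>_. 0) sequentially)"


section \<open>Distributions\<close>

text \<open>Since the space of test functions is a strict inductive limit of Frechet spaces, continuity
  of a linear functional is the same as sequential continuity at 0.\<close>

typedef distr = "{T :: test \<Rightarrow> real. linear T \<and> (\<forall>\<phi>. test_null \<phi> \<longrightarrow> (\<lambda>n. T (\<phi> n)) \<longlonglongrightarrow> 0)}"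
  morphisms dapply Abs_distr
  by (intro exI[of _ "\<lambda>_. 0"]) (simp add: module_hom_zero)

setup_lifting type_definition_distr

lemma distr_lincomb:
  assumes "linear S \<and> (\<forall>\<phi>. test_null \<phi> \<longrightarrow> (\<lambda>n. S (\<phi> n)) \<longlonglongrightarrow> 0)"
    and "linear T \<and> (\<forall>\<phi>. test_null \<phi> \<longrightarrow> (\<lambda>n. T (\<phi> n)) \<longlonglongrightarrow> 0)"
  shows "linear (\<lambda>\<phi>. a * S \<phi> + b * T \<phi> :: real) \<and>
    (\<forall>\<phi>. test_null \<phi> \<longrightarrow> (\<lambda>n. a * S (\<phi> n) + b * T (\<phi> n)) \<longlonglongrightarrow> 0)"
proof (intro conjI allI impI)
  show "linear (\<lambda>\<phi>. a * S \<phi> + b * T \<phi>)"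
    by (rule linearI) (use assms in \<open>simp_all add: linear_add linear_scale algebra_simps\<close>)
  fix \<phi> assume "test_null \<phi>"
  then have "(\<lambda>n. a * S (\<phi> n) + b * T (\<phi> n)) \<longlonglongrightarrow> a * 0 + b * 0"
    using assms by (intro tendsto_intros) blast+
  then show "(\<lambda>n. a * S (\<phi> n) + b * T (\<phi> n)) \<longlonglongrightarrow> 0" by simp
qed

instantiation distr :: real_vector
begin

lift_definition zero_distr :: distr is "\<lambda>_. 0"
  by (simp add: module_hom_zero)
lift_definition plus_distr :: "distr \<Rightarrow> distr \<Rightarrow> distr" is "\<lambda>S T \<phi>. S \<phi> + T \<phi>"
  subgoal for S T using distr_lincomb[of S T 1 1] by simp done
lift_definition minus_distr :: "distr \<Rightarrow> distr \<Rightarrow> distr" is "\<lambda>S T \<phi>. S \<phi> - T \<phi>"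
  subgoal for S T using distr_lincomb[of S T 1 "-1"] by simp done
lift_definition uminus_distr :: "distr \<Rightarrow> distr" is "\<lambda>T \<phi>. - T \<phi>"
  subgoal for T using distr_lincomb[of T T "-1" 0] by simp done
lift_definition scaleR_distr :: "real \<Rightarrow> distr \<Rightarrow> distr" is "\<lambda>c T \<phi>. c * T \<phi>"
  subgoal for c T using distr_lincomb[of T T c 0] by simp done

instance
  by standard (transfer; simp add: algebra_simps fun_eq_iff)+

end

lemma test_null_tdiff: "test_null \<phi> \<Longrightarrow> test_null (\<lambda>n. tdiff (\<phi> n))"
proof -
  assume *: "test_null \<phi>"
  have "uniform_limit UNIV (\<lambda>n. (deriv ^^ k) (tapply (tdiff (\<phi> n)))) (\<lambda>_. 0) sequentially" for k
  proof -
    have "(deriv ^^ k) (tapply (tdiff (\<phi> n))) = (deriv ^^ Suc k) (tapply (\<phi> n))" for n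
      by (simp add: tdiff.rep_eq funpow_swap1)
    then show ?thesis using * unfolding test_null_def by (simp only: simp_thms)
  qed
  moreover have "support (tapply (tdiff (\<phi> n))) \<subseteq> support (tapply (\<phi> n))" for n
    by (simp add: tdiff.rep_eq support_deriv)
  ultimately show ?thesis using * unfolding test_null_def by (meson order_trans)
qed

lemma test_null_tshift:
  assumes "test_null \<phi>"
  shows "test_null (\<lambda>n. tshift h (\<phi> n))"
proof -
  have eq: "(deriv ^^ k) (tapply (tshift h (\<phi> n))) = (\<lambda>x. (deriv ^^ k) (tapply (\<phi> n)) (x + h))" for k n
    unfolding tshift.rep_eq by (rule smooth_fun_shift(1)[OF test_smooth])
  have "uniform_limit UNIV (\<lambda>n. (deriv ^^ k) (tapply (tshift h (\<phi> n)))) (\<lambda>_. 0) sequentially" for k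
  proof (rule uniform_limitI)
    fix e :: real assume "e > 0"
    moreover have "uniform_limit UNIV (\<lambda>n. (deriv ^^ k) (tapply (\<phi> n))) (\<lambda>_. 0) sequentially"
      using assms unfolding test_null_def by blast
    ultimately have "\<forall>\<^sub>F n in sequentially. \<forall>x\<in>UNIV. dist ((deriv ^^ k) (tapply (\<phi> n)) x) 0 < e"
      by (rule uniform_limitD[rotated])
    then show "\<forall>\<^sub>F n in sequentially. \<forall>x\<in>UNIV. dist ((deriv ^^ k) (tapply (tshift h (\<phi> n))) x) 0 < e"
      by eventually_elim (simp add: eq)
  qed
  moreover obtain K where K: "compact K" "\<And>n. support (tapply (\<phi> n)) \<subseteq> K"
    using assms unfolding test_null_def by blast
  have "compact ((\<lambda>x. x - h) ` K)"
    by (rule compact_translation_subtract[OF K(1)])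
  moreover have "support (tapply (tshift h (\<phi> n))) \<subseteq> (\<lambda>x. x - h) ` K" for n
    unfolding tshift.rep_eq support_shift by (rule image_mono[OF K(2)])
  ultimately show ?thesis unfolding test_null_def by blast
qed

lemma tdiff_linear: "linear tdiff"
proof (rule linearI)
  show "tdiff (f + g) = tdiff f + tdiff g" for f g
    using smooth_fun_lincomb(1)[of "tapply f" "tapply g" 1 1 1] test_smooth
    by (simp add: tapply_inject[symmetric] tdiff.rep_eq plus_test.rep_eq)
  show "tdiff (c *\<^sub>R f) = c *\<^sub>R tdiff f" for f c
    using smooth_fun_lincomb(1)[of "tapply f" "tapply f" 1 c 0] test_smooth
    by (simp add: tapply_inject[symmetric] tdiff.rep_eq scaleR_test.rep_eq)
qed

lemma tshift_linear: "linear (tshift h)"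
  by (rule linearI; transfer; simp)

lift_definition ddiff :: "distr \<Rightarrow> distr" is "\<lambda>T \<phi>. - T (tdiff \<phi>)"
proof clarify
  fix T :: "test \<Rightarrow> real"
  assume T: "linear T" "\<forall>\<phi>. test_null \<phi> \<longrightarrow> (\<lambda>n. T (\<phi> n)) \<longlonglongrightarrow> 0"
  have "linear (\<lambda>\<phi>. - T (tdiff \<phi>))"
    using linear_compose_neg[OF linear_compose[OF tdiff_linear T(1)]] by (simp add: o_def)
  moreover have "(\<lambda>n. - T (tdiff (\<phi> n))) \<longlonglongrightarrow> 0" if "test_null \<phi>" for \<phi>
    using tendsto_minus[of "\<lambda>n. T (tdiff (\<phi> n))" 0] T(2) test_null_tdiff[OF that] by auto
  ultimately show "linear (\<lambda>\<phi>. - T (tdiff \<phi>)) \<and>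
      (\<forall>\<phi>. test_null \<phi> \<longrightarrow> (\<lambda>n. - T (tdiff (\<phi> n))) \<longlonglongrightarrow> 0)" by blast
qed

lift_definition dshift :: "real \<Rightarrow> distr \<Rightarrow> distr" is "\<lambda>h T \<phi>. T (tshift h \<phi>)"
proof clarify
  fix h and T :: "test \<Rightarrow> real"
  assume T: "linear T" "\<forall>\<phi>. test_null \<phi> \<longrightarrow> (\<lambda>n. T (\<phi> n)) \<longlonglongrightarrow> 0"
  have "linear (\<lambda>\<phi>. T (tshift h \<phi>))"
    using linear_compose[OF tshift_linear T(1)] by (simp add: o_def)
  then show "linear (\<lambda>\<phi>. T (tshift h \<phi>)) \<and>
      (\<forall>\<phi>. test_null \<phi> \<longrightarrow> (\<lambda>n. T (tshift h (\<phi> n))) \<longlonglongrightarrow> 0)"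
    using T(2) test_null_tshift by blast
qed

lemma test_null_uniform:
  assumes "test_null \<phi>"
  shows "uniform_limit UNIV (\<lambda>n. tapply (\<phi> n)) (\<lambda>_. 0) sequentially"
  using assms[unfolded test_null_def, THEN conjunct2, rule_format, of 0] by simp

lift_definition dirac :: "real \<Rightarrow> distr" is "\<lambda>x \<phi>. tapply \<phi> x"
proof (intro conjI allI impI)
  fix x
  show "linear (\<lambda>\<phi>. tapply \<phi> x)"
    by (rule linearI) (simp_all add: plus_test.rep_eq scaleR_test.rep_eq)
  show "(\<lambda>n. tapply (\<phi> n) x) \<longlonglongrightarrow> 0" if "test_null \<phi>" for \<phi>
    using tendsto_uniform_limitI[OF test_null_uniform[OF that] UNIV_I] .
qed

lemma test_continuous: "continuous_on A (tapply \<phi>)"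
  using smooth_fun_continuous[OF test_smooth, of A 0] by simp

lemma test_measurable [measurable]: "tapply \<phi> \<in> borel_measurable borel"
  by (rule borel_measurable_continuous_onI[OF test_continuous])

lemma test_outside: "x \<notin> support (tapply \<phi>) \<Longrightarrow> tapply \<phi> x = 0"
  unfolding support_def using closure_subset[of "{x. tapply \<phi> x \<noteq> 0}"] by blast

lemma test_bounded: "\<exists>B. \<forall>x. \<bar>tapply \<phi> x\<bar> \<le> B"
proof -
  have "bounded (tapply \<phi> ` support (tapply \<phi>))"
    by (intro compact_imp_bounded compact_continuous_image test_continuous test_compact)
  then obtain B where "\<And>x. x \<in> support (tapply \<phi>) \<Longrightarrow> \<bar>tapply \<phi> x\<bar> \<le> B"
    unfolding bounded_iff by auto
  then have "\<bar>tapply \<phi> x\<bar> \<le> max B 0" for x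
    by (cases "x \<in> support (tapply \<phi>)") (auto simp: test_outside le_max_iff_disj)
  then show ?thesis by blast
qed

text \<open>The regular distribution of a locally integrable function; 0 for all other functions.\<close>

lift_definition fun_distr :: "(real \<Rightarrow> real) \<Rightarrow> distr" is
  "\<lambda>f \<phi>. if \<forall>K. compact K \<longrightarrow> set_integrable lborel K f then LINT x|lborel. f x * tapply \<phi> x else 0"
proof -
  fix f :: "real \<Rightarrow> real"
  show "linear (\<lambda>\<phi>. if \<forall>K. compact K \<longrightarrow> set_integrable lborel K f then LINT x|lborel. f x * tapply \<phi> x else 0) \<and>
    (\<forall>\<phi>. test_null \<phi> \<longrightarrow> (\<lambda>n. if \<forall>K. compact K \<longrightarrow> set_integrable lborel K f
       then LINT x|lborel. f x * tapply (\<phi> n) x else 0) \<longlonglongrightarrow> 0)"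
  proof (cases "\<forall>K. compact K \<longrightarrow> set_integrable lborel K f")
    case False
    then show ?thesis unfolding if_not_P[OF False] by (simp add: module_hom_zero)
  next
    case True
    have eq: "f x * tapply \<phi> x = (indicator K x *\<^sub>R f x) * tapply \<phi> x" if "support (tapply \<phi>) \<subseteq> K" for K \<phi> x
      using that test_outside[of x \<phi>] by (auto simp: indicator_def)
    have int: "integrable lborel (\<lambda>x. f x * tapply \<phi> x)" for \<phi>
    proof -
      obtain B where B: "\<And>x. \<bar>tapply \<phi> x\<bar> \<le> B" using test_bounded by blast
      let ?g = "\<lambda>x. indicator (support (tapply \<phi>)) x *\<^sub>R f x"
      have g: "integrable lborel ?g"
        using True test_compact unfolding set_integrable_def by blast
      have "integrable lborel (\<lambda>x. ?g x * tapply \<phi> x)"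
      proof (rule Bochner_Integration.integrable_bound[of _ "\<lambda>x. B * ?g x"])
        show "integrable lborel (\<lambda>x. B * ?g x)" using g by simp
        show "(\<lambda>x. ?g x * tapply \<phi> x) \<in> borel_measurable lborel"
          using borel_measurable_integrable[OF g] by measurable
        have "\<bar>?g x * tapply \<phi> x\<bar> \<le> \<bar>B * ?g x\<bar>" for x
          using mult_right_mono[OF order_trans[OF B[of x] abs_ge_self], of "\<bar>?g x\<bar>"]
          unfolding abs_mult by (simp only: mult.commute)
        then show "AE x in lborel. norm (?g x * tapply \<phi> x) \<le> norm (B * ?g x)" by simp
      qed
      then show ?thesis unfolding eq[OF order_refl] .
    qed
    have "linear (\<lambda>\<phi>. LINT x|lborel. f x * tapply \<phi> x)"
      by (rule linearI) (simp_all add: plus_test.rep_eq scaleR_test.rep_eq distrib_left int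
          mult.left_commute[of _ _ "tapply _ _"])
    moreover have "(\<lambda>n. LINT x|lborel. f x * tapply (\<phi> n) x) \<longlonglongrightarrow> 0" if null: "test_null \<phi>" for \<phi>
    proof -
      obtain K where K: "compact K" "\<And>n. support (tapply (\<phi> n)) \<subseteq> K"
        using null unfolding test_null_def by blast
      let ?g = "\<lambda>x. indicator K x *\<^sub>R f x"
      have g: "integrable lborel ?g"
        using True K(1) unfolding set_integrable_def by blast
      define I where "I = (LINT x|lborel. \<bar>?g x\<bar>)"
      have I: "0 \<le> I" by (simp add: I_def)
      show ?thesis
      proof (rule tendstoI)
        fix e :: real assume "e > 0"
        then have "0 < e / (I + 1)" using I by simp
        then have "\<forall>\<^sub>F n in sequentially. \<forall>x. \<bar>tapply (\<phi> n) x\<bar> < e / (I + 1)"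
          using uniform_limitD[OF test_null_uniform[OF null]] by (simp add: dist_real_def)
        then show "\<forall>\<^sub>F n in sequentially. dist (LINT x|lborel. f x * tapply (\<phi> n) x) 0 < e"
        proof eventually_elim
          case (elim n)
          have "\<bar>LINT x|lborel. f x * tapply (\<phi> n) x\<bar> \<le> (LINT x|lborel. \<bar>f x * tapply (\<phi> n) x\<bar>)"
            by (rule integral_abs_bound)
          also have "\<dots> \<le> (LINT x|lborel. (e / (I + 1)) * \<bar>?g x\<bar>)"
          proof (rule integral_mono)
            show "integrable lborel (\<lambda>x. \<bar>f x * tapply (\<phi> n) x\<bar>)" using int by simp
            show "integrable lborel (\<lambda>x. (e / (I + 1)) * \<bar>?g x\<bar>)" using g by (intro integrable_mult_right integrable_abs)
            show "\<bar>f x * tapply (\<phi> n) x\<bar> \<le> (e / (I + 1)) * \<bar>?g x\<bar>" for x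
              unfolding eq[OF K(2)] abs_mult[of "indicator K x *\<^sub>R f x"]
              using mult_right_mono[OF less_imp_le[OF elim[rule_format, of x]], of "\<bar>?g x\<bar>"]
              by (simp only: mult.commute)
          qed
          also have "\<dots> = e / (I + 1) * I" unfolding I_def by (rule integral_mult_right_zero)
          also have "\<dots> < e" using I \<open>e > 0\<close> by (simp add: field_simps)
          finally show ?case by (simp add: dist_real_def)
        qed
      qed
    qed
    ultimately show ?thesis unfolding if_P[OF True] by blast
  qed
qed

definition pairing :: "distr ^ 'd \<Rightarrow> test ^ 'd \<Rightarrow> real" where
  "pairing f \<psi> = (\<Sum>d\<in>UNIV. dapply (f $ d) (\<psi> $ d))"

definition supported_in :: "distr \<Rightarrow> real set \<Rightarrow> bool" where
  "supported_in T A \<longleftrightarrow> (\<forall>\<phi>. support (tapply \<phi>) \<inter> A = {} \<longrightarrow> dapply T \<phi> = 0)"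

text \<open>The convolution of \<open>S\<close> with a compactly supported \<open>T\<close>: the function
  \<open>x \<mapsto> T(\<phi>(x + \<cdot>))\<close> is then again a test function \<open>\<psi>\<close>, and \<open>(S * T)(\<phi>) = S(\<psi>)\<close>.
  For other \<open>T\<close> the value is unspecified.\<close>

definition conv :: "distr \<Rightarrow> distr \<Rightarrow> distr" where
  "conv S T = (THE U. \<forall>\<phi>. \<exists>\<psi>. (\<forall>x. tapply \<psi> x = dapply T (tshift x \<phi>)) \<and> dapply U \<phi> = dapply S \<psi>)"

lemma conv_dirac: "conv S (dirac a) = dshift a S"
  unfolding conv_def
proof (rule the_equality)
  have "(\<forall>x. tapply (tshift a \<phi>) x = dapply (dirac a) (tshift x \<phi>)) \<and>
      dapply (dshift a S) \<phi> = dapply S (tshift a \<phi>)" for \<phi>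
    by (simp add: dirac.rep_eq tshift.rep_eq dshift.rep_eq add.commute)
  then show "\<forall>\<phi>. \<exists>\<psi>. (\<forall>x. tapply \<psi> x = dapply (dirac a) (tshift x \<phi>)) \<and> dapply (dshift a S) \<phi> = dapply S \<psi>"
    by blast
next
  fix U
  assume U: "\<forall>\<phi>. \<exists>\<psi>. (\<forall>x. tapply \<psi> x = dapply (dirac a) (tshift x \<phi>)) \<and> dapply U \<phi> = dapply S \<psi>"
  have "dapply U \<phi> = dapply (dshift a S) \<phi>" for \<phi>
  proof -
    obtain \<psi> where \<psi>: "\<And>x. tapply \<psi> x = dapply (dirac a) (tshift x \<phi>)" "dapply U \<phi> = dapply S \<psi>"
      using U by blast
    then have "\<psi> = tshift a \<phi>"
      by (intro tapply_inject[THEN iffD1] ext) (simp add: dirac.rep_eq tshift.rep_eq add.commute)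
    then show ?thesis using \<psi>(2) by (simp add: dshift.rep_eq)
  qed
  then show "U = dshift a S" by (simp add: dapply_inject[symmetric] fun_eq_iff)
qed

definition mconv :: "distr ^ 'd ^ 'd \<Rightarrow> distr ^ 'd \<Rightarrow> distr ^ 'd" where
  "mconv G u = (\<chi> r. \<Sum>c\<in>UNIV. conv (G $ r $ c) (u $ c))"


section \<open>Differential operators\<close>

text \<open>The operator \<open>\<Sum>n. a\<^sub>n D\<^sup>n\<close> is represented by the polynomial with coefficients \<open>a\<^sub>n\<close>;
  composition is multiplication of polynomials (\<open>odo_mult\<close>), so that the Leibniz formula with
  composition is \<open>det\<close> over the commutative ring of polynomials.\<close>

definition odo :: "real poly \<Rightarrow> distr \<Rightarrow> distr" where
  "odo p T = (\<Sum>n\<le>degree p. coeff p n *\<^sub>R (ddiff ^^ n) T)"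

lemma ddiff_linear: "linear ddiff"
  by (rule linearI; transfer; simp add: fun_eq_iff algebra_simps)

lemma odo_extend: "degree p \<le> m \<Longrightarrow> odo p T = (\<Sum>n\<le>m. coeff p n *\<^sub>R (ddiff ^^ n) T)"
  unfolding odo_def by (rule sum.mono_neutral_left) (auto simp: coeff_eq_0 not_le)

lemma odo_add: "odo (p + q) T = odo p T + odo q T"
  using odo_extend[of p "max (degree p) (degree q)"] odo_extend[of q "max (degree p) (degree q)"]
    odo_extend[OF degree_add_le_max]
  by (simp add: sum.distrib scaleR_left_distrib)

lemma odo_smult: "odo (smult c p) T = c *\<^sub>R odo p T"
  using odo_extend[OF degree_smult_le[of c p]] by (simp add: odo_def scaleR_sum_right)

lemma odo_pCons: "odo (pCons c p) T = c *\<^sub>R T + ddiff (odo p T)"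
proof -
  have "odo (pCons c p) T = (\<Sum>n\<le>Suc (degree p). coeff (pCons c p) n *\<^sub>R (ddiff ^^ n) T)"
    by (rule odo_extend) (simp add: degree_pCons_le)
  then show ?thesis
    by (simp add: sum.atMost_Suc_shift odo_def linear_sum[OF ddiff_linear]
        linear_scale[OF ddiff_linear] del: sum.atMost_Suc)
qed

lemma odo_mult: "odo (p * q) T = odo p (odo q T)"
proof (induction p)
  case 0
  then show ?case by (simp add: odo_def)
next
  case (pCons c p)
  then show ?case by (simp add: odo_add odo_smult odo_pCons)
qed

definition odo_adj :: "real poly \<Rightarrow> real poly" where
  "odo_adj p = (\<Sum>n\<le>degree p. monom ((- 1) ^ n * coeff p n) n)"

definition mdo :: "real poly ^ 'd ^ 'd \<Rightarrow> distr ^ 'd \<Rightarrow> distr ^ 'd" where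
  "mdo L f = (\<chi> r. \<Sum>d\<in>UNIV. odo (L $ r $ d) (f $ d))"

definition mdo_mat :: "real poly ^ 'd ^ 'd \<Rightarrow> distr ^ 'd ^ 'd \<Rightarrow> distr ^ 'd ^ 'd" where
  "mdo_mat L G = (\<chi> r c. mdo L (column c G) $ r)"

definition mdo_adj :: "real poly ^ 'd ^ 'd \<Rightarrow> real poly ^ 'd ^ 'd" where
  "mdo_adj L = (\<chi> r c. odo_adj (L $ c $ r))"

definition mdo_invertible :: "real poly ^ 'd ^ 'd \<Rightarrow> bool" where
  "mdo_invertible L \<longleftrightarrow> det L \<noteq> 0"

definition green :: "real poly ^ 'd ^ 'd \<Rightarrow> distr ^ 'd ^ 'd" where
  "green L = (THE G. mdo_mat L G = (\<chi> r c. if r = c then dirac 0 else 0) \<and>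
     (\<forall>r c. supported_in (G $ r $ c) {0..}))"

definition null_space :: "real poly ^ 'd ^ 'd \<Rightarrow> (distr ^ 'd) set" where
  "null_space L = {q. mdo L q = 0}"

abbreviation null_dim :: "real poly ^ 'd ^ 'd \<Rightarrow> nat" where
  "null_dim L \<equiv> dim (null_space L)"


section \<open>Finite signed measures\<close>

text \<open>Every finite signed Borel measure on the real line is Radon. The value outside the Borel sets
  is fixed to 0 to make equality extensional; the measure of the empty set is 0 by convergence of
  the series for the constant empty family.\<close>

typedef smeasure = "{\<mu> :: real set \<Rightarrow> real. (\<forall>A. A \<notin> sets borel \<longrightarrow> \<mu> A = 0) \<and>
    (\<forall>A :: nat \<Rightarrow> real set. range A \<subseteq> sets borel \<and> disjoint_family A \<longrightarrow>
       (\<lambda>n. \<mu> (A n)) sums \<mu> (\<Union>n. A n))}"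
  morphisms smeas Abs_smeasure
  by (intro exI[of _ "\<lambda>_. 0"]) simp

setup_lifting type_definition_smeasure

text \<open>Jordan decomposition: the positive part of \<open>m\<close> is \<open>A \<mapsto> sup {m B | B \<subseteq> A}\<close> and the
  negative part is the positive part of \<open>-m\<close>. The suprema are finite, since a finite signed measure
  has bounded range.\<close>

definition pos_part :: "(real set \<Rightarrow> real) \<Rightarrow> real measure" where
  "pos_part m = measure_of UNIV (sets borel) (\<lambda>A. ennreal (SUP B\<in>{B \<in> sets borel. B \<subseteq> A}. m B))"

definition smeas_integral :: "smeasure \<Rightarrow> (real \<Rightarrow> real) \<Rightarrow> real" where
  "smeas_integral \<mu> f =
     (LINT x|pos_part (smeas \<mu>). f x) - (LINT x|pos_part (\<lambda>A. - smeas \<mu> A). f x)"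

lemma pos_part_sets [measurable_cong, simp]: "sets (pos_part m) = sets borel"
  unfolding pos_part_def
  by (subst sets_measure_of) (auto simp: sets.sigma_sets_eq[of borel, unfolded space_borel])

lemma pos_part_finite: "finite_measure (pos_part m)"
  by (rule finite_measureI) (simp add: pos_part_def emeasure_measure_of_conv)

lemma pos_part_integrable: "integrable (pos_part m) (tapply \<phi>)"
proof -
  interpret finite_measure "pos_part m" by (rule pos_part_finite)
  obtain B where "\<And>x. \<bar>tapply \<phi> x\<bar> \<le> B" using test_bounded by blast
  then show ?thesis by (intro integrable_const_bound[of _ B]) auto
qed

lemma pos_part_tendsto:
  assumes "test_null \<phi>"
  shows "(\<lambda>n. LINT x|pos_part m. tapply (\<phi> n) x) \<longlonglongrightarrow> 0"
proof (rule tendstoI)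
  interpret finite_measure "pos_part m" by (rule pos_part_finite)
  fix e :: real assume "e > 0"
  define I where "I = measure (pos_part m) (space (pos_part m))"
  have I: "0 \<le> I" by (simp add: I_def)
  then have "0 < e / (I + 1)" using \<open>e > 0\<close> by simp
  then have "\<forall>\<^sub>F n in sequentially. \<forall>x. \<bar>tapply (\<phi> n) x\<bar> < e / (I + 1)"
    using uniform_limitD[OF test_null_uniform[OF assms]] by (simp add: dist_real_def)
  then show "\<forall>\<^sub>F n in sequentially. dist (LINT x|pos_part m. tapply (\<phi> n) x) 0 < e"
  proof eventually_elim
    case (elim n)
    have "\<bar>LINT x|pos_part m. tapply (\<phi> n) x\<bar> \<le> (LINT x|pos_part m. \<bar>tapply (\<phi> n) x\<bar>)"
      by (rule integral_abs_bound)
    also have "\<dots> \<le> (LINT x|pos_part m. e / (I + 1))"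
      by (rule integral_mono) (use pos_part_integrable elim in \<open>auto intro: less_imp_le\<close>)
    also have "\<dots> = e / (I + 1) * I" by (simp add: I_def)
    also have "\<dots> < e" using I \<open>e > 0\<close> by (simp add: field_simps)
    finally show ?case by (simp add: dist_real_def)
  qed
qed

lift_definition meas_distr :: "smeasure \<Rightarrow> distr" is "\<lambda>\<mu> \<phi>. smeas_integral \<mu> (tapply \<phi>)"
proof (intro conjI allI impI)
  fix \<mu>
  show "linear (\<lambda>\<phi>. smeas_integral \<mu> (tapply \<phi>))"
    by (rule linearI) (simp_all add: smeas_integral_def plus_test.rep_eq scaleR_test.rep_eq
        pos_part_integrable algebra_simps)
  show "(\<lambda>n. smeas_integral \<mu> (tapply (\<phi> n))) \<longlonglongrightarrow> 0" if "test_null \<phi>" for \<phi>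
    using tendsto_diff[OF pos_part_tendsto[OF that] pos_part_tendsto[OF that]]
    by (simp add: smeas_integral_def)
qed

definition mvec :: "smeasure ^ 'd \<Rightarrow> distr ^ 'd" where
  "mvec \<mu> = (\<chi> d. meas_distr (\<mu> $ d))"

text \<open>The inverse of the (injective) embedding of measures into distributions.\<close>

definition meas_of :: "distr ^ 'd \<Rightarrow> smeasure ^ 'd" where
  "meas_of f = (THE \<mu>. mvec \<mu> = f)"

definition finite_partitions :: "real set set set" where
  "finite_partitions = {\<pi>. finite \<pi> \<and> \<pi> \<subseteq> sets borel \<and> partition_on UNIV \<pi>}"

definition tv_norm :: "smeasure \<Rightarrow> real" where
  "tv_norm \<mu> = (SUP \<pi>\<in>finite_partitions. \<Sum>E\<in>\<pi>. \<bar>smeas \<mu> E\<bar>)"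

definition outer_norm :: "(real ^ 'd \<Rightarrow> real) \<Rightarrow> smeasure ^ 'd \<Rightarrow> real" where
  "outer_norm W \<mu> = W (\<chi> d. tv_norm (\<mu> $ d))"

definition inner_norm :: "(real ^ 'd \<Rightarrow> real) \<Rightarrow> smeasure ^ 'd \<Rightarrow> real" where
  "inner_norm W \<mu> = (SUP \<pi>\<in>finite_partitions. \<Sum>E\<in>\<pi>. W (\<chi> d. smeas (\<mu> $ d) E))"


section \<open>Norms, Banach spaces and duals\<close>

definition seminorm_on :: "'a::real_vector set \<Rightarrow> ('a \<Rightarrow> real) \<Rightarrow> bool" where
  "seminorm_on V p \<longleftrightarrow> subspace V \<and> (\<forall>x\<in>V. 0 \<le> p x) \<and>
     (\<forall>x\<in>V. \<forall>c. p (c *\<^sub>R x) = \<bar>c\<bar> * p x) \<and> (\<forall>x\<in>V. \<forall>y\<in>V. p (x + y) \<le> p x + p y)"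

definition norm_on :: "'a::real_vector set \<Rightarrow> ('a \<Rightarrow> real) \<Rightarrow> bool" where
  "norm_on V p \<longleftrightarrow> seminorm_on V p \<and> (\<forall>x\<in>V. p x = 0 \<longrightarrow> x = 0)"

definition banach_on :: "'a::real_vector set \<Rightarrow> ('a \<Rightarrow> real) \<Rightarrow> bool" where
  "banach_on V p \<longleftrightarrow> norm_on V p \<and> Metric_space.mcomplete V (\<lambda>x y. p (x - y))"

definition equivalent_on :: "'a set \<Rightarrow> ('a \<Rightarrow> real) \<Rightarrow> ('a \<Rightarrow> real) \<Rightarrow> bool" where
  "equivalent_on V p q \<longleftrightarrow> (\<exists>c>0. \<exists>C>0. \<forall>x\<in>V. c * p x \<le> q x \<and> q x \<le> C * p x)"

definition monotone_norm :: "(real ^ 'd \<Rightarrow> real) \<Rightarrow> bool" where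
  "monotone_norm Z \<longleftrightarrow> norm_on UNIV Z \<and> (\<forall>v w. (\<forall>d. \<bar>w $ d\<bar> \<le> \<bar>v $ d\<bar>) \<longrightarrow> Z w \<le> Z v)"

definition dual_norm :: "(real ^ 'd \<Rightarrow> real) \<Rightarrow> real ^ 'd \<Rightarrow> real" where
  "dual_norm Z w = (SUP v\<in>{v. Z v \<le> 1}. w \<bullet> v)"

definition l1_norm :: "real ^ 'd \<Rightarrow> real" where
  "l1_norm v = (\<Sum>d\<in>UNIV. \<bar>v $ d\<bar>)"

text \<open>\<open>\<real>\<^sup>N\<close> for a term \<open>N\<close> (possibly 0) is the set of real sequences that vanish from index \<open>N\<close> on,
  as in \<^const>\<open>Euclidean_space\<close>.\<close>

definition tuples :: "nat \<Rightarrow> (nat \<Rightarrow> real) set" where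
  "tuples N = {a. \<forall>i\<ge>N. a i = 0}"

definition tuple_dual_norm :: "nat \<Rightarrow> ((nat \<Rightarrow> real) \<Rightarrow> real) \<Rightarrow> (nat \<Rightarrow> real) \<Rightarrow> real" where
  "tuple_dual_norm N Y b = (SUP a\<in>{a \<in> tuples N. Y a \<le> 1}. \<Sum>i<N. b i * a i)"

text \<open>The same notion for spaces of real functions with pointwise operations, which are not an
  instance of \<^class>\<open>real_vector\<close>.\<close>

definition fun_norm_on :: "('x \<Rightarrow> real) set \<Rightarrow> (('x \<Rightarrow> real) \<Rightarrow> real) \<Rightarrow> bool" where
  "fun_norm_on W q \<longleftrightarrow>
     (\<lambda>_. 0) \<in> W \<and> (\<forall>a\<in>W. \<forall>b\<in>W. (\<lambda>i. a i + b i) \<in> W) \<and> (\<forall>a\<in>W. \<forall>c. (\<lambda>i. c * a i) \<in> W) \<and>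
     (\<forall>a\<in>W. 0 \<le> q a \<and> (q a = 0 \<longrightarrow> a = (\<lambda>_. 0))) \<and>
     (\<forall>a\<in>W. \<forall>c. q (\<lambda>i. c * a i) = \<bar>c\<bar> * q a) \<and>
     (\<forall>a\<in>W. \<forall>b\<in>W. q (\<lambda>i. a i + b i) \<le> q a + q b)"

text \<open>Functionals on a subspace \<open>W\<close> are made extensional by the value 0 outside \<open>W\<close>.\<close>

definition top_dual :: "'a::real_vector set \<Rightarrow> ('a \<Rightarrow> real) \<Rightarrow> ('a \<Rightarrow> real) set" where
  "top_dual W q = {F. (\<forall>g. g \<notin> W \<longrightarrow> F g = 0) \<and>
     (\<forall>g\<in>W. \<forall>h\<in>W. F (g + h) = F g + F h) \<and> (\<forall>g\<in>W. \<forall>c. F (c *\<^sub>R g) = c * F g) \<and>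
     (\<exists>C. \<forall>g\<in>W. \<bar>F g\<bar> \<le> C * q g)}"

definition fun_top_dual :: "('x \<Rightarrow> real) set \<Rightarrow> (('x \<Rightarrow> real) \<Rightarrow> real) \<Rightarrow> (('x \<Rightarrow> real) \<Rightarrow> real) set" where
  "fun_top_dual W q = {F. (\<forall>g. g \<notin> W \<longrightarrow> F g = 0) \<and>
     (\<forall>g\<in>W. \<forall>h\<in>W. F (\<lambda>x. g x + h x) = F g + F h) \<and> (\<forall>g\<in>W. \<forall>c. F (\<lambda>x. c * g x) = c * F g) \<and>
     (\<exists>C. \<forall>g\<in>W. \<bar>F g\<bar> \<le> C * q g)}"

definition functional_norm :: "'a set \<Rightarrow> ('a \<Rightarrow> real) \<Rightarrow> ('a \<Rightarrow> real) \<Rightarrow> real" where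
  "functional_norm W q F = (SUP g\<in>{g \<in> W. q g \<le> 1}. \<bar>F g\<bar>)"


section \<open>Native space and predual\<close>

definition native_space :: "real poly ^ 'd ^ 'd \<Rightarrow> (distr ^ 'd) set" where
  "native_space L = {f. mdo L f \<in> range mvec}"

definition outer_reg :: "real poly ^ 'd ^ 'd \<Rightarrow> (real ^ 'd \<Rightarrow> real) \<Rightarrow> distr ^ 'd \<Rightarrow> real" where
  "outer_reg L W f = outer_norm W (meas_of (mdo L f))"

definition inner_reg :: "real poly ^ 'd ^ 'd \<Rightarrow> (real ^ 'd \<Rightarrow> real) \<Rightarrow> distr ^ 'd \<Rightarrow> real" where
  "inner_reg L W f = inner_norm W (meas_of (mdo L f))"

definition admissible ::
  "real poly ^ 'd ^ 'd \<Rightarrow> (nat \<Rightarrow> distr ^ 'd) \<Rightarrow> (nat \<Rightarrow> test ^ 'd) \<Rightarrow> bool" where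
  "admissible L p \<phi> \<longleftrightarrow>
     inj_on p {..<null_dim L} \<and> independent (p ` {..<null_dim L}) \<and>
     span (p ` {..<null_dim L}) = null_space L \<and>
     (\<forall>n<null_dim L. \<forall>m<null_dim L. pairing (p n) (\<phi> m) = (if m = n then 1 else 0)) \<and>
     (\<exists>b\<ge>0. \<forall>n<null_dim L. \<forall>d. support (tapply (\<phi> n $ d)) \<subseteq> {0..b})"

definition coords :: "real poly ^ 'd ^ 'd \<Rightarrow> (nat \<Rightarrow> test ^ 'd) \<Rightarrow> distr ^ 'd \<Rightarrow> nat \<Rightarrow> real" where
  "coords L \<phi> f = (\<lambda>n. if n < null_dim L then pairing f (\<phi> n) else 0)"

definition native_norm ::
  "real poly ^ 'd ^ 'd \<Rightarrow> (nat \<Rightarrow> test ^ 'd) \<Rightarrow> ((nat \<Rightarrow> real) \<Rightarrow> real) \<Rightarrow>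
   (distr ^ 'd \<Rightarrow> real) \<Rightarrow> distr ^ 'd \<Rightarrow> real" where
  "native_norm L \<phi> Y reg f = reg f + tuple_dual_norm (null_dim L) Y (coords L \<phi> f)"

definition C0 :: "(real \<Rightarrow> real ^ 'd) set" where
  "C0 = {v. continuous_on UNIV v \<and> (v \<longlongrightarrow> 0) at_infinity}"

definition sup_inner :: "(real ^ 'd \<Rightarrow> real) \<Rightarrow> (real \<Rightarrow> real ^ 'd) \<Rightarrow> real" where
  "sup_inner Z v = (SUP x. Z (v x))"

definition sup_outer :: "(real ^ 'd \<Rightarrow> real) \<Rightarrow> (real \<Rightarrow> real ^ 'd) \<Rightarrow> real" where
  "sup_outer Z v = Z (\<chi> d. SUP x. \<bar>v x $ d\<bar>)"

definition fvec :: "(real \<Rightarrow> real ^ 'd) \<Rightarrow> distr ^ 'd" where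
  "fvec v = (\<chi> d. fun_distr (\<lambda>x. v x $ d))"

definition tvec :: "test ^ 'd \<Rightarrow> distr ^ 'd" where
  "tvec \<psi> = (\<chi> d. fun_distr (tapply (\<psi> $ d)))"

text \<open>The predual consists of the sums \<open>L\<^sup>*{v} + \<Sum>n. a\<^sub>n \<phi>\<^sub>n\<close> with \<open>v\<close> in \<open>C0\<close>, each determining
  \<open>(v, a)\<close> uniquely. As distributions these sums need not do so: for \<open>L = D + 1\<close>, the function
  \<open>v(x) = \<integral>\<^sub>x\<^sup>\<infinity> e\<^sup>x\<^sup>-\<^sup>t \<phi>\<^sub>1(t) dt\<close> is in \<open>C0\<close> and \<open>L\<^sup>*{v} = v - v' = \<phi>\<^sub>1\<close>. In general they are
  therefore taken as functionals on the native space, where \<open>L\<^sup>*\<close> is the adjoint of the operator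
  \<open>L\<close> from the native space to measures: \<open>L\<^sup>*{v}\<close> is \<open>f \<mapsto> \<langle>L{f}, v\<rangle>\<close>. On test functions these
  functionals agree with the distributions, and they do determine \<open>(v, a)\<close>.\<close>

definition meas_pairing :: "smeasure ^ 'd \<Rightarrow> (real \<Rightarrow> real ^ 'd) \<Rightarrow> real" where
  "meas_pairing \<mu> v = (\<Sum>d\<in>UNIV. smeas_integral (\<mu> $ d) (\<lambda>x. v x $ d))"

definition predual_elem ::
  "real poly ^ 'd ^ 'd \<Rightarrow> (nat \<Rightarrow> test ^ 'd) \<Rightarrow> (real \<Rightarrow> real ^ 'd) \<Rightarrow> (nat \<Rightarrow> real) \<Rightarrow> distr ^ 'd \<Rightarrow> real" where
  "predual_elem L \<phi> v a = (\<lambda>f. if f \<in> native_space L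
     then meas_pairing (meas_of (mdo L f)) v + (\<Sum>n<null_dim L. a n * pairing f (\<phi> n)) else 0)"

definition predual_dist ::
  "real poly ^ 'd ^ 'd \<Rightarrow> (nat \<Rightarrow> test ^ 'd) \<Rightarrow> (real \<Rightarrow> real ^ 'd) \<Rightarrow> (nat \<Rightarrow> real) \<Rightarrow> distr ^ 'd" where
  "predual_dist L \<phi> v a = mdo (mdo_adj L) (fvec v) + (\<Sum>n<null_dim L. a n *\<^sub>R tvec (\<phi> n))"

text \<open>In the following, \<open>e\<close> is \<open>predual_elem L \<phi>\<close> or \<open>predual_dist L \<phi>\<close>.\<close>

definition predual_space ::
  "nat \<Rightarrow> ((real \<Rightarrow> real ^ 'd) \<Rightarrow> (nat \<Rightarrow> real) \<Rightarrow> 'g) \<Rightarrow> 'g set" where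
  "predual_space N e = {e v a | v a. v \<in> C0 \<and> a \<in> tuples N}"

definition predual_norm ::
  "nat \<Rightarrow> ((real \<Rightarrow> real ^ 'd) \<Rightarrow> (nat \<Rightarrow> real) \<Rightarrow> 'g) \<Rightarrow> ((nat \<Rightarrow> real) \<Rightarrow> real) \<Rightarrow>
   ((real \<Rightarrow> real ^ 'd) \<Rightarrow> real) \<Rightarrow> 'g \<Rightarrow> real" where
  "predual_norm N e Y s g =
     (let (v, a) = (THE (v, a). v \<in> C0 \<and> a \<in> tuples N \<and> g = e v a) in max (s v) (Y a))"

text \<open>The normed space \<open>(V, p)\<close> of vector distributions is the topological dual, with its dual norm,
  of the space \<open>(W, q)\<close> of functionals on \<open>V\<close>, by evaluation; \<open>W\<close> contains the test functions.\<close>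

definition is_dual_of_functionals ::
  "(distr ^ 'd) set \<Rightarrow> (distr ^ 'd \<Rightarrow> real) \<Rightarrow>
   (distr ^ 'd \<Rightarrow> real) set \<Rightarrow> ((distr ^ 'd \<Rightarrow> real) \<Rightarrow> real) \<Rightarrow> bool" where
  "is_dual_of_functionals V p W q \<longleftrightarrow> norm_on V p \<and> fun_norm_on W q \<and>
     (\<forall>g\<in>W. \<forall>f\<in>V. \<forall>h\<in>V. \<forall>b c. g (b *\<^sub>R f + c *\<^sub>R h) = b * g f + c * g h) \<and>
     (\<forall>\<psi>. (\<lambda>f. if f \<in> V then pairing f \<psi> else 0) \<in> W) \<and>
     bij_betw (\<lambda>f g. if g \<in> W then g f else 0) V (fun_top_dual W q) \<and>
     (\<forall>f\<in>V. functional_norm W q (\<lambda>g. g f) = p f)"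

text \<open>The same for a space \<open>(W, q)\<close> of distributions, through the extension of the duality pairing
  with test functions to all of \<open>W\<close>.\<close>

definition is_dual_of_distributions ::
  "(distr ^ 'd) set \<Rightarrow> (distr ^ 'd \<Rightarrow> real) \<Rightarrow> (distr ^ 'd) set \<Rightarrow> (distr ^ 'd \<Rightarrow> real) \<Rightarrow> bool" where
  "is_dual_of_distributions V p W q \<longleftrightarrow> norm_on V p \<and> norm_on W q \<and> range tvec \<subseteq> W \<and>
     (\<exists>J. bij_betw J V (top_dual W q) \<and>
        (\<forall>f\<in>V. \<forall>g\<in>V. \<forall>b c. J (b *\<^sub>R f + c *\<^sub>R g) = (\<lambda>h. b * J f h + c * J g h)) \<and>
        (\<forall>f\<in>V. functional_norm W q (J f) = p f) \<and>
        (\<forall>f\<in>V. \<forall>\<psi>. J f (tvec \<psi>) = pairing f \<psi>))"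


section \<open>Quotient by the null space\<close>

definition coset :: "distr ^ 'd \<Rightarrow> (distr ^ 'd) set \<Rightarrow> (distr ^ 'd) set" where
  "coset f N = {f + q | q. q \<in> N}"

definition coset_comb :: "real \<Rightarrow> (distr ^ 'd) set \<Rightarrow> (distr ^ 'd) set \<Rightarrow> (distr ^ 'd) set" where
  "coset_comb u A B = {(1 - u) *\<^sub>R a + u *\<^sub>R b | a b. a \<in> A \<and> b \<in> B}"

text \<open>The quotient space is not a type, so \<^const>\<open>extreme_point_of\<close> is restated for a set of cosets:
  for \<open>0 < u < 1\<close>, \<open>coset_comb u A B\<close> is the convex combination of \<open>A\<close> and \<open>B\<close> in the quotient.\<close>

definition coset_extreme_point :: "(distr ^ 'd) set \<Rightarrow> (distr ^ 'd) set set \<Rightarrow> bool" where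
  "coset_extreme_point E S \<longleftrightarrow> E \<in> S \<and>
     (\<forall>A\<in>S. \<forall>B\<in>S. \<not> (A \<noteq> B \<and> (\<exists>u. 0 < u \<and> u < 1 \<and> E = coset_comb u A B)))"

definition quotient_ball :: "real poly ^ 'd ^ 'd \<Rightarrow> (distr ^ 'd \<Rightarrow> real) \<Rightarrow> (distr ^ 'd) set set" where
  "quotient_ball L reg = {coset f (null_space L) | f. f \<in> native_space L \<and> reg f \<le> 1}"

definition odot :: "real ^ 'd \<Rightarrow> distr ^ 'd \<Rightarrow> distr ^ 'd" where
  "odot w T = (\<chi> d. w $ d *\<^sub>R T $ d)"

definition diracs :: "real ^ 'd \<Rightarrow> distr ^ 'd" where
  "diracs x = (\<chi> d. dirac (x $ d))"

definition vec_dirac :: "real ^ 'd \<Rightarrow> real \<Rightarrow> distr ^ 'd" where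
  "vec_dirac w x = (\<chi> d. w $ d *\<^sub>R dirac x)"

end

theory Submission
  imports Defs
begin

text \<open>Everything rests on one identification. Since \<open>L\<close> is invertible, \<open>L\<close> maps the native space onto
  the vector measures: with the adjugate matrix \<open>M\<close>, \<open>L M = M L = det L\<close>, the equation \<open>L{f} = \<mu>\<close>
  reduces to scalar equations \<open>p(D) T = \<sigma>\<close>, and these are solved by means of a causal and an anticausal
  fundamental solution of \<open>p(D)\<close> (\<open>fundamental_solution\<close>, \<open>odo_surjective_measures\<close>). An admissible
  system fixes the remaining element of the null space, so \<open>f\<close> corresponds to the pair of \<open>L{f}\<close> and the
  tuple of its coordinates \<open>\<langle>f, \<phi>\<^sub>n\<rangle>\<close> (\<open>native_surjective\<close>, \<open>native_eq_0\<close>).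

  Duality and completeness are thus questions about measures and tuples. Both norms of
  vector measures are dual to the corresponding norms of continuous functions (\<open>dual_pair_inner\<close>,
  \<open>dual_pair_outer\<close>): one inequality integrates step functions, the other approximates norming vectors on the
  sets of a good partition by a continuous function. By the Riesz representation theorem every
  bounded functional comes from a measure (\<open>riesz_vector\<close>), which gives the representation of functionals on the
  predual, and completeness follows since a dual space is complete. For the predual to
  contain the test functions, a test function that annihilates the null space has to be of the form
  \<open>L\<^sup>*{w}\<close> with a test function \<open>w\<close> (\<open>orthogonal_imp_adjoint_image\<close>): applying the causal fundamental
  solution gives a smooth solution that vanishes far to the right by causality, and far to the
  left because there its value is the pairing with an element of the null space.

  The equivalence of the seminorms is that of the norms in finite dimension, applied on the sets of a
  partition.

  For the extreme points, \<open>L\<close> identifies the quotient by the null space with the vector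
  measures (\<open>extreme_cosets\<close>). An extreme point of a ball cannot be cut into two non-proportional pieces whose
  norms add up (\<open>extreme_point_split\<close>). The inner norm is additive on complementary Borel sets, and the
  outer norm can be cut additively along each component; hence every Borel set is null or of null
  complement, for the whole measure or for each component, which forces a single atom
  (\<open>concentrated_at_point\<close>). Conversely the value at the atom is an extreme point
  of the finite-dimensional ball and already has the full norm, which leaves no mass elsewhere; for
  the outer norm this uses that extreme points of the ball of a monotone norm are maximal in absolute
  value (\<open>extreme_point_maximal\<close>). Finally \<open>L{G * (w \<odot> \<delta>\<^sub>x)} = w \<odot> \<delta>\<^sub>x\<close> translates atoms
  into shifted Green functions (\<open>mdo_mconv_green\<close>).\<close>

section \<open>Finite signed measures\<close>

lemma smeas_not_borel: "A \<notin> sets borel \<Longrightarrow> smeas \<sigma> A = 0"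
  using smeas[of \<sigma>] by auto

lemma smeas_sums:
  "range A \<subseteq> sets borel \<Longrightarrow> disjoint_family A \<Longrightarrow> (\<lambda>n. smeas \<sigma> (A n)) sums smeas \<sigma> (\<Union>n. A n)"
  using smeas[of \<sigma>] by auto

lemma smeasure_eqI: "(\<And>A. A \<in> sets borel \<Longrightarrow> smeas \<sigma> A = smeas \<tau> A) \<Longrightarrow> \<sigma> = \<tau>"
  by (metis smeas_inject smeas_not_borel ext)

lemma smeas_empty [simp]: "smeas \<sigma> {} = 0"
proof -
  have "(\<lambda>n::nat. smeas \<sigma> {}) sums smeas \<sigma> (\<Union>n::nat. {})"
    by (rule smeas_sums) (auto simp: disjoint_family_on_def)
  then have "(\<lambda>n::nat. smeas \<sigma> {}) \<longlonglongrightarrow> 0" using sums_summable summable_LIMSEQ_zero by blast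
  then show ?thesis by (simp add: LIMSEQ_const_iff)
qed

lemma smeas_Un:
  assumes "A \<in> sets borel" "B \<in> sets borel" "A \<inter> B = {}"
  shows "smeas \<sigma> (A \<union> B) = smeas \<sigma> A + smeas \<sigma> B"
proof -
  have "(\<lambda>n. smeas \<sigma> (binaryset A B n)) sums smeas \<sigma> (\<Union>n. binaryset A B n)"
    using assms by (intro smeas_sums) (auto simp: disjoint_family_on_def binaryset_def)
  moreover have "(\<lambda>n. smeas \<sigma> (binaryset A B n)) sums (smeas \<sigma> A + smeas \<sigma> B)"
    by (rule binaryset_sums) simp
  ultimately show ?thesis by (simp add: sums_unique2 UN_binaryset_eq)
qed

lemma smeas_split:
  assumes "A \<in> sets borel" "B \<in> sets borel"
  shows "smeas \<sigma> A = smeas \<sigma> (A \<inter> B) + smeas \<sigma> (A - B)"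
  using smeas_Un[of "A \<inter> B" "A - B" \<sigma>] assms by (auto simp: Int_Diff_Un)

instantiation smeasure :: real_vector
begin

lift_definition zero_smeasure :: smeasure is "\<lambda>_. 0" by simp
lift_definition plus_smeasure :: "smeasure \<Rightarrow> smeasure \<Rightarrow> smeasure" is "\<lambda>\<sigma> \<tau> A. \<sigma> A + \<tau> A"
  by (auto intro: sums_add)
lift_definition minus_smeasure :: "smeasure \<Rightarrow> smeasure \<Rightarrow> smeasure" is "\<lambda>\<sigma> \<tau> A. \<sigma> A - \<tau> A"
  by (auto intro: sums_diff)
lift_definition uminus_smeasure :: "smeasure \<Rightarrow> smeasure" is "\<lambda>\<sigma> A. - \<sigma> A"
  by (auto intro: sums_minus)
lift_definition scaleR_smeasure :: "real \<Rightarrow> smeasure \<Rightarrow> smeasure" is "\<lambda>c \<sigma> A. c * \<sigma> A"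
  by (auto intro: sums_mult)

instance
  by standard (transfer; simp add: algebra_simps fun_eq_iff)+

end

lift_definition srestrict :: "real set \<Rightarrow> smeasure \<Rightarrow> smeasure" is
  "\<lambda>B \<sigma> A. if B \<in> sets borel \<and> A \<in> sets borel then \<sigma> (A \<inter> B) else 0"
proof (intro conjI allI impI; (elim conjE)?)
  fix B :: "real set" and \<sigma> :: "real set \<Rightarrow> real" and A :: "nat \<Rightarrow> real set"
  assume \<sigma>: "\<forall>A. range A \<subseteq> sets borel \<and> disjoint_family A \<longrightarrow> (\<lambda>n. \<sigma> (A n)) sums \<sigma> (\<Union> (range A))"
    and A: "range A \<subseteq> sets borel" "disjoint_family A"
  show "(\<lambda>n. if B \<in> sets borel \<and> A n \<in> sets borel then \<sigma> (A n \<inter> B) else 0) sums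
    (if B \<in> sets borel \<and> \<Union> (range A) \<in> sets borel then \<sigma> (\<Union> (range A) \<inter> B) else 0)"
  proof (cases "B \<in> sets borel")
    case True
    have "(\<lambda>n. \<sigma> (A n \<inter> B)) sums \<sigma> (\<Union>n. A n \<inter> B)"
      using A True by (intro \<sigma>[rule_format]) (auto simp: disjoint_family_on_def)
    moreover have "A n \<in> sets borel" for n using A by auto
    ultimately show ?thesis using True by (simp add: Int_UN_distrib2 flip: UN_simps(4))
  qed simp
qed auto

lift_definition sdirac :: "real \<Rightarrow> smeasure" is "\<lambda>x A. if A \<in> sets borel then indicator A x else 0"
proof (intro conjI allI impI; (elim conjE)?)
  fix x and A :: "nat \<Rightarrow> real set"
  assume A: "range A \<subseteq> sets borel" "disjoint_family A"
  then have [simp]: "A n \<in> sets borel" for n by auto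
  have "(\<lambda>n. indicator (A n) x :: real) sums indicator (\<Union>n. A n) x"
  proof (cases "x \<in> (\<Union>n. A n)")
    case True
    then obtain m where m: "x \<in> A m" by auto
    then have "indicator (A n) x = (if n = m then 1 else 0 :: real)" for n
      using A(2) by (auto simp: disjoint_family_on_def indicator_def)
    moreover have "(\<lambda>n. if n = m then 1 else 0 :: real) sums (\<Sum>n\<in>{m}. if n = m then 1 else 0)"
      by (rule sums_finite) auto
    ultimately show ?thesis using True by simp
  qed simp
  moreover have "(\<Union>n. A n) \<in> sets borel" by auto
  ultimately show "(\<lambda>n. if A n \<in> sets borel then indicator (A n) x else 0 :: real) sums
      (if \<Union> (range A) \<in> sets borel then indicator (\<Union> (range A)) x else 0)" by simp
qed auto

definition smeas_of :: "real measure \<Rightarrow> smeasure" where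
  "smeas_of M = Abs_smeasure (\<lambda>A. if A \<in> sets borel then measure M A else 0)"

lemma smeas_of:
  assumes "finite_measure M" "sets M = sets borel" "A \<in> sets borel"
  shows "smeas (smeas_of M) A = measure M A"
proof -
  interpret finite_measure M by fact
  have "(\<lambda>n. if A n \<in> sets borel then measure M (A n) else 0) sums
      (if \<Union> (range A) \<in> sets borel then measure M (\<Union> (range A)) else 0)"
    if "range A \<subseteq> sets borel" "disjoint_family A" for A :: "nat \<Rightarrow> real set"
  proof -
    have "A n \<in> sets borel" for n using that by auto
    then show ?thesis using that assms(2) finite_measure_UNION[of A] by auto
  qed
  then show ?thesis using assms(3) unfolding smeas_of_def
    by (subst Abs_smeasure_inverse) auto
qed

lemma smeas_sum: "smeas (\<Sum>i\<in>I. \<sigma> i) A = (\<Sum>i\<in>I. smeas (\<sigma> i) A)"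
  by (induction I rule: infinite_finite_induct) (auto simp: zero_smeasure.rep_eq plus_smeasure.rep_eq)

lemmas smeas_simps = zero_smeasure.rep_eq plus_smeasure.rep_eq minus_smeasure.rep_eq
  uminus_smeasure.rep_eq scaleR_smeasure.rep_eq smeas_sum

lemma srestrict_add: "B \<in> sets borel \<Longrightarrow> \<sigma> = srestrict B \<sigma> + srestrict (- B) \<sigma>"
  by (rule smeasure_eqI) (simp add: smeas_simps srestrict.rep_eq flip: smeas_split Diff_eq)


subsection \<open>The Hahn decomposition\<close>

definition positive_on :: "smeasure \<Rightarrow> real set \<Rightarrow> bool" where
  "positive_on \<sigma> P \<longleftrightarrow> P \<in> sets borel \<and> (\<forall>B\<in>sets borel. B \<subseteq> P \<longrightarrow> 0 \<le> smeas \<sigma> B)"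

lemma positive_on_subset: "positive_on \<sigma> P \<Longrightarrow> B \<in> sets borel \<Longrightarrow> B \<subseteq> P \<Longrightarrow> positive_on \<sigma> B"
  by (auto simp: positive_on_def)

lemma positive_on_UN:
  assumes "\<And>n::nat. positive_on \<sigma> (P n)"
  shows "positive_on \<sigma> (\<Union>n. P n)"
  unfolding positive_on_def
proof (intro conjI ballI impI)
  have [measurable]: "P n \<in> sets borel" for n using assms by (auto simp: positive_on_def)
  show "(\<Union>n. P n) \<in> sets borel" by measurable
  fix B assume B [measurable]: "B \<in> sets borel" and sub: "B \<subseteq> (\<Union>n. P n)"
  have meas: "disjointed P n \<in> sets borel" for n
    using sets.range_disjointed_sets[of P borel] \<open>\<And>n. P n \<in> sets borel\<close>
    by (simp add: image_subset_iff)
  have "(\<lambda>n. smeas \<sigma> (B \<inter> disjointed P n)) sums smeas \<sigma> (\<Union>n. B \<inter> disjointed P n)"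
    using disjoint_family_disjointed[of P] meas
    by (intro smeas_sums) (auto simp: disjoint_family_on_def)
  moreover have "(\<Union>n. B \<inter> disjointed P n) = B"
    using sub UN_disjointed_eq[of P] by blast
  moreover have "0 \<le> smeas \<sigma> (B \<inter> disjointed P n)" for n
    using assms[of n] disjointed_subset[of P n] meas[of n] B unfolding positive_on_def by blast
  ultimately show "0 \<le> smeas \<sigma> B" using sums_le[OF _ sums_zero] by metis
qed

lemma positive_on_Un: "positive_on \<sigma> P \<Longrightarrow> positive_on \<sigma> Q \<Longrightarrow> positive_on \<sigma> (P \<union> Q)"
proof -
  assume "positive_on \<sigma> P" "positive_on \<sigma> Q"
  then have "positive_on \<sigma> (\<Union>n::nat. if n = 0 then P else Q)"
    by (intro positive_on_UN) simp
  moreover have "(\<Union>n::nat. if n = 0 then P else Q) = P \<union> Q"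
    by (auto split: if_splits)
  ultimately show ?thesis by simp
qed

lemma positive_on_mono:
  assumes "positive_on \<sigma> Q" "P \<in> sets borel" "P \<subseteq> Q"
  shows "smeas \<sigma> P \<le> smeas \<sigma> Q"
proof -
  have "smeas \<sigma> Q = smeas \<sigma> P + smeas \<sigma> (Q - P)"
    using smeas_split[of Q P \<sigma>] assms by (auto simp: positive_on_def Int_absorb1)
  moreover have "0 \<le> smeas \<sigma> (Q - P)" using assms by (auto simp: positive_on_def)
  ultimately show ?thesis by simp
qed

text \<open>Removing, one after the other, sets whose negative measure is (up to a factor 2) as large as
  possible leaves a positive set: the removed measures form a convergent series, so they tend to
  0, and no set of negative measure can be left over.\<close>

lemma exists_positive_subset:
  assumes A: "A \<in> sets borel"
  obtains P where "P \<subseteq> A" "positive_on \<sigma> P" "smeas \<sigma> A \<le> smeas \<sigma> P"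
proof -
  define good where "good R B \<longleftrightarrow> B \<in> sets borel \<and> B \<subseteq> R \<and> smeas \<sigma> B \<le> 0 \<and>
    (\<forall>C\<in>sets borel. C \<subseteq> R \<longrightarrow> smeas \<sigma> B \<le> max (-1) (smeas \<sigma> C / 2))" for R B
  have ex: "\<exists>B. good R B" for R
  proof (cases "\<exists>B\<in>sets borel. B \<subseteq> R \<and> smeas \<sigma> B \<le> -1")
    case True
    then show ?thesis unfolding good_def by force
  next
    case False
    let ?S = "{smeas \<sigma> B | B. B \<in> sets borel \<and> B \<subseteq> R}"
    have bdd: "bdd_below ?S" by (rule bdd_belowI[of _ "-1"]) (use False in force)
    have z: "0 \<in> ?S" by (auto intro!: exI[of _ "{}"])
    have low: "Inf ?S \<le> smeas \<sigma> C" if "C \<in> sets borel" "C \<subseteq> R" for C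
      using that by (intro cInf_lower bdd) auto
    have I0: "Inf ?S \<le> 0" using z bdd by (rule cInf_lower)
    show ?thesis
    proof (cases "Inf ?S = 0")
      case True
      have "good R {}" unfolding good_def using low True by (force simp: le_max_iff_disj)
      then show ?thesis by blast
    next
      case False
      then have "Inf ?S < Inf ?S / 2" using I0 by auto
      then obtain B where B: "B \<in> sets borel" "B \<subseteq> R" "smeas \<sigma> B < Inf ?S / 2"
        using cInf_lessD[of ?S "Inf ?S / 2"] z by blast
      then have "good R B" unfolding good_def using low I0 by (force simp: le_max_iff_disj)
      then show ?thesis by blast
    qed
  qed
  define g where "g R = (SOME B. good R B)" for R
  have g: "good R (g R)" for R unfolding g_def using ex by (rule someI_ex)
  define R where "R = rec_nat A (\<lambda>_ R. R - g R)"
  have R0: "R 0 = A" and RS: "R (Suc n) = R n - g (R n)" for n by (auto simp: R_def)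
  define B where "B n = g (R n)" for n
  have B: "B n \<in> sets borel" "B n \<subseteq> R n" "smeas \<sigma> (B n) \<le> 0" for n
    using g[of "R n"] by (auto simp: good_def B_def)
  have Bmax: "smeas \<sigma> (B n) \<le> max (-1) (smeas \<sigma> C / 2)" if "C \<in> sets borel" "C \<subseteq> R n" for n C
    using g[of "R n"] that by (auto simp: good_def B_def)
  have Rdec: "R m \<subseteq> R n" if "n \<le> m" for n m
    using that by (induction rule: dec_induct) (auto simp: RS)
  have "disjoint_family B"
    unfolding disjoint_family_on_def
  proof (intro ballI impI)
    have *: "B n \<inter> B m = {}" if "n < m" for n m
      using B(2)[of m] Rdec[of "Suc n" m] that RS[of n] by (auto simp: B_def)
    show "B n \<inter> B m = {}" if "n \<noteq> m" for n m using *[of n m] *[of m n] that by (cases "n < m") auto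
  qed
  then have sums: "(\<lambda>n. smeas \<sigma> (B n)) sums smeas \<sigma> (\<Union>n. B n)" using B by (intro smeas_sums) auto
  define P where "P = A - (\<Union>n. B n)"
  have PR: "P \<subseteq> R n" for n by (induction n) (auto simp: R0 RS P_def B_def)
  have Pm: "P \<in> sets borel" using A B by (auto simp: P_def)
  have "positive_on \<sigma> P" unfolding positive_on_def
  proof (intro conjI ballI impI Pm, rule ccontr)
    fix C assume C: "C \<in> sets borel" "C \<subseteq> P" "\<not> 0 \<le> smeas \<sigma> C"
    have "(\<lambda>n. smeas \<sigma> (B n)) \<longlonglongrightarrow> 0" using sums sums_summable summable_LIMSEQ_zero by blast
    moreover have "smeas \<sigma> (B n) \<le> max (-1) (smeas \<sigma> C / 2)" for n
      using Bmax C PR by blast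
    ultimately have "0 \<le> max (-1) (smeas \<sigma> C / 2)" by (meson LIMSEQ_le_const2)
    then show False using C by auto
  qed
  moreover have "smeas \<sigma> A \<le> smeas \<sigma> P"
  proof -
    have "B n \<subseteq> A" for n using B(2)[of n] Rdec[of 0 n] R0 by auto
    then have "A \<inter> (\<Union>n. B n) = (\<Union>n. B n)" by auto
    then have "smeas \<sigma> A = smeas \<sigma> (\<Union>n. B n) + smeas \<sigma> P"
      using smeas_split[of A "\<Union>n. B n" \<sigma>] A B by (simp add: P_def sets.countable_UN image_subset_iff)
    moreover have "smeas \<sigma> (\<Union>n. B n) \<le> 0"
      using sums_le[OF _ sums sums_zero] B by auto
    ultimately show ?thesis by simp
  qed
  ultimately show ?thesis using that[of P] by (auto simp: P_def)
qed

text \<open>The union of positive sets whose measures tend to the supremum is a positive set of maximal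
  measure. A set of positive measure in its complement would contain a positive set, which would enlarge
  it.\<close>

lemma hahn:
  obtains P where "positive_on \<sigma> P" "positive_on (- \<sigma>) (- P)"
proof -
  let ?S = "{smeas \<sigma> P | P. positive_on \<sigma> P}"
  have "positive_on \<sigma> {}" by (simp add: positive_on_def)
  then have ne: "?S \<noteq> {}" by blast
  have bdd: "bdd_above ?S"
  proof (rule ccontr)
    assume "\<not> bdd_above ?S"
    then have "\<forall>n. \<exists>P. positive_on \<sigma> P \<and> real n < smeas \<sigma> P"
      unfolding bdd_above_def by (force simp: not_le)
    then obtain P where P: "\<And>n. positive_on \<sigma> (P n)" "\<And>n. real n < smeas \<sigma> (P n)" by metis
    have "real n < smeas \<sigma> (\<Union>n. P n)" for n
    proof -
      have "smeas \<sigma> (P n) \<le> smeas \<sigma> (\<Union>n. P n)"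
        by (rule positive_on_mono[OF positive_on_UN[of \<sigma> P]])
          (use P(1) in \<open>auto simp: positive_on_def\<close>)
      then show ?thesis using P(2)[of n] by simp
    qed
    then show False by (meson not_less_iff_gr_or_eq reals_Archimedean2)
  qed
  have "\<exists>P. positive_on \<sigma> P \<and> Sup ?S - 1 / real (Suc n) < smeas \<sigma> P" for n
  proof -
    have "Sup ?S - 1 / real (Suc n) < Sup ?S" by simp
    from less_cSupD[OF ne this] show ?thesis by blast
  qed
  then have "\<forall>n. \<exists>P. positive_on \<sigma> P \<and> Sup ?S - 1 / real (Suc n) < smeas \<sigma> P" by (rule allI)
  from choice[OF this] obtain P where P: "\<And>n. positive_on \<sigma> (P n)"
      "\<And>n. Sup ?S - 1 / real (Suc n) < smeas \<sigma> (P n)" by blast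
  define U where "U = (\<Union>n. P n)"
  have U: "positive_on \<sigma> U" unfolding U_def by (rule positive_on_UN) fact
  have "Sup ?S - 1 / real (Suc n) \<le> smeas \<sigma> U" for n
  proof -
    have "P n \<in> sets borel" "P n \<subseteq> U" using P(1)[of n] by (auto simp: positive_on_def U_def)
    then show ?thesis using positive_on_mono[OF U] P(2)[of n] by force
  qed
  note approx = this
  have "Sup ?S \<le> smeas \<sigma> U"
  proof (rule field_le_epsilon)
    fix e :: real assume "0 < e"
    then obtain n where n: "1 / real (Suc n) < e" using nat_approx_posE by blast
    have "Sup ?S \<le> smeas \<sigma> U + 1 / real (Suc n)" using approx[of n] by (simp only: diff_le_eq)
    also have "\<dots> \<le> smeas \<sigma> U + e" using n by (intro add_left_mono less_imp_le)
    finally show "Sup ?S \<le> smeas \<sigma> U + e" .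
  qed
  have max: "smeas \<sigma> Q \<le> smeas \<sigma> U" if "positive_on \<sigma> Q" for Q
  proof -
    have "smeas \<sigma> Q \<in> ?S" using that by blast
    then show ?thesis using cSup_upper[OF _ bdd] \<open>Sup ?S \<le> smeas \<sigma> U\<close> by (meson order_trans)
  qed
  have "positive_on (- \<sigma>) (- U)" unfolding positive_on_def
  proof (intro conjI ballI impI)
    show "- U \<in> sets borel" using U by (auto simp: positive_on_def)
  next
    fix B assume B': "B \<in> sets borel" "B \<subseteq> - U"
    show "0 \<le> smeas (- \<sigma>) B"
    proof (rule ccontr)
    assume "\<not> 0 \<le> smeas (- \<sigma>) B"
    with B' have B: "B \<in> sets borel" "B \<subseteq> - U" "\<not> 0 \<le> smeas (- \<sigma>) B" by blast+
    from B(1) obtain Q where Q: "Q \<subseteq> B" "positive_on \<sigma> Q" "smeas \<sigma> B \<le> smeas \<sigma> Q"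
      by (rule exists_positive_subset)
    have "smeas \<sigma> (U \<union> Q) = smeas \<sigma> U + smeas \<sigma> Q"
      using U Q B by (intro smeas_Un) (auto simp: positive_on_def)
    then show False using max[OF positive_on_Un[OF U Q(2)]] Q(3) B(3) by (simp add: smeas_simps)
    qed
  qed
  then show ?thesis using that U by blast
qed

text \<open>The supremum over the Borel subsets of \<open>A\<close> that defines the positive part is
  attained at the intersection of \<open>A\<close> with the positive set of a Hahn
  decomposition.\<close>

lemma hahn_parts:
  obtains P where "P \<in> sets borel"
    "\<And>A. A \<in> sets borel \<Longrightarrow> emeasure (pos_part (smeas \<sigma>)) A = ennreal (smeas \<sigma> (A \<inter> P))"
    "\<And>A. A \<in> sets borel \<Longrightarrow> emeasure (pos_part (smeas (- \<sigma>))) A = ennreal (- smeas \<sigma> (A - P))"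
    "positive_on \<sigma> P" "positive_on (- \<sigma>) (- P)"
proof -
  have *: "emeasure (pos_part (smeas \<sigma>)) A = ennreal (smeas \<sigma> (A \<inter> P))"
    if P: "positive_on \<sigma> P" "positive_on (- \<sigma>) (- P)" and A: "A \<in> sets borel" for \<sigma> P A
  proof -
    have Pm: "P \<in> sets borel" using P by (simp add: positive_on_def)
    have sup: "(SUP B\<in>{B \<in> sets borel. B \<subseteq> A}. smeas \<sigma> B) = smeas \<sigma> (A \<inter> P)" if A: "A \<in> sets borel" for A
    proof (rule cSup_eq_maximum)
      show "smeas \<sigma> (A \<inter> P) \<in> smeas \<sigma> ` {B \<in> sets borel. B \<subseteq> A}" using A Pm by auto
      fix y assume "y \<in> smeas \<sigma> ` {B \<in> sets borel. B \<subseteq> A}"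
      then obtain B where B: "B \<in> sets borel" "B \<subseteq> A" "y = smeas \<sigma> B" by auto
      have "smeas \<sigma> (B - P) \<le> 0" using P(2) B(1) Pm by (auto simp: positive_on_def smeas_simps)
      moreover have "smeas \<sigma> (B \<inter> P) \<le> smeas \<sigma> (A \<inter> P)"
        using P A B Pm by (intro positive_on_mono positive_on_subset[OF P(1)]) auto
      ultimately show "y \<le> smeas \<sigma> (A \<inter> P)" using smeas_split[OF B(1) Pm, of \<sigma>] B(3) by simp
    qed
    have nonneg: "0 \<le> smeas \<sigma> (A \<inter> P)" if "A \<in> sets borel" for A
      using that P Pm by (auto simp: positive_on_def)
    have "emeasure (measure_of UNIV (sets borel) (\<lambda>A. ennreal (smeas \<sigma> (A \<inter> P)))) A = ennreal (smeas \<sigma> (A \<inter> P))"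
    proof (rule emeasure_measure_of_sigma)
      show "sigma_algebra UNIV (sets (borel :: real measure))"
        using sets.sigma_algebra_axioms[of "borel :: real measure"] by simp
      show "positive (sets borel) (\<lambda>A. ennreal (smeas \<sigma> (A \<inter> P)))" by (simp add: positive_def)
      show "countably_additive (sets borel) (\<lambda>A. ennreal (smeas \<sigma> (A \<inter> P)))"
      proof (rule countably_additiveI)
        fix F :: "nat \<Rightarrow> real set" assume F: "range F \<subseteq> sets borel" "disjoint_family F"
        have "(\<lambda>n. smeas \<sigma> (F n \<inter> P)) sums smeas \<sigma> (\<Union>n. F n \<inter> P)"
          using F Pm by (intro smeas_sums) (auto simp: disjoint_family_on_def)
        then show "(\<Sum>i. ennreal (smeas \<sigma> (F i \<inter> P))) = ennreal (smeas \<sigma> (\<Union> (range F) \<inter> P))"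
          using F nonneg by (subst suminf_ennreal_eq) (auto simp: image_subset_iff Int_UN_distrib2)
      qed
    qed (use A in auto)
    moreover have "pos_part (smeas \<sigma>) = measure_of UNIV (sets borel) (\<lambda>A. ennreal (smeas \<sigma> (A \<inter> P)))"
      unfolding pos_part_def
      by (rule measure_of_eq) (auto simp: sup sets.sigma_sets_eq[of borel, unfolded space_borel])
    ultimately show ?thesis by simp
  qed
  obtain P where P: "positive_on \<sigma> P" "positive_on (- \<sigma>) (- P)" by (rule hahn)
  show ?thesis
  proof (rule that)
    show "P \<in> sets borel" using P by (simp add: positive_on_def)
    fix A :: "real set" assume A: "A \<in> sets borel"
    show "emeasure (pos_part (smeas \<sigma>)) A = ennreal (smeas \<sigma> (A \<inter> P))" using *[OF P A] .
    show "emeasure (pos_part (smeas (- \<sigma>))) A = ennreal (- smeas \<sigma> (A - P))"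
      using *[of "- \<sigma>" "- P" A] P A by (simp add: smeas_simps Diff_eq)
  qed (use P in auto)
qed

abbreviation ppart :: "smeasure \<Rightarrow> real measure" where "ppart \<sigma> \<equiv> pos_part (smeas \<sigma>)"
abbreviation npart :: "smeasure \<Rightarrow> real measure" where "npart \<sigma> \<equiv> pos_part (smeas (- \<sigma>))"

lemma jordan:
  assumes A: "A \<in> sets borel"
  shows "smeas \<sigma> A = measure (ppart \<sigma>) A - measure (npart \<sigma>) A"
    and "\<bar>smeas \<sigma> A\<bar> \<le> measure (ppart \<sigma>) A + measure (npart \<sigma>) A"
proof -
  obtain P where P: "P \<in> sets borel"
    "\<And>A. A \<in> sets borel \<Longrightarrow> emeasure (pos_part (smeas \<sigma>)) A = ennreal (smeas \<sigma> (A \<inter> P))"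
    "\<And>A. A \<in> sets borel \<Longrightarrow> emeasure (pos_part (smeas (- \<sigma>))) A = ennreal (- smeas \<sigma> (A - P))"
    "positive_on \<sigma> P" "positive_on (- \<sigma>) (- P)"
    by (rule hahn_parts[of \<sigma>]) (assumption | blast)+
  have "0 \<le> smeas \<sigma> (A \<inter> P)" using P(1,4) A by (auto simp: positive_on_def)
  then have 1: "measure (pos_part (smeas \<sigma>)) A = smeas \<sigma> (A \<inter> P)" using P(2)[OF A] by (simp add: measure_def)
  have "0 \<le> - smeas \<sigma> (A - P)" using P(5) P(1) A by (auto simp: positive_on_def smeas_simps)
  then have 2: "measure (pos_part (smeas (- \<sigma>))) A = - smeas \<sigma> (A - P)" using P(3)[OF A] by (simp add: measure_def)
  show "smeas \<sigma> A = measure (pos_part (smeas \<sigma>)) A - measure (pos_part (smeas (- \<sigma>))) A"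
    using 1 2 smeas_split[OF A P(1), of \<sigma>] by simp
  then show "\<bar>smeas \<sigma> A\<bar> \<le> measure (ppart \<sigma>) A + measure (npart \<sigma>) A"
    using measure_nonneg[of "ppart \<sigma>" A] measure_nonneg[of "npart \<sigma>" A] by linarith
qed

subsection \<open>Integration of bounded Borel functions\<close>

definition bdd_borel :: "(real \<Rightarrow> real) \<Rightarrow> bool" where
  "bdd_borel f \<longleftrightarrow> f \<in> borel_measurable borel \<and> (\<exists>B. \<forall>x. \<bar>f x\<bar> \<le> B)"

lemma bdd_borelI: "f \<in> borel_measurable borel \<Longrightarrow> (\<And>x. \<bar>f x\<bar> \<le> B) \<Longrightarrow> bdd_borel f"
  unfolding bdd_borel_def by blast

lemma bdd_borel_add: "bdd_borel f \<Longrightarrow> bdd_borel g \<Longrightarrow> bdd_borel (\<lambda>x. f x + g x)"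
  unfolding bdd_borel_def
proof (elim conjE exE, intro conjI)
  fix B C assume "\<forall>x. \<bar>f x\<bar> \<le> B" "\<forall>x. \<bar>g x\<bar> \<le> C"
  then show "\<exists>B. \<forall>x. \<bar>f x + g x\<bar> \<le> B" by (intro exI[of _ "B + C"]) (meson abs_triangle_ineq add_mono order_trans)
qed auto

lemma bdd_borel_scale: "bdd_borel f \<Longrightarrow> bdd_borel (\<lambda>x. c * f x)"
  unfolding bdd_borel_def
proof (elim conjE exE, intro conjI)
  fix B assume "\<forall>x. \<bar>f x\<bar> \<le> B"
  then show "\<exists>B. \<forall>x. \<bar>c * f x\<bar> \<le> B" by (intro exI[of _ "\<bar>c\<bar> * B"]) (simp add: abs_mult mult_left_mono)
qed auto

lemma bdd_borel_zero: "bdd_borel (\<lambda>_. 0)"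
  by (rule bdd_borelI[of _ 0]) auto

lemma bdd_borel_diff: "bdd_borel f \<Longrightarrow> bdd_borel g \<Longrightarrow> bdd_borel (\<lambda>x. f x - g x)"
  using bdd_borel_add[of f "\<lambda>x. -1 * g x"] bdd_borel_scale[of g "-1"] by simp

lemma bdd_borel_sum: "(\<And>i. i \<in> I \<Longrightarrow> bdd_borel (f i)) \<Longrightarrow> bdd_borel (\<lambda>x. \<Sum>i\<in>I. f i x)"
  by (induction I rule: infinite_finite_induct) (auto simp: bdd_borel_zero bdd_borel_add)

lemma bdd_borel_indicator: "A \<in> sets borel \<Longrightarrow> bdd_borel (indicator A)"
  by (rule bdd_borelI[of _ 1]) (auto simp: indicator_def)

lemma bdd_borel_test: "bdd_borel (tapply \<phi>)"
  using test_bounded[of \<phi>] unfolding bdd_borel_def by auto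

lemma bdd_borel_integrable:
  assumes "finite_measure M" "sets M = sets borel" "bdd_borel f"
  shows "integrable M f"
proof -
  interpret finite_measure M by fact
  obtain B where "\<And>x. \<bar>f x\<bar> \<le> B" "f \<in> borel_measurable borel"
    using assms(3) unfolding bdd_borel_def by auto
  then show ?thesis
    by (intro integrable_const_bound[of _ B]) (auto simp: assms(2) cong: measurable_cong_sets)
qed

text \<open>This makes the integral with respect to a signed measure independent of how the signed measure
  is written as a linear combination of positive ones.\<close>

lemma integral_combination_zero:
  assumes M: "\<And>i. i \<in> I \<Longrightarrow> finite_measure (M i)" "\<And>i. i \<in> I \<Longrightarrow> sets (M i) = sets borel"
    and rel: "\<And>A. A \<in> sets borel \<Longrightarrow> (\<Sum>i\<in>I. c i * measure (M i) A) = 0"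
    and f: "bdd_borel f"
  shows "(\<Sum>i\<in>I. c i * (LINT x|M i. f x)) = 0"
proof -
  note int = bdd_borel_integrable[OF M]
  have nonneg: "(\<Sum>i\<in>I. c i * (LINT x|M i. u x)) = 0"
    if "u \<in> borel_measurable borel" "\<And>x. 0 \<le> u x" "\<And>x. u x \<le> B" for u :: "real \<Rightarrow> real" and B
    using that
  proof (induction u arbitrary: B rule: borel_measurable_induct_real)
    case (set A)
    then show ?case using rel[of A] M by (simp cong: sum.cong)
  next
    case (mult u c' B)
    show ?case
    proof (cases "c' = 0")
      case False
      then have "u x \<le> B / c'" for x using mult(1) mult(5)[of x] by (simp add: field_simps)
      from mult.IH[OF this] have "c' * (\<Sum>i\<in>I. c i * (LINT x|M i. u x)) = 0" by simp
      then show ?thesis by (simp add: sum_distrib_left mult.left_commute)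
    qed simp
  next
    case (add u v B)
    have b: "u x \<le> B" "v x \<le> B" for x
      using add.hyps(2)[of x] add.hyps(4)[of x] add.prems[of x] by linarith+
    have "bdd_borel u" "bdd_borel v"
      using b add by (auto intro!: bdd_borelI[of _ B] simp: abs_of_nonneg)
    then have "(\<Sum>i\<in>I. c i * (LINT x|M i. v x + u x)) = (\<Sum>i\<in>I. c i * (LINT x|M i. u x) + c i * (LINT x|M i. v x))"
      by (intro sum.cong) (simp_all add: int distrib_left)
    then show ?case using add.IH(1)[OF b(1)] add.IH(2)[OF b(2)] by (simp add: sum.distrib)
  next
    case (seq U B)
    have le: "U i x \<le> u x" for i x
      using seq.hyps(3,4) by (intro incseq_le[of "\<lambda>i. U i x" "u x"]) (auto simp: incseq_def le_fun_def)
    have [measurable]: "u \<in> borel_measurable borel"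
      using seq.hyps(1,4) by (intro borel_measurable_LIMSEQ_real[of borel U u]) auto
    have "(\<lambda>n. \<Sum>i\<in>I. c i * (LINT x|M i. U n x)) \<longlonglongrightarrow> (\<Sum>i\<in>I. c i * (LINT x|M i. u x))"
    proof (intro tendsto_sum tendsto_mult_left)
      fix i assume i: "i \<in> I"
      interpret finite_measure "M i" using M i by blast
      show "(\<lambda>n. LINT x|M i. U n x) \<longlonglongrightarrow> (LINT x|M i. u x)"
      proof (rule integral_dominated_convergence[where w = "\<lambda>_. B"])
        show "AE x in M i. norm (U n x) \<le> B" for n
          using le seq.hyps(2) seq.prems by (intro AE_I2) (metis abs_of_nonneg order_trans real_norm_def)
      qed (use seq.hyps M(2)[OF i] in \<open>auto cong: measurable_cong_sets\<close>)
    qed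
    moreover have "(\<Sum>i\<in>I. c i * (LINT x|M i. U n x)) = 0" for n
      using le[of n] seq.prems by (intro seq.IH[of n B]) (meson order_trans)
    ultimately show ?case by (simp add: LIMSEQ_const_iff)
  qed
  obtain B where B: "\<And>x. \<bar>f x\<bar> \<le> B" and [measurable]: "f \<in> borel_measurable borel"
    using f unfolding bdd_borel_def by auto
  have B': "f x \<le> B" "- f x \<le> B" "0 \<le> B" for x using B[of x] by auto
  have pn: "bdd_borel (\<lambda>x. max (f x) 0)" "bdd_borel (\<lambda>x. max (- f x) 0)"
    using B' by (auto intro!: bdd_borelI[of _ B])
  have "(\<Sum>i\<in>I. c i * (LINT x|M i. f x)) = (\<Sum>i\<in>I. c i * (LINT x|M i. max (f x) 0 - max (- f x) 0))"
    by (intro sum.cong arg_cong2[of _ _ _ _ "(*)"] Bochner_Integration.integral_cong) auto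
  also have "\<dots> = (\<Sum>i\<in>I. c i * (LINT x|M i. max (f x) 0)) - (\<Sum>i\<in>I. c i * (LINT x|M i. max (- f x) 0))"
    by (simp add: int[OF _ _ pn(1)] int[OF _ _ pn(2)] right_diff_distrib sum_subtractf cong: sum.cong)
  also have "\<dots> = 0"
    using nonneg[of "\<lambda>x. max (f x) 0" B] nonneg[of "\<lambda>x. max (- f x) 0" B] pn B'
    by (simp add: bdd_borel_def)
  finally show ?thesis .
qed

lemma pos_part_uminus: "pos_part (\<lambda>A. - smeas \<sigma> A) = npart \<sigma>"
  by (simp add: uminus_smeasure.rep_eq[abs_def] fun_eq_iff arg_cong[where f = pos_part])

lemma smeas_integral_parts: "smeas_integral \<sigma> f = (LINT x|ppart \<sigma>. f x) - (LINT x|npart \<sigma>. f x)"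
  by (simp add: smeas_integral_def pos_part_uminus)

lemma pos_part_integrable_bdd [simp]: "bdd_borel f \<Longrightarrow> integrable (pos_part m) f"
  by (rule bdd_borel_integrable) (auto simp: pos_part_finite)

lemma integral_list_zero:
  assumes M: "\<forall>(c, M)\<in>set xs. finite_measure M \<and> sets M = sets borel"
    and rel: "\<And>A. A \<in> sets borel \<Longrightarrow> (\<Sum>(c, M)\<leftarrow>xs. c * measure M A) = 0"
    and f: "bdd_borel f"
  shows "(\<Sum>(c, M)\<leftarrow>xs. c * (LINT x|M. f x)) = 0"
proof -
  have "(\<Sum>i\<in>{..<length xs}. fst (xs ! i) * (LINT x|snd (xs ! i). f x)) = 0"
  proof (rule integral_combination_zero[where M = "\<lambda>i. snd (xs ! i)" and c = "\<lambda>i. fst (xs ! i)"])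
    show "finite_measure (snd (xs ! i))" "sets (snd (xs ! i)) = sets borel" if "i \<in> {..<length xs}" for i
      using bspec[OF M, of "xs ! i"] that by (simp_all add: split_beta)
    show "(\<Sum>i\<in>{..<length xs}. fst (xs ! i) * measure (snd (xs ! i)) A) = 0" if "A \<in> sets borel" for A
      using rel[OF that] by (simp add: sum_list_sum_nth split_beta atLeast0LessThan)
  qed fact
  then show ?thesis by (simp add: sum_list_sum_nth split_beta atLeast0LessThan)
qed

lemma smeas_integral_of:
  assumes "finite_measure M" "sets M = sets borel" "bdd_borel f"
  shows "smeas_integral (smeas_of M) f = (LINT x|M. f x)"
proof -
  let ?xs = "[(1, M), (- 1, ppart (smeas_of M)), (1, npart (smeas_of M))]"
  have "(\<Sum>(c, M)\<leftarrow>?xs. c * (LINT x|M. f x)) = 0"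
  proof (rule integral_list_zero)
    show "(\<Sum>(c, M)\<leftarrow>?xs. c * measure M A) = 0" if "A \<in> sets borel" for A
      using smeas_of[OF assms(1,2) that] jordan(1)[OF that, of "smeas_of M"] by simp
  qed (use assms in \<open>simp_all add: pos_part_finite\<close>)
  then show ?thesis by (simp add: smeas_integral_parts)
qed

lemma smeas_integral_add_measure:
  assumes "bdd_borel f"
  shows "smeas_integral (\<sigma> + \<tau>) f = smeas_integral \<sigma> f + smeas_integral \<tau> f"
proof -
  let ?xs = "[(1, ppart (\<sigma> + \<tau>)), (- 1, npart (\<sigma> + \<tau>)), (- 1, ppart \<sigma>), (1, npart \<sigma>),
    (- 1, ppart \<tau>), (1, npart \<tau>)]"
  have "(\<Sum>(c, M)\<leftarrow>?xs. c * (LINT x|M. f x)) = 0"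
  proof (rule integral_list_zero)
    show "(\<Sum>(c, M)\<leftarrow>?xs. c * measure M A) = 0" if A: "A \<in> sets borel" for A
    proof -
      have "smeas (\<sigma> + \<tau>) A = smeas \<sigma> A + smeas \<tau> A" by (simp add: smeas_simps)
      then show ?thesis unfolding jordan(1)[OF A] by simp
    qed
  qed (use assms in \<open>simp_all add: pos_part_finite\<close>)
  then show ?thesis by (simp add: smeas_integral_parts)
qed

lemma smeas_integral_scale_measure:
  assumes "bdd_borel f"
  shows "smeas_integral (c *\<^sub>R \<sigma>) f = c * smeas_integral \<sigma> f"
proof -
  let ?xs = "[(1, ppart (c *\<^sub>R \<sigma>)), (- 1, npart (c *\<^sub>R \<sigma>)), (- c, ppart \<sigma>), (c, npart \<sigma>)]"
  have "(\<Sum>(c, M)\<leftarrow>?xs. c * (LINT x|M. f x)) = 0"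
  proof (rule integral_list_zero)
    show "(\<Sum>(c, M)\<leftarrow>?xs. c * measure M A) = 0" if A: "A \<in> sets borel" for A
    proof -
      have "smeas (c *\<^sub>R \<sigma>) A = c * smeas \<sigma> A" by (simp add: smeas_simps)
      then show ?thesis unfolding jordan(1)[OF A] by (simp add: algebra_simps)
    qed
  qed (use assms in \<open>simp_all add: pos_part_finite\<close>)
  then show ?thesis by (simp add: smeas_integral_parts algebra_simps)
qed

lemma smeas_integral_linear_measure: "bdd_borel f \<Longrightarrow> linear (\<lambda>\<sigma>. smeas_integral \<sigma> f)"
  by (rule linearI) (simp_all add: smeas_integral_add_measure smeas_integral_scale_measure)

lemma smeas_integral_add:
  "bdd_borel f \<Longrightarrow> bdd_borel g \<Longrightarrow> smeas_integral \<sigma> (\<lambda>x. f x + g x) = smeas_integral \<sigma> f + smeas_integral \<sigma> g"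
  by (simp add: smeas_integral_parts)

lemma smeas_integral_scale: "smeas_integral \<sigma> (\<lambda>x. c * f x) = c * smeas_integral \<sigma> f"
  by (simp add: smeas_integral_parts right_diff_distrib)

lemma smeas_integral_diff:
  "bdd_borel f \<Longrightarrow> bdd_borel g \<Longrightarrow> smeas_integral \<sigma> (\<lambda>x. f x - g x) = smeas_integral \<sigma> f - smeas_integral \<sigma> g"
  by (simp add: smeas_integral_parts)

lemma smeas_integral_sum:
  assumes "\<And>i. i \<in> I \<Longrightarrow> bdd_borel (f i)"
  shows "smeas_integral \<sigma> (\<lambda>x. \<Sum>i\<in>I. f i x) = (\<Sum>i\<in>I. smeas_integral \<sigma> (f i))"
  using assms by (simp add: smeas_integral_parts Bochner_Integration.integral_sum sum_subtractf)

lemma smeas_integral_indicator: "A \<in> sets borel \<Longrightarrow> smeas_integral \<sigma> (indicator A) = smeas \<sigma> A"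
  by (simp add: smeas_integral_parts jordan(1))

definition tv_mass :: "smeasure \<Rightarrow> real" where
  "tv_mass \<sigma> = measure (ppart \<sigma>) UNIV + measure (npart \<sigma>) UNIV"

lemma space_pos_part [simp]: "space (pos_part m) = UNIV"
  using sets_eq_imp_space_eq[OF pos_part_sets] by simp

lemma integral_pos_part_bound:
  assumes f: "bdd_borel f" "\<And>x. x \<notin> A \<Longrightarrow> f x = 0" "\<And>x. \<bar>f x\<bar> \<le> B" and A: "A \<in> sets borel"
  shows "\<bar>LINT x|pos_part m. f x\<bar> \<le> B * measure (pos_part m) A"
proof -
  have "\<bar>LINT x|pos_part m. f x\<bar> \<le> (LINT x|pos_part m. \<bar>f x\<bar>)" by (rule integral_abs_bound)
  also have "\<dots> \<le> (LINT x|pos_part m. B * indicator A x)"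
    using f A by (intro integral_mono integrable_abs) (auto simp: bdd_borel_scale bdd_borel_indicator split: split_indicator)
  also have "\<dots> = B * measure (pos_part m) A" using A by simp
  finally show ?thesis .
qed

lemma smeas_integral_bound_on:
  assumes "bdd_borel f" "\<And>x. x \<notin> A \<Longrightarrow> f x = 0" "\<And>x. \<bar>f x\<bar> \<le> B" "A \<in> sets borel"
  shows "\<bar>smeas_integral \<sigma> f\<bar> \<le> B * (measure (ppart \<sigma>) A + measure (npart \<sigma>) A)"
  using integral_pos_part_bound[OF assms, of "smeas \<sigma>"] integral_pos_part_bound[OF assms, of "smeas (- \<sigma>)"]
  unfolding smeas_integral_parts distrib_left by linarith

lemma smeas_integral_bound:
  assumes "bdd_borel f" "\<And>x. \<bar>f x\<bar> \<le> B"
  shows "\<bar>smeas_integral \<sigma> f\<bar> \<le> B * tv_mass \<sigma>"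
  unfolding tv_mass_def by (rule smeas_integral_bound_on) (use assms in auto)

lemma smeas_integral_dirac:
  assumes f: "bdd_borel f"
  shows "smeas_integral (sdirac x) f = f x"
proof -
  let ?M = "distr (count_space {()}) borel (\<lambda>_. x)"
  have fin: "finite_measure ?M"
    by (rule finite_measure.finite_measure_distr) (auto intro: finite_measure_count_space)
  have "sdirac x = smeas_of ?M"
    by (rule smeasure_eqI) (auto simp: sdirac.rep_eq smeas_of[OF fin] measure_distr indicator_def)
  moreover have "(LINT y|?M. f y) = f x"
    using f by (subst integral_distr) (auto simp: bdd_borel_def lebesgue_integral_count_space_finite)
  moreover have "smeas_integral (smeas_of ?M) f = (LINT y|?M. f y)"
    by (rule smeas_integral_of[OF fin _ f]) (rule sets_distr)
  ultimately show ?thesis by (simp only:)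
qed

section \<open>Norms on finite-dimensional spaces\<close>

lemma norm_onD:
  assumes "norm_on UNIV W"
  shows "W (x + y) \<le> W x + W y" "W (c *\<^sub>R x) = \<bar>c\<bar> * W x" "0 \<le> W x" "W x = 0 \<longleftrightarrow> x = 0" "W 0 = 0"
    "W (- x) = W x" "W (x - y) \<le> W x + W y"
proof -
  show *: "W (x + y) \<le> W x + W y" "W (c *\<^sub>R x) = \<bar>c\<bar> * W x" "0 \<le> W x" for x y c
    using assms by (auto simp: norm_on_def seminorm_on_def)
  show z: "W 0 = 0" using *(2)[of 0 0] by simp
  show "W x = 0 \<longleftrightarrow> x = 0" using assms z by (auto simp: norm_on_def)
  show m: "W (- x) = W x" for x using *(2)[of "-1" x] by simp
  show "W (x - y) \<le> W x + W y" using *(1)[of x "- y"] m[of y] by simp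
qed

lemma norm_on_sum:
  assumes "norm_on UNIV W"
  shows "W (\<Sum>i\<in>I. f i) \<le> (\<Sum>i\<in>I. W (f i))"
proof (induction I rule: infinite_finite_induct)
  case (insert i I)
  then show ?case using norm_onD(1)[OF assms, of "f i" "sum f I"] by simp
qed (simp_all add: norm_onD(5)[OF assms])

lemma norm_on_convex_continuous:
  fixes W :: "real ^ 'd \<Rightarrow> real"
  assumes "norm_on UNIV W"
  shows "convex_on UNIV W" "continuous_on A W"
proof -
  note W = norm_onD[OF assms]
  show "convex_on UNIV W"
  proof (rule convex_onI)
    fix t :: real and x y assume t: "0 < t" "t < 1"
    have "W ((1 - t) *\<^sub>R x + t *\<^sub>R y) \<le> W ((1 - t) *\<^sub>R x) + W (t *\<^sub>R y)" by (rule W(1))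
    also have "\<dots> = (1 - t) * W x + t * W y" using t by (simp add: W(2))
    finally show "W ((1 - t) *\<^sub>R x + t *\<^sub>R y) \<le> (1 - t) * W x + t * W y" .
  qed simp
  then have "continuous_on UNIV W" by (intro convex_on_continuous) auto
  then show "continuous_on A W" by (rule continuous_on_subset) simp
qed

lemma
  fixes W :: "real ^ 'd \<Rightarrow> real"
  assumes "norm_on UNIV W"
  shows norm_on_lower: "\<exists>c>0. \<forall>v. c * norm v \<le> W v"
    and norm_on_upper: "\<exists>C>0. \<forall>v. W v \<le> C * norm v"
proof -
  note W = norm_onD[OF assms]
  let ?S = "sphere (0 :: real ^ 'd) 1"
  have ne: "?S \<noteq> {}" by simp
  have comp: "compact ?S" by simp
  obtain a where a: "a \<in> ?S" "\<And>x. x \<in> ?S \<Longrightarrow> W a \<le> W x"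
    using continuous_attains_inf[OF comp ne norm_on_convex_continuous(2)[OF assms]] by blast
  obtain b where b: "b \<in> ?S" "\<And>x. x \<in> ?S \<Longrightarrow> W x \<le> W b"
    using continuous_attains_sup[OF comp ne norm_on_convex_continuous(2)[OF assms]] by blast
  have scale: "W v = norm v * W ((1 / norm v) *\<^sub>R v)" if "v \<noteq> 0" for v
    using that by (simp add: W(2))
  have "a \<noteq> 0" "b \<noteq> 0" using a b by auto
  then have pos: "0 < W a" "0 < W b" using W(3,4) by (metis less_eq_real_def)+
  have "W a * norm v \<le> W v" "W v \<le> W b * norm v" for v
  proof -
    show "W a * norm v \<le> W v"
    proof (cases "v = 0")
      case False
      then have "W a \<le> W ((1 / norm v) *\<^sub>R v)" by (intro a) simp
      then show ?thesis using scale[OF False] False by (simp add: field_simps)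
    qed (simp add: W)
    show "W v \<le> W b * norm v"
    proof (cases "v = 0")
      case False
      then have "W ((1 / norm v) *\<^sub>R v) \<le> W b" by (intro b) simp
      then show ?thesis using scale[OF False] False by (simp add: field_simps)
    qed (simp add: W)
  qed
  then show "\<exists>c>0. \<forall>v. c * norm v \<le> W v" "\<exists>C>0. \<forall>v. W v \<le> C * norm v"
    using pos by blast+
qed

text \<open>The unit ball is compact, since every norm is bounded below by a multiple of the Euclidean
  one.\<close>

lemma dual_norm_attained:
  fixes Z :: "real ^ 'd \<Rightarrow> real"
  assumes Z: "norm_on UNIV Z"
  obtains v where "Z v \<le> 1" "w \<bullet> v = dual_norm Z w"
proof -
  obtain c where c: "0 < c" "\<And>v. c * norm v \<le> Z v" using norm_on_lower[OF Z] by auto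
  have "norm v \<le> 1 / c" if "Z v \<le> 1" for v
    using order_trans[OF c(2) that] c(1) by (simp add: pos_le_divide_eq mult.commute)
  then have "bounded {v. Z v \<le> 1}" unfolding bounded_iff by blast
  moreover have "closed {v. Z v \<le> 1}"
    using norm_on_convex_continuous(2)[OF Z, of UNIV] by (intro closed_Collect_le) auto
  ultimately have "compact {v. Z v \<le> 1}" by (simp add: compact_eq_bounded_closed)
  moreover have "{v. Z v \<le> 1} \<noteq> {}" using norm_onD(5)[OF Z] by (auto intro!: exI[of _ 0])
  moreover have "continuous_on {v. Z v \<le> 1} (\<lambda>v. w \<bullet> v)" by (intro continuous_intros)
  ultimately obtain v where v: "v \<in> {v. Z v \<le> 1}" "\<And>u. u \<in> {v. Z v \<le> 1} \<Longrightarrow> w \<bullet> u \<le> w \<bullet> v"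
    using continuous_attains_sup[of "{v. Z v \<le> 1}" "\<lambda>v. w \<bullet> v"] by blast
  have "dual_norm Z w = w \<bullet> v" unfolding dual_norm_def
  proof (rule cSup_eq_maximum)
    show "w \<bullet> v \<in> (\<bullet>) w ` {v. Z v \<le> 1}" using v(1) by blast
    show "y \<le> w \<bullet> v" if "y \<in> (\<bullet>) w ` {v. Z v \<le> 1}" for y
      using that v(2) by blast
  qed
  then show ?thesis using that[of v] v(1) by simp
qed

lemma dual_norm_upper:
  fixes Z :: "real ^ 'd \<Rightarrow> real"
  assumes Z: "norm_on UNIV Z"
  shows "w \<bullet> v \<le> dual_norm Z w * Z v"
proof (cases "v = 0")
  case True then show ?thesis by (simp add: norm_onD(5)[OF Z])
next
  case False
  note W = norm_onD[OF Z]
  have pos: "0 < Z v" using False W(3,4) by (metis less_eq_real_def)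
  obtain c where c: "0 < c" "\<And>v. c * norm v \<le> Z v" using norm_on_lower[OF Z] by auto
  have "bdd_above ((\<bullet>) w ` {v. Z v \<le> 1})"
  proof (rule bdd_aboveI2)
    fix u assume "u \<in> {v. Z v \<le> 1}"
    then have "norm u \<le> 1 / c"
      using order_trans[OF c(2)[of u]] c(1) by (simp add: pos_le_divide_eq mult.commute)
    then have "norm w * norm u \<le> norm w * (1 / c)" by (rule mult_left_mono) simp
    then show "w \<bullet> u \<le> norm w * (1 / c)" using norm_cauchy_schwarz order_trans by blast
  qed
  moreover have "(1 / Z v) *\<^sub>R v \<in> {v. Z v \<le> 1}" using pos by (simp add: W(2))
  ultimately have "w \<bullet> ((1 / Z v) *\<^sub>R v) \<le> dual_norm Z w"
    unfolding dual_norm_def by (intro cSUP_upper)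
  then show ?thesis using pos by (simp add: pos_divide_le_eq)
qed

lemma norm_on_dual_norm:
  fixes Z :: "real ^ 'd \<Rightarrow> real"
  assumes Z: "norm_on UNIV Z"
  shows "norm_on UNIV (dual_norm Z)"
proof -
  note W = norm_onD[OF Z]
  have ub: "w \<bullet> v \<le> dual_norm Z w" if "Z v \<le> 1" "0 \<le> dual_norm Z w" for w v
    using dual_norm_upper[OF Z, of w v] mult_left_le[OF that] by linarith
  have nonneg: "0 \<le> dual_norm Z w" for w
  proof -
    obtain v where v: "Z v \<le> 1" "w \<bullet> v = dual_norm Z w" by (rule dual_norm_attained[OF Z])
    have "0 \<le> dual_norm Z w * Z w" using dual_norm_upper[OF Z, of w w] by (meson inner_ge_zero order_trans)
    show ?thesis
    proof (cases "w = 0")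
      case True then show ?thesis using v by simp
    next
      case False
      then have "0 < Z w" using W(3,4) by (metis less_eq_real_def)
      then show ?thesis using \<open>0 \<le> dual_norm Z w * Z w\<close> by (simp add: zero_le_mult_iff)
    qed
  qed
  have zero: "w = 0" if "dual_norm Z w = 0" for w
    using dual_norm_upper[OF Z, of w w] that inner_ge_zero[of w] by simp
  have add: "dual_norm Z (w + u) \<le> dual_norm Z w + dual_norm Z u" for w u
  proof -
    obtain v where v: "Z v \<le> 1" "(w + u) \<bullet> v = dual_norm Z (w + u)" by (rule dual_norm_attained[OF Z])
    then show ?thesis using ub[OF v(1) nonneg, of w] ub[OF v(1) nonneg, of u] by (simp add: inner_add_left)
  qed
  have le: "dual_norm Z (c *\<^sub>R w) \<le> \<bar>c\<bar> * dual_norm Z w" for c w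
  proof -
    obtain v where v: "Z v \<le> 1" "(c *\<^sub>R w) \<bullet> v = dual_norm Z (c *\<^sub>R w)" by (rule dual_norm_attained[OF Z])
    have "dual_norm Z (c *\<^sub>R w) = \<bar>c\<bar> * (w \<bullet> (sgn c *\<^sub>R v))"
      using v(2) abs_mult_sgn[of c] by (simp flip: mult.assoc)
    also have "\<dots> \<le> \<bar>c\<bar> * dual_norm Z w"
    proof (intro mult_left_mono ub nonneg)
      have "\<bar>sgn c\<bar> \<le> 1" by (simp add: abs_sgn_eq)
      then show "Z (sgn c *\<^sub>R v) \<le> 1" using v(1) W(3)[of v] by (simp add: W(2) mult_le_one)
    qed simp
    finally show ?thesis .
  qed
  have scale: "dual_norm Z (c *\<^sub>R w) = \<bar>c\<bar> * dual_norm Z w" for c w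
  proof (cases "c = 0")
    case True
    then show ?thesis using le[of 0 w] nonneg[of "0 *\<^sub>R w"] by simp
  next
    case False
    have "dual_norm Z w \<le> \<bar>1 / c\<bar> * dual_norm Z (c *\<^sub>R w)" using le[of "1 / c" "c *\<^sub>R w"] False by simp
    then have "\<bar>c\<bar> * dual_norm Z w \<le> dual_norm Z (c *\<^sub>R w)" using False by (simp add: field_simps)
    then show ?thesis using le[of c w] by simp
  qed
  show ?thesis
    unfolding norm_on_def seminorm_on_def using nonneg scale add zero by auto
qed

lemma monotone_norm_norm_on: "monotone_norm Z \<Longrightarrow> norm_on UNIV Z"
  by (simp add: monotone_norm_def)

lemma monotone_norm_mono: "monotone_norm Z \<Longrightarrow> (\<And>d. \<bar>w $ d\<bar> \<le> \<bar>v $ d\<bar>) \<Longrightarrow> Z w \<le> Z v"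
  by (simp add: monotone_norm_def)

lemma monotone_norm_abs: "monotone_norm Z \<Longrightarrow> (\<And>d. \<bar>w $ d\<bar> = \<bar>v $ d\<bar>) \<Longrightarrow> Z w = Z v"
  by (simp add: antisym monotone_norm_mono)

text \<open>Let \<open>u\<close> be a maximiser for \<open>w\<close>. The vector with the absolute
  values of \<open>u\<close> and the signs of \<open>v\<close> stays in the unit ball and pairs at least
  as well with \<open>v\<close> as \<open>u\<close> does with \<open>w\<close>.\<close>

lemma monotone_dual_norm:
  fixes Z :: "real ^ 'd \<Rightarrow> real"
  assumes Z: "monotone_norm Z"
  shows "monotone_norm (dual_norm Z)"
  unfolding monotone_norm_def
proof (intro conjI allI impI)
  note N = monotone_norm_norm_on[OF Z]
  show "norm_on UNIV (dual_norm Z)" by (rule norm_on_dual_norm) (rule N)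
  fix v w :: "real ^ 'd" assume le: "\<forall>d. \<bar>w $ d\<bar> \<le> \<bar>v $ d\<bar>"
  obtain u where u: "Z u \<le> 1" "w \<bullet> u = dual_norm Z w" by (rule dual_norm_attained[OF N])
  define u' where "u' = (\<chi> d. sgn (v $ d) * \<bar>u $ d\<bar>)"
  have "w $ d * u $ d \<le> v $ d * u' $ d" for d
  proof -
    have "w $ d * u $ d \<le> \<bar>w $ d\<bar> * \<bar>u $ d\<bar>" by (metis abs_ge_self abs_mult)
    also have "\<dots> \<le> \<bar>v $ d\<bar> * \<bar>u $ d\<bar>" using le by (intro mult_right_mono) auto
    also have "\<dots> = v $ d * u' $ d" by (simp add: u'_def abs_sgn)
    finally show ?thesis .
  qed
  then have "w \<bullet> u \<le> v \<bullet> u'" by (auto simp: inner_vec_def intro: sum_mono)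
  also have "\<dots> \<le> dual_norm Z v * Z u'" by (rule dual_norm_upper[OF N])
  also have "Z u' \<le> 1"
    by (rule order_trans[OF monotone_norm_mono[OF Z] u(1)]) (simp add: u'_def abs_mult abs_sgn_eq)
  then have "dual_norm Z v * Z u' \<le> dual_norm Z v"
    using norm_onD(3)[OF norm_on_dual_norm[OF N], of v] by (rule mult_left_le)
  finally show "dual_norm Z w \<le> dual_norm Z v" using u(2) by simp
qed

section \<open>Norms of vector measures\<close>

definition svec :: "smeasure ^ 'd \<Rightarrow> real set \<Rightarrow> real ^ 'd" where
  "svec \<mu> E = (\<chi> d. smeas (\<mu> $ d) E)"

lemma svec_simps [simp]: "svec \<mu> {} = 0" "svec (\<mu> + \<nu>) E = svec \<mu> E + svec \<nu> E"
  "svec (c *\<^sub>R \<mu>) E = c *\<^sub>R svec \<mu> E" "svec 0 E = 0"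
  by (simp_all add: svec_def vec_eq_iff smeas_simps)

lemma sum_abs_smeas_le:
  assumes I: "finite I" and A: "\<And>i. i \<in> I \<Longrightarrow> A i \<in> sets borel" "disjoint_family_on A I"
  shows "(\<Sum>i\<in>I. \<bar>smeas \<sigma> (A i)\<bar>) \<le> tv_mass \<sigma>"
proof -
  have *: "(\<Sum>i\<in>I. measure M (A i)) \<le> measure M UNIV" if "finite_measure M" "sets M = sets borel" for M
  proof -
    interpret finite_measure M by fact
    have "(\<Sum>i\<in>I. measure M (A i)) = measure M (\<Union>i\<in>I. A i)"
    proof (rule finite_measure_finite_Union[symmetric])
      show "A ` I \<subseteq> sets M" using A(1) that(2) by auto
    qed fact+
    also have "\<dots> \<le> measure M UNIV"
      using that(2) sets_eq_imp_space_eq[OF that(2)] by (intro finite_measure_mono) auto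
    finally show ?thesis .
  qed
  have "(\<Sum>i\<in>I. \<bar>smeas \<sigma> (A i)\<bar>) \<le> (\<Sum>i\<in>I. measure (ppart \<sigma>) (A i) + measure (npart \<sigma>) (A i))"
    by (intro sum_mono jordan A)
  also have "\<dots> \<le> tv_mass \<sigma>"
    unfolding sum.distrib tv_mass_def by (intro add_mono * ) (auto simp: pos_part_finite)
  finally show ?thesis .
qed

lemma finite_partitionsD:
  assumes "\<pi> \<in> finite_partitions"
  shows "finite \<pi>" "\<And>E. E \<in> \<pi> \<Longrightarrow> E \<in> sets borel" "disjoint_family_on (\<lambda>E. E) \<pi>" "\<Union>\<pi> = UNIV"
proof -
  show "finite \<pi>" "\<And>E. E \<in> \<pi> \<Longrightarrow> E \<in> sets borel" "\<Union>\<pi> = UNIV"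
    using assms unfolding finite_partitions_def partition_on_def by blast+
  show "disjoint_family_on (\<lambda>E. E) \<pi>"
    using assms unfolding finite_partitions_def partition_on_def disjoint_family_on_def disjoint_def
    by blast
qed

lemma UNIV_in_finite_partitions: "{UNIV} \<in> finite_partitions"
  by (auto simp: finite_partitions_def partition_on_def)

lemma norm_on_le_sum_abs:
  fixes W :: "real ^ 'd \<Rightarrow> real"
  assumes "norm_on UNIV W"
  shows "\<exists>C\<ge>0. \<forall>v. W v \<le> C * (\<Sum>d\<in>UNIV. \<bar>v $ d\<bar>)"
proof -
  obtain C where C: "0 < C" "\<And>v. W v \<le> C * norm v" using norm_on_upper[OF assms] by auto
  have "W v \<le> C * (\<Sum>d\<in>UNIV. \<bar>v $ d\<bar>)" for v
    using C(2)[of v] mult_left_mono[OF norm_le_l1_cart[of v], of C] C(1) by linarith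
  then show ?thesis using C(1) by (intro exI[of _ C]) simp
qed

lemma inner_norm_bdd:
  fixes W :: "real ^ 'd \<Rightarrow> real"
  assumes "norm_on UNIV W"
  shows "bdd_above ((\<lambda>\<pi>. \<Sum>E\<in>\<pi>. W (svec \<mu> E)) ` finite_partitions)"
proof -
  obtain C where C: "0 \<le> C" "\<And>v. W v \<le> C * (\<Sum>d\<in>UNIV. \<bar>v $ d\<bar>)"
    using norm_on_le_sum_abs[OF assms] by auto
  show ?thesis
  proof (rule bdd_aboveI2)
    fix \<pi> assume \<pi>: "\<pi> \<in> finite_partitions"
    have "(\<Sum>E\<in>\<pi>. W (svec \<mu> E)) \<le> (\<Sum>E\<in>\<pi>. C * (\<Sum>d\<in>UNIV. \<bar>smeas (\<mu> $ d) E\<bar>))"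
      using C(2)[of "svec \<mu> _"] by (intro sum_mono) (simp add: svec_def)
    also have "\<dots> = C * (\<Sum>d\<in>UNIV. \<Sum>E\<in>\<pi>. \<bar>smeas (\<mu> $ d) E\<bar>)"
      by (subst sum.swap) (simp add: sum_distrib_left)
    also have "\<dots> \<le> C * (\<Sum>d\<in>UNIV. tv_mass (\<mu> $ d))"
      using finite_partitionsD[OF \<pi>] C by (intro mult_left_mono sum_mono sum_abs_smeas_le) auto
    finally show "(\<Sum>E\<in>\<pi>. W (svec \<mu> E)) \<le> C * (\<Sum>d\<in>UNIV. tv_mass (\<mu> $ d))" .
  qed
qed

lemma inner_norm_svec: "inner_norm W \<mu> = (SUP \<pi>\<in>finite_partitions. \<Sum>E\<in>\<pi>. W (svec \<mu> E))"
  by (simp add: inner_norm_def svec_def)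

lemma inner_norm_least:
  assumes "\<And>\<pi>. \<pi> \<in> finite_partitions \<Longrightarrow> (\<Sum>E\<in>\<pi>. W (svec \<mu> E)) \<le> B"
  shows "inner_norm W \<mu> \<le> B"
  unfolding inner_norm_svec using UNIV_in_finite_partitions by (intro cSUP_least assms) auto

lemma inner_norm_partition:
  fixes W :: "real ^ 'd \<Rightarrow> real"
  assumes "norm_on UNIV W" "\<pi> \<in> finite_partitions"
  shows "(\<Sum>E\<in>\<pi>. W (svec \<mu> E)) \<le> inner_norm W \<mu>"
  unfolding inner_norm_svec by (rule cSUP_upper[OF assms(2) inner_norm_bdd[OF assms(1)]])

text \<open>The supremum may be taken over families of disjoint sets: empty sets do not matter, and the
  complement of the union can be added.\<close>

lemma inner_norm_family:
  fixes W :: "real ^ 'd \<Rightarrow> real"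
  assumes W: "norm_on UNIV W" and I: "finite I"
    and A: "\<And>i. i \<in> I \<Longrightarrow> A i \<in> sets borel" "disjoint_family_on A I"
  shows "(\<Sum>i\<in>I. W (svec \<mu> (A i))) \<le> inner_norm W \<mu>"
proof -
  note W' = norm_onD[OF W]
  define J where "J = {i\<in>I. A i \<noteq> {}}"
  define R where "R = - (\<Union>i\<in>I. A i)"
  define \<pi> where "\<pi> = (A ` J \<union> {R}) - {{}}"
  have inj: "inj_on A J"
    using A(2) unfolding inj_on_def J_def disjoint_family_on_def by blast
  have "(\<Union>i\<in>I. A i) \<in> sets borel" using A I by auto
  then have R: "R \<in> sets borel" unfolding R_def by (rule borel_comp)
  have \<pi>: "\<pi> \<in> finite_partitions" unfolding finite_partitions_def partition_on_def mem_Collect_eq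
  proof (intro conjI)
    show "finite \<pi>" using I by (simp add: \<pi>_def J_def)
    show "\<pi> \<subseteq> sets borel" using A(1) R by (auto simp: \<pi>_def J_def)
    have "x \<in> \<Union>\<pi>" for x
    proof (cases "x \<in> R")
      case True
      then have "R \<in> \<pi>" unfolding \<pi>_def by blast
      with True show ?thesis by blast
    next
      case False
      then obtain i where "i \<in> I" "x \<in> A i" unfolding R_def by blast
      then have "A i \<in> \<pi>" unfolding \<pi>_def J_def by blast
      with \<open>x \<in> A i\<close> show ?thesis by blast
    qed
    then show "\<Union>\<pi> = UNIV" by blast
    show "disjoint \<pi>" unfolding disjoint_def
    proof (intro ballI impI)
      fix E F assume EF: "E \<in> \<pi>" "F \<in> \<pi>" "E \<noteq> F"
      have *: "A i \<inter> R = {}" if "i \<in> I" for i using that unfolding R_def by blast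
      have **: "A i \<inter> A j = {}" if "i \<in> I" "j \<in> I" "A i \<noteq> A j" for i j
        using A(2) that unfolding disjoint_family_on_def by metis
      have "E = R \<or> (\<exists>i\<in>I. E = A i)" "F = R \<or> (\<exists>i\<in>I. F = A i)"
        using EF unfolding \<pi>_def J_def by blast+
      then consider "E = R" "F = R" | i where "i \<in> I" "E = A i" "F = R" | i where "i \<in> I" "E = R" "F = A i"
        | i j where "i \<in> I" "j \<in> I" "E = A i" "F = A j" by blast
      then show "E \<inter> F = {}"
      proof cases
        case 1 then show ?thesis using EF(3) by simp
      next
        case 2 then show ?thesis using * by simp
      next
        case 3 then show ?thesis using * by (simp add: Int_commute)
      next
        case 4 then show ?thesis using ** EF(3) by blast
      qed
    qed
    show "{} \<notin> \<pi>" by (simp add: \<pi>_def)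
  qed
  have "(\<Sum>i\<in>I. W (svec \<mu> (A i))) = (\<Sum>i\<in>J. W (svec \<mu> (A i)))"
    unfolding J_def by (rule sum.mono_neutral_right) (auto simp: I W')
  also have "\<dots> = (\<Sum>E\<in>A ` J. W (svec \<mu> E))" by (simp add: sum.reindex[OF inj])
  also have "\<dots> \<le> (\<Sum>E\<in>\<pi>. W (svec \<mu> E))"
    using I by (intro sum_mono2) (auto simp: \<pi>_def J_def W')
  also have "\<dots> \<le> inner_norm W \<mu>" by (rule inner_norm_partition[OF W \<pi>])
  finally show ?thesis .
qed

lemma inner_norm_nonneg: "norm_on UNIV (W :: real ^ 'd \<Rightarrow> real) \<Longrightarrow> 0 \<le> inner_norm W \<mu>"
  using inner_norm_family[of W "{}" "\<lambda>_. {}" \<mu>] by (simp add: disjoint_family_on_def)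

lemma inner_norm_ge: "norm_on UNIV (W :: real ^ 'd \<Rightarrow> real) \<Longrightarrow> E \<in> sets borel \<Longrightarrow> W (svec \<mu> E) \<le> inner_norm W \<mu>"
  using inner_norm_family[of W "{()}" "\<lambda>_. E" \<mu>] by (simp add: disjoint_family_on_def)

lemma svec_zero_iff: "(\<forall>E\<in>sets borel. svec \<mu> E = 0) \<longleftrightarrow> \<mu> = 0"
  by (auto simp: vec_eq_iff svec_def smeas_simps intro!: smeasure_eqI)

lemma inner_norm_near:
  fixes W :: "real ^ 'd \<Rightarrow> real"
  assumes "norm_on UNIV W" "0 < e"
  obtains \<pi> where "\<pi> \<in> finite_partitions" "inner_norm W \<mu> - e < (\<Sum>E\<in>\<pi>. W (svec \<mu> E))"
proof -
  have "\<exists>y\<in>(\<lambda>\<pi>. \<Sum>E\<in>\<pi>. W (svec \<mu> E)) ` finite_partitions. inner_norm W \<mu> - e < y"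
    unfolding inner_norm_svec using UNIV_in_finite_partitions assms(2) by (intro less_cSupD) auto
  then show ?thesis using that by blast
qed

lemma norm_on_inner_norm:
  fixes W :: "real ^ 'd \<Rightarrow> real"
  assumes W: "norm_on UNIV W"
  shows "norm_on UNIV (inner_norm W)"
proof -
  note W' = norm_onD[OF W]
  have add: "inner_norm W (\<mu> + \<nu>) \<le> inner_norm W \<mu> + inner_norm W \<nu>" for \<mu> \<nu>
  proof (rule inner_norm_least)
    fix \<pi> assume \<pi>: "\<pi> \<in> finite_partitions"
    have "(\<Sum>E\<in>\<pi>. W (svec (\<mu> + \<nu>) E)) \<le> (\<Sum>E\<in>\<pi>. W (svec \<mu> E)) + (\<Sum>E\<in>\<pi>. W (svec \<nu> E))"
      unfolding sum.distrib[symmetric] by (intro sum_mono) (simp add: W')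
    also have "\<dots> \<le> inner_norm W \<mu> + inner_norm W \<nu>"
      by (intro add_mono inner_norm_partition W \<pi>)
    finally show "(\<Sum>E\<in>\<pi>. W (svec (\<mu> + \<nu>) E)) \<le> inner_norm W \<mu> + inner_norm W \<nu>" .
  qed
  have le: "inner_norm W (c *\<^sub>R \<mu>) \<le> \<bar>c\<bar> * inner_norm W \<mu>" for c \<mu>
  proof (rule inner_norm_least)
    fix \<pi> assume \<pi>: "\<pi> \<in> finite_partitions"
    have "(\<Sum>E\<in>\<pi>. W (svec (c *\<^sub>R \<mu>) E)) = \<bar>c\<bar> * (\<Sum>E\<in>\<pi>. W (svec \<mu> E))"
      by (simp add: W' sum_distrib_left)
    also have "\<dots> \<le> \<bar>c\<bar> * inner_norm W \<mu>"
      by (intro mult_left_mono inner_norm_partition W \<pi>) simp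
    finally show "(\<Sum>E\<in>\<pi>. W (svec (c *\<^sub>R \<mu>) E)) \<le> \<bar>c\<bar> * inner_norm W \<mu>" .
  qed
  have scale: "inner_norm W (c *\<^sub>R \<mu>) = \<bar>c\<bar> * inner_norm W \<mu>" for c \<mu>
  proof (cases "c = 0")
    case True
    then show ?thesis using le[of 0 \<mu>] inner_norm_nonneg[OF W, of "0 *\<^sub>R \<mu>"] by simp
  next
    case False
    have "inner_norm W \<mu> \<le> \<bar>1 / c\<bar> * inner_norm W (c *\<^sub>R \<mu>)" using le[of "1 / c" "c *\<^sub>R \<mu>"] False by simp
    then have "\<bar>c\<bar> * inner_norm W \<mu> \<le> inner_norm W (c *\<^sub>R \<mu>)" using False by (simp add: field_simps)
    then show ?thesis using le[of c \<mu>] by simp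
  qed
  have zero: "\<mu> = 0" if "inner_norm W \<mu> = 0" for \<mu>
  proof -
    have "svec \<mu> E = 0" if "E \<in> sets borel" for E
      using inner_norm_ge[OF W that, of \<mu>] W'(3,4)[of "svec \<mu> E"] \<open>inner_norm W \<mu> = 0\<close> by (metis antisym)
    then show ?thesis using svec_zero_iff by blast
  qed
  show ?thesis unfolding norm_on_def seminorm_on_def
    using inner_norm_nonneg[OF W] add scale zero by auto
qed

definition vrestrict :: "real set \<Rightarrow> smeasure ^ 'd \<Rightarrow> smeasure ^ 'd" where
  "vrestrict B \<mu> = (\<chi> d. srestrict B (\<mu> $ d))"

lemma svec_vrestrict: "B \<in> sets borel \<Longrightarrow> A \<in> sets borel \<Longrightarrow> svec (vrestrict B \<mu>) A = svec \<mu> (A \<inter> B)"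
  by (simp add: svec_def vrestrict_def srestrict.rep_eq)

lemma vrestrict_add: "B \<in> sets borel \<Longrightarrow> \<mu> = vrestrict B \<mu> + vrestrict (- B) \<mu>"
  by (simp add: vec_eq_iff vrestrict_def flip: srestrict_add)

text \<open>The sets of a partition intersected with \<open>B\<close>, and those of another one
  intersected with \<open>- B\<close>, form a disjoint family; so near-optimal partitions for the two
  restrictions combine.\<close>

lemma inner_norm_restrict:
  fixes W :: "real ^ 'd \<Rightarrow> real"
  assumes W: "norm_on UNIV W" and B: "B \<in> sets borel"
  shows "inner_norm W \<mu> = inner_norm W (vrestrict B \<mu>) + inner_norm W (vrestrict (- B) \<mu>)"
proof (rule antisym)
  show "inner_norm W \<mu> \<le> inner_norm W (vrestrict B \<mu>) + inner_norm W (vrestrict (- B) \<mu>)"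
    using norm_onD(1)[OF norm_on_inner_norm[OF W], of "vrestrict B \<mu>" "vrestrict (- B) \<mu>"]
    by (simp flip: vrestrict_add[OF B])
  show "inner_norm W (vrestrict B \<mu>) + inner_norm W (vrestrict (- B) \<mu>) \<le> inner_norm W \<mu>"
  proof (rule field_le_epsilon)
    fix e :: real assume "0 < e"
    then have e: "0 < e / 2" by simp
    obtain \<pi>1 where \<pi>1: "\<pi>1 \<in> finite_partitions"
      "inner_norm W (vrestrict B \<mu>) - e / 2 < (\<Sum>E\<in>\<pi>1. W (svec (vrestrict B \<mu>) E))"
      by (rule inner_norm_near[OF W e])
    obtain \<pi>2 where \<pi>2: "\<pi>2 \<in> finite_partitions"
      "inner_norm W (vrestrict (- B) \<mu>) - e / 2 < (\<Sum>E\<in>\<pi>2. W (svec (vrestrict (- B) \<mu>) E))"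
      by (rule inner_norm_near[OF W e])
    note p1 = finite_partitionsD[OF \<pi>1(1)] and p2 = finite_partitionsD[OF \<pi>2(1)]
    let ?A = "\<lambda>i. case i of Inl E \<Rightarrow> E \<inter> B | Inr E \<Rightarrow> E \<inter> - B"
    have "(\<Sum>E\<in>\<pi>1. W (svec (vrestrict B \<mu>) E)) + (\<Sum>E\<in>\<pi>2. W (svec (vrestrict (- B) \<mu>) E))
        = (\<Sum>E\<in>\<pi>1. W (svec \<mu> (E \<inter> B))) + (\<Sum>E\<in>\<pi>2. W (svec \<mu> (E \<inter> - B)))"
      using B p1(2) p2(2) by (simp add: svec_vrestrict cong: sum.cong)
    also have "\<dots> = (\<Sum>i\<in>\<pi>1 <+> \<pi>2. W (svec \<mu> (?A i)))"
      by (simp add: sum.Plus p1 p2)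
    also have "\<dots> \<le> inner_norm W \<mu>"
    proof (rule inner_norm_family[OF W])
      show "finite (\<pi>1 <+> \<pi>2)" using p1 p2 by simp
      show "?A i \<in> sets borel" if "i \<in> \<pi>1 <+> \<pi>2" for i
        using that
      proof (rule PlusE)
        fix E assume "E \<in> \<pi>1" "i = Inl E"
        then show ?thesis using p1(2)[of E] B by (simp add: sets.Int)
      next
        fix E assume "E \<in> \<pi>2" "i = Inr E"
        then show ?thesis using p2(2)[of E] B by (simp add: sets.Int borel_comp)
      qed
      show "disjoint_family_on ?A (\<pi>1 <+> \<pi>2)"
        unfolding disjoint_family_on_def
      proof (intro ballI impI)
        have d1: "E \<inter> F = {}" if "E \<in> \<pi>1" "F \<in> \<pi>1" "E \<noteq> F" for E F
          using p1(3) that unfolding disjoint_family_on_def by blast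
        have d2: "E \<inter> F = {}" if "E \<in> \<pi>2" "F \<in> \<pi>2" "E \<noteq> F" for E F
          using p2(3) that unfolding disjoint_family_on_def by blast
        fix i j assume ij: "i \<in> \<pi>1 <+> \<pi>2" "j \<in> \<pi>1 <+> \<pi>2" "i \<noteq> j"
        show "?A i \<inter> ?A j = {}"
        proof (cases i; cases j)
          fix E F assume "i = Inl E" "j = Inl F"
          then show ?thesis using d1[of E F] ij by auto
        next
          fix E F assume "i = Inr E" "j = Inr F"
          then show ?thesis using d2[of E F] ij by auto
        qed auto
      qed
    qed
    finally show "inner_norm W (vrestrict B \<mu>) + inner_norm W (vrestrict (- B) \<mu>) \<le> inner_norm W \<mu> + e"
      using \<pi>1(2) \<pi>2(2) by linarith
  qed
qed

text \<open>The total variation is the inner norm for one component. Facts about it are obtained in this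
  way.\<close>

lemma norm_on_abs_1: "norm_on UNIV (\<lambda>v :: real ^ 1. \<bar>v $ 1\<bar>)"
  by (auto simp: norm_on_def seminorm_on_def abs_mult vec_eq_iff forall_1 abs_triangle_ineq)

lemma tv_norm_inner: "tv_norm \<sigma> = inner_norm (\<lambda>v :: real ^ 1. \<bar>v $ 1\<bar>) (\<chi> d. \<sigma>)"
  by (simp add: tv_norm_def inner_norm_def)

lemma tv_norm_mass: "tv_norm \<sigma> = tv_mass \<sigma>"
proof (rule antisym)
  show "tv_norm \<sigma> \<le> tv_mass \<sigma>" unfolding tv_norm_def
    using UNIV_in_finite_partitions
    by (intro cSUP_least sum_abs_smeas_le) (auto simp: finite_partitionsD)
  obtain P where P: "P \<in> sets borel"
    "\<And>A. A \<in> sets borel \<Longrightarrow> emeasure (pos_part (smeas \<sigma>)) A = ennreal (smeas \<sigma> (A \<inter> P))"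
    "\<And>A. A \<in> sets borel \<Longrightarrow> emeasure (pos_part (smeas (- \<sigma>))) A = ennreal (- smeas \<sigma> (A - P))"
    "positive_on \<sigma> P" "positive_on (- \<sigma>) (- P)"
    by (rule hahn_parts[of \<sigma>]) (assumption | blast)+
  have nn: "0 \<le> smeas \<sigma> P" "0 \<le> - smeas \<sigma> (- P)"
    using P(1,4,5) by (auto simp: positive_on_def smeas_simps)
  have "tv_mass \<sigma> = smeas \<sigma> P - smeas \<sigma> (- P)"
    using nn P(2,3)[of UNIV] by (simp add: tv_mass_def measure_def Compl_eq_Diff_UNIV)
  also have "\<dots> = (\<Sum>b\<in>UNIV. \<bar>svec (\<chi> d::1. \<sigma>) (if b then P else - P) $ 1\<bar>)"
    using nn by (simp add: UNIV_bool svec_def)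
  also have "\<dots> \<le> tv_norm \<sigma>" unfolding tv_norm_inner
    using P(1) by (intro inner_norm_family norm_on_abs_1) (auto simp: disjoint_family_on_def)
  finally show "tv_mass \<sigma> \<le> tv_norm \<sigma>" .
qed

lemma tv_norm_add: "tv_norm (\<sigma> + \<tau>) \<le> tv_norm \<sigma> + tv_norm \<tau>"
  and tv_norm_scale: "tv_norm (c *\<^sub>R \<sigma>) = \<bar>c\<bar> * tv_norm \<sigma>"
  and tv_norm_nonneg: "0 \<le> tv_norm \<sigma>"
  and tv_norm_zero_iff: "tv_norm \<sigma> = 0 \<longleftrightarrow> \<sigma> = 0"
  using norm_onD(1)[OF norm_on_inner_norm[OF norm_on_abs_1], of "\<chi> d. \<sigma>" "\<chi> d. \<tau>"]
    norm_onD(2)[OF norm_on_inner_norm[OF norm_on_abs_1], of c "\<chi> d. \<sigma>"]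
    norm_onD(3)[OF norm_on_inner_norm[OF norm_on_abs_1], of "\<chi> d. \<sigma>"]
    norm_onD(4)[OF norm_on_inner_norm[OF norm_on_abs_1], of "\<chi> d. \<sigma>"]
  by (simp_all add: tv_norm_inner plus_vec_def scaleR_vec_def vec_eq_iff)

lemma tv_norm_restrict: "B \<in> sets borel \<Longrightarrow> tv_norm \<sigma> = tv_norm (srestrict B \<sigma>) + tv_norm (srestrict (- B) \<sigma>)"
  using inner_norm_restrict[OF norm_on_abs_1, of B "\<chi> d. \<sigma>"] by (simp add: tv_norm_inner vrestrict_def)

lemma tv_norm_ge: "E \<in> sets borel \<Longrightarrow> \<bar>smeas \<sigma> E\<bar> \<le> tv_norm \<sigma>"
  using inner_norm_ge[OF norm_on_abs_1, of E "\<chi> d. \<sigma>"] by (simp add: tv_norm_inner svec_def)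

lemma norm_on_outer_norm:
  fixes W :: "real ^ 'd \<Rightarrow> real"
  assumes W: "monotone_norm W"
  shows "norm_on UNIV (outer_norm W)"
proof -
  note W' = norm_onD[OF monotone_norm_norm_on[OF W]]
  have "outer_norm W (\<mu> + \<nu>) \<le> outer_norm W \<mu> + outer_norm W \<nu>" for \<mu> \<nu>
  proof -
    have "outer_norm W (\<mu> + \<nu>) \<le> W ((\<chi> d. tv_norm (\<mu> $ d)) + (\<chi> d. tv_norm (\<nu> $ d)))"
      unfolding outer_norm_def
      by (rule monotone_norm_mono[OF W]) (simp add: tv_norm_nonneg tv_norm_add abs_of_nonneg)
    also have "\<dots> \<le> outer_norm W \<mu> + outer_norm W \<nu>" unfolding outer_norm_def by (rule W'(1))
    finally show ?thesis .
  qed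
  moreover have "outer_norm W (c *\<^sub>R \<mu>) = \<bar>c\<bar> * outer_norm W \<mu>" for c \<mu>
  proof -
    have "(\<chi> d. tv_norm ((c *\<^sub>R \<mu>) $ d)) = \<bar>c\<bar> *\<^sub>R (\<chi> d. tv_norm (\<mu> $ d))"
      by (simp add: vec_eq_iff tv_norm_scale)
    then show ?thesis unfolding outer_norm_def by (simp add: W'(2))
  qed
  moreover have "\<mu> = 0" if "outer_norm W \<mu> = 0" for \<mu>
    using that unfolding outer_norm_def W'(4) by (simp add: vec_eq_iff tv_norm_zero_iff)
  ultimately show ?thesis unfolding norm_on_def seminorm_on_def
    by (auto simp: outer_norm_def W')
qed

section \<open>Duality between continuous functions and vector measures\<close>

definition C0_real :: "(real \<Rightarrow> real) set" where
  "C0_real = {f. continuous_on UNIV f \<and> (f \<longlongrightarrow> 0) at_infinity}"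

lemma vanishing_bounded:
  fixes f :: "real \<Rightarrow> 'a::real_normed_vector"
  assumes "continuous_on UNIV f" "(f \<longlongrightarrow> 0) at_infinity"
  shows "\<exists>B. \<forall>x. norm (f x) \<le> B"
proof -
  have "\<forall>\<^sub>F x in at_infinity. norm (f x) < 1"
    using tendstoD[OF assms(2), of 1] by (simp add: dist_norm)
  then obtain b where b: "\<And>x. b \<le> norm x \<Longrightarrow> norm (f x) < 1"
    unfolding eventually_at_infinity by blast
  have "compact (f ` cball 0 b)"
    by (intro compact_continuous_image continuous_on_subset[OF assms(1)]) auto
  then have "bounded (f ` cball 0 b)" by (rule compact_imp_bounded)
  then obtain B where B: "\<And>x. x \<in> cball 0 b \<Longrightarrow> norm (f x) \<le> B"
    unfolding bounded_iff by blast
  have "norm (f x) \<le> max B 1" for x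
  proof (cases "b \<le> norm x")
    case True then show ?thesis using b[of x] by simp
  next
    case False then show ?thesis using B[of x] by (simp add: le_max_iff_disj)
  qed
  then show ?thesis by blast
qed

lemma vanishing_compact_support:
  fixes f :: "real \<Rightarrow> 'a::real_normed_vector"
  assumes "\<And>x. b < \<bar>x\<bar> \<Longrightarrow> f x = 0"
  shows "(f \<longlongrightarrow> 0) at_infinity"
proof (rule tendsto_eventually)
  show "\<forall>\<^sub>F x in at_infinity. f x = 0"
    unfolding eventually_at_infinity using assms by (intro exI[of _ "b + 1"]) auto
qed

lemma C0_real_bdd_borel: "f \<in> C0_real \<Longrightarrow> bdd_borel f"
  using vanishing_bounded[of f] borel_measurable_continuous_onI[of f]
  by (simp add: C0_real_def bdd_borel_def)

lemma C0_component: "v \<in> C0 \<Longrightarrow> (\<lambda>x. v x $ d) \<in> C0_real"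
  using tendsto_vec_nth[of v 0 at_infinity d] continuous_on_component[of UNIV v d]
  by (simp add: C0_def C0_real_def)

lemma C0_iff_components: "v \<in> C0 \<longleftrightarrow> (\<forall>d. (\<lambda>x. v x $ d) \<in> C0_real)"
proof
  assume *: "\<forall>d. (\<lambda>x. v x $ d) \<in> C0_real"
  have "continuous_on UNIV (\<lambda>x. \<chi> d. v x $ d)"
    using * by (intro continuous_on_vec_lambda) (simp add: C0_real_def)
  moreover have "((\<lambda>x. \<chi> d. v x $ d) \<longlongrightarrow> (\<chi> d. 0)) at_infinity"
    using * by (intro tendsto_vec_lambda) (simp add: C0_real_def)
  ultimately show "v \<in> C0" by (simp add: C0_def zero_vec_def)
qed (simp add: C0_component)

lemma C0_bdd_borel: "v \<in> C0 \<Longrightarrow> bdd_borel (\<lambda>x. v x $ d)"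
  by (intro C0_real_bdd_borel C0_component)

lemma C0_closed:
  shows C0_zero: "(\<lambda>_. 0) \<in> C0"
    and C0_add: "v \<in> C0 \<Longrightarrow> w \<in> C0 \<Longrightarrow> (\<lambda>x. v x + w x) \<in> C0"
    and C0_scale: "v \<in> C0 \<Longrightarrow> (\<lambda>x. c *\<^sub>R v x) \<in> C0"
proof -
  show "(\<lambda>_. 0) \<in> C0" by (simp add: C0_def)
  show "(\<lambda>x. v x + w x) \<in> C0" if "v \<in> C0" "w \<in> C0"
    using that unfolding C0_def mem_Collect_eq
    by (elim conjE, intro conjI continuous_on_add tendsto_add_zero)
  show "(\<lambda>x. c *\<^sub>R v x) \<in> C0" if "v \<in> C0"
  proof -
    have "((\<lambda>x. c *\<^sub>R v x) \<longlongrightarrow> c *\<^sub>R 0) at_infinity"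
      using that unfolding C0_def by (intro tendsto_scaleR tendsto_const) blast
    then show ?thesis
      using that unfolding C0_def mem_Collect_eq
      by (elim conjE, intro conjI continuous_on_scaleR continuous_on_const) simp_all
  qed
qed

lemma C0_bounded: "v \<in> C0 \<Longrightarrow> \<exists>B. \<forall>x. norm (v x) \<le> B"
  using vanishing_bounded unfolding C0_def by blast

lemma meas_pairing_linear_measure: "v \<in> C0 \<Longrightarrow> linear (\<lambda>\<mu>. meas_pairing \<mu> v)"
  by (rule linearI)
    (simp_all add: meas_pairing_def C0_bdd_borel smeas_integral_add_measure smeas_integral_scale_measure
      sum.distrib sum_distrib_left)

lemma meas_pairing_add:
  "v \<in> C0 \<Longrightarrow> w \<in> C0 \<Longrightarrow> meas_pairing \<mu> (\<lambda>x. v x + w x) = meas_pairing \<mu> v + meas_pairing \<mu> w"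
  by (simp add: meas_pairing_def C0_bdd_borel smeas_integral_add sum.distrib)

lemma meas_pairing_scale: "meas_pairing \<mu> (\<lambda>x. c *\<^sub>R v x) = c * meas_pairing \<mu> v"
  by (simp add: meas_pairing_def smeas_integral_scale sum_distrib_left)

text \<open>The integral of a function is approximated by that of a function with finitely many values,
  obtained by rounding the components to multiples of \<open>1 / n\<close>.\<close>

lemma meas_pairing_le_inner:
  fixes v :: "real \<Rightarrow> real ^ 'd"
  assumes Z: "norm_on UNIV Z" and v: "v \<in> C0" and le: "\<And>x. Z (v x) \<le> 1"
  shows "meas_pairing \<mu> v \<le> inner_norm (dual_norm Z) \<mu>"
proof -
  let ?W = "dual_norm Z"
  note W = norm_on_dual_norm[OF Z]
  define T where "T = (\<Sum>d\<in>UNIV. tv_mass (\<mu> $ d))"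
  have approx: "meas_pairing \<mu> v \<le> inner_norm ?W \<mu> + (1 / real (Suc n)) * T" for n
  proof -
    define N where "N = real (Suc n)"
    have N: "0 < N" by (simp add: N_def)
    define g where "g x = (\<chi> d. \<lfloor>N * v x $ d\<rfloor>)" for x
    obtain B where B: "\<And>x. norm (v x) \<le> B" using C0_bounded[OF v] by blast
    have fin: "finite (range g)"
    proof (rule finite_subset)
      have "- \<lceil>N * B\<rceil> - 1 \<le> \<lfloor>N * v x $ d\<rfloor>" "\<lfloor>N * v x $ d\<rfloor> \<le> \<lceil>N * B\<rceil>" for x d
      proof -
        have "\<bar>v x $ d\<bar> \<le> B" using component_le_norm_cart[of "v x" d] B[of x] by linarith
        then have "\<bar>N * v x $ d\<bar> \<le> N * B" using N by (simp add: abs_mult)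
        then show "- \<lceil>N * B\<rceil> - 1 \<le> \<lfloor>N * v x $ d\<rfloor>" "\<lfloor>N * v x $ d\<rfloor> \<le> \<lceil>N * B\<rceil>" by linarith+
      qed
      then show "range g \<subseteq> {k. \<forall>d. k $ d \<in> {- \<lceil>N * B\<rceil> - 1..\<lceil>N * B\<rceil>}}" by (auto simp: g_def)
      show "finite {k :: int ^ 'd. \<forall>d. k $ d \<in> {- \<lceil>N * B\<rceil> - 1..\<lceil>N * B\<rceil>}}"
      proof (rule finite_subset)
        let ?S = "UNIV \<rightarrow>\<^sub>E {- \<lceil>N * B\<rceil> - 1..\<lceil>N * B\<rceil>} :: ('d \<Rightarrow> int) set"
        show "{k :: int ^ 'd. \<forall>d. k $ d \<in> {- \<lceil>N * B\<rceil> - 1..\<lceil>N * B\<rceil>}} \<subseteq> vec_lambda ` ?S"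
        proof
          fix k :: "int ^ 'd" assume "k \<in> {k. \<forall>d. k $ d \<in> {- \<lceil>N * B\<rceil> - 1..\<lceil>N * B\<rceil>}}"
          then have "vec_nth k \<in> ?S" by (simp add: PiE_UNIV_domain)
          then show "k \<in> vec_lambda ` ?S" by (metis image_eqI vec_nth_inverse)
        qed
        show "finite (vec_lambda ` ?S)" by (intro finite_imageI finite_PiE) auto
      qed
    qed
    define y where "y k = (SOME x. g x = k)" for k
    have y: "g (y (g x)) = g x" for x unfolding y_def by (rule someI[of "\<lambda>z. g z = g x"]) simp
    define A where "A k = {x. g x = k}" for k
    have meas: "A k \<in> sets borel" for k
    proof -
      have [measurable]: "(\<lambda>x. v x $ d) \<in> borel_measurable borel" for d
        using C0_bdd_borel[OF v] unfolding bdd_borel_def by blast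
      have "A k = (\<Inter>d. {x. \<lfloor>N * v x $ d\<rfloor> = k $ d})" by (auto simp: A_def g_def vec_eq_iff)
      moreover have "{x. \<lfloor>N * v x $ d\<rfloor> = k $ d} \<in> sets borel" for d by measurable
      ultimately show ?thesis by (simp add: sets.countable_INT'')
    qed
    have disj: "disjoint_family_on A (range g)" by (auto simp: disjoint_family_on_def A_def)
    have simple: "(\<Sum>k\<in>range g. c k * indicator (A k) x) = c (g x)" for c :: "_ \<Rightarrow> real" and x
    proof -
      have "(\<Sum>k\<in>range g. c k * indicator (A k) x) = (\<Sum>k\<in>range g. if k = g x then c k else 0)"
        by (intro sum.cong) (auto simp: A_def)
      then show ?thesis using fin by simp
    qed
    have bb: "bdd_borel (\<lambda>x. \<Sum>k\<in>range g. c k * indicator (A k) x)" for c :: "_ \<Rightarrow> real"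
      by (intro bdd_borel_sum bdd_borel_scale bdd_borel_indicator meas)
    have comp: "smeas_integral (\<mu> $ d) (\<lambda>x. v x $ d)
        \<le> (\<Sum>k\<in>range g. v (y k) $ d * smeas (\<mu> $ d) (A k)) + (1 / N) * tv_mass (\<mu> $ d)" for d
    proof -
      let ?s = "\<lambda>x. \<Sum>k\<in>range g. v (y k) $ d * indicator (A k) x"
      have "\<bar>v x $ d - ?s x\<bar> \<le> 1 / N" for x
      proof -
        have "\<lfloor>N * v x $ d\<rfloor> = \<lfloor>N * v (y (g x)) $ d\<rfloor>" using y[of x] by (simp add: g_def vec_eq_iff)
        then have "\<bar>N * v x $ d - N * v (y (g x)) $ d\<bar> \<le> 1" by linarith
        then have "N * \<bar>v x $ d - v (y (g x)) $ d\<bar> \<le> 1"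
          using N by (simp add: abs_mult flip: right_diff_distrib)
        then have "\<bar>v x $ d - v (y (g x)) $ d\<bar> \<le> 1 / N"
          using N by (simp add: pos_le_divide_eq mult.commute)
        then show ?thesis by (simp only: simple[of "\<lambda>k. v (y k) $ d" x])
      qed
      then have "\<bar>smeas_integral (\<mu> $ d) (\<lambda>x. v x $ d - ?s x)\<bar> \<le> (1 / N) * tv_mass (\<mu> $ d)"
        by (intro smeas_integral_bound bdd_borel_diff C0_bdd_borel v bb)
      moreover have "smeas_integral (\<mu> $ d) (\<lambda>x. v x $ d - ?s x) =
          smeas_integral (\<mu> $ d) (\<lambda>x. v x $ d) - smeas_integral (\<mu> $ d) ?s"
        by (intro smeas_integral_diff C0_bdd_borel v bb)
      moreover have "smeas_integral (\<mu> $ d) ?s = (\<Sum>k\<in>range g. v (y k) $ d * smeas (\<mu> $ d) (A k))"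
        by (subst smeas_integral_sum)
          (simp_all add: bdd_borel_scale bdd_borel_indicator meas smeas_integral_scale smeas_integral_indicator)
      ultimately show ?thesis by linarith
    qed
    have "meas_pairing \<mu> v \<le> (\<Sum>d\<in>UNIV. (\<Sum>k\<in>range g. v (y k) $ d * smeas (\<mu> $ d) (A k)) + (1 / N) * tv_mass (\<mu> $ d))"
      unfolding meas_pairing_def by (intro sum_mono comp)
    also have "\<dots> = (\<Sum>k\<in>range g. svec \<mu> (A k) \<bullet> v (y k)) + (1 / N) * T"
      unfolding sum.distrib T_def sum_distrib_left
      by (subst sum.swap) (simp add: inner_vec_def svec_def mult.commute)
    also have "(\<Sum>k\<in>range g. svec \<mu> (A k) \<bullet> v (y k)) \<le> (\<Sum>k\<in>range g. ?W (svec \<mu> (A k)))"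
    proof (rule sum_mono)
      fix k
      have "svec \<mu> (A k) \<bullet> v (y k) \<le> ?W (svec \<mu> (A k)) * Z (v (y k))" by (rule dual_norm_upper[OF Z])
      also have "\<dots> \<le> ?W (svec \<mu> (A k))" by (rule mult_left_le) (auto simp: le norm_onD(3)[OF W])
      finally show "svec \<mu> (A k) \<bullet> v (y k) \<le> ?W (svec \<mu> (A k))" .
    qed
    also have "\<dots> \<le> inner_norm ?W \<mu>" by (intro inner_norm_family W fin meas disj)
    finally show ?thesis by (simp add: N_def)
  qed
  have T: "0 \<le> T" unfolding T_def by (intro sum_nonneg) (simp add: tv_mass_def)
  show ?thesis
  proof (rule field_le_epsilon)
    fix e :: real assume "0 < e"
    then have "0 < e / (T + 1)" using T by simp
    then obtain n where n: "1 / real (Suc n) < e / (T + 1)" using nat_approx_posE by blast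
    have "(1 / real (Suc n)) * T \<le> (e / (T + 1)) * T" using n T by (intro mult_right_mono) auto
    also have "\<dots> \<le> e" using T \<open>0 < e\<close> by (simp add: divide_le_eq)
    finally show "meas_pairing \<mu> v \<le> inner_norm ?W \<mu> + e" using approx[of n] by linarith
  qed
qed

text \<open>Inner regularity, for finitely many finite measures with a common compact set.\<close>

lemma compact_approximation:
  assumes J: "finite J" and M: "\<And>j. j \<in> J \<Longrightarrow> finite_measure (M j)" "\<And>j. j \<in> J \<Longrightarrow> sets (M j) = sets borel"
    and E: "E \<in> sets (borel :: real measure)" and e: "0 < e"
  shows "\<exists>K. compact K \<and> K \<subseteq> E \<and> (\<forall>j\<in>J. measure (M j) (E - K) < e)"
proof -
  have single: "\<exists>K. compact K \<and> K \<subseteq> E \<and> measure (M j) (E - K) < e" if j: "j \<in> J" for j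
  proof -
    interpret finite_measure "M j" using M j by blast
    have "emeasure (M j) E = (SUP K \<in> {K. K \<subseteq> E \<and> compact K}. emeasure (M j) K)"
      using M(2)[OF j] E emeasure_finite by (intro inner_regular) auto
    also have "\<dots> = (SUP K \<in> {K. K \<subseteq> E \<and> compact K}. ennreal (measure (M j) K))"
      by (simp add: emeasure_eq_measure)
    finally have sup: "ennreal (measure (M j) E) = \<dots>" by (simp add: emeasure_eq_measure)
    show ?thesis
    proof (cases "measure (M j) E < e")
      case True then show ?thesis by (intro exI[of _ "{}"]) auto
    next
      case False
      then have "ennreal (measure (M j) E - e) < ennreal (measure (M j) E)"
        using e by (intro ennreal_lessI) auto
      then obtain K where K: "K \<subseteq> E" "compact K" "ennreal (measure (M j) E - e) < ennreal (measure (M j) K)"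
        unfolding sup less_SUP_iff by auto
      have "measure (M j) E - e < measure (M j) K" using K(3) False by (simp add: ennreal_less_iff)
      moreover have "measure (M j) (E - K) = measure (M j) E - measure (M j) K"
        using K(1,2) E M(2)[OF j] by (intro finite_measure_Diff) (auto intro: borel_compact)
      ultimately show ?thesis using K by (intro exI[of _ K]) auto
    qed
  qed
  then obtain K where K: "\<And>j. j \<in> J \<Longrightarrow> compact (K j)" "\<And>j. j \<in> J \<Longrightarrow> K j \<subseteq> E"
    "\<And>j. j \<in> J \<Longrightarrow> measure (M j) (E - K j) < e" by metis
  show ?thesis
  proof (intro exI[of _ "\<Union>j\<in>J. K j"] conjI ballI)
    show "compact (\<Union>j\<in>J. K j)" using J K(1) by (intro compact_UN)
    show "(\<Union>j\<in>J. K j) \<subseteq> E" using K(2) by blast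
    fix j assume j: "j \<in> J"
    have "measure (M j) (E - (\<Union>j\<in>J. K j)) \<le> measure (M j) (E - K j)"
      using j E K(1)[OF j] M(2)[OF j]
      by (intro finite_measure.finite_measure_mono M) (auto intro: borel_compact)
    then show "measure (M j) (E - (\<Union>j\<in>J. K j)) < e" using K(3)[OF j] by linarith
  qed
qed


text \<open>Near equality: inside the sets of a good partition choose disjoint compact sets carrying almost
  all the mass, put the norming vectors of the partition on them, and extend this locally constant
  function by Dugundji's theorem without leaving the (convex) unit ball.\<close>

lemma meas_pairing_near_inner:
  fixes \<mu> :: "smeasure ^ 'd"
  assumes Z: "norm_on UNIV Z" and e: "0 < e"
  shows "\<exists>v\<in>C0. (\<forall>x. Z (v x) \<le> 1) \<and> inner_norm (dual_norm Z) \<mu> - e < meas_pairing \<mu> v"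
proof -
  let ?W = "dual_norm Z"
  note W = norm_on_dual_norm[OF Z]
  note Z' = norm_onD[OF Z]
  have "0 < e / 2" using e by simp
  from inner_norm_near[OF W this] obtain \<pi> where \<pi>: "\<pi> \<in> finite_partitions"
    "inner_norm ?W \<mu> - e / 2 < (\<Sum>E\<in>\<pi>. ?W (svec \<mu> E))" .
  note p = finite_partitionsD[OF \<pi>(1)]
  have "\<exists>w. Z w \<le> 1 \<and> svec \<mu> E \<bullet> w = ?W (svec \<mu> E)" for E
    using dual_norm_attained[OF Z, of "svec \<mu> E"] by blast
  then obtain w where w: "\<And>E. Z (w E) \<le> 1" "\<And>E. svec \<mu> E \<bullet> w E = ?W (svec \<mu> E)" by metis
  obtain c where c: "0 < c" "\<And>v. c * norm v \<le> Z v" using norm_on_lower[OF Z] by auto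
  define B where "B = 1 / c"
  have B: "0 < B" using c by (simp add: B_def)
  have bound: "\<bar>u $ d\<bar> \<le> B" if "Z u \<le> 1" for u d
  proof -
    have "norm u \<le> B" using order_trans[OF c(2)[of u] that] c(1)
      by (simp add: B_def pos_le_divide_eq mult.commute)
    then show ?thesis using component_le_norm_cart[of u d] by linarith
  qed
  define D where "D = real (CARD('d)) * (2 * B) * (real (card \<pi>) * 2)"
  have D: "0 \<le> D" using B by (simp add: D_def)
  define \<eta> where "\<eta> = (e / 2) / (D + 1)"
  have \<eta>: "0 < \<eta>" using e D by (simp add: \<eta>_def)
  define M where "M = (\<lambda>(d, b). if b then ppart (\<mu> $ d) else npart (\<mu> $ d))"
  have Mj: "finite_measure (M j)" "sets (M j) = sets borel" for j
    by (cases j; simp add: M_def pos_part_finite)+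
  have "\<exists>K. compact K \<and> K \<subseteq> E \<and> (\<forall>j\<in>UNIV. measure (M j) (E - K) < \<eta>)" if "E \<in> \<pi>" for E
    using p(2)[OF that] \<eta> by (intro compact_approximation Mj) simp_all
  then obtain K where K: "\<And>E. E \<in> \<pi> \<Longrightarrow> compact (K E)" "\<And>E. E \<in> \<pi> \<Longrightarrow> K E \<subseteq> E"
    "\<And>E j. E \<in> \<pi> \<Longrightarrow> measure (M j) (E - K E) < \<eta>" by (metis UNIV_I)
  define U where "U = (\<Union>E\<in>\<pi>. K E)"
  have U: "compact U" unfolding U_def using p(1) K(1) by (intro compact_UN)
  define f where "f x = w (THE E. E \<in> \<pi> \<and> x \<in> E)" for x
  have f: "f x = w E" if "E \<in> \<pi>" "x \<in> E" for x E
  proof -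
    have "(THE F. F \<in> \<pi> \<and> x \<in> F) = E"
      using that p(3) unfolding disjoint_family_on_def by (intro the_equality) blast+
    then show ?thesis by (simp add: f_def)
  qed
  have "continuous_on (\<Union>E\<in>\<pi>. K E) f"
  proof (rule continuous_on_closed_Union)
    show "closed (K E)" if "E \<in> \<pi>" for E using K(1)[OF that] by (rule compact_imp_closed)
    show "continuous_on (K E) f" if E: "E \<in> \<pi>" for E
    proof -
      have "f x = w E" if "x \<in> K E" for x using f[OF E, of x] K(2)[OF E] that by blast
      then show ?thesis using continuous_on_cong[of "K E" "K E" f "\<lambda>_. w E"] by simp
    qed
  qed (rule p(1))
  then have contf: "continuous_on U f" by (simp add: U_def)
  have convC: "convex {u. Z u \<le> 1}"
  proof (rule convexI)
    fix x y and a b :: real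
    assume xy: "x \<in> {u. Z u \<le> 1}" "y \<in> {u. Z u \<le> 1}" and ab: "0 \<le> a" "0 \<le> b" "a + b = 1"
    have "Z (a *\<^sub>R x + b *\<^sub>R y) \<le> a * Z x + b * Z y"
      using Z'(1)[of "a *\<^sub>R x" "b *\<^sub>R y"] ab by (simp add: Z'(2))
    also have "\<dots> \<le> a * 1 + b * 1" using xy ab by (intro add_mono mult_left_mono) auto
    finally show "a *\<^sub>R x + b *\<^sub>R y \<in> {u. Z u \<le> 1}" using ab by simp
  qed
  have "0 \<in> {u. Z u \<le> 1}" by (simp add: Z'(5))
  then have neC: "{u. Z u \<le> 1} \<noteq> {}" by blast
  have cloU: "closedin (top_of_set UNIV) U" using compact_imp_closed[OF U] by simp
  have imgf: "f ` U \<subseteq> {u. Z u \<le> 1}" using w(1) by (auto simp: f_def)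
  obtain g where g: "continuous_on UNIV g" "g ` UNIV \<subseteq> {u. Z u \<le> 1}" "\<And>x. x \<in> U \<Longrightarrow> g x = f x"
    using Dugundji[OF convC neC cloU contf imgf] by metis
  obtain m where m: "\<And>x. x \<in> U \<Longrightarrow> \<bar>x\<bar> \<le> m"
    using compact_imp_bounded[OF U] unfolding bounded_iff real_norm_def by blast
  define cut where "cut x = max 0 (min 1 (m + 1 - \<bar>x\<bar>))" for x :: real
  have cut: "0 \<le> cut x" "cut x \<le> 1" "x \<in> U \<Longrightarrow> cut x = 1" "m + 1 < \<bar>x\<bar> \<Longrightarrow> cut x = 0" for x
    using m[of x] by (auto simp: cut_def)
  define v where "v x = cut x *\<^sub>R g x" for x
  have Zg: "Z (g x) \<le> 1" for x using g(2) by blast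
  have Zv: "Z (v x) \<le> 1" for x
    using mult_le_one[OF cut(2) Z'(3) Zg, of x x] cut(1)[of x] by (simp add: v_def Z'(2))
  have v: "v \<in> C0" unfolding C0_def mem_Collect_eq
  proof
    show "continuous_on UNIV v" unfolding v_def cut_def by (intro continuous_intros g)
    show "(v \<longlongrightarrow> 0) at_infinity" by (rule vanishing_compact_support[of "m + 1"]) (simp add: v_def cut)
  qed
  define s where "s d x = (\<Sum>E\<in>\<pi>. w E $ d * indicator E x)" for d x
  have s: "s d x = w E $ d" if "E \<in> \<pi>" "x \<in> E" for E x d
  proof -
    have "s d x = (\<Sum>F\<in>\<pi>. if F = E then w F $ d else 0)"
      unfolding s_def using that p(3) by (intro sum.cong) (auto simp: disjoint_family_on_def indicator_def)
    then show ?thesis using p(1) that by simp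
  qed
  have exE: "\<exists>E\<in>\<pi>. x \<in> E" for x using p(4) by blast
  have bs: "bdd_borel (s d)" for d
    unfolding s_def by (intro bdd_borel_sum bdd_borel_scale bdd_borel_indicator p)
  define R where "R = (\<Union>E\<in>\<pi>. E - K E)"
  have Km: "E - K E \<in> sets borel" if "E \<in> \<pi>" for E
    using p(2)[OF that] borel_compact[OF K(1)[OF that]] by blast
  have Rm: "R \<in> sets borel" unfolding R_def using p(1) Km by (intro sets.finite_UN)
  have massR: "measure (ppart (\<mu> $ d)) R + measure (npart (\<mu> $ d)) R \<le> real (card \<pi>) * 2 * \<eta>" for d
  proof -
    have *: "measure (M j) R \<le> real (card \<pi>) * \<eta>" for j
    proof -
      have "measure (M j) R \<le> (\<Sum>E\<in>\<pi>. measure (M j) (E - K E))"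
        unfolding R_def
        by (intro finite_measure.finite_measure_subadditive_finite p(1) Mj)
          (use Km Mj(2) in blast)
      also have "\<dots> \<le> (\<Sum>E\<in>\<pi>. \<eta>)" using K(3) by (intro sum_mono less_imp_le)
      finally show ?thesis by simp
    qed
    show ?thesis using *[of "(d, True)"] *[of "(d, False)"] by (simp add: M_def)
  qed
  have comp: "smeas_integral (\<mu> $ d) (s d) - 2 * B * (real (card \<pi>) * 2 * \<eta>) \<le> smeas_integral (\<mu> $ d) (\<lambda>x. v x $ d)" for d
  proof -
    have "\<bar>smeas_integral (\<mu> $ d) (\<lambda>x. v x $ d - s d x)\<bar>
        \<le> (2 * B) * (measure (ppart (\<mu> $ d)) R + measure (npart (\<mu> $ d)) R)"
    proof (rule smeas_integral_bound_on)
      show "bdd_borel (\<lambda>x. v x $ d - s d x)" by (intro bdd_borel_diff C0_bdd_borel v bs)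
      show "v x $ d - s d x = 0" if "x \<notin> R" for x
      proof -
        obtain E where E: "E \<in> \<pi>" "x \<in> E" using exE by blast
        then have "x \<in> U" using that by (auto simp: R_def U_def)
        then show ?thesis using E by (simp add: v_def cut g(3) f s)
      qed
      show "\<bar>v x $ d - s d x\<bar> \<le> 2 * B" for x
      proof -
        obtain E where E: "E \<in> \<pi>" "x \<in> E" using exE by blast
        show ?thesis using bound[OF Zv[of x], of d] bound[OF w(1)[of E], of d] s[OF E, of d] by linarith
      qed
    qed (rule Rm)
    also have "\<dots> \<le> (2 * B) * (real (card \<pi>) * 2 * \<eta>)" using B massR by (intro mult_left_mono) auto
    finally show ?thesis by (simp add: smeas_integral_diff C0_bdd_borel v bs)
  qed
  have "(\<Sum>E\<in>\<pi>. ?W (svec \<mu> E)) = (\<Sum>d\<in>UNIV. smeas_integral (\<mu> $ d) (s d))"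
  proof -
    have "smeas_integral (\<mu> $ d) (s d) = (\<Sum>E\<in>\<pi>. w E $ d * smeas (\<mu> $ d) E)" for d
      unfolding s_def using p(2)
      by (subst smeas_integral_sum)
        (simp_all add: bdd_borel_scale bdd_borel_indicator smeas_integral_scale smeas_integral_indicator)
    then have "(\<Sum>d\<in>UNIV. smeas_integral (\<mu> $ d) (s d)) = (\<Sum>E\<in>\<pi>. \<Sum>d\<in>UNIV. w E $ d * smeas (\<mu> $ d) E)"
      by (simp add: sum.swap[of _ UNIV])
    also have "\<dots> = (\<Sum>E\<in>\<pi>. svec \<mu> E \<bullet> w E)" by (simp add: inner_vec_def svec_def mult.commute)
    finally show ?thesis by (simp add: w(2))
  qed
  also have "\<dots> \<le> (\<Sum>d\<in>UNIV. smeas_integral (\<mu> $ d) (\<lambda>x. v x $ d) + 2 * B * (real (card \<pi>) * 2 * \<eta>))"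
    using comp by (intro sum_mono) (simp add: diff_le_eq)
  also have "\<dots> = meas_pairing \<mu> v + D * \<eta>"
    by (simp add: sum.distrib meas_pairing_def D_def)
  also have "D * \<eta> \<le> e / 2" using D e by (simp add: \<eta>_def field_simps)
  finally have "inner_norm ?W \<mu> - e < meas_pairing \<mu> v" using \<pi>(2) by linarith
  then show ?thesis using v Zv by blast
qed

text \<open>The case of one component, in which the absolute value is its own dual norm.\<close>

lemma tv_near:
  assumes "0 < e"
  shows "\<exists>u\<in>C0_real. (\<forall>x. \<bar>u x\<bar> \<le> 1) \<and> tv_norm \<sigma> - e < smeas_integral \<sigma> u"
proof -
  let ?Z = "\<lambda>v :: real ^ 1. \<bar>v $ 1\<bar>"
  have "dual_norm ?Z w = ?Z w" for w
  proof (rule antisym)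
    obtain v where v: "?Z v \<le> 1" "w \<bullet> v = dual_norm ?Z w" by (rule dual_norm_attained[OF norm_on_abs_1])
    have "w $ 1 * v $ 1 \<le> \<bar>w $ 1\<bar> * \<bar>v $ 1\<bar>" by (metis abs_ge_self abs_mult)
    also have "\<dots> \<le> \<bar>w $ 1\<bar> * 1" using v(1) by (intro mult_left_mono) auto
    finally show "dual_norm ?Z w \<le> ?Z w" using v(2) by (simp add: inner_vec_def)
    show "?Z w \<le> dual_norm ?Z w"
    proof (cases "w $ 1 = 0")
      case True
      then show ?thesis using norm_onD(3)[OF norm_on_dual_norm[OF norm_on_abs_1], of w] by simp
    next
      case False
      then show ?thesis using dual_norm_upper[OF norm_on_abs_1, of w "\<chi> d. sgn (w $ 1)"]
        by (simp add: inner_vec_def abs_sgn_eq flip: abs_sgn)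
    qed
  qed
  then have eq: "dual_norm ?Z = ?Z" by (rule ext)
  obtain v where v: "v \<in> C0" "\<And>x. ?Z (v x) \<le> 1"
    "inner_norm (dual_norm ?Z) (\<chi> d. \<sigma>) - e < meas_pairing (\<chi> d. \<sigma>) v"
    using meas_pairing_near_inner[OF norm_on_abs_1 assms, of "\<chi> d. \<sigma>"] by blast
  then show ?thesis
    by (intro bexI[of _ "\<lambda>x. v x $ 1"] C0_component)
      (simp_all add: eq meas_pairing_def flip: tv_norm_inner)
qed

text \<open>A norm on the space of vector measures that is dual to a norm on the space of continuous
  functions. The last condition, domination by the uniform norm, lets the Riesz representation
  theorem produce the measures.\<close>

definition dual_pair :: "(smeasure ^ 'd \<Rightarrow> real) \<Rightarrow> ((real \<Rightarrow> real ^ 'd) \<Rightarrow> real) \<Rightarrow> bool" where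
  "dual_pair n s \<longleftrightarrow> norm_on UNIV n \<and>
    (\<forall>v\<in>C0. 0 \<le> s v \<and> (s v = 0 \<longrightarrow> v = (\<lambda>_. 0))) \<and>
    (\<forall>v\<in>C0. \<forall>c. s (\<lambda>x. c *\<^sub>R v x) = \<bar>c\<bar> * s v) \<and>
    (\<forall>v\<in>C0. \<forall>w\<in>C0. s (\<lambda>x. v x + w x) \<le> s v + s w) \<and>
    (\<forall>v\<in>C0. \<forall>\<mu>. meas_pairing \<mu> v \<le> n \<mu> * s v) \<and>
    (\<forall>\<mu>. \<forall>e>0. \<exists>v\<in>C0. s v \<le> 1 \<and> n \<mu> - e < meas_pairing \<mu> v) \<and>
    (\<exists>C. \<forall>v\<in>C0. \<forall>B. (\<forall>x d. \<bar>v x $ d\<bar> \<le> B) \<longrightarrow> s v \<le> C * B)"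

lemma homogeneous_from_le:
  assumes le: "\<And>c v. v \<in> C0 \<Longrightarrow> s (\<lambda>x. c *\<^sub>R v x) \<le> \<bar>c\<bar> * s v"
    and nn: "\<And>v. v \<in> C0 \<Longrightarrow> 0 \<le> s v" and v: "v \<in> C0"
  shows "s (\<lambda>x. c *\<^sub>R v x) = \<bar>c\<bar> * (s v :: real)"
proof (cases "c = 0")
  case True
  then show ?thesis using le[OF v, of 0] nn[OF C0_scale[OF v, of 0]] by simp
next
  case False
  have "s v \<le> \<bar>1 / c\<bar> * s (\<lambda>x. c *\<^sub>R v x)" using le[OF C0_scale[OF v, of c], of "1 / c"] False by simp
  then have "\<bar>c\<bar> * s v \<le> s (\<lambda>x. c *\<^sub>R v x)" using False by (simp add: field_simps)
  then show ?thesis using le[OF v, of c] by simp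
qed

text \<open>For a seminorm, so that it applies to \<open>Z\<close> and to the absolute value of a single component.\<close>

lemma
  fixes N :: "real ^ 'd \<Rightarrow> real"
  assumes N: "seminorm_on UNIV N" and C: "\<And>u. N u \<le> C * norm u" "0 \<le> C"
  shows sup_inner_upper: "v \<in> C0 \<Longrightarrow> N (v x) \<le> sup_inner N v"
    and sup_inner_least: "(\<And>x. N (v x) \<le> B) \<Longrightarrow> sup_inner N v \<le> B"
    and sup_inner_nonneg: "v \<in> C0 \<Longrightarrow> 0 \<le> sup_inner N v"
    and sup_inner_add: "v \<in> C0 \<Longrightarrow> w \<in> C0 \<Longrightarrow> sup_inner N (\<lambda>x. v x + w x) \<le> sup_inner N v + sup_inner N w"
    and sup_inner_scale: "v \<in> C0 \<Longrightarrow> sup_inner N (\<lambda>x. c *\<^sub>R v x) = \<bar>c\<bar> * sup_inner N v"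
proof -
  have N': "0 \<le> N x" "N (x + y) \<le> N x + N y" "N (c *\<^sub>R x) = \<bar>c\<bar> * N x" for x y c
    using N by (auto simp: seminorm_on_def)
  show up: "N (v x) \<le> sup_inner N v" if v: "v \<in> C0" for v x
  proof -
    obtain B where "\<And>x. norm (v x) \<le> B" using C0_bounded[OF v] by blast
    then have "N (v x) \<le> C * B" for x by (meson C mult_left_mono order_trans)
    then have "bdd_above (range (\<lambda>x. N (v x)))" by (intro bdd_aboveI2)
    then show ?thesis unfolding sup_inner_def by (intro cSUP_upper) simp_all
  qed
  show least: "sup_inner N v \<le> B" if "\<And>x. N (v x) \<le> B" for v B
    unfolding sup_inner_def using that by (intro cSUP_least) simp_all
  show nn: "0 \<le> sup_inner N v" if v: "v \<in> C0" for v using up[OF v, of 0] N'(1)[of "v 0"] by linarith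
  show "sup_inner N (\<lambda>x. v x + w x) \<le> sup_inner N v + sup_inner N w" if "v \<in> C0" "w \<in> C0" for v w
    by (intro least order_trans[OF N'(2)] add_mono up that)
  have le: "sup_inner N (\<lambda>x. c *\<^sub>R v x) \<le> \<bar>c\<bar> * sup_inner N v" if "v \<in> C0" for c v
    unfolding N'(3) by (intro least) (simp add: N'(3) up mult_left_mono that)
  show "sup_inner N (\<lambda>x. c *\<^sub>R v x) = \<bar>c\<bar> * sup_inner N v" if "v \<in> C0" for v c
    by (rule homogeneous_from_le[where s = "sup_inner N"]) (fact le nn that)+
qed

lemma norm_le_card_max:
  fixes u :: "real ^ 'd"
  assumes "\<And>d. \<bar>u $ d\<bar> \<le> B"
  shows "norm u \<le> real CARD('d) * B"
proof -
  have "norm u \<le> (\<Sum>d\<in>UNIV. \<bar>u $ d\<bar>)" by (rule norm_le_l1_cart)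
  also have "\<dots> \<le> (\<Sum>d\<in>(UNIV :: 'd set). B)" by (intro sum_mono assms)
  finally show ?thesis by simp
qed

lemma dual_pair_inner:
  fixes Z :: "real ^ 'd \<Rightarrow> real"
  assumes Z: "norm_on UNIV Z"
  shows "dual_pair (inner_norm (dual_norm Z)) (sup_inner Z)"
proof -
  note Z' = norm_onD[OF Z]
  obtain C where C: "0 < C" "\<And>v. Z v \<le> C * norm v" using norm_on_upper[OF Z] by auto
  have sem: "seminorm_on UNIV Z" using Z by (simp add: norm_on_def)
  note sup = sup_inner_upper[OF sem C(2) less_imp_le[OF C(1)]] sup_inner_least[OF sem C(2) less_imp_le[OF C(1)]]
    sup_inner_nonneg[OF sem C(2) less_imp_le[OF C(1)]] sup_inner_add[OF sem C(2) less_imp_le[OF C(1)]]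
    sup_inner_scale[OF sem C(2) less_imp_le[OF C(1)]]
  have zero: "v = (\<lambda>_. 0)" if "v \<in> C0" "sup_inner Z v = 0" for v
  proof
    fix x show "v x = 0" using sup(1)[OF that(1), of x] that(2) Z'(3)[of "v x"] Z'(4)[of "v x"] by simp
  qed
  have bound: "meas_pairing \<mu> v \<le> inner_norm (dual_norm Z) \<mu> * sup_inner Z v" if v: "v \<in> C0" for v \<mu>
  proof (cases "sup_inner Z v = 0")
    case True
    have "meas_pairing \<mu> (\<lambda>_. 0 :: real ^ 'd) = 0" using meas_pairing_scale[of \<mu> 0 v] by simp
    then show ?thesis using zero[OF v True] True by simp
  next
    case False
    then have pos: "0 < sup_inner Z v" using sup(3)[OF v] by simp
    have "meas_pairing \<mu> (\<lambda>x. (1 / sup_inner Z v) *\<^sub>R v x) \<le> inner_norm (dual_norm Z) \<mu>"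
      using pos sup(1)[OF v] by (intro meas_pairing_le_inner Z C0_scale v) (simp add: Z'(2))
    then show ?thesis using pos by (simp only: meas_pairing_scale) (simp add: field_simps)
  qed
  have near: "\<exists>v\<in>C0. sup_inner Z v \<le> 1 \<and> inner_norm (dual_norm Z) \<mu> - e < meas_pairing \<mu> v"
    if e: "0 < e" for \<mu> and e :: real
  proof -
    obtain v where "v \<in> C0" "\<And>x. Z (v x) \<le> 1" "inner_norm (dual_norm Z) \<mu> - e < meas_pairing \<mu> v"
      using meas_pairing_near_inner[OF Z e] by blast
    then show ?thesis using sup(2)[of v 1] by blast
  qed
  have dom: "sup_inner Z v \<le> (C * real CARD('d)) * B" if "\<And>x d. \<bar>v x $ d\<bar> \<le> B" for v B
  proof (rule sup(2))
    fix x
    have "Z (v x) \<le> C * norm (v x)" by (rule C)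
    also have "\<dots> \<le> C * (real CARD('d) * B)"
      using C(1) that by (intro mult_left_mono norm_le_card_max) simp_all
    finally show "Z (v x) \<le> (C * real CARD('d)) * B" by simp
  qed
  show ?thesis
    unfolding dual_pair_def
    using norm_on_inner_norm[OF norm_on_dual_norm[OF Z]] sup(3,4,5) zero bound near dom
    by (intro conjI ballI allI impI exI[of _ "C * real CARD('d)"]) simp_all
qed

lemma smeas_integral_le_tv:
  assumes "bdd_borel f" "\<And>x. \<bar>f x\<bar> \<le> B"
  shows "smeas_integral \<sigma> f \<le> tv_norm \<sigma> * B"
  using smeas_integral_bound[OF assms, of \<sigma>] by (simp add: tv_norm_mass mult.commute)

text \<open>If \<open>t\<close> norms the vector of total variations and \<open>u d\<close> nearly norms
  the component \<open>d\<close>, then the function with components \<open>\<bar>t $ d\<bar> * u d\<close>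
  nearly norms the measure.\<close>

lemma dual_pair_outer:
  fixes Z :: "real ^ 'd \<Rightarrow> real"
  assumes Z: "monotone_norm Z"
  shows "dual_pair (outer_norm (dual_norm Z)) (sup_outer Z)"
proof -
  note nZ = monotone_norm_norm_on[OF Z]
  note Z' = norm_onD[OF nZ]
  have sem: "seminorm_on UNIV (\<lambda>u :: real ^ 'd. \<bar>u $ d\<bar>)" for d
    by (simp add: seminorm_on_def abs_mult abs_triangle_ineq)
  have cn: "\<bar>u $ d\<bar> \<le> 1 * norm u" for u :: "real ^ 'd" and d by (simp add: component_le_norm_cart)
  define m where "m v d = sup_inner (\<lambda>u. \<bar>u $ d\<bar>) v" for v :: "real \<Rightarrow> real ^ 'd" and d
  have so: "sup_outer Z v = Z (\<chi> d. m v d)" for v by (simp add: sup_outer_def m_def sup_inner_def)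
  note sup = sup_inner_upper[OF sem cn zero_le_one, folded m_def] sup_inner_least[OF sem cn zero_le_one, folded m_def]
    sup_inner_nonneg[OF sem cn zero_le_one, folded m_def] sup_inner_add[OF sem cn zero_le_one, folded m_def]
    sup_inner_scale[OF sem cn zero_le_one, folded m_def]
  have zero: "v = (\<lambda>_. 0)" if "v \<in> C0" "sup_outer Z v = 0" for v
  proof
    fix x
    have "m v d = 0" for d using that(2) by (simp add: so Z'(4) vec_eq_iff)
    then show "v x = 0" using sup(1)[OF that(1), of x] by (simp add: vec_eq_iff)
  qed
  have add: "sup_outer Z (\<lambda>x. v x + w x) \<le> sup_outer Z v + sup_outer Z w" if "v \<in> C0" "w \<in> C0" for v w
  proof -
    have "sup_outer Z (\<lambda>x. v x + w x) \<le> Z ((\<chi> d. m v d) + (\<chi> d. m w d))"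
      unfolding so
    proof (rule monotone_norm_mono[OF Z])
      fix d
      show "\<bar>(\<chi> d. m (\<lambda>x. v x + w x) d) $ d\<bar> \<le> \<bar>((\<chi> d. m v d) + (\<chi> d. m w d)) $ d\<bar>"
        using sup(4)[OF that, of d] sup(3)[OF C0_add[OF that], of d] by simp
    qed
    also have "\<dots> \<le> sup_outer Z v + sup_outer Z w" unfolding so by (rule Z')
    finally show ?thesis .
  qed
  have scale: "sup_outer Z (\<lambda>x. c *\<^sub>R v x) = \<bar>c\<bar> * sup_outer Z v" if "v \<in> C0" for v c
  proof -
    have "(\<chi> d. m (\<lambda>x. c *\<^sub>R v x) d) = \<bar>c\<bar> *\<^sub>R (\<chi> d. m v d)" using sup(5)[OF that] by (simp add: vec_eq_iff)
    then show ?thesis by (simp add: so Z'(2))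
  qed
  have bound: "meas_pairing \<mu> v \<le> outer_norm (dual_norm Z) \<mu> * sup_outer Z v" if v: "v \<in> C0" for v \<mu>
  proof -
    have "meas_pairing \<mu> v \<le> (\<Sum>d\<in>UNIV. tv_norm (\<mu> $ d) * m v d)"
      unfolding meas_pairing_def by (intro sum_mono smeas_integral_le_tv C0_bdd_borel v sup(1))
    also have "\<dots> = (\<chi> d. tv_norm (\<mu> $ d)) \<bullet> (\<chi> d. m v d)" by (simp add: inner_vec_def)
    also have "\<dots> \<le> outer_norm (dual_norm Z) \<mu> * sup_outer Z v"
      unfolding so outer_norm_def by (rule dual_norm_upper[OF nZ])
    finally show ?thesis .
  qed
  have near: "\<exists>v\<in>C0. sup_outer Z v \<le> 1 \<and> outer_norm (dual_norm Z) \<mu> - e < meas_pairing \<mu> v"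
    if e: "0 < e" for \<mu> and e :: real
  proof -
    obtain t where t: "Z t \<le> 1" "(\<chi> d. tv_norm (\<mu> $ d)) \<bullet> t = dual_norm Z (\<chi> d. tv_norm (\<mu> $ d))"
      by (rule dual_norm_attained[OF nZ])
    define T where "T = (\<Sum>d\<in>UNIV. \<bar>t $ d\<bar>)"
    have T: "0 \<le> T" by (simp add: T_def sum_nonneg)
    define e' where "e' = e / (T + 1)"
    have e': "0 < e'" using e T by (simp add: e'_def)
    have "\<exists>u. u \<in> C0_real \<and> (\<forall>x. \<bar>u x\<bar> \<le> 1) \<and> tv_norm (\<mu> $ d) - e' < smeas_integral (\<mu> $ d) u" for d
      using tv_near[OF e', of "\<mu> $ d"] by blast
    then obtain u where u: "\<And>d. u d \<in> C0_real" "\<And>d x. \<bar>u d x\<bar> \<le> 1"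
      "\<And>d. tv_norm (\<mu> $ d) - e' < smeas_integral (\<mu> $ d) (u d)"
      by metis
    define v where "v x = (\<chi> d. \<bar>t $ d\<bar> * u d x)" for x
    have v: "v \<in> C0" unfolding C0_iff_components
    proof
      fix d
      show "(\<lambda>x. v x $ d) \<in> C0_real"
        using u(1)[of d] tendsto_mult_left[of "u d" 0 at_infinity "\<bar>t $ d\<bar>"]
        by (simp add: v_def C0_real_def continuous_on_mult_left)
    qed
    have "\<bar>m v d\<bar> \<le> \<bar>t $ d\<bar>" for d
    proof -
      have "m v d \<le> \<bar>t $ d\<bar>"
        using u(2) by (intro sup(2)) (simp add: v_def abs_mult mult_left_le)
      then show ?thesis using sup(3)[OF v, of d] by simp
    qed
    then have "sup_outer Z v \<le> Z t" unfolding so by (intro monotone_norm_mono[OF Z]) simp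
    moreover have "outer_norm (dual_norm Z) \<mu> - e < meas_pairing \<mu> v"
    proof -
      have "outer_norm (dual_norm Z) \<mu> = (\<Sum>d\<in>UNIV. tv_norm (\<mu> $ d) * t $ d)"
        using t(2) by (simp add: outer_norm_def inner_vec_def)
      also have "\<dots> \<le> (\<Sum>d\<in>UNIV. \<bar>t $ d\<bar> * (smeas_integral (\<mu> $ d) (u d) + e'))"
      proof (rule sum_mono)
        fix d
        have "tv_norm (\<mu> $ d) * t $ d \<le> tv_norm (\<mu> $ d) * \<bar>t $ d\<bar>"
          by (intro mult_left_mono tv_norm_nonneg) simp
        also have "\<dots> \<le> (smeas_integral (\<mu> $ d) (u d) + e') * \<bar>t $ d\<bar>"
          using u(3)[of d] by (intro mult_right_mono) simp_all
        finally show "tv_norm (\<mu> $ d) * t $ d \<le> \<bar>t $ d\<bar> * (smeas_integral (\<mu> $ d) (u d) + e')"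
          by (simp add: mult.commute)
      qed
      also have "\<dots> = meas_pairing \<mu> v + T * e'"
        by (simp add: meas_pairing_def v_def smeas_integral_scale distrib_left sum.distrib T_def sum_distrib_right)
      also have "T * e' < e" using e T by (simp add: e'_def field_simps)
      finally show ?thesis by linarith
    qed
    ultimately show ?thesis using v t(1) by (intro bexI[of _ v]) simp_all
  qed
  obtain C where C: "0 < C" "\<And>v. Z v \<le> C * norm v" using norm_on_upper[OF nZ] by auto
  have dom: "sup_outer Z v \<le> (C * real CARD('d)) * B" if "v \<in> C0" "\<And>x d. \<bar>v x $ d\<bar> \<le> B" for v B
  proof -
    have "Z (\<chi> d. m v d) \<le> C * norm (\<chi> d. m v d)" by (rule C)
    also have "\<dots> \<le> C * (real CARD('d) * B)"
    proof (intro mult_left_mono norm_le_card_max)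
      show "\<bar>(\<chi> d. m v d) $ d\<bar> \<le> B" for d
        using sup(2)[of v d B] that(2) sup(3)[OF that(1), of d] by simp
    qed (use C(1) in simp)
    finally show ?thesis by (simp add: so)
  qed
  have nn: "0 \<le> sup_outer Z v" for v by (simp add: so Z'(3))
  show ?thesis
    unfolding dual_pair_def
    using norm_on_outer_norm[OF monotone_dual_norm[OF Z]] nn scale add zero bound near dom
    by (intro conjI ballI allI impI exI[of _ "C * real CARD('d)"]) simp_all
qed

subsection \<open>Comparison of the norms\<close>

lemma monotone_l1_norm: "monotone_norm (l1_norm :: real ^ 'd \<Rightarrow> real)"
  unfolding monotone_norm_def
proof
  have "norm u \<le> l1_norm u" for u :: "real ^ 'd" unfolding l1_norm_def by (rule norm_le_l1_cart)
  then have "u = 0" if "l1_norm u = 0" for u :: "real ^ 'd" using that by (metis norm_le_zero_iff)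
  then show "norm_on UNIV (l1_norm :: real ^ 'd \<Rightarrow> real)"
    unfolding norm_on_def seminorm_on_def l1_norm_def
    by (auto simp: sum_nonneg abs_mult sum_distrib_left sum.distrib[symmetric] intro!: sum_mono abs_triangle_ineq)
qed (simp add: l1_norm_def sum_mono)

lemma outer_norm_l1: "outer_norm l1_norm \<mu> = (\<Sum>d\<in>UNIV. tv_norm (\<mu> $ d))"
  by (simp add: outer_norm_def l1_norm_def tv_norm_nonneg)

lemma norm_on_infnorm: "norm_on UNIV (infnorm :: real ^ 'd \<Rightarrow> real)"
  by (simp add: norm_on_def seminorm_on_def infnorm_pos_le infnorm_mul infnorm_triangle infnorm_eq_0)

lemma infnorm_le: "(\<And>d. \<bar>u $ d\<bar> \<le> B) \<Longrightarrow> infnorm (u :: real ^ 'd) \<le> B"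
  unfolding infnorm_cart by (rule cSup_least) auto

text \<open>The norm \<open>l1\<close> is dual to the maximum norm, and a function is in the unit ball for the latter if
  its components are: so the components can be optimised separately.\<close>

lemma inner_norm_l1: "inner_norm l1_norm \<mu> = outer_norm l1_norm (\<mu> :: smeasure ^ 'd)"
proof (rule antisym)
  show "inner_norm l1_norm \<mu> \<le> outer_norm l1_norm \<mu>"
  proof (rule inner_norm_least)
    fix \<pi> assume \<pi>: "\<pi> \<in> finite_partitions"
    have "(\<Sum>E\<in>\<pi>. l1_norm (svec \<mu> E)) = (\<Sum>d\<in>UNIV. \<Sum>E\<in>\<pi>. \<bar>smeas (\<mu> $ d) E\<bar>)"
      by (simp add: l1_norm_def svec_def sum.swap[of _ UNIV])
    also have "\<dots> \<le> (\<Sum>d\<in>UNIV. tv_norm (\<mu> $ d))"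
      unfolding tv_norm_mass by (intro sum_mono sum_abs_smeas_le finite_partitionsD[OF \<pi>])
    finally show "(\<Sum>E\<in>\<pi>. l1_norm (svec \<mu> E)) \<le> outer_norm l1_norm \<mu>" by (simp add: outer_norm_l1)
  qed
  have dual: "dual_norm infnorm w \<le> l1_norm w" for w :: "real ^ 'd"
  proof -
    obtain v where v: "infnorm v \<le> 1" "w \<bullet> v = dual_norm infnorm w"
      by (rule dual_norm_attained[OF norm_on_infnorm])
    have "w $ d * v $ d \<le> \<bar>w $ d\<bar>" for d
    proof -
      have "\<bar>v $ d\<bar> \<le> 1" using component_le_infnorm_cart[of v d] v(1) by linarith
      have "w $ d * v $ d \<le> \<bar>w $ d\<bar> * \<bar>v $ d\<bar>" by (metis abs_ge_self abs_mult)
      also have "\<dots> \<le> \<bar>w $ d\<bar>" using \<open>\<bar>v $ d\<bar> \<le> 1\<close> by (intro mult_left_le) simp_all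
      finally show ?thesis .
    qed
    then show ?thesis unfolding v(2)[symmetric] by (simp add: inner_vec_def l1_norm_def sum_mono)
  qed
  have le: "inner_norm (dual_norm infnorm) \<mu> \<le> inner_norm l1_norm \<mu>"
  proof (rule inner_norm_least)
    fix \<pi> assume \<pi>: "\<pi> \<in> finite_partitions"
    have "(\<Sum>E\<in>\<pi>. dual_norm infnorm (svec \<mu> E)) \<le> (\<Sum>E\<in>\<pi>. l1_norm (svec \<mu> E))"
      by (intro sum_mono dual)
    also have "\<dots> \<le> inner_norm l1_norm \<mu>"
      by (intro inner_norm_partition monotone_norm_norm_on monotone_l1_norm \<pi>)
    finally show "(\<Sum>E\<in>\<pi>. dual_norm infnorm (svec \<mu> E)) \<le> inner_norm l1_norm \<mu>" .
  qed
  show "outer_norm l1_norm \<mu> \<le> inner_norm l1_norm \<mu>"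
  proof (rule field_le_epsilon)
    fix e :: real assume e: "0 < e"
    define e' where "e' = e / real CARD('d)"
    have e': "0 < e'" using e by (simp add: e'_def)
    have "\<exists>u. u \<in> C0_real \<and> (\<forall>x. \<bar>u x\<bar> \<le> 1) \<and> tv_norm (\<mu> $ d) - e' < smeas_integral (\<mu> $ d) u" for d
      using tv_near[OF e', of "\<mu> $ d"] by blast
    then obtain u where u: "\<And>d. u d \<in> C0_real" "\<And>d x. \<bar>u d x\<bar> \<le> 1"
      "\<And>d. tv_norm (\<mu> $ d) - e' < smeas_integral (\<mu> $ d) (u d)"
      by metis
    define v where "v x = (\<chi> d. u d x)" for x
    have "outer_norm l1_norm \<mu> \<le> (\<Sum>d\<in>UNIV. smeas_integral (\<mu> $ d) (u d) + e')"
      unfolding outer_norm_l1 using u(3) by (intro sum_mono) (simp add: diff_less_eq less_imp_le)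
    also have "\<dots> = meas_pairing \<mu> v + e" by (simp add: sum.distrib meas_pairing_def v_def e'_def)
    also have "meas_pairing \<mu> v \<le> inner_norm (dual_norm infnorm) \<mu>"
    proof (rule meas_pairing_le_inner[OF norm_on_infnorm])
      show "v \<in> C0" using u(1) by (simp add: C0_iff_components v_def)
      show "infnorm (v x) \<le> 1" for x using u(2) by (intro infnorm_le) (simp add: v_def)
    qed
    finally show "outer_norm l1_norm \<mu> \<le> inner_norm l1_norm \<mu> + e" using le by simp
  qed
qed

lemma norms_comparable_l1:
  fixes W :: "real ^ 'd \<Rightarrow> real"
  assumes W: "norm_on UNIV W"
  shows "\<exists>c>0. \<exists>C>0. (\<forall>v. c * l1_norm v \<le> W v \<and> W v \<le> C * l1_norm v)"
proof -
  obtain c where c: "0 < c" "\<And>v. c * norm v \<le> W v" using norm_on_lower[OF W] by auto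
  obtain C where C: "0 < C" "\<And>v. W v \<le> C * norm v" using norm_on_upper[OF W] by auto
  have "(c / real CARD('d)) * l1_norm v \<le> W v \<and> W v \<le> C * l1_norm v" for v
  proof
    have "l1_norm v \<le> (\<Sum>d\<in>(UNIV :: 'd set). norm v)"
      unfolding l1_norm_def by (intro sum_mono component_le_norm_cart)
    then have "c * l1_norm v \<le> c * (real CARD('d) * norm v)" using c(1) by (intro mult_left_mono) simp_all
    also have "\<dots> \<le> real CARD('d) * W v" using c(2)[of v] by (simp add: mult_left_mono mult.left_commute)
    finally show "(c / real CARD('d)) * l1_norm v \<le> W v" by (simp add: field_simps)
    have "W v \<le> C * norm v" by (rule C)
    also have "\<dots> \<le> C * l1_norm v"
      using C(1) norm_le_l1_cart[of v] by (intro mult_left_mono) (simp_all add: l1_norm_def)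
    finally show "W v \<le> C * l1_norm v" .
  qed
  moreover have "0 < c / real CARD('d)" using c(1) by simp
  ultimately show ?thesis using C(1) by blast
qed

lemma outer_norm_comparable:
  assumes "norm_on UNIV W"
  shows "\<exists>c>0. \<exists>C>0. \<forall>\<mu>. c * outer_norm l1_norm \<mu> \<le> outer_norm W \<mu> \<and> outer_norm W \<mu> \<le> C * outer_norm l1_norm \<mu>"
  using norms_comparable_l1[OF assms] unfolding outer_norm_def by blast

lemma inner_norm_comparable:
  assumes W: "norm_on UNIV W"
  shows "\<exists>c>0. \<exists>C>0. \<forall>\<mu>. c * outer_norm l1_norm \<mu> \<le> inner_norm W \<mu> \<and> inner_norm W \<mu> \<le> C * outer_norm l1_norm \<mu>"
proof -
  obtain c C where c: "0 < c" "\<And>v. c * l1_norm v \<le> W v" and C: "0 < C" "\<And>v. W v \<le> C * l1_norm v"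
    using norms_comparable_l1[OF W] by auto
  note l1 = monotone_norm_norm_on[OF monotone_l1_norm]
  have "c * outer_norm l1_norm \<mu> \<le> inner_norm W \<mu>" for \<mu>
  proof -
    have "inner_norm l1_norm \<mu> \<le> inner_norm W \<mu> / c"
    proof (rule inner_norm_least)
      fix \<pi> assume \<pi>: "\<pi> \<in> finite_partitions"
      have "c * (\<Sum>E\<in>\<pi>. l1_norm (svec \<mu> E)) \<le> (\<Sum>E\<in>\<pi>. W (svec \<mu> E))"
        unfolding sum_distrib_left by (intro sum_mono c)
      also have "\<dots> \<le> inner_norm W \<mu>" by (rule inner_norm_partition[OF W \<pi>])
      finally show "(\<Sum>E\<in>\<pi>. l1_norm (svec \<mu> E)) \<le> inner_norm W \<mu> / c"
        using c(1) by (simp add: pos_le_divide_eq mult.commute)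
    qed
    then show ?thesis using c(1) by (simp add: inner_norm_l1 pos_le_divide_eq mult.commute)
  qed
  moreover have "inner_norm W \<mu> \<le> C * outer_norm l1_norm \<mu>" for \<mu>
  proof (rule inner_norm_least)
    fix \<pi> assume \<pi>: "\<pi> \<in> finite_partitions"
    have "(\<Sum>E\<in>\<pi>. W (svec \<mu> E)) \<le> C * (\<Sum>E\<in>\<pi>. l1_norm (svec \<mu> E))"
      unfolding sum_distrib_left by (intro sum_mono C)
    also have "\<dots> \<le> C * outer_norm l1_norm \<mu>"
      using C(1) by (intro mult_left_mono inner_norm_partition[OF l1 \<pi>, of \<mu>, unfolded inner_norm_l1]) simp
    finally show "(\<Sum>E\<in>\<pi>. W (svec \<mu> E)) \<le> C * outer_norm l1_norm \<mu>" .
  qed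
  ultimately show ?thesis using c(1) C(1) by blast
qed

subsection \<open>Discrete measures\<close>

definition vdirac :: "real ^ 'd \<Rightarrow> real \<Rightarrow> smeasure ^ 'd" where
  "vdirac w x = (\<chi> d. w $ d *\<^sub>R sdirac x)"

lemma svec_vdirac: "E \<in> sets borel \<Longrightarrow> svec (vdirac w x) E = indicator E x *\<^sub>R w"
  by (simp add: svec_def vdirac_def smeas_simps sdirac.rep_eq vec_eq_iff)

lemma svec_sum: "svec (\<Sum>i\<in>I. \<mu> i) E = (\<Sum>i\<in>I. svec (\<mu> i) E)"
  by (induction I rule: infinite_finite_induct) simp_all

lemma inner_norm_vdirac_le:
  fixes W :: "real ^ 'd \<Rightarrow> real"
  assumes W: "norm_on UNIV W"
  shows "inner_norm W (vdirac w x) \<le> W w"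
proof (rule inner_norm_least)
  fix \<pi> assume \<pi>: "\<pi> \<in> finite_partitions"
  note p = finite_partitionsD[OF \<pi>]
  obtain E where E: "E \<in> \<pi>" "x \<in> E" using p(4) by blast
  have "(\<Sum>F\<in>\<pi>. W (svec (vdirac w x) F)) = (\<Sum>F\<in>\<pi>. if F = E then W w else 0)"
  proof (rule sum.cong)
    fix F assume F: "F \<in> \<pi>"
    have "x \<in> F \<longleftrightarrow> F = E" using p(3) E F unfolding disjoint_family_on_def by blast
    then show "W (svec (vdirac w x) F) = (if F = E then W w else 0)"
      using p(2)[OF F] E(2) by (simp add: svec_vdirac norm_onD(5)[OF W])
  qed simp
  then show "(\<Sum>F\<in>\<pi>. W (svec (vdirac w x) F)) \<le> W w" using p(1) E(1) by simp
qed

lemma inner_norm_discrete: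
  fixes W :: "real ^ 'd \<Rightarrow> real"
  assumes W: "norm_on UNIV W" and K: "finite K" and x: "inj_on x K"
  shows "inner_norm W (\<Sum>k\<in>K. vdirac (a k) (x k)) = (\<Sum>k\<in>K. W (a k))"
proof (rule antisym)
  have "inner_norm W (\<Sum>k\<in>K. vdirac (a k) (x k)) \<le> (\<Sum>k\<in>K. inner_norm W (vdirac (a k) (x k)))"
    by (rule norm_on_sum[OF norm_on_inner_norm[OF W]])
  also have "\<dots> \<le> (\<Sum>k\<in>K. W (a k))" by (intro sum_mono inner_norm_vdirac_le W)
  finally show "inner_norm W (\<Sum>k\<in>K. vdirac (a k) (x k)) \<le> (\<Sum>k\<in>K. W (a k))" .
  have sv: "svec (\<Sum>k\<in>K. vdirac (a k) (x k)) {x j} = a j" if j: "j \<in> K" for j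
  proof -
    have "svec (\<Sum>k\<in>K. vdirac (a k) (x k)) {x j} = (\<Sum>k\<in>K. if k = j then a k else 0)"
      unfolding svec_sum
    proof (rule sum.cong)
      fix k assume "k \<in> K"
      then have "x k = x j \<longleftrightarrow> k = j" using x j by (auto simp: inj_on_def)
      then show "svec (vdirac (a k) (x k)) {x j} = (if k = j then a k else 0)" by (simp add: svec_vdirac)
    qed simp
    then show ?thesis using K j by simp
  qed
  have "(\<Sum>k\<in>K. W (a k)) = (\<Sum>k\<in>K. W (svec (\<Sum>k\<in>K. vdirac (a k) (x k)) {x k}))"
    by (rule sum.cong) (simp_all add: sv)
  also have "\<dots> \<le> inner_norm W (\<Sum>k\<in>K. vdirac (a k) (x k))"
    using x by (intro inner_norm_family W K) (auto simp: disjoint_family_on_def inj_on_def)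
  finally show "(\<Sum>k\<in>K. W (a k)) \<le> inner_norm W (\<Sum>k\<in>K. vdirac (a k) (x k))" .
qed

lemma tv_norm_discrete:
  assumes "finite K" "inj_on x K"
  shows "tv_norm (\<Sum>k\<in>K. c k *\<^sub>R sdirac (x k)) = (\<Sum>k\<in>K. \<bar>c k\<bar>)"
proof -
  have "(\<chi> d :: 1. \<Sum>k\<in>K. c k *\<^sub>R sdirac (x k)) = (\<Sum>k\<in>K. vdirac (\<chi> d. c k) (x k))"
    by (simp add: vec_eq_iff vdirac_def)
  then show ?thesis using inner_norm_discrete[OF norm_on_abs_1 assms, of "\<lambda>k. \<chi> d. c k"]
    by (simp add: tv_norm_inner)
qed

section \<open>The Riesz representation theorem on the real line\<close>

lemma
  assumes "f \<in> C0_real" "g \<in> C0_real"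
  shows C0_real_add: "(\<lambda>x. f x + g x) \<in> C0_real"
    and C0_real_diff: "(\<lambda>x. f x - g x) \<in> C0_real"
    and C0_real_max: "(\<lambda>x. max (f x) (g x)) \<in> C0_real"
    and C0_real_min: "(\<lambda>x. min (f x) (g x)) \<in> C0_real"
  using assms tendsto_add[of f 0 at_infinity g 0] tendsto_diff[of f 0 at_infinity g 0]
    tendsto_max[of f 0 at_infinity g 0] tendsto_min[of f 0 at_infinity g 0]
  by (simp_all add: C0_real_def continuous_on_add continuous_on_diff continuous_on_max continuous_on_min)

lemma C0_real_scale: "f \<in> C0_real \<Longrightarrow> (\<lambda>x. c * f x) \<in> C0_real"
  using tendsto_mult_left[of f 0 at_infinity c] by (simp add: C0_real_def continuous_on_mult_left)

lemma C0_real_zero: "(\<lambda>_. 0) \<in> C0_real"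
  by (simp add: C0_real_def)

definition C0_pos :: "(real \<Rightarrow> real) set" where
  "C0_pos = {f \<in> C0_real. \<forall>x. 0 \<le> f x}"

lemma C0_posD: "f \<in> C0_pos \<Longrightarrow> f \<in> C0_real" "f \<in> C0_pos \<Longrightarrow> 0 \<le> f x"
  by (simp_all add: C0_pos_def)

lemma C0_pos_closed:
  shows "(\<lambda>_. 0) \<in> C0_pos"
    and "f \<in> C0_pos \<Longrightarrow> g \<in> C0_pos \<Longrightarrow> (\<lambda>x. f x + g x) \<in> C0_pos"
    and "f \<in> C0_pos \<Longrightarrow> 0 \<le> c \<Longrightarrow> (\<lambda>x. c * f x) \<in> C0_pos"
    and "f \<in> C0_pos \<Longrightarrow> g \<in> C0_pos \<Longrightarrow> (\<lambda>x. max (f x) (g x)) \<in> C0_pos"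
    and "f \<in> C0_pos \<Longrightarrow> g \<in> C0_pos \<Longrightarrow> (\<lambda>x. min (f x) (g x)) \<in> C0_pos"
    and "f \<in> C0_pos \<Longrightarrow> g \<in> C0_pos \<Longrightarrow> (\<And>x. f x \<le> g x) \<Longrightarrow> (\<lambda>x. g x - f x) \<in> C0_pos"
  by (simp_all add: C0_pos_def C0_real_zero C0_real_add C0_real_scale C0_real_max C0_real_min C0_real_diff le_max_iff_disj)

lemma C0_pos_bdd_borel: "f \<in> C0_pos \<Longrightarrow> bdd_borel f"
  by (intro C0_real_bdd_borel C0_posD)

text \<open>The trapezoid that is 1 on \<open>{a..b}\<close> and 0 outside \<open>{a - h<..<b + h}\<close>.\<close>

definition trapezoid :: "real \<Rightarrow> real \<Rightarrow> real \<Rightarrow> real \<Rightarrow> real" where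
  "trapezoid h a b x = max 0 (min 1 (min ((x - a) / h + 1) ((b - x) / h + 1)))"

lemma trapezoid:
  assumes "0 < h"
  shows "trapezoid h a b \<in> C0_pos" "0 \<le> trapezoid h a b x" "trapezoid h a b x \<le> 1"
    "a \<le> x \<Longrightarrow> x \<le> b \<Longrightarrow> trapezoid h a b x = 1"
    "x \<le> a - h \<or> b + h \<le> x \<Longrightarrow> trapezoid h a b x = 0"
proof -
  show z: "x \<le> a - h \<or> b + h \<le> x \<Longrightarrow> trapezoid h a b x = 0" for x
  proof -
    assume "x \<le> a - h \<or> b + h \<le> x"
    then have "(x - a) / h \<le> - 1 \<or> (b - x) / h \<le> - 1" using assms by (auto simp: pos_divide_le_eq)
    then show ?thesis by (auto simp: trapezoid_def)
  qed
  show nn: "0 \<le> trapezoid h a b x" "trapezoid h a b x \<le> 1" for x by (simp_all add: trapezoid_def)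
  show "a \<le> x \<Longrightarrow> x \<le> b \<Longrightarrow> trapezoid h a b x = 1" using assms by (simp add: trapezoid_def)
  have "continuous_on UNIV (trapezoid h a b)"
    unfolding trapezoid_def using assms by (intro continuous_intros) auto
  moreover have "(trapezoid h a b \<longlongrightarrow> 0) at_infinity"
    by (rule vanishing_compact_support[of "\<bar>a - h\<bar> + \<bar>b + h\<bar>"]) (rule z, linarith)
  ultimately show "trapezoid h a b \<in> C0_pos" by (simp add: C0_pos_def C0_real_def nn)
qed

text \<open>The bound \<open>M\<close> is sharp, that is, the norm of the functional; this is used to
  bound the integral by the functional.\<close>

locale positive_functional =
  fixes A :: "(real \<Rightarrow> real) \<Rightarrow> real" and M :: real
  assumes add: "f \<in> C0_pos \<Longrightarrow> g \<in> C0_pos \<Longrightarrow> A (\<lambda>x. f x + g x) = A f + A g"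
    and scale: "f \<in> C0_pos \<Longrightarrow> 0 \<le> c \<Longrightarrow> A (\<lambda>x. c * f x) = c * A f"
    and nonneg: "f \<in> C0_pos \<Longrightarrow> 0 \<le> A f"
    and bound: "f \<in> C0_pos \<Longrightarrow> (\<And>x. f x \<le> 1) \<Longrightarrow> A f \<le> M"
    and sharp: "0 < e \<Longrightarrow> \<exists>f\<in>C0_pos. (\<forall>x. f x \<le> 1) \<and> M - e < A f"
begin

lemma mono:
  assumes "f \<in> C0_pos" "g \<in> C0_pos" "\<And>x. f x \<le> g x"
  shows "A f \<le> A g"
proof -
  have "A (\<lambda>x. f x + (g x - f x)) = A f + A (\<lambda>x. g x - f x)"
    using assms by (intro add C0_pos_closed)
  then show ?thesis using nonneg[OF C0_pos_closed(6)[OF assms]] by simp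
qed

lemma M_nonneg: "0 \<le> M"
  using bound[OF C0_pos_closed(1)] nonneg[OF C0_pos_closed(1)] by simp

lemma sum:
  assumes "finite I" "\<And>i. i \<in> I \<Longrightarrow> f i \<in> C0_pos" "\<And>i. i \<in> I \<Longrightarrow> 0 \<le> c i"
  shows "(\<lambda>x. \<Sum>i\<in>I. c i * f i x) \<in> C0_pos \<and> A (\<lambda>x. \<Sum>i\<in>I. c i * f i x) = (\<Sum>i\<in>I. c i * A (f i))"
  using assms
proof (induction I rule: finite_induct)
  case empty
  show ?case using scale[OF C0_pos_closed(1), of 0] by (simp add: C0_pos_closed(1))
next
  case (insert i I)
  have f: "(\<lambda>x. c i * f i x) \<in> C0_pos" using insert.prems by (intro C0_pos_closed(3)) simp_all
  have IH: "(\<lambda>x. \<Sum>i\<in>I. c i * f i x) \<in> C0_pos" "A (\<lambda>x. \<Sum>i\<in>I. c i * f i x) = (\<Sum>i\<in>I. c i * A (f i))"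
    using insert.IH insert.prems by simp_all
  show ?case using insert.hyps insert.prems add[OF f IH(1)] C0_pos_closed(2)[OF f IH(1)] IH(2) scale[of "f i" "c i"]
    by simp
qed

text \<open>The mass of \<open>{..<x}\<close> for the measure to be constructed.\<close>

definition left_mass :: "real \<Rightarrow> real" where
  "left_mass x = (SUP f\<in>{f \<in> C0_pos. (\<forall>t. f t \<le> 1) \<and> (\<forall>t\<ge>x. f t = 0)}. A f)"

lemma left_mass_bdd: "bdd_above (A ` {f \<in> C0_pos. (\<forall>t. f t \<le> 1) \<and> (\<forall>t\<ge>x. f t = 0)})"
  by (rule bdd_aboveI2[of _ _ M]) (simp add: bound)

lemma left_mass_upper:
  "f \<in> C0_pos \<Longrightarrow> (\<And>t. f t \<le> 1) \<Longrightarrow> (\<And>t. x \<le> t \<Longrightarrow> f t = 0) \<Longrightarrow> A f \<le> left_mass x"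
  unfolding left_mass_def by (rule cSUP_upper[OF _ left_mass_bdd]) simp

lemma left_mass_least:
  assumes "\<And>f. f \<in> C0_pos \<Longrightarrow> (\<And>t. f t \<le> 1) \<Longrightarrow> (\<And>t. x \<le> t \<Longrightarrow> f t = 0) \<Longrightarrow> A f \<le> b"
  shows "left_mass x \<le> b"
  unfolding left_mass_def
proof (rule cSUP_least)
  show "{f \<in> C0_pos. (\<forall>t. f t \<le> 1) \<and> (\<forall>t\<ge>x. f t = 0)} \<noteq> {}"
    using C0_pos_closed(1) by (intro ex_in_conv[THEN iffD1] exI[of _ "\<lambda>_. 0"]) simp
qed (use assms in simp)

lemma left_mass_mono: "x \<le> y \<Longrightarrow> left_mass x \<le> left_mass y"
  by (intro left_mass_least left_mass_upper) simp_all

lemma left_mass_range: "0 \<le> left_mass x" "left_mass x \<le> M"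
  using left_mass_upper[OF C0_pos_closed(1), of x] nonneg[OF C0_pos_closed(1)] left_mass_least[of x M] bound
  by simp_all

lemma left_mass_superadditive:
  assumes g: "g \<in> C0_pos" "\<And>t. g t \<le> 1" and z: "\<And>t. t \<le> a \<or> b \<le> t \<Longrightarrow> g t = 0" and ab: "a \<le> b"
  shows "left_mass a + A g \<le> left_mass b"
proof -
  have "left_mass a \<le> left_mass b - A g"
  proof (rule left_mass_least)
    fix f assume f: "f \<in> C0_pos" "\<And>t. f t \<le> 1" "\<And>t. a \<le> t \<Longrightarrow> f t = 0"
    have "f t + g t \<le> 1" for t
      using f(2,3)[of t] g(2)[of t] z[of t] by (cases "a \<le> t") simp_all
    moreover have "f t + g t = 0" if "b \<le> t" for t using f(3)[of t] z[of t] that ab by simp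
    ultimately have "A (\<lambda>t. f t + g t) \<le> left_mass b" by (intro left_mass_upper C0_pos_closed f(1) g(1))
    then show "A f \<le> left_mass b - A g" by (simp add: add f(1) g(1))
  qed
  then show ?thesis by simp
qed

text \<open>The right-continuous modification of \<open>left_mass\<close>, the distribution function of
  the representing measure.\<close>

definition F :: "real \<Rightarrow> real" where
  "F x = (INF y\<in>{x<..}. left_mass y)"

lemma F_bdd: "bdd_below (left_mass ` {x<..})"
  by (rule bdd_belowI2[of _ 0]) (simp add: left_mass_range)

lemma F_le: "x < y \<Longrightarrow> F x \<le> left_mass y"
  unfolding F_def by (rule cINF_lower[OF F_bdd]) simp

lemma F_ge: "(\<And>y. x < y \<Longrightarrow> b \<le> left_mass y) \<Longrightarrow> b \<le> F x"
  unfolding F_def by (rule cINF_greatest) (auto simp: greaterThan_non_empty)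

lemma F_near:
  assumes "0 < e" obtains y where "x < y" "left_mass y < F x + e"
proof -
  have "(INF y\<in>{x<..}. left_mass y) < F x + e" using assms by (simp add: F_def)
  then show ?thesis using that by (subst (asm) cINF_less_iff) (auto simp: F_bdd)
qed

lemma left_mass_le_F: "left_mass x \<le> F x"
  by (intro F_ge left_mass_mono) simp

lemma F_mono: "x \<le> y \<Longrightarrow> F x \<le> F y"
  by (intro F_ge F_le) simp

lemma F_range: "0 \<le> F x" "F x \<le> M"
  using left_mass_le_F[of x] left_mass_range(1)[of x] F_le[of x "x + 1"] left_mass_range(2)[of "x + 1"] by simp_all

lemma F_rcont: "continuous (at_right x) F"
  unfolding continuous_within tendsto_iff
proof (intro allI impI)
  fix e :: real assume "0 < e"
  then obtain y where y: "x < y" "left_mass y < F x + e" by (rule F_near)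
  show "\<forall>\<^sub>F z in at_right x. dist (F z) (F x) < e"
    unfolding eventually_at_right_field
  proof (intro exI[of _ y] conjI allI impI)
    fix z assume z: "x < z" "z < y"
    show "dist (F z) (F x) < e" using F_mono[of x z] F_le[OF z(2)] y(2) z(1) by (simp add: dist_real_def)
  qed (rule y(1))
qed

definition N :: "real measure" where "N = interval_measure F"

lemma sets_N [simp]: "sets N = sets borel" and space_N [simp]: "space N = UNIV"
  by (simp_all add: N_def)

lemma emeasure_N: "a \<le> b \<Longrightarrow> emeasure N {a<..b} = ennreal (F b - F a)"
  unfolding N_def by (rule emeasure_interval_measure_Ioc) (simp_all add: F_mono F_rcont)

lemma N_mass: "emeasure N UNIV \<le> ennreal M"
proof -
  have "(\<Union>n::nat. {- real n<..real n}) = UNIV"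
  proof -
    have "\<exists>n::nat. x \<in> {- real n<..real n}" for x
    proof -
      obtain n :: nat where "\<bar>x\<bar> < real n" using reals_Archimedean2 by blast
      then show ?thesis by (intro exI[of _ n]) auto
    qed
    then show ?thesis by blast
  qed
  moreover have "(SUP n::nat. emeasure N {- real n<..real n}) = emeasure N (\<Union>n::nat. {- real n<..real n})"
    by (rule SUP_emeasure_incseq) (auto simp: incseq_def)
  moreover have "emeasure N {- real n<..real n} \<le> ennreal M" for n :: nat
    using F_range(2)[of "real n"] F_range(1)[of "- real n"] by (simp add: emeasure_N ennreal_leI)
  ultimately show ?thesis using SUP_least[of UNIV "\<lambda>n::nat. emeasure N {- real n<..real n}" "ennreal M"]
    by simp
qed

lemma N_finite: "finite_measure N"
proof (rule finite_measureI)
  show "emeasure N (space N) \<noteq> \<infinity>" using N_mass by (auto simp: top_unique)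
qed

lemma N_mass': "measure N UNIV \<le> M"
  using N_mass M_nonneg by (simp add: measure_def enn2real_leI)

lemma measure_N: "a \<le> b \<Longrightarrow> measure N {a<..b} = F b - F a"
  by (simp add: measure_def emeasure_N F_mono)

lemma small_trapezoid:
  assumes ab: "a \<le> b" and cont: "isCont F a" and e: "0 < e"
  shows "\<exists>h>0. A (trapezoid h a b) \<le> measure N {a<..b} + e"
proof -
  have e2: "0 < e / 2" using e by simp
  obtain y where y: "b < y" "left_mass y < F b + e / 2" by (rule F_near[OF e2])
  have "\<forall>e>0. \<exists>d>0. \<forall>z. \<bar>z - a\<bar> < d \<longrightarrow> \<bar>F z - F a\<bar> < e"
    using cont unfolding continuous_at_eps_delta dist_real_def .
  from this[rule_format, OF e2] obtain d where d: "0 < d" "\<And>z. \<bar>z - a\<bar> < d \<Longrightarrow> \<bar>F z - F a\<bar> < e / 2"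
    by blast
  define h where "h = min (y - b) (d / 3)"
  have "h \<le> d / 3" unfolding h_def by (rule min.cobounded2)
  then have h: "0 < h" "h \<le> y - b" "2 * h < d" using y(1) d(1) by (simp_all add: h_def)
  have "left_mass (a - h) + A (trapezoid h a b) \<le> left_mass (b + h)"
    using h(1) ab by (intro left_mass_superadditive trapezoid) simp_all
  moreover have "left_mass (b + h) \<le> left_mass y" using h by (intro left_mass_mono) simp
  moreover have "F (a - 2 * h) \<le> left_mass (a - h)" using h by (intro F_le) simp
  moreover have "\<bar>F (a - 2 * h) - F a\<bar> < e / 2" using h by (intro d(2)) simp
  ultimately have "A (trapezoid h a b) \<le> F b - F a + e" using y(2) by linarith
  then show ?thesis using h(1) by (intro exI[of _ h]) (simp add: measure_N[OF ab])
qed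

text \<open>The functional is subadditive, so it suffices to cover \<open>g\<close> by small multiples of trapezoids
  over a fine grid; the grid points are chosen where \<open>F\<close> is continuous, so that overlaps cost
  nothing.\<close>

lemma A_le_integral:
  assumes g: "g \<in> C0_pos"
  shows "A g \<le> (LINT x|N. g x)"
proof (rule field_le_epsilon)
  fix e0 :: real assume e0: "0 < e0"
  interpret finite_measure N by (rule N_finite)
  define e where "e = e0 / (3 * M + 1)"
  have e: "0 < e" using e0 M_nonneg by (simp add: e_def)
  have e_e0: "e * (3 * M + 1) = e0" using M_nonneg by (simp add: e_def)
  define g' where "g' x = max (g x - e) 0" for x
  have mn: "(\<lambda>x. min (g x) e) \<in> C0_pos" and g': "g' \<in> C0_pos"
  proof -
    have c: "continuous_on UNIV g" "(g \<longlongrightarrow> 0) at_infinity" "\<And>x. 0 \<le> g x" using g by (simp_all add: C0_pos_def C0_real_def)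
    have "((\<lambda>x. min (g x) e) \<longlongrightarrow> min 0 e) at_infinity" by (intro tendsto_min c tendsto_const)
    then show "(\<lambda>x. min (g x) e) \<in> C0_pos"
      using c e by (simp add: C0_pos_def C0_real_def continuous_on_min)
    have "((\<lambda>x. max (g x - e) 0) \<longlongrightarrow> max (0 - e) 0) at_infinity" by (intro tendsto_max tendsto_diff c tendsto_const)
    then show "g' \<in> C0_pos"
      using c e unfolding g'_def by (simp add: C0_pos_def C0_real_def continuous_on_max continuous_on_diff)
  qed
  have "A g = A (\<lambda>x. g' x + min (g x) e)" by (rule arg_cong[where f = A]) (auto simp: g'_def)
  also have "\<dots> = A g' + A (\<lambda>x. min (g x) e)" by (rule add[OF g' mn])
  also have "A (\<lambda>x. min (g x) e) \<le> e * M"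
  proof -
    have "A (\<lambda>x. (1 / e) * min (g x) e) \<le> M" using e by (intro bound C0_pos_closed(3)[OF mn]) simp_all
    then have "(1 / e) * A (\<lambda>x. min (g x) e) \<le> M" using e scale[OF mn, of "1 / e"] by simp
    then show ?thesis using e by (simp add: pos_divide_le_eq mult.commute)
  qed
  finally have split: "A g \<le> A g' + e * M" by simp
  have "\<forall>\<^sub>F x in at_infinity. g x < e"
    using g e order_tendstoD(2)[of g 0 at_infinity e] by (simp add: C0_pos_def C0_real_def)
  then obtain m0 where m0: "\<And>x. m0 \<le> norm x \<Longrightarrow> g x < e" unfolding eventually_at_infinity by blast
  define m where "m = max m0 1"
  have "0 < m" by (simp add: m_def)
  have m: "0 < m" "g' x = 0" if "m \<le> \<bar>x\<bar>" for x
  proof -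
    show "0 < m" by fact
    have "g x < e" by (rule m0) (use that in \<open>simp add: m_def\<close>)
    then show "g' x = 0" by (simp add: g'_def)
  qed
  note m = \<open>0 < m\<close> m(2)
  have "continuous_on UNIV g'" using g' by (simp add: C0_pos_def C0_real_def)
  then have "continuous_on {- (m + 2)..m + 2} g'" by (rule continuous_on_subset) simp
  then have "uniformly_continuous_on {- (m + 2)..m + 2} g'"
    by (rule compact_uniformly_continuous) (rule compact_Icc)
  then have "\<exists>d>0. \<forall>x\<in>{- (m + 2)..m + 2}. \<forall>y\<in>{- (m + 2)..m + 2}. \<bar>y - x\<bar> < d \<longrightarrow> \<bar>g' y - g' x\<bar> < e"
    using e unfolding uniformly_continuous_on_def dist_real_def by blast
  then obtain d where d: "0 < d"
    "\<And>x y. x \<in> {- (m + 2)..m + 2} \<Longrightarrow> y \<in> {- (m + 2)..m + 2} \<Longrightarrow> \<bar>y - x\<bar> < d \<Longrightarrow> \<bar>g' y - g' x\<bar> < e"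
    by blast
  define \<delta> where "\<delta> = min (d / 2) 1"
  have \<delta>: "0 < \<delta>" "2 * \<delta> \<le> d" "\<delta> \<le> 1" using d(1) by (auto simp: \<delta>_def)
  define l where "l = - m - \<delta>"
  have count: "countable {a. \<not> isCont F a}" by (rule mono_ctble_discont) (simp add: mono_def F_mono)
  have "\<exists>x. l + real k * \<delta> < x \<and> x < l + (real k + 1) * \<delta> \<and> isCont F x" for k
  proof -
    have "{l + real k * \<delta><..<l + (real k + 1) * \<delta>} \<noteq> {}" using \<delta>(1) by (simp add: distrib_right)
    from open_minus_countable[OF count this open_greaterThanLessThan] show ?thesis by auto
  qed
  then have "\<forall>k. \<exists>x. l + real k * \<delta> < x \<and> x < l + (real k + 1) * \<delta> \<and> isCont F x" by (rule allI)
  from choice[OF this]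
  obtain x where x: "\<And>k. l + real k * \<delta> < x k" "\<And>k. x k < l + (real k + 1) * \<delta>" "\<And>k. isCont F (x k)"
    by blast
  have step: "x k < x (Suc k)" "x (Suc k) - x k < 2 * \<delta>" for k
    using x(1)[of k] x(2)[of k] x(1)[of "Suc k"] x(2)[of "Suc k"] by (simp_all add: algebra_simps)
  have smono: "x i \<le> x j" if "i \<le> j" for i j using lift_Suc_mono_le[of x] step(1) that by (simp add: less_imp_le)
  define n where "n = nat \<lceil>(2 * m + \<delta>) / \<delta>\<rceil>"
  have n: "2 * m + \<delta> \<le> real n * \<delta>" "real n * \<delta> < 2 * m + 2 * \<delta>"
  proof -
    have "(2 * m + \<delta>) / \<delta> \<le> real n" "real n < (2 * m + \<delta>) / \<delta> + 1"
      using m(1) \<delta>(1) by (simp_all add: n_def) linarith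
    then show "2 * m + \<delta> \<le> real n * \<delta>" "real n * \<delta> < 2 * m + 2 * \<delta>" using \<delta>(1) by (simp_all add: field_simps)
  qed
  have ends: "x 0 \<le> - m" "m \<le> x n" "- (m + 2) \<le> x 0" "x n \<le> m + 2"
    using x(2)[of 0] x(1)[of n] x(1)[of 0] x(2)[of n] n \<delta> by (simp_all add: l_def algebra_simps)
  have inside: "x k \<in> {- (m + 2)..m + 2}" if "k \<le> n" for k
    using smono[of 0 k] smono[OF that] ends by simp
  have cell: "\<bar>g' t - g' (x k)\<bar> < e" if "k < n" "x k \<le> t" "t \<le> x (Suc k)" for k t
  proof (rule d(2))
    show "x k \<in> {- (m + 2)..m + 2}" using inside[of k] that(1) by simp
    show "t \<in> {- (m + 2)..m + 2}" using inside[of k] inside[of "Suc k"] that by simp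
    show "\<bar>t - x k\<bar> < d" using step(2)[of k] \<delta>(2) that(2,3) by linarith
  qed
  define c where "c k = g' (x k) + e" for k
  have c: "0 \<le> c k" for k using C0_posD(2)[OF g'] e by (simp add: c_def)
  define T where "T = (\<Sum>k<n. c k)"
  have T: "0 \<le> T" unfolding T_def by (intro sum_nonneg c)
  define e' where "e' = e / (T + 1)"
  have e': "0 < e'" "T * e' \<le> e" using e T by (simp_all add: e'_def divide_le_eq)
  have "\<exists>h>0. A (trapezoid h (x k) (x (Suc k))) \<le> measure N {x k<..x (Suc k)} + e'" for k
    using small_trapezoid[OF less_imp_le[OF step(1)] x(3) e'(1)] .
  then have "\<forall>k. \<exists>h>0. A (trapezoid h (x k) (x (Suc k))) \<le> measure N {x k<..x (Suc k)} + e'" by (rule allI)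
  from choice[OF this] obtain h where h: "\<And>k. 0 < h k"
    "\<And>k. A (trapezoid (h k) (x k) (x (Suc k))) \<le> measure N {x k<..x (Suc k)} + e'" by blast
  have int_step: "integrable N (\<lambda>t. c k * indicator {x k<..x (Suc k)} t)" for k
    by (intro bdd_borel_integrable N_finite sets_N bdd_borel_scale bdd_borel_indicator) simp
  have integral_steps: "(LINT t|N. (\<Sum>k<n. c k * indicator {x k<..x (Suc k)} t))
      = (\<Sum>k<n. c k * measure N {x k<..x (Suc k)})"
    by (subst Bochner_Integration.integral_sum[OF int_step]) simp
  let ?\<tau> = "\<lambda>k. trapezoid (h k) (x k) (x (Suc k))"
  note S = sum[of "{..<n}" ?\<tau> c, OF finite_lessThan trapezoid(1)[OF h(1)] c]
  have "A g' \<le> A (\<lambda>t. \<Sum>k<n. c k * ?\<tau> k t)"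
  proof (rule mono[OF g'])
    show "(\<lambda>t. \<Sum>k<n. c k * ?\<tau> k t) \<in> C0_pos" using S by blast
    fix t
    have nn: "0 \<le> c k * ?\<tau> k t" for k by (intro mult_nonneg_nonneg c trapezoid(2) h(1))
    show "g' t \<le> (\<Sum>k<n. c k * ?\<tau> k t)"
    proof (cases "x 0 \<le> t \<and> t \<le> x n")
      case False
      then have "m \<le> \<bar>t\<bar>" using ends by linarith
      then show ?thesis using m(2)[of t] nn by (simp add: sum_nonneg)
    next
      case True
      have "\<exists>k<j. x k \<le> t \<and> t \<le> x (Suc k)" if "x 0 \<le> t" "t \<le> x j" "0 < j" for j
        using that
      proof (induction j)
        case (Suc j)
        show ?case
        proof (cases "x j \<le> t")
          case True then show ?thesis using Suc.prems by blast
        next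
          case False
          then have "0 < j" using Suc.prems(1) by (cases j) simp_all
          then show ?thesis using Suc.IH[OF Suc.prems(1)] False by (metis less_SucI linear)
        qed
      qed simp
      moreover have "0 < n"
      proof (rule ccontr)
        assume "\<not> 0 < n" then show False using ends(1,2) m(1) by simp
      qed
      ultimately obtain k where k: "k < n" "x k \<le> t" "t \<le> x (Suc k)" using True by blast
      have "g' t \<le> c k * ?\<tau> k t" using cell[OF k] trapezoid(4)[OF h(1) k(2,3)] by (simp add: c_def)
      also have "\<dots> \<le> (\<Sum>k<n. c k * ?\<tau> k t)" using k(1) nn by (intro member_le_sum) simp_all
      finally show ?thesis .
    qed
  qed
  also have "\<dots> = (\<Sum>k<n. c k * A (?\<tau> k))" using S by blast
  also have "\<dots> \<le> (\<Sum>k<n. c k * (measure N {x k<..x (Suc k)} + e'))"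
    by (intro sum_mono mult_left_mono h(2) c)
  also have "\<dots> = (LINT t|N. (\<Sum>k<n. c k * indicator {x k<..x (Suc k)} t)) + T * e'"
    unfolding integral_steps by (simp add: distrib_left sum.distrib T_def sum_distrib_right)
  also have "(LINT t|N. (\<Sum>k<n. c k * indicator {x k<..x (Suc k)} t)) \<le> (LINT t|N. g' t + 2 * e)"
  proof (rule integral_mono)
    have ig: "integrable N g'" by (intro bdd_borel_integrable N_finite C0_pos_bdd_borel g') simp
    show "integrable N (\<lambda>t. g' t + 2 * e)" using ig by simp
    show "integrable N (\<lambda>t. \<Sum>k<n. c k * indicator {x k<..x (Suc k)} t)"
      by (intro Bochner_Integration.integrable_sum int_step)
    fix t
    show "(\<Sum>k<n. c k * indicator {x k<..x (Suc k)} t) \<le> g' t + 2 * e"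
    proof (cases "\<exists>k<n. t \<in> {x k<..x (Suc k)}")
      case True
      then obtain k where k: "k < n" "x k < t" "t \<le> x (Suc k)" by auto
      have "t \<in> {x j<..x (Suc j)} \<longleftrightarrow> j = k" for j
      proof (cases j k rule: linorder_cases)
        case less then show ?thesis using smono[of "Suc j" k] k(2) by simp
      next
        case equal then show ?thesis using k by simp
      next
        case greater then show ?thesis using smono[of "Suc k" j] k(3) by simp
      qed
      then have "(\<Sum>j<n. c j * indicator {x j<..x (Suc j)} t) = (\<Sum>j<n. if j = k then c j else 0)"
        by (intro sum.cong) (auto simp: indicator_def)
      also have "\<dots> = c k" using k(1) by simp
      also have "\<dots> \<le> g' t + 2 * e" using cell[OF k(1) less_imp_le[OF k(2)] k(3)] by (simp add: c_def)
      finally show ?thesis .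
    next
      case False
      then have "(\<Sum>k<n. c k * indicator {x k<..x (Suc k)} t) = 0" by (intro sum.neutral) (auto simp: indicator_def)
      then show ?thesis using C0_posD(2)[OF g', of t] e by simp
    qed
  qed
  also have "\<dots> = (LINT t|N. g' t) + 2 * e * measure N UNIV"
    using bdd_borel_integrable[OF N_finite sets_N C0_pos_bdd_borel[OF g']] by simp
  also have "\<dots> \<le> (LINT t|N. g t) + 2 * e * M"
  proof (intro add_mono mult_left_mono N_mass')
    show "(LINT t|N. g' t) \<le> (LINT t|N. g t)"
    proof (rule integral_mono)
      show "integrable N g'" "integrable N g"
        by (intro bdd_borel_integrable N_finite C0_pos_bdd_borel g g' sets_N)+
      show "g' t \<le> g t" for t using C0_posD(2)[OF g, of t] e by (simp add: g'_def)
    qed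
  qed (use e in simp)
  finally have "A g' \<le> (LINT t|N. g t) + 2 * e * M + e" using e'(2) by linarith
  then show "A g \<le> (LINT x|N. g x) + e0" using split e_e0 by (simp add: algebra_simps)
qed

text \<open>One inequality is enough: the total mass of the measure does not exceed the norm of the
  functional, so a strict inequality for \<open>g\<close> would have to be compensated on the complement.\<close>

lemma A_eq_integral:
  assumes g: "g \<in> C0_pos"
  shows "A g = (LINT x|N. g x)"
proof -
  note int = bdd_borel_integrable[OF N_finite sets_N C0_pos_bdd_borel]
  have le1: "(LINT x|N. g x) \<le> A g" if g: "g \<in> C0_pos" "\<And>x. g x \<le> 1" for g
  proof (rule field_le_epsilon)
    fix e :: real assume "0 < e"
    then obtain f where f: "f \<in> C0_pos" "\<And>x. f x \<le> 1" "M - e < A f" using sharp by blast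
    let ?h = "\<lambda>x. max (f x) (g x)"
    have h: "?h \<in> C0_pos" by (intro C0_pos_closed f g)
    have "A f \<le> A ?h" by (intro mono f h) simp
    have hg: "(\<lambda>x. ?h x - g x) \<in> C0_pos" by (intro C0_pos_closed(6) h g) simp
    have "A ?h = A (\<lambda>x. g x + (?h x - g x))" by simp
    also have "\<dots> = A g + A (\<lambda>x. ?h x - g x)" by (rule add[OF g(1) hg])
    also have "A (\<lambda>x. ?h x - g x) \<le> (LINT x|N. ?h x - g x)" by (rule A_le_integral[OF hg])
    also have "\<dots> = (LINT x|N. ?h x) - (LINT x|N. g x)" by (intro Bochner_Integration.integral_diff int h g)
    also have "(LINT x|N. ?h x) \<le> M"
    proof -
      interpret finite_measure N by (rule N_finite)
      have "(LINT x|N. ?h x) \<le> (LINT x|N. 1)" using f(2) g(2) int[OF h] by (intro integral_mono) simp_all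
      then show ?thesis using N_mass' by simp
    qed
    finally show "(LINT x|N. g x) \<le> A g + e" using f(3) \<open>A f \<le> A ?h\<close> by linarith
  qed
  obtain B where B: "\<And>x. \<bar>g x\<bar> \<le> B" using C0_pos_bdd_borel[OF g] unfolding bdd_borel_def by blast
  define b where "b = max B 1"
  have b: "0 < b" "\<And>x. g x \<le> b" using B by (auto simp: b_def abs_le_iff le_max_iff_disj)
  have "(LINT x|N. (1 / b) * g x) \<le> A (\<lambda>x. (1 / b) * g x)"
    using b by (intro le1 C0_pos_closed g) simp_all
  then have "(1 / b) * (LINT x|N. g x) \<le> (1 / b) * A g"
    using scale[OF g, of "1 / b"] b(1) by (simp only: Bochner_Integration.integral_mult_right_zero) simp
  then have "(LINT x|N. g x) \<le> A g" using b(1) by (simp add: divide_le_cancel)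
  then show ?thesis using A_le_integral[OF g] by simp
qed

end

lemma riesz_positive:
  assumes add: "\<And>f g. f \<in> C0_pos \<Longrightarrow> g \<in> C0_pos \<Longrightarrow> A (\<lambda>x. f x + g x) = A f + A g"
    and scale: "\<And>f c. f \<in> C0_pos \<Longrightarrow> 0 \<le> c \<Longrightarrow> A (\<lambda>x. c * f x) = c * A f"
    and nonneg: "\<And>f. f \<in> C0_pos \<Longrightarrow> 0 \<le> A f"
    and bound: "\<And>f. f \<in> C0_pos \<Longrightarrow> (\<And>x. f x \<le> 1) \<Longrightarrow> A f \<le> C"
  shows "\<exists>\<sigma>. \<forall>f\<in>C0_pos. A f = smeas_integral \<sigma> f"
proof -
  let ?S = "{f \<in> C0_pos. \<forall>x. f x \<le> 1}"
  define M where "M = (SUP f\<in>?S. A f)"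
  have bdd: "bdd_above (A ` ?S)" by (rule bdd_aboveI2[of _ _ C]) (simp add: bound)
  have ne: "A ` ?S \<noteq> {}" using C0_pos_closed(1) by (intro ex_in_conv[THEN iffD1] exI[of _ "A (\<lambda>_. 0)"] imageI) simp
  interpret positive_functional A M
  proof
    show "A f \<le> M" if "f \<in> C0_pos" "\<And>x. f x \<le> 1" for f
      unfolding M_def by (rule cSUP_upper[OF _ bdd]) (simp add: that)
    show "\<exists>f\<in>C0_pos. (\<forall>x. f x \<le> 1) \<and> M - e < A f" if "0 < e" for e :: real
    proof -
      have "M - e < Sup (A ` ?S)" using that by (simp add: M_def)
      from less_cSupD[OF ne this] show ?thesis by blast
    qed
  qed (fact add scale nonneg)+
  have "A f = smeas_integral (smeas_of N) f" if "f \<in> C0_pos" for f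
    using A_eq_integral[OF that] smeas_integral_of[OF N_finite sets_N C0_pos_bdd_borel[OF that]] by simp
  then show ?thesis by blast
qed

text \<open>The positive part of a bounded functional is the supremum over the functions below the argument;
  it is additive since a function below a sum splits into functions below the summands. This writes
  the functional as a difference of two positive ones.\<close>

lemma riesz_real:
  assumes add: "\<And>f g. f \<in> C0_real \<Longrightarrow> g \<in> C0_real \<Longrightarrow> \<Lambda> (\<lambda>x. f x + g x) = \<Lambda> f + \<Lambda> g"
    and scale: "\<And>f c. f \<in> C0_real \<Longrightarrow> \<Lambda> (\<lambda>x. c * f x) = c * \<Lambda> f"
    and bound: "\<And>f B. f \<in> C0_real \<Longrightarrow> (\<And>x. \<bar>f x\<bar> \<le> B) \<Longrightarrow> \<bar>\<Lambda> f\<bar> \<le> C * B"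
  shows "\<exists>\<sigma>. \<forall>f\<in>C0_real. \<Lambda> f = smeas_integral \<sigma> f"
proof -
  define below where "below f = {g \<in> C0_pos. \<forall>x. g x \<le> f x}" for f :: "real \<Rightarrow> real"
  define P where "P f = (SUP g\<in>below f. \<Lambda> g)" for f
  have zero: "\<Lambda> (\<lambda>_. 0) = 0" using scale[OF C0_real_zero, of 0] by simp
  have zero_below: "(\<lambda>_. 0) \<in> below f" if "f \<in> C0_pos" for f
    using that C0_pos_closed(1) by (simp add: below_def C0_posD)
  have self_below: "f \<in> below f" if "f \<in> C0_pos" for f using that by (simp add: below_def)
  have belowD: "g \<in> C0_pos" "g x \<le> f x" if "g \<in> below f" for f g x using that by (simp_all add: below_def)
  have le: "\<Lambda> g \<le> C * B" if "g \<in> below f" "\<And>x. f x \<le> B" for f g B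
  proof -
    have "\<bar>g x\<bar> \<le> B" for x
      using belowD(2)[OF that(1), of x] that(2)[of x] C0_posD(2)[OF belowD(1)[OF that(1)], of x] by simp
    then have "\<bar>\<Lambda> g\<bar> \<le> C * B" by (intro bound C0_posD(1) belowD(1)[OF that(1)])
    then show ?thesis by simp
  qed
  have bdd: "bdd_above (\<Lambda> ` below f)" if f: "f \<in> C0_pos" for f
  proof -
    obtain B where "\<And>x. \<bar>f x\<bar> \<le> B" using C0_pos_bdd_borel[OF f] unfolding bdd_borel_def by blast
    then have "f x \<le> B" for x by (rule abs_le_D1)
    then show ?thesis by (intro bdd_aboveI2[of _ _ "C * B"] le)
  qed
  have up: "\<Lambda> g \<le> P f" if "f \<in> C0_pos" "g \<in> below f" for f g
    unfolding P_def by (rule cSUP_upper[OF that(2) bdd[OF that(1)]])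
  have least: "P f \<le> b" if "f \<in> C0_pos" "\<And>g. g \<in> below f \<Longrightarrow> \<Lambda> g \<le> b" for f b
  proof -
    have "below f \<noteq> {}" using zero_below[OF that(1)] by blast
    then show ?thesis unfolding P_def using that(2) by (rule cSUP_least)
  qed
  have Pnn: "0 \<le> P f" if "f \<in> C0_pos" for f using up[OF that zero_below[OF that]] zero by simp
  have Padd: "P (\<lambda>x. f x + g x) = P f + P g" if f: "f \<in> C0_pos" and g: "g \<in> C0_pos" for f g
  proof (rule antisym)
    note fg = C0_pos_closed(2)[OF f g]
    show "P (\<lambda>x. f x + g x) \<le> P f + P g"
    proof (rule least[OF fg])
      fix h assume h: "h \<in> below (\<lambda>x. f x + g x)"
      note hp = belowD(1)[OF h]
      have 1: "(\<lambda>x. min (h x) (f x)) \<in> below f" by (simp add: below_def C0_pos_closed(5)[OF hp f])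
      have m: "(\<lambda>x. h x - min (h x) (f x)) \<in> C0_pos"
        by (rule C0_pos_closed(6)[OF C0_pos_closed(5)[OF hp f] hp]) simp
      have "h x - min (h x) (f x) \<le> g x" for x
        using belowD(2)[OF h, of x] C0_posD(2)[OF g, of x] by (simp add: min_def)
      then have 2: "(\<lambda>x. h x - min (h x) (f x)) \<in> below g" by (simp add: below_def m)
      have "\<Lambda> (\<lambda>x. min (h x) (f x) + (h x - min (h x) (f x))) = \<Lambda> (\<lambda>x. min (h x) (f x)) + \<Lambda> (\<lambda>x. h x - min (h x) (f x))"
        by (intro add C0_posD(1) m C0_pos_closed(5)[OF hp f])
      then show "\<Lambda> h \<le> P f + P g" using up[OF f 1] up[OF g 2] by simp
    qed
    have "P f \<le> P (\<lambda>x. f x + g x) - P g"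
    proof (rule least[OF f])
      fix h assume h: "h \<in> below f"
      have "P g \<le> P (\<lambda>x. f x + g x) - \<Lambda> h"
      proof (rule least[OF g])
        fix k assume k: "k \<in> below g"
        have "(\<lambda>x. h x + k x) \<in> below (\<lambda>x. f x + g x)"
          using belowD(2)[OF h] belowD(2)[OF k]
          by (simp add: below_def C0_pos_closed(2)[OF belowD(1)[OF h] belowD(1)[OF k]] add_mono)
        from up[OF fg this] show "\<Lambda> k \<le> P (\<lambda>x. f x + g x) - \<Lambda> h"
          using add[OF C0_posD(1)[OF belowD(1)[OF h]] C0_posD(1)[OF belowD(1)[OF k]]] by simp
      qed
      then show "\<Lambda> h \<le> P (\<lambda>x. f x + g x) - P g" by simp
    qed
    then show "P f + P g \<le> P (\<lambda>x. f x + g x)" by simp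
  qed
  have Pscale_le: "P (\<lambda>x. c * f x) \<le> c * P f" if f: "f \<in> C0_pos" and c: "0 < c" for f c
  proof (rule least[OF C0_pos_closed(3)[OF f less_imp_le[OF c]]])
    fix g assume g: "g \<in> below (\<lambda>x. c * f x)"
    have "(\<lambda>x. (1 / c) * g x) \<in> below f"
      using belowD[OF g] c by (simp add: below_def C0_pos_closed(3)[of g "1 / c", simplified] pos_divide_le_eq mult.commute)
    from up[OF f this] have "(1 / c) * \<Lambda> g \<le> P f" using scale[OF C0_posD(1)[OF belowD(1)[OF g]], of "1 / c"] by simp
    then show "\<Lambda> g \<le> c * P f" using c by (simp add: pos_divide_le_eq mult.commute)
  qed
  have Pscale: "P (\<lambda>x. c * f x) = c * P f" if f: "f \<in> C0_pos" and c: "0 \<le> c" for f c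
  proof (cases "c = 0")
    case True
    have "P (\<lambda>_. 0) \<le> 0"
    proof (rule least[OF C0_pos_closed(1)])
      fix g assume g: "g \<in> below (\<lambda>_. 0)"
      have "g x = 0" for x using belowD(2)[OF g, of x] C0_posD(2)[OF belowD(1)[OF g], of x] by simp
      then have "g = (\<lambda>_. 0)" by (rule ext)
      then show "\<Lambda> g \<le> 0" using zero by simp
    qed
    then show ?thesis using Pnn[OF C0_pos_closed(1)] True by simp
  next
    case False
    then have c: "0 < c" using c by simp
    have "P (\<lambda>x. (1 / c) * (c * f x)) \<le> (1 / c) * P (\<lambda>x. c * f x)"
      using c by (intro Pscale_le C0_pos_closed(3) f) simp_all
    then have "P f \<le> (1 / c) * P (\<lambda>x. c * f x)" using c by simp
    then have "c * P f \<le> P (\<lambda>x. c * f x)" using c by (simp add: pos_le_divide_eq mult.commute)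
    then show ?thesis using Pscale_le[OF f c] by simp
  qed
  have Pb: "P f \<le> C * 1" if "f \<in> C0_pos" "\<And>x. f x \<le> 1" for f
    by (rule least[OF that(1)]) (rule le, assumption, rule that(2))
  obtain \<sigma> where \<sigma>: "\<And>f. f \<in> C0_pos \<Longrightarrow> P f = smeas_integral \<sigma> f"
    using riesz_positive[of P "C * 1", OF Padd Pscale Pnn Pb] by blast
  have "\<exists>\<sigma>. \<forall>f\<in>C0_pos. P f - \<Lambda> f = smeas_integral \<sigma> f"
  proof (rule riesz_positive)
    fix f g c assume f: "f \<in> C0_pos"
    show "0 \<le> P f - \<Lambda> f" using up[OF f self_below[OF f]] by simp
    show "P (\<lambda>x. f x + g x) - \<Lambda> (\<lambda>x. f x + g x) = P f - \<Lambda> f + (P g - \<Lambda> g)" if g: "g \<in> C0_pos"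
      using Padd[OF f g] add[OF C0_posD(1)[OF f] C0_posD(1)[OF g]] by simp
    show "P (\<lambda>x. c * f x) - \<Lambda> (\<lambda>x. c * f x) = c * (P f - \<Lambda> f)" if c: "0 \<le> c"
      using Pscale[OF f c] scale[OF C0_posD(1)[OF f]] by (simp add: right_diff_distrib)
    show "P f - \<Lambda> f \<le> 2 * C" if le1: "\<And>x. f x \<le> 1"
    proof -
      have "\<bar>\<Lambda> f\<bar> \<le> C * 1" by (rule bound[OF C0_posD(1)[OF f]]) (simp add: C0_posD(2)[OF f] le1)
      then show ?thesis using Pb[OF f le1] by linarith
    qed
  qed
  then obtain \<tau> where \<tau>: "\<And>f. f \<in> C0_pos \<Longrightarrow> P f - \<Lambda> f = smeas_integral \<tau> f" by blast
  have pos: "\<Lambda> f = smeas_integral (\<sigma> - \<tau>) f" if f: "f \<in> C0_pos" for f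
    using \<sigma>[OF f] \<tau>[OF f] linear_diff[OF smeas_integral_linear_measure[OF C0_pos_bdd_borel[OF f]], of \<sigma> \<tau>] by simp
  have "\<Lambda> f = smeas_integral (\<sigma> - \<tau>) f" if f: "f \<in> C0_real" for f
  proof -
    let ?p = "\<lambda>x. max (f x) 0" and ?n = "\<lambda>x. max (- 1 * f x) 0"
    have p: "?p \<in> C0_pos" and n: "?n \<in> C0_pos"
      using C0_real_max[OF f C0_real_zero] C0_real_max[OF C0_real_scale[OF f, of "- 1"] C0_real_zero]
      by (simp_all add: C0_pos_def)
    have n': "(\<lambda>x. - 1 * ?n x) \<in> C0_real" by (rule C0_real_scale[OF C0_posD(1)[OF n]])
    have eq: "f = (\<lambda>x. ?p x + (- 1) * ?n x)" by (auto simp: fun_eq_iff max_def)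
    have "\<Lambda> f = \<Lambda> ?p + - 1 * \<Lambda> ?n"
      unfolding eq[THEN arg_cong[where f = \<Lambda>]]
      using add[OF C0_posD(1)[OF p] n'] scale[OF C0_posD(1)[OF n], of "- 1"] by simp
    also have "\<dots> = smeas_integral (\<sigma> - \<tau>) ?p + smeas_integral (\<sigma> - \<tau>) (\<lambda>x. - 1 * ?n x)"
      by (simp only: pos[OF p] pos[OF n] smeas_integral_scale)
    also have "\<dots> = smeas_integral (\<sigma> - \<tau>) f"
      unfolding eq[THEN arg_cong[where f = "smeas_integral (\<sigma> - \<tau>)"]]
      by (rule smeas_integral_add[symmetric]) (intro C0_real_bdd_borel C0_posD(1) p n')+
    finally show ?thesis .
  qed
  then show ?thesis by blast
qed

theorem riesz_vector:
  fixes \<Lambda> :: "(real \<Rightarrow> real ^ 'd) \<Rightarrow> real"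
  assumes add: "\<And>v w. v \<in> C0 \<Longrightarrow> w \<in> C0 \<Longrightarrow> \<Lambda> (\<lambda>x. v x + w x) = \<Lambda> v + \<Lambda> w"
    and scale: "\<And>v c. v \<in> C0 \<Longrightarrow> \<Lambda> (\<lambda>x. c *\<^sub>R v x) = c * \<Lambda> v"
    and bound: "\<And>v B. v \<in> C0 \<Longrightarrow> (\<And>x d. \<bar>v x $ d\<bar> \<le> B) \<Longrightarrow> \<bar>\<Lambda> v\<bar> \<le> C * B"
  shows "\<exists>\<mu>. \<forall>v\<in>C0. \<Lambda> v = meas_pairing \<mu> v"
proof -
  define ins where "ins d f = (\<lambda>x. axis d (f x) :: real ^ 'd)" for d and f :: "real \<Rightarrow> real"
  have comp: "ins d f x $ e = (if e = d then f x else 0)" for d f x e by (simp add: ins_def axis_def)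
  have ins: "ins d f \<in> C0" if "f \<in> C0_real" for d f
    unfolding C0_iff_components
  proof
    fix e show "(\<lambda>x. ins d f x $ e) \<in> C0_real" using that by (cases "e = d") (simp_all add: comp C0_real_zero)
  qed
  have "\<exists>\<sigma>. \<forall>f\<in>C0_real. \<Lambda> (ins d f) = smeas_integral \<sigma> f" for d
  proof (rule riesz_real)
    fix f g :: "real \<Rightarrow> real" and c B assume f: "f \<in> C0_real"
    show "\<Lambda> (ins d (\<lambda>x. f x + g x)) = \<Lambda> (ins d f) + \<Lambda> (ins d g)" if g: "g \<in> C0_real"
    proof -
      have "ins d (\<lambda>x. f x + g x) = (\<lambda>x. ins d f x + ins d g x)" by (simp add: fun_eq_iff vec_eq_iff comp)
      then show ?thesis using add[OF ins[OF f] ins[OF g]] by simp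
    qed
    show "\<Lambda> (ins d (\<lambda>x. c * f x)) = c * \<Lambda> (ins d f)"
    proof -
      have "ins d (\<lambda>x. c * f x) = (\<lambda>x. c *\<^sub>R ins d f x)" by (simp add: fun_eq_iff vec_eq_iff comp)
      then show ?thesis using scale[OF ins[OF f]] by simp
    qed
    show "\<bar>\<Lambda> (ins d f)\<bar> \<le> C * B" if B: "\<And>x. \<bar>f x\<bar> \<le> B"
    proof (rule bound[OF ins[OF f]])
      show "\<bar>ins d f x $ e\<bar> \<le> B" for x e using B[of x] order_trans[OF abs_ge_zero B[of x]] by (simp add: comp)
    qed
  qed
  then have "\<forall>d. \<exists>\<sigma>. \<forall>f\<in>C0_real. \<Lambda> (ins d f) = smeas_integral \<sigma> f" by (rule allI)
  from choice[OF this] obtain \<sigma> where \<sigma>: "\<And>d f. f \<in> C0_real \<Longrightarrow> \<Lambda> (ins d f) = smeas_integral (\<sigma> d) f" by blast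
  have zero: "\<Lambda> (\<lambda>_. 0) = 0" using scale[OF C0_zero, of 0] by simp
  have sum: "(\<lambda>x. \<Sum>d\<in>I. f d x) \<in> C0 \<and> \<Lambda> (\<lambda>x. \<Sum>d\<in>I. f d x) = (\<Sum>d\<in>I. \<Lambda> (f d))"
    if "finite I" "\<And>d. f d \<in> C0" for I :: "'d set" and f
    using that(1)
  proof (induction I rule: finite_induct)
    case (insert d I)
    then show ?case using add[OF that(2)[of d], of "\<lambda>x. \<Sum>d\<in>I. f d x"] C0_add[OF that(2)[of d]] by simp
  qed (simp add: zero C0_zero)
  have "\<Lambda> v = meas_pairing (\<chi> d. \<sigma> d) v" if v: "v \<in> C0" for v
  proof -
    let ?f = "\<lambda>d. ins d (\<lambda>x. v x $ d)"
    have f: "?f d \<in> C0" for d by (intro ins C0_component v)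
    have "v = (\<lambda>x. \<Sum>d\<in>UNIV. ?f d x)" by (simp add: fun_eq_iff vec_eq_iff comp)
    then have "\<Lambda> v = \<Lambda> (\<lambda>x. \<Sum>d\<in>UNIV. ?f d x)" by simp
    also have "\<dots> = (\<Sum>d\<in>UNIV. \<Lambda> (?f d))" using sum[of UNIV ?f, OF finite_class.finite_UNIV f] by blast
    also have "\<dots> = meas_pairing (\<chi> d. \<sigma> d) v" by (simp add: \<sigma>[OF C0_component[OF v]] meas_pairing_def)
    finally show ?thesis .
  qed
  then show ?thesis by blast
qed

section \<open>Test functions separate measures\<close>

text \<open>Smoothness is shown by membership in a set of functions that is closed under
  differentiation, which avoids formulas for higher derivatives.\<close>

lemma smooth_fun_from_closed_set:
  assumes S: "\<And>g. g \<in> S \<Longrightarrow> \<exists>g'\<in>S. \<forall>x. (g has_field_derivative g' x) (at x)" and f: "f \<in> S"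
  shows "smooth_fun f"
proof -
  have D: "deriv g \<in> S \<and> (\<forall>x. g field_differentiable at x)" if g: "g \<in> S" for g
  proof -
    obtain g' where g': "g' \<in> S" "\<And>x. (g has_field_derivative g' x) (at x)" using S[OF g] by blast
    have "deriv g = g'" by (rule ext) (rule DERIV_imp_deriv[OF g'(2)])
    then show ?thesis using g' field_differentiable_def by blast
  qed
  have "(deriv ^^ k) f \<in> S" for k by (induction k) (simp_all add: f D)
  then show ?thesis unfolding smooth_fun_def using D by blast
qed

lemma smooth_fun_deriv: "smooth_fun f \<Longrightarrow> smooth_fun (deriv f)"
  unfolding smooth_fun_def by (metis funpow_simps_right(2) o_apply)

lemma smooth_fun_has_deriv: "smooth_fun f \<Longrightarrow> (f has_field_derivative deriv f x) (at x)"
  using smooth_fun_DERIV[of f 0 x] by simp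

lemma smooth_fun_mult:
  assumes "smooth_fun f" "smooth_fun g"
  shows "smooth_fun (\<lambda>x. f x * g x)"
proof -
  let ?S = "{\<lambda>x. \<Sum>(u, v)\<leftarrow>ps. u x * v x | ps. \<forall>(u, v)\<in>set ps. smooth_fun u \<and> smooth_fun v}"
  have *: "\<exists>qs. (\<forall>(u, v)\<in>set qs. smooth_fun u \<and> smooth_fun v) \<and>
      (\<forall>x. ((\<lambda>x. \<Sum>(u, v)\<leftarrow>ps. u x * v x) has_field_derivative (\<Sum>(u, v)\<leftarrow>qs. u x * v x)) (at x))"
    if "\<forall>(u, v)\<in>set ps. smooth_fun u \<and> smooth_fun v" for ps :: "((real \<Rightarrow> real) \<times> (real \<Rightarrow> real)) list"
    using that
  proof (induction ps)
    case Nil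
    show ?case by (intro exI[of _ "[]"]) simp
  next
    case (Cons p ps)
    obtain u v where p: "p = (u, v)" by (cases p)
    have uv: "smooth_fun u" "smooth_fun v" using Cons.prems p by simp_all
    obtain qs where qs: "\<forall>(u, v)\<in>set qs. smooth_fun u \<and> smooth_fun v"
      "\<And>x. ((\<lambda>x. \<Sum>(u, v)\<leftarrow>ps. u x * v x) has_field_derivative (\<Sum>(u, v)\<leftarrow>qs. u x * v x)) (at x)"
      using Cons.IH Cons.prems by (meson list.set_intros(2))
    have "((\<lambda>x. u x * v x + (\<Sum>(u, v)\<leftarrow>ps. u x * v x)) has_field_derivative
        (deriv u x * v x + deriv v x * u x) + (\<Sum>(u, v)\<leftarrow>qs. u x * v x)) (at x)" for x
      by (intro DERIV_add DERIV_mult smooth_fun_has_deriv uv qs(2))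
    then show ?case
      using qs(1) uv smooth_fun_deriv p
      by (intro exI[of _ "(deriv u, v) # (deriv v, u) # qs"]) (simp add: add.assoc)
  qed
  show ?thesis
  proof (rule smooth_fun_from_closed_set[of ?S])
    have "(\<lambda>x. f x * g x) = (\<lambda>x. \<Sum>(u, v)\<leftarrow>[(f, g)]. u x * v x)" by simp
    moreover have "\<forall>(u, v)\<in>set [(f, g)]. smooth_fun u \<and> smooth_fun v" using assms by simp
    ultimately show "(\<lambda>x. f x * g x) \<in> ?S" by blast
  next
    fix h assume "h \<in> ?S"
    then obtain ps where h: "h = (\<lambda>x. \<Sum>(u, v)\<leftarrow>ps. u x * v x)" and ps: "\<forall>(u, v)\<in>set ps. smooth_fun u \<and> smooth_fun v"
      by blast
    from *[OF ps] obtain qs where qs: "\<forall>(u, v)\<in>set qs. smooth_fun u \<and> smooth_fun v"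
      "\<And>x. (h has_field_derivative (\<Sum>(u, v)\<leftarrow>qs. u x * v x)) (at x)" unfolding h by blast
    have "(\<lambda>x. \<Sum>(u, v)\<leftarrow>qs. u x * v x) \<in> ?S" using qs(1) by blast
    then show "\<exists>g'\<in>?S. \<forall>x. (h has_field_derivative g' x) (at x)" using qs(2) by (intro bexI) simp_all
  qed
qed

lemma smooth_fun_affine:
  assumes "smooth_fun f"
  shows "smooth_fun (\<lambda>x. f (c * x + h))"
proof (rule smooth_fun_from_closed_set[of "{\<lambda>x. k * g (c * x + h) | k g. smooth_fun g}"])
  have "(\<lambda>x. f (c * x + h)) = (\<lambda>x. 1 * f (c * x + h))" by simp
  then show "(\<lambda>x. f (c * x + h)) \<in> {\<lambda>x. k * g (c * x + h) | k g. smooth_fun g}" using assms by blast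
next
  fix u assume "u \<in> {\<lambda>x. k * g (c * x + h) | k g. smooth_fun g}"
  then obtain k g where u: "u = (\<lambda>x. k * g (c * x + h))" and g: "smooth_fun g" by blast
  have "(u has_field_derivative (k * c) * deriv g (c * x + h)) (at x)" for x
  proof -
    have "((\<lambda>x. g (c * x + h)) has_field_derivative deriv g (c * x + h) * c) (at x)"
      by (rule DERIV_chain2[OF smooth_fun_has_deriv[OF g]]) (auto intro!: derivative_eq_intros)
    from DERIV_cmult[OF this, of k] show ?thesis unfolding u by (simp add: mult_ac)
  qed
  moreover have "(\<lambda>x. (k * c) * deriv g (c * x + h)) \<in> {\<lambda>x. k * g (c * x + h) | k g. smooth_fun g}"
    using smooth_fun_deriv[OF g] by blast
  ultimately show "\<exists>g'\<in>{\<lambda>x. k * g (c * x + h) | k g. smooth_fun g}. \<forall>x. (u has_field_derivative g' x) (at x)"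
    by (intro bexI) simp_all
qed

definition exp_inv :: "real poly \<Rightarrow> real \<Rightarrow> real" where
  "exp_inv q t = (if 0 < t then poly q (1 / t) * exp (- (1 / t)) else 0)"

lemma poly_exp_decay: "((\<lambda>s. poly q s * exp (- s)) \<longlongrightarrow> 0) (at_top :: real filter)"
proof -
  have "((\<lambda>s. \<Sum>i\<le>degree q. coeff q i * (s ^ i / exp s)) \<longlongrightarrow> (\<Sum>i\<le>degree q. coeff q i * 0)) (at_top :: real filter)"
    by (intro tendsto_sum tendsto_mult tendsto_const tendsto_power_div_exp_0)
  then show ?thesis by (simp add: poly_altdef exp_minus divide_inverse sum_distrib_right mult.assoc)
qed

text \<open>At 0 the exponential decay beats every polynomial in \<open>1 / t\<close>. So these functions are closed
  under differentiation, which makes them smooth.\<close>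

lemma exp_inv_deriv:
  "(exp_inv q has_field_derivative exp_inv ([:0, 0, 1:] * (q - pderiv q)) t) (at t)"
proof (cases t "0 :: real" rule: linorder_cases)
  case less
  then have "\<forall>\<^sub>F s in nhds t. exp_inv q s = 0"
    by (intro eventually_nhds_in_open[of "{..<0}", THEN eventually_mono]) (auto simp: exp_inv_def)
  then have "(exp_inv q has_field_derivative 0) (at t) \<longleftrightarrow> ((\<lambda>_. 0) has_field_derivative (0::real)) (at t)"
    by (intro DERIV_cong_ev) simp_all
  then show ?thesis using less by (simp add: exp_inv_def)
next
  case greater
  have "\<forall>\<^sub>F s in nhds t. exp_inv q s = poly q (1 / s) * exp (- (1 / s))"
    using greater by (intro eventually_nhds_in_open[of "{0<..}", THEN eventually_mono]) (auto simp: exp_inv_def)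
  moreover have "((\<lambda>s. poly q (1 / s) * exp (- (1 / s))) has_field_derivative
      exp_inv ([:0, 0, 1:] * (q - pderiv q)) t) (at t)"
    using greater
    by (auto intro!: derivative_eq_intros poly_DERIV[THEN DERIV_chain2] simp: exp_inv_def field_simps power2_eq_square)
  ultimately show ?thesis
    using DERIV_cong_ev[OF refl, of "exp_inv q" "\<lambda>s. poly q (1 / s) * exp (- (1 / s))" t] by blast
next
  case equal
  have r: "((\<lambda>s. exp_inv q s / s) \<longlongrightarrow> 0) (at_right 0)"
  proof -
    have "((\<lambda>s. poly ([:0, 1:] * q) (inverse s) * exp (- inverse s)) \<longlongrightarrow> 0) (at_right (0::real))"
      by (rule filterlim_compose[OF poly_exp_decay filterlim_inverse_at_top_right])
    moreover have "\<forall>\<^sub>F s in at_right (0::real). poly ([:0, 1:] * q) (inverse s) * exp (- inverse s) = exp_inv q s / s"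
      by (rule eventually_at_right_less[THEN eventually_mono]) (simp add: exp_inv_def divide_inverse)
    ultimately show ?thesis by (rule Lim_transform_eventually)
  qed
  have l: "((\<lambda>s. exp_inv q s / s) \<longlongrightarrow> 0) (at_left 0)"
  proof (rule tendsto_eventually)
    show "\<forall>\<^sub>F s in at_left 0. exp_inv q s / s = 0"
      unfolding eventually_at_filter by (simp add: exp_inv_def)
  qed
  have "((\<lambda>s. exp_inv q s / s) \<longlongrightarrow> 0) (at 0)" using filterlim_split_at[OF l r] .
  then show ?thesis using equal by (simp add: has_field_derivative_iff exp_inv_def)
qed

lemma smooth_exp_inv: "smooth_fun (exp_inv q)"
  by (rule smooth_fun_from_closed_set[of "range exp_inv"]) (use exp_inv_deriv in blast)+

text \<open>For \<open>n \<rightarrow> \<infinity>\<close> this tends boundedly to the indicator of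
  \<open>{a<..<b}\<close>.\<close>

definition plateau_fun :: "real \<Rightarrow> real \<Rightarrow> real \<Rightarrow> real \<Rightarrow> real" where
  "plateau_fun n a b x = exp_inv 1 (n * x + - n * a) * exp_inv 1 (- n * x + n * b)"

lift_definition plateau :: "real \<Rightarrow> real \<Rightarrow> real \<Rightarrow> test" is
  "\<lambda>n a b. if 0 < n then plateau_fun n a b else (\<lambda>_. 0)"
proof -
  fix n a b :: real
  show "smooth_fun (if 0 < n then plateau_fun n a b else (\<lambda>_. 0)) \<and>
      compact (support (if 0 < n then plateau_fun n a b else (\<lambda>_. 0)))"
  proof (cases "0 < n")
    case False
    then show ?thesis using smooth_compact_zero by simp
  next
    case True
    have "smooth_fun (plateau_fun n a b)"
      unfolding plateau_fun_def by (intro smooth_fun_mult smooth_fun_affine smooth_exp_inv)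
    moreover have "support (plateau_fun n a b) \<subseteq> {a..b}"
      unfolding support_def
    proof (rule closure_minimal)
      show "{x. plateau_fun n a b x \<noteq> 0} \<subseteq> {a..b}"
      proof
        fix x assume "x \<in> {x. plateau_fun n a b x \<noteq> 0}"
        then have "0 < n * x + - n * a" "0 < - n * x + n * b"
          unfolding plateau_fun_def exp_inv_def by (auto split: if_splits)
        then have "0 < n * (x - a)" "0 < n * (b - x)" by (simp_all add: algebra_simps)
        then show "x \<in> {a..b}" using True by (simp add: zero_less_mult_iff)
      qed
    qed simp
    ultimately show ?thesis using True compact_support_mono[of "{a..b}"] by simp
  qed
qed

lemma plateau_apply:
  assumes "0 < n"
  shows "tapply (plateau n a b) x = (if a < x \<and> x < b then exp (- (1 / (n * (x - a)))) * exp (- (1 / (n * (b - x)))) else 0)"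
proof -
  have "n * x + - n * a = n * (x - a)" "- n * x + n * b = n * (b - x)" by (simp_all add: algebra_simps)
  then show ?thesis using assms
    by (simp add: plateau.rep_eq plateau_fun_def exp_inv_def zero_less_mult_iff)
qed

lemma plateau_tendsto: "(\<lambda>n. tapply (plateau (real (Suc n)) a (a + real (Suc n))) x) \<longlonglongrightarrow> indicator {a<..} x"
proof (cases "a < x")
  case False
  then show ?thesis by (simp add: plateau_apply)
next
  case True
  have ev: "\<forall>\<^sub>F n in sequentially. x - a + 1 < real (Suc n)"
    using filterlim_real_sequentially[THEN filterlim_at_top_dense[THEN iffD1], rule_format, of "x - a + 1"]
    by (rule eventually_mono) simp
  have lim: "(\<lambda>n. 1 / (real (Suc n) * c)) \<longlonglongrightarrow> 0" if "0 < c" for c :: real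
    using tendsto_mult_right[OF LIMSEQ_inverse_real_of_nat, of "1 / c"] by (simp add: divide_inverse)
  have sq: "(\<lambda>n. 1 / (real (Suc n) * (a + real (Suc n) - x))) \<longlonglongrightarrow> 0"
  proof (rule tendsto_sandwich[OF _ _ tendsto_const lim[of 1]])
    show "\<forall>\<^sub>F n in sequentially. 0 \<le> 1 / (real (Suc n) * (a + real (Suc n) - x))"
      using ev by (rule eventually_mono) simp
    show "\<forall>\<^sub>F n in sequentially. 1 / (real (Suc n) * (a + real (Suc n) - x)) \<le> 1 / (real (Suc n) * 1)"
      using ev by (rule eventually_mono) (intro divide_left_mono mult_left_mono, simp_all)
  qed simp
  have "(\<lambda>n. exp (- (1 / (real (Suc n) * (x - a)))) * exp (- (1 / (real (Suc n) * (a + real (Suc n) - x))))) \<longlonglongrightarrow> exp (- 0) * exp (- 0)"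
    using True by (intro tendsto_mult tendsto_exp tendsto_minus lim sq) simp
  moreover have "\<forall>\<^sub>F n in sequentially. exp (- (1 / (real (Suc n) * (x - a)))) * exp (- (1 / (real (Suc n) * (a + real (Suc n) - x))))
      = tapply (plateau (real (Suc n)) a (a + real (Suc n))) x"
    using ev by (rule eventually_mono) (use True in \<open>simp add: plateau_apply\<close>)
  ultimately have "(\<lambda>n. tapply (plateau (real (Suc n)) a (a + real (Suc n))) x) \<longlonglongrightarrow> exp (- 0) * exp (- 0)"
    by (rule Lim_transform_eventually)
  then show ?thesis using True by simp
qed

lemma plateau_bound: "norm (tapply (plateau (real (Suc n)) a b) x) \<le> 1"
proof -
  have "exp (- (1 / (real (Suc n) * (x - a)))) * exp (- (1 / (real (Suc n) * (b - x)))) \<le> 1 * 1" if "a < x" "x < b"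
    by (intro mult_mono) (use that in simp_all)
  then show ?thesis by (simp add: plateau_apply abs_mult del: of_nat_Suc)
qed

text \<open>Indicators of the half-lines \<open>{a<..}\<close>, which generate the Borel sets, are
  bounded limits of test functions.\<close>

lemma measure_eq_from_tests:
  assumes M: "finite_measure M" "sets M = sets borel" and N: "finite_measure N" "sets N = sets borel"
    and eq: "\<And>\<phi>. (LINT x|M. tapply \<phi> x) = (LINT x|N. tapply \<phi> x)"
  shows "M = N"
proof -
  have lim: "(\<lambda>n. LINT x|M. tapply (plateau (real (Suc n)) a (a + real (Suc n))) x) \<longlonglongrightarrow> measure M {a<..}"
    if "finite_measure M" "sets M = sets borel" for M and a :: real
  proof -
    interpret finite_measure M by fact
    have "(\<lambda>n. LINT x|M. tapply (plateau (real (Suc n)) a (a + real (Suc n))) x) \<longlonglongrightarrow> (LINT x|M. indicator {a<..} x)"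
    proof (rule integral_dominated_convergence[where w = "\<lambda>_. 1"])
      show "indicator {a<..} \<in> borel_measurable M" using that(2) by simp
      show "tapply \<phi> \<in> borel_measurable M" for \<phi> using that(2) by (simp cong: measurable_cong_sets)
      show "integrable M (\<lambda>_. 1 :: real)" by simp
      show "AE x in M. (\<lambda>n. tapply (plateau (real (Suc n)) a (a + real (Suc n))) x) \<longlonglongrightarrow> indicator {a<..} x"
        by (rule AE_I2) (rule plateau_tendsto)
      show "AE x in M. norm (tapply (plateau (real (Suc n)) a (a + real (Suc n))) x) \<le> 1" for n
        by (rule AE_I2) (rule plateau_bound)
    qed
    then show ?thesis using that(2) by simp
  qed
  have "measure M {a<..} = measure N {a<..}" for a
    using lim[OF M, of a] lim[OF N, of a] unfolding eq by (rule LIMSEQ_unique)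
  then have "emeasure M {a<..} = emeasure N {a<..}" for a
    using finite_measure.emeasure_eq_measure[OF M(1)] finite_measure.emeasure_eq_measure[OF N(1)] by simp
  moreover have "emeasure M {a<..} < \<infinity>" for a
    using finite_measure.emeasure_finite[OF M(1)] by (simp add: less_top)
  ultimately show ?thesis using M(2) N(2) by (intro measure_eqI_lessThan) simp_all
qed

lemma meas_distr_apply: "dapply (meas_distr \<sigma>) \<phi> = smeas_integral \<sigma> (tapply \<phi>)"
  by (simp add: meas_distr.rep_eq)

lemma distr_eqI: "(\<And>\<phi>. dapply S \<phi> = dapply T \<phi>) \<Longrightarrow> S = T"
  by (metis dapply_inject ext)

lemma meas_distr_linear: "linear meas_distr"
  by (rule linearI; rule distr_eqI)
    (simp_all add: meas_distr_apply plus_distr.rep_eq scaleR_distr.rep_eq bdd_borel_test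
      smeas_integral_add_measure smeas_integral_scale_measure)

lemma meas_distr_eq_0: "meas_distr \<sigma> = 0 \<Longrightarrow> \<sigma> = 0"
proof -
  assume *: "meas_distr \<sigma> = 0"
  have "(LINT x|ppart \<sigma>. tapply \<phi> x) = (LINT x|npart \<sigma>. tapply \<phi> x)" for \<phi>
  proof -
    have "dapply (meas_distr \<sigma>) \<phi> = 0" by (simp add: * zero_distr.rep_eq)
    then show ?thesis by (simp add: meas_distr_apply smeas_integral_parts)
  qed
  then have "ppart \<sigma> = npart \<sigma>" by (intro measure_eq_from_tests) (simp_all add: pos_part_finite)
  then show ?thesis by (intro smeasure_eqI) (simp add: jordan(1) zero_smeasure.rep_eq)
qed

lemma mvec_linear: "linear mvec"
  by (rule linearI) (simp_all add: mvec_def vec_eq_iff linear_add[OF meas_distr_linear] linear_scale[OF meas_distr_linear])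

lemma mvec_inj: "inj mvec"
  unfolding linear_injective_0[OF mvec_linear]
  by (simp add: mvec_def vec_eq_iff meas_distr_eq_0)

lemma meas_of_mvec [simp]: "meas_of (mvec \<mu>) = \<mu>"
  unfolding meas_of_def by (rule the_equality) (simp_all add: inj_eq[OF mvec_inj])

lemma meas_distr_dirac: "meas_distr (sdirac x) = dirac x"
  by (rule distr_eqI) (simp add: meas_distr_apply smeas_integral_dirac bdd_borel_test dirac.rep_eq)

section \<open>Distributions and differential operators\<close>

lemma dapply_linear: "linear (dapply T)"
  using dapply[of T] by simp

lemma dapply_null: "test_null \<phi> \<Longrightarrow> (\<lambda>n. dapply T (\<phi> n)) \<longlonglongrightarrow> 0"
  using dapply[of T] by simp

lemma test_eqI: "(\<And>T. dapply T \<phi> = dapply T \<psi>) \<Longrightarrow> \<phi> = \<psi>"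
  by (metis dirac.rep_eq ext tapply_inject)

lemmas dapply_simps = zero_distr.rep_eq plus_distr.rep_eq minus_distr.rep_eq uminus_distr.rep_eq
  scaleR_distr.rep_eq

lemmas tapply_simps = zero_test.rep_eq plus_test.rep_eq minus_test.rep_eq uminus_test.rep_eq
  scaleR_test.rep_eq

lemma dapply_sum: "dapply (\<Sum>i\<in>I. T i) \<phi> = (\<Sum>i\<in>I. dapply (T i) \<phi>)"
  by (induction I rule: infinite_finite_induct) (simp_all add: dapply_simps)

lemma tapply_sum: "tapply (\<Sum>i\<in>I. \<phi> i) x = (\<Sum>i\<in>I. tapply (\<phi> i) x)"
  by (induction I rule: infinite_finite_induct) (simp_all add: tapply_simps)

lemma support_subset:
  assumes "closed K" "\<And>x. x \<notin> K \<Longrightarrow> f x = 0"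
  shows "support f \<subseteq> K"
  unfolding support_def by (rule closure_minimal) (use assms in auto)

lemma test_support_bounded: "\<exists>r>0. \<forall>x. r \<le> \<bar>x\<bar> \<longrightarrow> x \<notin> support (tapply \<phi>)"
proof -
  obtain r where r: "\<And>x. x \<in> support (tapply \<phi>) \<Longrightarrow> \<bar>x\<bar> \<le> r"
    using compact_imp_bounded[OF test_compact[of \<phi>]] unfolding bounded_iff real_norm_def by blast
  show ?thesis
  proof (intro exI[of _ "max r 0 + 1"] conjI allI impI notI)
    fix x assume "max r 0 + 1 \<le> \<bar>x\<bar>" "x \<in> support (tapply \<phi>)"
    then show False using r[of x] by simp
  qed simp
qed

text \<open>The transpose of \<open>p(D)\<close> on test functions.\<close>

definition tad :: "real poly \<Rightarrow> test \<Rightarrow> test" where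
  "tad p \<phi> = (\<Sum>n\<le>degree p. coeff p n *\<^sub>R ((\<lambda>\<phi>. - tdiff \<phi>) ^^ n) \<phi>)"

lemma dapply_ddiff_funpow: "dapply ((ddiff ^^ n) T) \<phi> = dapply T (((\<lambda>\<phi>. - tdiff \<phi>) ^^ n) \<phi>)"
proof (induction n arbitrary: \<phi>)
  case (Suc n)
  have "dapply ((ddiff ^^ Suc n) T) \<phi> = dapply ((ddiff ^^ n) T) (- tdiff \<phi>)"
    by (simp add: ddiff.rep_eq linear_neg[OF dapply_linear])
  also have "\<dots> = dapply T (((\<lambda>\<phi>. - tdiff \<phi>) ^^ Suc n) \<phi>)"
    unfolding Suc.IH funpow_Suc_right o_apply ..
  finally show ?case .
qed simp

lemma dapply_odo: "dapply (odo p T) \<phi> = dapply T (tad p \<phi>)"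
  by (simp add: odo_def tad_def dapply_sum dapply_simps dapply_ddiff_funpow
      linear_sum[OF dapply_linear] linear_scale[OF dapply_linear])

lemma odo_linear: "linear (odo p)"
  by (rule linearI; rule distr_eqI) (simp_all add: dapply_odo dapply_simps)

lemma tad_mult: "tad (p * q) \<phi> = tad p (tad q \<phi>)"
  by (rule test_eqI) (simp add: dapply_odo[symmetric] odo_mult[symmetric] mult.commute)

lemma tad_sum: "tad (\<Sum>i\<in>I. p i) \<phi> = (\<Sum>i\<in>I. tad (p i) \<phi>)"
proof (rule test_eqI)
  fix T
  have "odo (\<Sum>i\<in>I. p i) T = (\<Sum>i\<in>I. odo (p i) T)"
    by (induction I rule: infinite_finite_induct) (simp_all add: odo_add odo_def[of 0])
  then show "dapply T (tad (\<Sum>i\<in>I. p i) \<phi>) = dapply T (\<Sum>i\<in>I. tad (p i) \<phi>)"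
    by (simp add: dapply_odo[symmetric] dapply_sum linear_sum[OF dapply_linear])
qed

lemma tdiff_tshift: "tdiff (tshift h \<phi>) = tshift h (tdiff \<phi>)"
  by (rule tapply_inject[THEN iffD1])
    (use smooth_fun_shift(1)[OF test_smooth, of 1 \<phi> h] in \<open>simp add: tdiff.rep_eq tshift.rep_eq\<close>)

lemma tshift_tshift: "tshift h (tshift k \<phi>) = tshift (h + k) \<phi>"
  by (rule tapply_inject[THEN iffD1]) (simp add: tshift.rep_eq fun_eq_iff add.assoc)

lemma tshift_0 [simp]: "tshift 0 \<phi> = \<phi>"
  by (rule tapply_inject[THEN iffD1]) (simp add: tshift.rep_eq fun_eq_iff)

lemma tad_tshift: "tad p (tshift h \<phi>) = tshift h (tad p \<phi>)"
proof -
  have "((\<lambda>\<phi>. - tdiff \<phi>) ^^ n) (tshift h \<phi>) = tshift h (((\<lambda>\<phi>. - tdiff \<phi>) ^^ n) \<phi>)" for n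
    by (induction n) (simp_all add: tdiff_tshift linear_neg[OF tshift_linear])
  then show ?thesis by (simp add: tad_def linear_sum[OF tshift_linear] linear_scale[OF tshift_linear])
qed

lemma odo_dshift: "odo p (dshift h T) = dshift h (odo p T)"
  by (rule distr_eqI) (simp add: dapply_odo dshift.rep_eq tad_tshift)

lemma dshift_linear: "linear (dshift h)"
  by (rule linearI; rule distr_eqI) (simp_all add: dshift.rep_eq dapply_simps)

lemma tdiff_funpow_apply: "tapply ((tdiff ^^ n) \<phi>) = (deriv ^^ n) (tapply \<phi>)"
  by (induction n) (simp_all add: tdiff.rep_eq)

lemma tdiff_funpow_linear: "linear (tdiff ^^ n)"
proof (induction n)
  case 0
  show ?case by (simp add: linear_iff)
next
  case (Suc n)
  then show ?case using linear_compose[OF Suc.IH tdiff_linear] by (simp add: o_def)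
qed

lemma tneg_funpow: "((\<lambda>\<phi>. - tdiff \<phi>) ^^ n) \<phi> = (- 1) ^ n *\<^sub>R (tdiff ^^ n) \<phi>"
  by (induction n) (simp_all add: linear_scale[OF tdiff_linear])

lemma support_tdiff_funpow: "support (tapply ((tdiff ^^ n) \<phi>)) \<subseteq> support (tapply \<phi>)"
proof (induction n)
  case (Suc n)
  then show ?case using support_deriv[of "tapply ((tdiff ^^ n) \<phi>)"] by (simp add: tdiff.rep_eq)
qed simp

lemma closed_support: "closed (support f)"
  by (simp add: support_def)

lemma support_tad: "support (tapply (tad p \<phi>)) \<subseteq> support (tapply \<phi>)"
proof (rule support_subset[OF closed_support])
  fix x assume x: "x \<notin> support (tapply \<phi>)"
  have "tapply ((tdiff ^^ n) \<phi>) x = 0" for n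
    using x support_tdiff_funpow[of n \<phi>] by (intro test_outside) blast
  then show "tapply (tad p \<phi>) x = 0" by (simp add: tad_def tapply_sum tapply_simps tneg_funpow)
qed

lemma supported_in_odo: "supported_in T A \<Longrightarrow> supported_in (odo p T) A"
  unfolding supported_in_def dapply_odo using support_tad by blast

lemma support_tshift: "support (tapply (tshift h \<phi>)) = (\<lambda>x. x - h) ` support (tapply \<phi>)"
  by (simp add: tshift.rep_eq support_shift)

subsection \<open>Regularisation\<close>

text \<open>The difference quotients of a test function converge to its derivative in the space of test
  functions; hence applying a distribution to the translates of a test function gives a smooth
  function.\<close>

lemma difference_quotient_null:
  assumes h: "\<And>n. h n \<noteq> 0" "h \<longlonglongrightarrow> 0"
  shows "test_null (\<lambda>n. (1 / h n) *\<^sub>R (tshift (h n) \<phi> - \<phi>) - tdiff \<phi>)"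
  unfolding test_null_def
proof (intro conjI allI)
  let ?q = "\<lambda>\<xi> n. (1 / h n) *\<^sub>R (tshift (h n) \<xi> - \<xi>) - tdiff \<xi>"
  obtain r where r: "\<And>x. r \<le> \<bar>x\<bar> \<Longrightarrow> x \<notin> support (tapply \<phi>)" using test_support_bounded by blast
  obtain H where H: "\<And>n. \<bar>h n\<bar> \<le> H"
    using convergent_imp_Bseq[OF convergentI[OF h(2)]] unfolding Bseq_def by auto
  have H0: "0 \<le> H" using H[of 0] by simp
  show "\<exists>K. compact K \<and> (\<forall>n. support (tapply (?q \<phi> n)) \<subseteq> K)"
  proof (intro exI[of _ "{- (r + H)..r + H}"] conjI allI)
    fix n
    show "support (tapply (?q \<phi> n)) \<subseteq> {- (r + H)..r + H}"
    proof (rule support_subset)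
      fix x assume "x \<notin> {- (r + H)..r + H}"
      then have "r \<le> \<bar>x\<bar>" "r \<le> \<bar>x + h n\<bar>" using H[of n] H0 by auto
      then have "x \<notin> support (tapply \<phi>)" "x + h n \<notin> support (tapply \<phi>)" using r by blast+
      moreover from this have "x \<notin> support (tapply (tdiff \<phi>))"
        using support_deriv[of "tapply \<phi>"] by (auto simp: tdiff.rep_eq)
      ultimately show "tapply (?q \<phi> n) x = 0"
        by (simp add: tapply_simps tshift.rep_eq test_outside)
    qed simp
  qed simp
  fix k
  define \<xi>' where "\<xi>' = (tdiff ^^ k) \<phi>"
  have funpow: "(tdiff ^^ k) (tshift c \<phi>) = tshift c ((tdiff ^^ k) \<phi>)" for c
    by (induction k) (simp_all add: tdiff_tshift)
  have "(tdiff ^^ k) (tdiff \<phi>) = tdiff ((tdiff ^^ k) \<phi>)" by (rule funpow_swap1[symmetric])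
  then have eq: "(deriv ^^ k) (tapply (?q \<phi> n)) = tapply (?q \<xi>' n)" for n
    unfolding tdiff_funpow_apply[symmetric] \<xi>'_def
    by (simp add: linear_diff[OF tdiff_funpow_linear] linear_scale[OF tdiff_funpow_linear] funpow)
  obtain B where B: "\<And>x. \<bar>tapply (tdiff (tdiff \<xi>')) x\<bar> \<le> B" using test_bounded by blast
  have D: "(tapply \<psi> has_field_derivative tapply (tdiff \<psi>) x) (at x)" for \<psi> x
    using smooth_fun_has_deriv[OF test_smooth] by (simp add: tdiff.rep_eq)
  have est: "\<bar>tapply (?q \<xi>' n) x\<bar> \<le> B * \<bar>h n\<bar>" for n x
  proof -
    have lip: "\<bar>tapply (tdiff \<xi>') y - tapply (tdiff \<xi>') x\<bar> \<le> B * \<bar>y - x\<bar>" for y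
      using field_differentiable_bound[of UNIV "tapply (tdiff \<xi>')" "tapply (tdiff (tdiff \<xi>'))" B y x] D B
      by simp
    have B0: "0 \<le> B" using B[of 0] by simp
    have "\<bar>(tapply \<xi>' (x + h n) - tapply (tdiff \<xi>') x * (x + h n)) - (tapply \<xi>' x - tapply (tdiff \<xi>') x * x)\<bar>
        \<le> (B * \<bar>h n\<bar>) * \<bar>(x + h n) - x\<bar>"
    proof (rule field_differentiable_bound[of "cball x \<bar>h n\<bar>", unfolded real_norm_def])
      fix y assume "y \<in> cball x \<bar>h n\<bar>"
      then have "\<bar>y - x\<bar> \<le> \<bar>h n\<bar>" by (simp add: dist_real_def abs_minus_commute)
      then show "\<bar>tapply (tdiff \<xi>') y - tapply (tdiff \<xi>') x\<bar> \<le> B * \<bar>h n\<bar>"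
        using order_trans[OF lip mult_left_mono[OF _ B0]] by blast
      have "((\<lambda>y. tapply \<xi>' y - tapply (tdiff \<xi>') x * y) has_field_derivative
          tapply (tdiff \<xi>') y - tapply (tdiff \<xi>') x) (at y)"
        by (auto intro!: derivative_eq_intros D)
      then show "((\<lambda>y. tapply \<xi>' y - tapply (tdiff \<xi>') x * y) has_field_derivative
          tapply (tdiff \<xi>') y - tapply (tdiff \<xi>') x) (at y within cball x \<bar>h n\<bar>)"
        by (rule has_field_derivative_at_within)
    qed (simp_all add: dist_real_def)
    then have "\<bar>tapply \<xi>' (x + h n) - tapply \<xi>' x - tapply (tdiff \<xi>') x * h n\<bar> \<le> B * \<bar>h n\<bar> * \<bar>h n\<bar>"
      by (simp add: algebra_simps)
    then have "\<bar>h n * tapply (?q \<xi>' n) x\<bar> \<le> \<bar>h n\<bar> * (B * \<bar>h n\<bar>)"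
      using h(1)[of n] by (simp add: tapply_simps tshift.rep_eq right_diff_distrib mult_ac)
    then show ?thesis using h(1)[of n] by (simp add: abs_mult)
  qed
  show "uniform_limit UNIV (\<lambda>n. (deriv ^^ k) (tapply (?q \<phi> n))) (\<lambda>_. 0) sequentially"
    unfolding eq
  proof (rule uniform_limitI)
    fix e :: real assume e: "0 < e"
    have "(\<lambda>n. B * \<bar>h n\<bar>) \<longlonglongrightarrow> 0" using tendsto_mult_right_zero[OF tendsto_rabs_zero[OF h(2)], of B] .
    then have "\<forall>\<^sub>F n in sequentially. B * \<bar>h n\<bar> < e" using e by (rule order_tendstoD)
    then show "\<forall>\<^sub>F n in sequentially. \<forall>x\<in>UNIV. dist (tapply (?q \<xi>' n) x) 0 < e"
    proof (rule eventually_mono, intro ballI)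
      fix n x assume "B * \<bar>h n\<bar> < e"
      then show "dist (tapply (?q \<xi>' n) x) 0 < e" using est[of n x] by (simp add: dist_real_def)
    qed
  qed
qed

lemma regularisation_deriv:
  "((\<lambda>x. dapply T (tshift x \<phi>)) has_field_derivative dapply T (tshift x (tdiff \<phi>))) (at x)"
  unfolding DERIV_def LIMSEQ_SEQ_conv[symmetric]
proof (intro allI impI)
  fix h :: "nat \<Rightarrow> real" assume "(\<forall>n. h n \<noteq> 0) \<and> h \<longlonglongrightarrow> 0"
  then have h: "\<And>n. h n \<noteq> 0" "h \<longlonglongrightarrow> 0" by blast+
  have "(\<lambda>n. dapply T ((1 / h n) *\<^sub>R (tshift (h n) (tshift x \<phi>) - tshift x \<phi>) - tdiff (tshift x \<phi>))) \<longlonglongrightarrow> 0"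
    by (intro dapply_null difference_quotient_null h)
  then have "(\<lambda>n. (dapply T (tshift (h n + x) \<phi>) - dapply T (tshift x \<phi>)) / h n - dapply T (tshift x (tdiff \<phi>))) \<longlonglongrightarrow> 0"
    by (simp add: linear_diff[OF dapply_linear] linear_scale[OF dapply_linear] tshift_tshift tdiff_tshift)
  from LIM_zero_cancel[OF this]
  show "(\<lambda>n. (dapply T (tshift (x + h n) \<phi>) - dapply T (tshift x \<phi>)) / h n) \<longlonglongrightarrow> dapply T (tshift x (tdiff \<phi>))"
    by (simp add: add.commute)
qed

lemma regularisation_smooth: "smooth_fun (\<lambda>x. dapply T (tshift x \<phi>))"
proof (rule smooth_fun_from_closed_set[of "range (\<lambda>\<phi> x. dapply T (tshift x \<phi>))"])
  fix g assume "g \<in> range (\<lambda>\<phi> x. dapply T (tshift x \<phi>))"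
  then obtain \<psi> where g: "g = (\<lambda>x. dapply T (tshift x \<psi>))" by blast
  show "\<exists>g'\<in>range (\<lambda>\<phi> x. dapply T (tshift x \<phi>)). \<forall>x. (g has_field_derivative g' x) (at x)"
    unfolding g by (rule bexI[of _ "\<lambda>x. dapply T (tshift x (tdiff \<psi>))"]) (simp_all add: regularisation_deriv)
qed simp

lemma regularisation_continuous: "continuous_on UNIV (\<lambda>x. dapply T (tshift x \<phi>))"
  using smooth_fun_continuous[OF regularisation_smooth, of UNIV 0] by simp

lemma regularisation_0:
  assumes "supported_in T A" "\<And>t. t \<in> support (tapply \<phi>) \<Longrightarrow> t - x \<notin> A"
  shows "dapply T (tshift x \<phi>) = 0"
proof -
  have "support (tapply (tshift x \<phi>)) \<inter> A = {}" unfolding support_tshift using assms(2) by blast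
  then show ?thesis using assms(1) unfolding supported_in_def by blast
qed

subsection \<open>Uniqueness of causal solutions\<close>

text \<open>An energy estimate: for the sum \<open>v\<close> of the squares of the derivatives of order
  less than \<open>n\<close> and a large constant \<open>C\<close>, \<open>exp (C * x) * v x\<close> is
  nondecreasing. As \<open>v\<close> vanishes far to the right, it vanishes everywhere.\<close>

lemma ode_unique:
  fixes u :: "nat \<Rightarrow> real \<Rightarrow> real"
  assumes D: "\<And>k x. (u k has_field_derivative u (Suc k) x) (at x)"
    and eq: "\<And>x. (\<Sum>k\<le>n. c k * u k x) = 0" and c: "c n \<noteq> 0"
    and z: "\<And>k x. b \<le> x \<Longrightarrow> u k x = 0"
  shows "u 0 x = 0"
proof -
  define v where "v x = (\<Sum>k<n. (u k x)\<^sup>2)" for x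
  define S where "S = (\<Sum>k<n. (c k / c n)\<^sup>2)"
  define C where "C = 2 + S"
  have top: "u n x = - (\<Sum>k<n. (c k / c n) * u k x)" for x
  proof -
    have "c n * u n x = - (\<Sum>k<n. c k * u k x)"
      using eq[of x] by (simp add: lessThan_Suc_atMost[symmetric])
    then have "u n x = - (\<Sum>k<n. c k * u k x) / c n" using c by (simp add: field_simps)
    then show ?thesis by (simp add: sum_divide_distrib)
  qed
  have top_le: "(u n x)\<^sup>2 \<le> S * v x" for x
    unfolding top power2_minus S_def v_def by (rule Cauchy_Schwarz_ineq_sum)
  have Dv: "(v has_field_derivative (\<Sum>k<n. 2 * u k x * u (Suc k) x)) (at x)" for x
    unfolding v_def by (rule DERIV_sum) (auto intro!: derivative_eq_intros D)
  have "- (\<Sum>k<n. 2 * u k x * u (Suc k) x) \<le> C * v x" for x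
  proof -
    have "- (\<Sum>k<n. 2 * u k x * u (Suc k) x) \<le> (\<Sum>k<n. (u k x)\<^sup>2 + (u (Suc k) x)\<^sup>2)"
      unfolding sum_negf[symmetric]
    proof (rule sum_mono)
      fix k show "- (2 * u k x * u (Suc k) x) \<le> (u k x)\<^sup>2 + (u (Suc k) x)\<^sup>2"
        using zero_le_power2[of "u k x + u (Suc k) x"] by (simp add: power2_sum)
    qed
    also have "\<dots> = v x + (\<Sum>k<n. (u (Suc k) x)\<^sup>2)" by (simp add: sum.distrib v_def)
    also have "(\<Sum>k<n. (u (Suc k) x)\<^sup>2) \<le> v x + (u n x)\<^sup>2"
    proof -
      have "(\<Sum>k<n. (u (Suc k) x)\<^sup>2) \<le> (u 0 x)\<^sup>2 + (\<Sum>k<n. (u (Suc k) x)\<^sup>2)" by simp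
      also have "\<dots> = (\<Sum>k<Suc n. (u k x)\<^sup>2)" by (rule sum.lessThan_Suc_shift[symmetric])
      finally show ?thesis by (simp add: v_def)
    qed
    finally show ?thesis using top_le[of x] by (simp add: C_def distrib_right)
  qed
  then have bound: "0 \<le> C * v x + (\<Sum>k<n. 2 * u k x * u (Suc k) x)" for x
  proof -
    have "- s \<le> c \<Longrightarrow> 0 \<le> c + s" for s c :: real by simp
    then show ?thesis using \<open>\<And>x. - (\<Sum>k<n. 2 * u k x * u (Suc k) x) \<le> C * v x\<close> .
  qed
  have mono: "exp (C * x) * v x \<le> exp (C * y) * v y" if "x \<le> y" for x y
  proof (rule DERIV_nonneg_imp_nondecreasing[OF that])
    fix t
    have "((\<lambda>t. exp (C * t) * v t) has_field_derivative
        exp (C * t) * (C * v t + (\<Sum>k<n. 2 * u k t * u (Suc k) t))) (at t)"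
      by (auto intro!: derivative_eq_intros Dv simp: algebra_simps)
    then show "\<exists>y. ((\<lambda>t. exp (C * t) * v t) has_field_derivative y) (at t) \<and> 0 \<le> y"
      using bound[of t] by (intro exI conjI) (assumption, simp)
  qed
  have v0: "v x = 0" for x
  proof -
    have "exp (C * x) * v x \<le> exp (C * max x b) * v (max x b)" by (rule mono) simp
    also have "v (max x b) = 0" by (simp add: v_def z)
    finally have "v x \<le> 0" by (simp add: mult_le_0_iff)
    moreover have "0 \<le> v x" by (simp add: v_def sum_nonneg)
    ultimately show ?thesis by simp
  qed
  show "u 0 x = 0"
  proof (cases "n = 0")
    case True then show ?thesis using eq[of x] c by simp
  next
    case False
    then have "(u 0 x)\<^sup>2 \<le> v x" unfolding v_def by (intro member_le_sum) simp_all
    then show ?thesis using v0 by simp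
  qed
qed

text \<open>Applying \<open>T\<close> to the translates of a test function gives a smooth solution of a
  linear differential equation. It vanishes once the support has been moved to the negative
  half-line.\<close>

lemma causal_solution_zero:
  assumes p: "p \<noteq> 0" and T: "odo p T = 0" "supported_in T {0..}"
  shows "T = 0"
proof (rule distr_eqI)
  fix \<phi>
  obtain r where r: "\<And>x. r \<le> \<bar>x\<bar> \<Longrightarrow> x \<notin> support (tapply \<phi>)" using test_support_bounded by blast
  define u where "u k x = dapply T (tshift x ((tdiff ^^ k) \<phi>))" for k x
  have "u 0 0 = 0"
  proof (rule ode_unique[where u = u and c = "\<lambda>k. (- 1) ^ k * coeff p k" and n = "degree p" and b = "\<bar>r\<bar> + 1"])
    show "(u k has_field_derivative u (Suc k) x) (at x)" for k x
      unfolding u_def using regularisation_deriv[of T "(tdiff ^^ k) \<phi>"] by simp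
    show "(- 1) ^ degree p * coeff p (degree p) \<noteq> 0" using p by simp
    show "(\<Sum>k\<le>degree p. (- 1) ^ k * coeff p k * u k x) = 0" for x
    proof -
      have "dapply (odo p T) (tshift x \<phi>) = 0" by (simp add: T zero_distr.rep_eq)
      then have "dapply T (tshift x (tad p \<phi>)) = 0" by (simp add: dapply_odo tad_tshift)
      then show ?thesis
        by (simp add: tad_def tneg_funpow linear_sum[OF tshift_linear] linear_scale[OF tshift_linear]
            linear_sum[OF dapply_linear] linear_scale[OF dapply_linear] u_def mult_ac)
    qed
    show "u k x = 0" if "\<bar>r\<bar> + 1 \<le> x" for k x
      unfolding u_def
    proof (rule regularisation_0[OF T(2)])
      fix t assume "t \<in> support (tapply ((tdiff ^^ k) \<phi>))"
      then have "t \<in> support (tapply \<phi>)" using support_tdiff_funpow by blast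
      then have "\<bar>t\<bar> < r" using r[of t] by force
      then show "t - x \<notin> {0..}" using that by auto
    qed
  qed
  then show "dapply T \<phi> = dapply 0 \<phi>" by (simp add: u_def zero_distr.rep_eq)
qed

section \<open>Fundamental solutions\<close>

text \<open>The exponential generating function of a sequence.\<close>

definition expser :: "(nat \<Rightarrow> real) \<Rightarrow> real \<Rightarrow> real" where
  "expser a t = (\<Sum>n. a n / fact n * t ^ n)"

definition exp_bounded :: "(nat \<Rightarrow> real) \<Rightarrow> bool" where
  "exp_bounded a \<longleftrightarrow> (\<exists>B R. 0 \<le> R \<and> (\<forall>n. \<bar>a n\<bar> \<le> B * R ^ n))"

lemma exp_bounded_shift: "exp_bounded a \<Longrightarrow> exp_bounded (\<lambda>n. a (n + k))"
proof -
  assume "exp_bounded a"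
  then obtain B R where R: "0 \<le> R" and a: "\<And>n. \<bar>a n\<bar> \<le> B * R ^ n" unfolding exp_bounded_def by blast
  have "\<bar>a (n + k)\<bar> \<le> (B * R ^ k) * R ^ n" for n using a[of "n + k"] by (simp add: power_add mult_ac)
  then show ?thesis using R unfolding exp_bounded_def by blast
qed

lemma expser_summable:
  assumes "exp_bounded a"
  shows "summable (\<lambda>n. a n / fact n * t ^ n)"
proof -
  obtain B R where R: "0 \<le> R" and a: "\<And>n. \<bar>a n\<bar> \<le> B * R ^ n" using assms unfolding exp_bounded_def by blast
  have s: "summable (\<lambda>n. B * (inverse (fact n) * (R * \<bar>t\<bar>) ^ n))" by (intro summable_mult summable_exp)
  show ?thesis
  proof (rule summable_comparison_test'[OF s])
    fix n :: nat
    have "\<bar>a n\<bar> * (\<bar>t\<bar> ^ n / fact n) \<le> (B * R ^ n) * (\<bar>t\<bar> ^ n / fact n)"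
      by (intro mult_right_mono a) simp
    then show "norm (a n / fact n * t ^ n) \<le> B * (inverse (fact n) * (R * \<bar>t\<bar>) ^ n)"
      by (simp add: abs_mult power_abs power_mult_distrib divide_inverse mult_ac)
  qed
qed

text \<open>Differentiation shifts the coefficient sequence, so a linear differential equation with
  constant coefficients becomes a linear recurrence.\<close>

lemma expser_deriv:
  assumes "exp_bounded a"
  shows "(expser a has_field_derivative expser (\<lambda>n. a (Suc n)) t) (at t)"
proof -
  have "((\<lambda>x. \<Sum>n. a n / fact n * x ^ n) has_field_derivative (\<Sum>n. diffs (\<lambda>n. a n / fact n) n * t ^ n)) (at t)"
    by (intro termdiffs_strong_converges_everywhere expser_summable assms)
  moreover have "diffs (\<lambda>n. a n / fact n) = (\<lambda>n. a (Suc n) / fact n)"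
  proof
    fix n
    have "real (Suc n) * a (Suc n) / (real (Suc n) * fact n) = a (Suc n) / fact n"
      by (rule nonzero_mult_divide_mult_cancel_left) simp
    then show "diffs (\<lambda>n. a n / fact n) n = a (Suc n) / fact n" by (simp add: diffs_def)
  qed
  ultimately show ?thesis unfolding expser_def[abs_def] by simp
qed

lemma expser_0: "expser a 0 = a 0"
  using powser_zero[of "\<lambda>n. a n / fact n"] by (simp add: expser_def)

lemma expser_continuous: "exp_bounded a \<Longrightarrow> continuous_on A (expser a)"
  by (rule DERIV_continuous_on[OF has_field_derivative_at_within[OF expser_deriv]])

text \<open>The initial values are those of the kernel of the variation of constants formula.\<close>

fun rec_seq :: "real poly \<Rightarrow> nat \<Rightarrow> real" where
  "rec_seq p k = (if k < degree p then (if Suc k = degree p then 1 / lead_coeff p else 0)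
     else - (\<Sum>j\<in>{..<degree p}. if j < degree p then coeff p j * rec_seq p (k - degree p + j) else 0) / lead_coeff p)"

declare rec_seq.simps [simp del]

lemma rec_seq_init: "k < degree p \<Longrightarrow> rec_seq p k = (if Suc k = degree p then 1 / lead_coeff p else 0)"
  by (simp add: rec_seq.simps)

lemma rec_seq_rec:
  assumes "p \<noteq> 0"
  shows "(\<Sum>k\<le>degree p. coeff p k * rec_seq p (j + k)) = 0"
proof -
  have "lead_coeff p * rec_seq p (j + degree p) = - (\<Sum>k<degree p. coeff p k * rec_seq p (j + k))"
    using assms by (subst rec_seq.simps) simp
  then show ?thesis by (simp add: lessThan_Suc_atMost[symmetric])
qed

lemma rec_seq_bounded:
  assumes "p \<noteq> 0"
  shows "exp_bounded (rec_seq p)"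
proof -
  define S where "S = (\<Sum>k<degree p. \<bar>coeff p k / lead_coeff p\<bar>)"
  define B where "B = 1 + S + \<bar>1 / lead_coeff p\<bar>"
  have S: "0 \<le> S" by (simp add: S_def sum_nonneg)
  have B: "1 \<le> B" "S \<le> B" "\<bar>1 / lead_coeff p\<bar> \<le> B" using S by (simp_all add: B_def)
  have "\<bar>rec_seq p k\<bar> \<le> B ^ Suc k" for k
  proof (induction k rule: less_induct)
    case (less k)
    show ?case
    proof (cases "k < degree p")
      case True
      then have "\<bar>rec_seq p k\<bar> \<le> \<bar>1 / lead_coeff p\<bar>" by (simp add: rec_seq_init)
      also have "\<dots> \<le> B ^ 1" using B by simp
      also have "\<dots> \<le> B ^ Suc k" using B by (intro power_increasing) simp_all
      finally show ?thesis .
    next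
      case False
      define j where "j = k - degree p"
      have k: "k = j + degree p" using False by (simp add: j_def)
      have "rec_seq p k = - (\<Sum>i<degree p. coeff p i / lead_coeff p * rec_seq p (j + i))"
        using rec_seq_rec[OF assms, of j] assms k
        by (simp add: lessThan_Suc_atMost[symmetric] sum_divide_distrib[symmetric] field_simps)
      then have "\<bar>rec_seq p k\<bar> \<le> (\<Sum>i<degree p. \<bar>coeff p i / lead_coeff p * rec_seq p (j + i)\<bar>)"
        by (simp only: abs_minus_cancel sum_abs)
      also have "\<dots> \<le> (\<Sum>i<degree p. \<bar>coeff p i / lead_coeff p\<bar> * B ^ k)"
      proof (rule sum_mono)
        fix i assume "i \<in> {..<degree p}"
        then have ij: "j + i < k" using k by simp
        have "\<bar>rec_seq p (j + i)\<bar> \<le> B ^ k"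
          using order_trans[OF less.IH[OF ij] power_increasing[OF Suc_leI[OF ij] B(1)]] .
        then have "\<bar>coeff p i / lead_coeff p\<bar> * \<bar>rec_seq p (j + i)\<bar> \<le> \<bar>coeff p i / lead_coeff p\<bar> * B ^ k"
          by (intro mult_left_mono) simp_all
        then show "\<bar>coeff p i / lead_coeff p * rec_seq p (j + i)\<bar> \<le> \<bar>coeff p i / lead_coeff p\<bar> * B ^ k"
          by (simp only: abs_mult)
      qed
      also have "\<dots> = S * B ^ k" by (simp add: S_def sum_distrib_right)
      also have "\<dots> \<le> B * B ^ k" using B by (intro mult_right_mono) simp_all
      finally show ?thesis by simp
    qed
  qed
  then have "\<forall>n. \<bar>rec_seq p n\<bar> \<le> B * B ^ n" by simp
  moreover have "0 \<le> B" using B(1) by simp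
  ultimately show ?thesis unfolding exp_bounded_def by blast
qed

lemma expser_ode:
  assumes "p \<noteq> 0"
  shows "(\<Sum>k\<le>degree p. coeff p k * expser (\<lambda>n. rec_seq p (n + k)) t) = 0"
proof -
  have "(\<Sum>k\<le>degree p. coeff p k * expser (\<lambda>n. rec_seq p (n + k)) t)
      = (\<Sum>k\<le>degree p. \<Sum>n. coeff p k * (rec_seq p (n + k) / fact n * t ^ n))"
    unfolding expser_def
    by (intro sum.cong refl suminf_mult[symmetric] expser_summable exp_bounded_shift rec_seq_bounded assms)
  also have "\<dots> = (\<Sum>n. \<Sum>k\<le>degree p. coeff p k * (rec_seq p (n + k) / fact n * t ^ n))"
    by (rule suminf_sum[symmetric])
      (intro summable_mult expser_summable exp_bounded_shift rec_seq_bounded assms)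
  also have "\<dots> = (\<Sum>n. (\<Sum>k\<le>degree p. coeff p k * rec_seq p (n + k)) * (t ^ n / fact n))"
    by (rule suminf_cong) (simp add: sum_distrib_left sum_distrib_right mult_ac divide_inverse)
  finally show ?thesis by (simp add: rec_seq_rec[OF assms])
qed

subsection \<open>Distributions given by functions on half-lines\<close>

definition cut_distr :: "real set \<Rightarrow> (real \<Rightarrow> real) \<Rightarrow> distr" where
  "cut_distr I u = fun_distr (\<lambda>t. indicator I t * u t)"

lemma
  assumes "closed I" "continuous_on UNIV u"
  shows cut_distr_apply: "dapply (cut_distr I u) \<phi> = (LINT t|lborel. indicator I t * u t * tapply \<phi> t)"
    and cut_distr_integrable: "integrable lborel (\<lambda>t. indicator I t * u t * tapply \<phi> t)"
proof -
  have "set_integrable lborel K (\<lambda>t. indicator I t * u t)" if "compact K" for K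
  proof -
    have "integrable lborel (\<lambda>t. indicator (K \<inter> I) t *\<^sub>R u t)"
      using assms that by (intro borel_integrable_compact) (auto intro: compact_Int_closed continuous_on_subset)
    moreover have "(\<lambda>t. indicator (K \<inter> I) t *\<^sub>R u t) = (\<lambda>t. indicator K t *\<^sub>R (indicator I t * u t))"
      by (simp add: fun_eq_iff indicator_inter_arith)
    ultimately show ?thesis unfolding set_integrable_def by simp
  qed
  then show "dapply (cut_distr I u) \<phi> = (LINT t|lborel. indicator I t * u t * tapply \<phi> t)"
    unfolding cut_distr_def fun_distr.rep_eq by simp
  have "compact (support (tapply \<phi>) \<inter> I)"
    by (rule compact_Int_closed[OF test_compact assms(1)])
  moreover have "continuous_on (support (tapply \<phi>) \<inter> I) (\<lambda>t. u t * tapply \<phi> t)"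
    by (intro continuous_on_mult test_continuous continuous_on_subset[OF assms(2)]) simp
  ultimately have "integrable lborel (\<lambda>t. indicator (support (tapply \<phi>) \<inter> I) t *\<^sub>R (u t * tapply \<phi> t))"
    by (rule borel_integrable_compact)
  moreover have "(\<lambda>t. indicator (support (tapply \<phi>) \<inter> I) t *\<^sub>R (u t * tapply \<phi> t)) = (\<lambda>t. indicator I t * u t * tapply \<phi> t)"
  proof
    fix t
    show "indicator (support (tapply \<phi>) \<inter> I) t *\<^sub>R (u t * tapply \<phi> t) = indicator I t * u t * tapply \<phi> t"
      by (cases "t \<in> support (tapply \<phi>)") (simp_all add: test_outside indicator_def)
  qed
  ultimately show "integrable lborel (\<lambda>t. indicator I t * u t * tapply \<phi> t)" by simp
qed

lemma cut_distr_supported: "closed I \<Longrightarrow> continuous_on UNIV u \<Longrightarrow> supported_in (cut_distr I u) I"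
  unfolding supported_in_def
proof (intro allI impI)
  fix \<phi> assume I: "closed I" "continuous_on UNIV u" and d: "support (tapply \<phi>) \<inter> I = {}"
  have "indicator I t * u t * tapply \<phi> t = 0" for t
  proof (cases "t \<in> I")
    case True
    then have "t \<notin> support (tapply \<phi>)" using d by blast
    then show ?thesis by (simp add: test_outside)
  qed simp
  then have "(\<lambda>t. indicator I t * u t * tapply \<phi> t) = (\<lambda>_. 0)" by (rule ext)
  then show "dapply (cut_distr I u) \<phi> = 0" by (simp only: cut_distr_apply[OF I]) simp
qed

lemma cut_distr_parts:
  assumes I: "closed I" and D: "\<And>t. (u has_field_derivative u' t) (at t)" and u': "continuous_on UNIV u'"
    and lr: "l \<le> r" "\<And>t. t \<in> support (tapply \<phi>) \<Longrightarrow> t \<in> I \<longleftrightarrow> l \<le> t \<and> t \<le> r" "tapply \<phi> r = 0"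
  shows "dapply (ddiff (cut_distr I u)) \<phi> = u l * tapply \<phi> l + dapply (cut_distr I u') \<phi>"
proof -
  have u: "continuous_on UNIV u" by (rule DERIV_continuous_on[OF has_field_derivative_at_within[OF D]])
  have D\<phi>: "(tapply \<phi> has_field_derivative tapply (tdiff \<phi>) t) (at t)" for t
    using smooth_fun_has_deriv[OF test_smooth] by (simp add: tdiff.rep_eq)
  have cut: "indicator I t * v t * tapply \<psi> t = (v t * tapply \<psi> t) * indicator {l..r} t"
    if "support (tapply \<psi>) \<subseteq> support (tapply \<phi>)" for v t \<psi>
  proof (cases "t \<in> support (tapply \<psi>)")
    case True
    then show ?thesis using lr(2)[of t] that by (auto simp: indicator_def)
  qed (simp add: test_outside)
  have sd: "support (tapply (tdiff \<phi>)) \<subseteq> support (tapply \<phi>)" by (simp add: tdiff.rep_eq support_deriv)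
  have "(LINT t|lborel. (u' t * tapply \<phi> t + u t * tapply (tdiff \<phi>) t) * indicator {l..r} t)
      = u r * tapply \<phi> r - u l * tapply \<phi> l"
  proof (rule integral_FTC_Icc_real[OF lr(1)])
    fix t
    show "((\<lambda>t. u t * tapply \<phi> t) has_field_derivative u' t * tapply \<phi> t + u t * tapply (tdiff \<phi>) t) (at t)"
      using DERIV_mult[OF D[of t] D\<phi>[of t]] by (simp add: mult.commute)
    have "continuous_on UNIV (\<lambda>t. u' t * tapply \<phi> t + u t * tapply (tdiff \<phi>) t)"
      by (intro continuous_on_add continuous_on_mult u u' test_continuous)
    then show "isCont (\<lambda>t. u' t * tapply \<phi> t + u t * tapply (tdiff \<phi>) t) t"
      by (simp add: continuous_on_eq_continuous_at)
  qed
  moreover have "(LINT t|lborel. (u' t * tapply \<phi> t + u t * tapply (tdiff \<phi>) t) * indicator {l..r} t)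
      = (LINT t|lborel. indicator I t * u' t * tapply \<phi> t + indicator I t * u t * tapply (tdiff \<phi>) t)"
    by (rule Bochner_Integration.integral_cong) (simp_all add: cut[OF order_refl] cut[OF sd] distrib_right)
  moreover have "\<dots> = dapply (cut_distr I u') \<phi> + dapply (cut_distr I u) (tdiff \<phi>)"
    by (simp add: cut_distr_apply[OF I u] cut_distr_apply[OF I u'] cut_distr_integrable[OF I u] cut_distr_integrable[OF I u'])
  ultimately show ?thesis using lr(3) by (simp add: ddiff.rep_eq)
qed

lemma ddiff_cut_UNIV:
  assumes "\<And>t. (u has_field_derivative u' t) (at t)" "continuous_on UNIV u'"
  shows "ddiff (cut_distr UNIV u) = cut_distr UNIV u'"
proof (rule distr_eqI)
  fix \<phi>
  obtain r where r: "0 < r" "\<And>x. r \<le> \<bar>x\<bar> \<Longrightarrow> x \<notin> support (tapply \<phi>)" using test_support_bounded by blast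
  have "dapply (ddiff (cut_distr UNIV u)) \<phi> = u (- r) * tapply \<phi> (- r) + dapply (cut_distr UNIV u') \<phi>"
  proof (rule cut_distr_parts[OF closed_UNIV assms, where r = r])
    show "t \<in> UNIV \<longleftrightarrow> - r \<le> t \<and> t \<le> r" if "t \<in> support (tapply \<phi>)" for t
      using r(2)[of t] that by force
    show "tapply \<phi> r = 0" using r by (intro test_outside) simp
  qed (use r(1) in simp)
  moreover have "tapply \<phi> (- r) = 0" using r by (intro test_outside) simp
  ultimately show "dapply (ddiff (cut_distr UNIV u)) \<phi> = dapply (cut_distr UNIV u') \<phi>" by simp
qed

lemma ddiff_cut_half:
  assumes "\<And>t. (u has_field_derivative u' t) (at t)" "continuous_on UNIV u'"
  shows "ddiff (cut_distr {0..} u) = u 0 *\<^sub>R dirac 0 + cut_distr {0..} u'"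
proof (rule distr_eqI)
  fix \<phi>
  obtain r where r: "0 < r" "\<And>x. r \<le> \<bar>x\<bar> \<Longrightarrow> x \<notin> support (tapply \<phi>)" using test_support_bounded by blast
  have "dapply (ddiff (cut_distr {0..} u)) \<phi> = u 0 * tapply \<phi> 0 + dapply (cut_distr {0..} u') \<phi>"
  proof (rule cut_distr_parts[OF closed_atLeast assms, where r = r])
    show "t \<in> {0..} \<longleftrightarrow> 0 \<le> t \<and> t \<le> r" if "t \<in> support (tapply \<phi>)" for t
      using r(2)[of t] that by force
    show "tapply \<phi> r = 0" using r by (intro test_outside) simp
  qed (use r(1) in simp)
  then show "dapply (ddiff (cut_distr {0..} u)) \<phi> = dapply (u 0 *\<^sub>R dirac 0 + cut_distr {0..} u') \<phi>"
    by (simp add: dapply_simps dirac.rep_eq)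
qed

lemma cut_expser_annihilated:
  assumes "p \<noteq> 0" "closed I"
  shows "(\<Sum>k\<le>degree p. coeff p k *\<^sub>R cut_distr I (expser (\<lambda>n. rec_seq p (n + k)))) = 0"
proof (rule distr_eqI)
  fix \<phi>
  have c: "continuous_on UNIV (expser (\<lambda>n. rec_seq p (n + k)))" for k
    by (intro expser_continuous exp_bounded_shift rec_seq_bounded assms)
  have "dapply (\<Sum>k\<le>degree p. coeff p k *\<^sub>R cut_distr I (expser (\<lambda>n. rec_seq p (n + k)))) \<phi>
      = (\<Sum>k\<le>degree p. LINT t|lborel. coeff p k * (indicator I t * expser (\<lambda>n. rec_seq p (n + k)) t * tapply \<phi> t))"
    by (simp add: dapply_sum dapply_simps cut_distr_apply[OF assms(2) c])
  also have "\<dots> = (LINT t|lborel. (\<Sum>k\<le>degree p. coeff p k * (indicator I t * expser (\<lambda>n. rec_seq p (n + k)) t * tapply \<phi> t)))"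
    by (intro Bochner_Integration.integral_sum[symmetric] integrable_mult_right cut_distr_integrable[OF assms(2) c])
  also have "\<dots> = (LINT t|lborel. (\<Sum>k\<le>degree p. coeff p k * expser (\<lambda>n. rec_seq p (n + k)) t) * (indicator I t * tapply \<phi> t))"
    by (rule Bochner_Integration.integral_cong) (simp_all add: sum_distrib_left sum_distrib_right mult_ac)
  finally show "dapply (\<Sum>k\<le>degree p. coeff p k *\<^sub>R cut_distr I (expser (\<lambda>n. rec_seq p (n + k)))) \<phi> = dapply 0 \<phi>"
    by (simp add: expser_ode[OF assms(1)] zero_distr.rep_eq)
qed

text \<open>When the homogeneous solution is cut off at 0, only its derivative of order \<open>degree p - 1\<close> has a
  jump there, and this produces the Dirac measure.\<close>

lemma odo_cut_expser:
  assumes p: "p \<noteq> 0" and n: "0 < degree p"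
  shows "odo p (cut_distr {0..} (expser (rec_seq p))) = dirac 0"
    and "odo p (cut_distr UNIV (expser (rec_seq p))) = 0"
proof -
  let ?e = "\<lambda>k. expser (\<lambda>n. rec_seq p (n + k))"
  have D: "(?e k has_field_derivative ?e (Suc k) t) (at t)" for k t
    using expser_deriv[OF exp_bounded_shift[OF rec_seq_bounded[OF p], of k]] by simp
  have c: "continuous_on UNIV (?e k)" for k
    by (intro expser_continuous exp_bounded_shift rec_seq_bounded p)
  have half: "(ddiff ^^ k) (cut_distr {0..} (?e 0))
      = (if k = degree p then (1 / lead_coeff p) *\<^sub>R dirac 0 else 0) + cut_distr {0..} (?e k)" if "k \<le> degree p" for k
    using that
  proof (induction k)
    case 0
    show ?case using n by simp
  next
    case (Suc k)
    have "?e k 0 = (if Suc k = degree p then 1 / lead_coeff p else 0)"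
      using Suc.prems by (simp add: expser_0 rec_seq_init)
    then show ?case using Suc.IH Suc.prems ddiff_cut_half[OF D c, of k] by simp
  qed
  have full: "(ddiff ^^ k) (cut_distr UNIV (?e 0)) = cut_distr UNIV (?e k)" for k
    by (induction k) (simp_all add: ddiff_cut_UNIV[OF D c])
  have "odo p (cut_distr {0..} (?e 0)) = (\<Sum>k\<le>degree p. coeff p k *\<^sub>R
      ((if k = degree p then (1 / lead_coeff p) *\<^sub>R dirac 0 else 0) + cut_distr {0..} (?e k)))"
    unfolding odo_def using half by (intro sum.cong refl arg_cong2[where f = "(*\<^sub>R)"]) blast
  also have "\<dots> = (\<Sum>k\<le>degree p. coeff p k *\<^sub>R (if k = degree p then (1 / lead_coeff p) *\<^sub>R dirac 0 else 0))
      + (\<Sum>k\<le>degree p. coeff p k *\<^sub>R cut_distr {0..} (?e k))"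
    by (simp only: scaleR_right_distrib sum.distrib)
  also have "(\<Sum>k\<le>degree p. coeff p k *\<^sub>R (if k = degree p then (1 / lead_coeff p) *\<^sub>R dirac 0 else 0))
      = (\<Sum>k\<le>degree p. if k = degree p then dirac 0 else 0)"
    using p by (intro sum.cong) auto
  finally show "odo p (cut_distr {0..} (expser (rec_seq p))) = dirac 0"
    using cut_expser_annihilated[OF p closed_atLeast[of "0::real"]] by simp
  have "odo p (cut_distr UNIV (?e 0)) = (\<Sum>k\<le>degree p. coeff p k *\<^sub>R cut_distr UNIV (?e k))"
    by (simp only: odo_def full)
  then show "odo p (cut_distr UNIV (expser (rec_seq p))) = 0"
    using cut_expser_annihilated[OF p closed_UNIV] by simp
qed

text \<open>Besides the causal fundamental solution \<open>E\<close>, a homogeneous solution \<open>e\<close> that agrees with it on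
  the positive half-line, so that \<open>E - e\<close> is an anticausal fundamental solution. Multiplying the
  polynomial by \<open>D\<close> first makes the degree positive.\<close>

lemma fundamental_solution:
  assumes p: "p \<noteq> 0"
  shows "\<exists>E e. odo p E = dirac 0 \<and> supported_in E {0..} \<and> odo p e = 0 \<and> supported_in (E - e) {..0}"
proof -
  let ?q = "p * [:0, 1:]"
  have q: "?q \<noteq> 0" "0 < degree ?q" using p by (simp_all add: degree_mult_eq)
  have D: "odo [:0, 1:] T = ddiff T" for T by (simp add: odo_pCons odo_def[of 0] linear_0[OF ddiff_linear])
  have c: "continuous_on UNIV (expser (rec_seq ?q))" by (intro expser_continuous rec_seq_bounded q)
  define E where "E = ddiff (cut_distr {0..} (expser (rec_seq ?q)))"
  define e where "e = ddiff (cut_distr UNIV (expser (rec_seq ?q)))"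
  have "odo p E = dirac 0" "odo p e = 0"
    using odo_cut_expser[OF q] by (simp_all only: E_def e_def odo_mult D)
  moreover have "supported_in E {0..}"
    using supported_in_odo[OF cut_distr_supported[OF closed_atLeast c], of "[:0, 1:]"] by (simp only: D E_def)
  moreover have "supported_in (E - e) {..0}"
  proof -
    have "supported_in (cut_distr {0..} (expser (rec_seq ?q)) - cut_distr UNIV (expser (rec_seq ?q))) {..0}"
      unfolding supported_in_def
    proof (intro allI impI)
      fix \<phi> assume d: "support (tapply \<phi>) \<inter> {..0} = {}"
      have "indicator {0..} t * expser (rec_seq ?q) t * tapply \<phi> t = indicator UNIV t * expser (rec_seq ?q) t * tapply \<phi> t" for t
      proof (cases "t \<in> support (tapply \<phi>)")
        case True
        then have "t \<notin> {..0}" using d by blast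
        then show ?thesis by simp
      qed (simp add: test_outside)
      then have "(\<lambda>t. indicator {0..} t * expser (rec_seq ?q) t * tapply \<phi> t)
          = (\<lambda>t. indicator UNIV t * expser (rec_seq ?q) t * tapply \<phi> t)" by (rule ext)
      then have "dapply (cut_distr {0..} (expser (rec_seq ?q))) \<phi> = dapply (cut_distr UNIV (expser (rec_seq ?q))) \<phi>"
        unfolding cut_distr_apply[OF closed_atLeast c] cut_distr_apply[OF closed_UNIV c]
        by (rule arg_cong)
      then show "dapply (cut_distr {0..} (expser (rec_seq ?q)) - cut_distr UNIV (expser (rec_seq ?q))) \<phi> = 0"
        unfolding minus_distr.rep_eq by (rule right_minus_eq[THEN iffD2])
    qed
    from supported_in_odo[OF this, of "[:0, 1:]"] show ?thesis
      by (simp only: D E_def e_def linear_diff[OF ddiff_linear])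
  qed
  ultimately show ?thesis by blast
qed

lemma test_null_tshift_bounded:
  assumes \<phi>: "test_null \<phi>" and x: "\<And>n. \<bar>x n\<bar> \<le> B"
  shows "test_null (\<lambda>n. tshift (x n) (\<phi> n))"
proof -
  have eq: "(deriv ^^ k) (tapply (tshift (x n) (\<phi> n))) = (\<lambda>t. (deriv ^^ k) (tapply (\<phi> n)) (t + x n))" for k n
    unfolding tshift.rep_eq by (rule smooth_fun_shift(1)[OF test_smooth])
  have "uniform_limit UNIV (\<lambda>n. (deriv ^^ k) (tapply (tshift (x n) (\<phi> n)))) (\<lambda>_. 0) sequentially" for k
  proof (rule uniform_limitI)
    fix e :: real assume "e > 0"
    moreover have "uniform_limit UNIV (\<lambda>n. (deriv ^^ k) (tapply (\<phi> n))) (\<lambda>_. 0) sequentially"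
      using \<phi> unfolding test_null_def by blast
    ultimately have "\<forall>\<^sub>F n in sequentially. \<forall>x\<in>UNIV. dist ((deriv ^^ k) (tapply (\<phi> n)) x) 0 < e"
      by (rule uniform_limitD[rotated])
    then show "\<forall>\<^sub>F n in sequentially. \<forall>t\<in>UNIV. dist ((deriv ^^ k) (tapply (tshift (x n) (\<phi> n))) t) 0 < e"
      by (rule eventually_mono) (simp add: eq)
  qed
  moreover obtain K where K: "compact K" "\<And>n. support (tapply (\<phi> n)) \<subseteq> K"
    using \<phi> unfolding test_null_def by blast
  obtain r where r: "\<And>t. t \<in> K \<Longrightarrow> \<bar>t\<bar> \<le> r"
    using compact_imp_bounded[OF K(1)] unfolding bounded_iff real_norm_def by blast
  have "support (tapply (tshift (x n) (\<phi> n))) \<subseteq> {- (r + B)..r + B}" for n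
  proof
    fix t assume "t \<in> support (tapply (tshift (x n) (\<phi> n)))"
    then obtain s where s: "s \<in> K" "t = s - x n" unfolding support_tshift using K(2) by blast
    then show "t \<in> {- (r + B)..r + B}" using r[OF s(1)] x[of n] by auto
  qed
  ultimately show ?thesis unfolding test_null_def using compact_Icc by blast
qed

lemma test_null_support: "test_null \<phi> \<Longrightarrow> \<exists>r>0. \<forall>n t. t \<in> support (tapply (\<phi> n)) \<longrightarrow> \<bar>t\<bar> < r"
proof -
  assume "test_null \<phi>"
  then obtain K where K: "compact K" "\<And>n. support (tapply (\<phi> n)) \<subseteq> K" unfolding test_null_def by blast
  obtain r where r: "\<And>t. t \<in> K \<Longrightarrow> \<bar>t\<bar> \<le> r"
    using compact_imp_bounded[OF K(1)] unfolding bounded_iff real_norm_def by blast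
  have "\<bar>t\<bar> < \<bar>r\<bar> + 1" if "t \<in> support (tapply (\<phi> n))" for n t
    using r[of t] K(2)[of n] that by force
  then show ?thesis by (intro exI[of _ "\<bar>r\<bar> + 1"]) auto
qed

text \<open>The equation \<open>p(D) T = \<sigma>\<close> is solved by convolving the part of \<open>\<sigma>\<close> on the positive half-line
  with a causal and the rest with an anticausal fundamental solution. Since these may grow
  exponentially, this is done by duality: \<open>T\<close> integrates a bounded function against \<open>\<sigma>\<close>.\<close>

lemma odo_surjective_measures:
  assumes p: "p \<noteq> 0"
  shows "\<exists>T. odo p T = meas_distr \<sigma>"
proof -
  obtain E e where E: "odo p E = dirac 0" "supported_in E {0..}" "odo p e = 0" "supported_in (E - e) {..0}"
    using fundamental_solution[OF p] by blast
  define G where "G = E - e"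
  have G: "odo p G = dirac 0" "supported_in G {..0}"
    using E by (simp_all add: G_def linear_diff[OF odo_linear])
  \<comment> \<open>The causal solution is used on the right and the anticausal one on the left, so that \<open>w \<phi>\<close>
    vanishes far out.\<close>
  define w where "w \<phi> x = (if 0 \<le> x then dapply E (tshift x \<phi>) else dapply G (tshift x \<phi>))" for \<phi> x
  have w0: "w \<phi> x = 0" if r: "\<And>t. t \<in> support (tapply \<phi>) \<Longrightarrow> \<bar>t\<bar> < r" and x: "r \<le> \<bar>x\<bar>" for \<phi> x r
  proof (cases "0 \<le> x")
    case True
    have "dapply E (tshift x \<phi>) = 0"
    proof (rule regularisation_0[OF E(2)])
      show "t - x \<notin> {0..}" if "t \<in> support (tapply \<phi>)" for t using r[OF that] x True by auto
    qed
    then show ?thesis using True by (simp add: w_def)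
  next
    case False
    have "dapply G (tshift x \<phi>) = 0"
    proof (rule regularisation_0[OF G(2)])
      show "t - x \<notin> {..0}" if "t \<in> support (tapply \<phi>)" for t using r[OF that] x False by auto
    qed
    then show ?thesis using False by (simp add: w_def)
  qed
  have wb: "bdd_borel (w \<phi>)" for \<phi>
  proof -
    obtain r where r: "0 < r" "\<And>x. r \<le> \<bar>x\<bar> \<Longrightarrow> x \<notin> support (tapply \<phi>)" using test_support_bounded by blast
    have sup: "\<bar>t\<bar> < r" if "t \<in> support (tapply \<phi>)" for t using r(2)[of t] that by force
    have cont: "continuous_on {- r..r} (\<lambda>x. dapply T (tshift x \<phi>))" for T
      using regularisation_continuous by (rule continuous_on_subset) simp
    have "\<exists>B. \<forall>x\<in>{- r..r}. \<bar>dapply T (tshift x \<phi>)\<bar> \<le> B" for T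
      using compact_imp_bounded[OF compact_continuous_image[OF cont compact_Icc], of T]
      unfolding bounded_iff by auto
    then obtain B1 B2 where B: "\<And>x. x \<in> {- r..r} \<Longrightarrow> \<bar>dapply E (tshift x \<phi>)\<bar> \<le> B1"
      "\<And>x. x \<in> {- r..r} \<Longrightarrow> \<bar>dapply G (tshift x \<phi>)\<bar> \<le> B2" by metis
    have nn: "0 \<le> B1" "0 \<le> B2" using B(1)[of 0] B(2)[of 0] r(1) by simp_all
    show ?thesis
    proof (rule bdd_borelI)
      have [measurable]: "(\<lambda>x. dapply T (tshift x \<phi>)) \<in> borel_measurable borel" for T
        by (rule borel_measurable_continuous_onI[OF regularisation_continuous])
      show "w \<phi> \<in> borel_measurable borel" unfolding w_def by measurable
      show "\<bar>w \<phi> x\<bar> \<le> B1 + B2" for x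
      proof (cases "x \<in> {- r..r}")
        case True then show ?thesis using B[OF True] nn by (simp add: w_def)
      next
        case False
        then have "r \<le> \<bar>x\<bar>" by auto
        then have "w \<phi> x = 0" using w0[of \<phi> r x] sup by blast
        then show ?thesis using nn by simp
      qed
    qed
  qed
  have wadd: "w (\<phi> + \<psi>) = (\<lambda>x. w \<phi> x + w \<psi> x)" for \<phi> \<psi>
    by (simp add: w_def fun_eq_iff linear_add[OF tshift_linear] linear_add[OF dapply_linear])
  have wscale: "w (c *\<^sub>R \<phi>) = (\<lambda>x. c * w \<phi> x)" for c \<phi>
    by (simp add: w_def fun_eq_iff linear_scale[OF tshift_linear] linear_scale[OF dapply_linear])
  have lin: "linear (\<lambda>\<phi>. smeas_integral \<sigma> (w \<phi>))"
    by (rule linearI) (simp_all add: wadd wscale smeas_integral_add wb smeas_integral_scale)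
  have null: "(\<lambda>n. smeas_integral \<sigma> (w (\<phi> n))) \<longlonglongrightarrow> 0" if \<phi>: "test_null \<phi>" for \<phi>
  proof (rule tendstoI)
    obtain r where r: "0 < r" "\<And>n t. t \<in> support (tapply (\<phi> n)) \<Longrightarrow> \<bar>t\<bar> < r" using test_null_support[OF \<phi>] by blast
    fix \<epsilon> :: real assume \<epsilon>: "0 < \<epsilon>"
    define d where "d = \<epsilon> / (tv_mass \<sigma> + 1)"
    have tv: "0 \<le> tv_mass \<sigma>" by (simp add: tv_mass_def)
    have d: "0 < d" using \<epsilon> tv by (simp add: d_def)
    define x where "x n = (if \<exists>x. d \<le> \<bar>w (\<phi> n) x\<bar> then SOME x. d \<le> \<bar>w (\<phi> n) x\<bar> else 0)" for n
    have x: "d \<le> \<bar>w (\<phi> n) (x n)\<bar>" if "d \<le> \<bar>w (\<phi> n) y\<bar>" for n y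
      using someI[of "\<lambda>x. d \<le> \<bar>w (\<phi> n) x\<bar>" y] that by (auto simp: x_def)
    have xr: "\<bar>x n\<bar> \<le> r" for n
    proof (cases "\<exists>y. d \<le> \<bar>w (\<phi> n) y\<bar>")
      case True
      then have "d \<le> \<bar>w (\<phi> n) (x n)\<bar>" using x by blast
      then have "w (\<phi> n) (x n) \<noteq> 0" using d by auto
      then show ?thesis using w0[of "\<phi> n" r "x n"] r(2) by force
    next
      case False then show ?thesis using r(1) by (simp add: x_def)
    qed
    have lim: "(\<lambda>n. \<bar>dapply E (tshift (x n) (\<phi> n))\<bar> + \<bar>dapply G (tshift (x n) (\<phi> n))\<bar>) \<longlonglongrightarrow> 0 + 0"
      by (intro tendsto_add tendsto_rabs_zero dapply_null test_null_tshift_bounded[OF \<phi> xr])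
    then have "\<forall>\<^sub>F n in sequentially. \<bar>dapply E (tshift (x n) (\<phi> n))\<bar> + \<bar>dapply G (tshift (x n) (\<phi> n))\<bar> < d"
      using d by (intro order_tendstoD(2)) simp_all
    then show "\<forall>\<^sub>F n in sequentially. dist (smeas_integral \<sigma> (w (\<phi> n))) 0 < \<epsilon>"
    proof (rule eventually_mono)
      fix n assume n: "\<bar>dapply E (tshift (x n) (\<phi> n))\<bar> + \<bar>dapply G (tshift (x n) (\<phi> n))\<bar> < d"
      have "\<bar>w (\<phi> n) (x n)\<bar> \<le> \<bar>dapply E (tshift (x n) (\<phi> n))\<bar> + \<bar>dapply G (tshift (x n) (\<phi> n))\<bar>"
        by (simp add: w_def)
      then have "\<bar>w (\<phi> n) (x n)\<bar> < d" using n by (rule le_less_trans)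
      then have "\<bar>w (\<phi> n) y\<bar> \<le> d" for y using x[of n y] by force
      then have "\<bar>smeas_integral \<sigma> (w (\<phi> n))\<bar> \<le> d * tv_mass \<sigma>" by (intro smeas_integral_bound wb)
      also have "\<dots> < \<epsilon>" using \<epsilon> tv by (simp add: d_def field_simps)
      finally show "dist (smeas_integral \<sigma> (w (\<phi> n))) 0 < \<epsilon>" by (simp add: dist_real_def)
    qed
  qed
  define T where "T = Abs_distr (\<lambda>\<phi>. smeas_integral \<sigma> (w \<phi>))"
  have T: "dapply T = (\<lambda>\<phi>. smeas_integral \<sigma> (w \<phi>))"
    unfolding T_def using lin null by (intro Abs_distr_inverse) simp
  have "odo p T = meas_distr \<sigma>"
  proof (rule distr_eqI)
    fix \<phi>
    have "w (tad p \<phi>) x = tapply \<phi> x" for x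
    proof -
      have "dapply F (tshift x (tad p \<phi>)) = tapply \<phi> x" if "odo p F = dirac 0" for F
      proof -
        have "dapply F (tshift x (tad p \<phi>)) = dapply (odo p F) (tshift x \<phi>)" by (simp add: dapply_odo tad_tshift)
        then show ?thesis by (simp add: that dirac.rep_eq tshift.rep_eq)
      qed
      then show ?thesis using E(1) G(1) by (simp add: w_def)
    qed
    then have "w (tad p \<phi>) = tapply \<phi>" by (rule ext)
    then show "dapply (odo p T) \<phi> = dapply (meas_distr \<sigma>) \<phi>" by (simp add: dapply_odo T meas_distr_apply)
  qed
  then show ?thesis by blast
qed

section \<open>Matrices of differential operators\<close>

subsection \<open>The adjugate matrix\<close>

text \<open>Laplace expansion in the multilinear form of Cramer's rule: the entries of the adjugate are
  determinants with one row replaced by a unit vector, and expanding a row of \<open>L\<close> in unit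
  vectors gives the determinant with one row replaced by another.\<close>

lemma right_adjugate:
  fixes L :: "'a::comm_ring_1 ^ 'n ^ 'n"
  shows "\<exists>M. L ** M = mat (det L)"
proof -
  define M where "M = (\<chi> i s. det (\<chi> r. if r = s then axis i 1 else L $ r))"
  have "(\<Sum>i\<in>UNIV. L $ r $ i * M $ i $ s) = (if r = s then det L else 0)" for r s
  proof -
    have row: "(\<Sum>i\<in>UNIV. L $ r $ i *s axis i 1) = L $ r"
      by (simp add: vec_eq_iff vector_scalar_mult_def axis_def if_distrib sum.delta' cong: if_cong)
    have "(\<Sum>i\<in>UNIV. L $ r $ i * M $ i $ s) = (\<Sum>i\<in>UNIV. det (\<chi> k. if k = s then L $ r $ i *s axis i 1 else L $ k))"
      by (simp add: M_def det_row_mul)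
    also have "\<dots> = det (\<chi> k. if k = s then \<Sum>i\<in>UNIV. L $ r $ i *s axis i 1 else L $ k)"
      by (rule det_linear_row_sum[symmetric]) simp
    also have "\<dots> = det (\<chi> k. if k = s then L $ r else L $ k)" by (simp only: row)
    also have "\<dots> = (if r = s then det L else 0)"
    proof (cases "r = s")
      case True
      then have "(\<chi> k. if k = s then L $ r else L $ k) = L" by (simp add: vec_eq_iff)
      then show ?thesis using True by simp
    next
      case False
      then show ?thesis by (simp add: det_identical_rows[of r s] row_def)
    qed
    finally show ?thesis .
  qed
  then have "L ** M = mat (det L)" by (simp add: matrix_matrix_mult_def mat_def vec_eq_iff)
  then show ?thesis by blast
qed

lemma mat_mult: "mat c ** (A :: 'a::comm_ring_1 ^ 'n ^ 'n) = (\<chi> i j. c * A $ i $ j)"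
  "(A :: 'a::comm_ring_1 ^ 'n ^ 'n) ** mat c = (\<chi> i j. c * A $ i $ j)"
  by (simp_all add: matrix_matrix_mult_def mat_def vec_eq_iff if_distrib if_distribR sum.delta sum.delta' mult.commute cong: if_cong)

text \<open>Transposing gives a left adjugate; over an integral domain it coincides with the right one.\<close>

lemma adjugate:
  fixes L :: "'a::idom ^ 'n ^ 'n"
  assumes "det L \<noteq> 0"
  shows "\<exists>M. L ** M = mat (det L) \<and> M ** L = mat (det L)"
proof -
  obtain M where M: "L ** M = mat (det L)" using right_adjugate by blast
  obtain N where "transpose L ** N = mat (det L)" using right_adjugate[of "transpose L"] by auto
  then have "transpose (transpose L ** N) = transpose (mat (det L))" by simp
  then have N: "transpose N ** L = mat (det L)" by (simp add: matrix_transpose_mul)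
  have "mat (det L) ** M = (transpose N ** L) ** M" by (simp only: N)
  also have "\<dots> = transpose N ** (L ** M)" by (simp only: matrix_mul_assoc)
  also have "\<dots> = transpose N ** mat (det L)" by (simp only: M)
  finally have "M = transpose N" using assms by (simp add: mat_mult vec_eq_iff)
  then show ?thesis using M N by blast
qed

subsection \<open>Linearity and composition\<close>

lemma mdo_linear: "linear (mdo L)"
  by (rule linearI)
    (simp_all add: mdo_def vec_eq_iff linear_add[OF odo_linear] linear_scale[OF odo_linear] sum.distrib scaleR_sum_right)

lemma odo_sum: "odo (\<Sum>i\<in>I. p i) T = (\<Sum>i\<in>I. odo (p i) T)"
  by (induction I rule: infinite_finite_induct) (simp_all add: odo_add odo_def[of 0])

lemma mdo_mult: "mdo (L ** M) f = mdo L (mdo M f)"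
proof -
  have "(\<Sum>d\<in>UNIV. odo ((L ** M) $ r $ d) (f $ d)) = (\<Sum>k\<in>UNIV. odo (L $ r $ k) (\<Sum>d\<in>UNIV. odo (M $ k $ d) (f $ d)))" for r
  proof -
    have "(\<Sum>d\<in>UNIV. odo ((L ** M) $ r $ d) (f $ d)) = (\<Sum>d\<in>UNIV. \<Sum>k\<in>UNIV. odo (L $ r $ k) (odo (M $ k $ d) (f $ d)))"
      by (simp add: matrix_matrix_mult_def odo_sum odo_mult)
    also have "\<dots> = (\<Sum>k\<in>UNIV. \<Sum>d\<in>UNIV. odo (L $ r $ k) (odo (M $ k $ d) (f $ d)))" by (rule sum.swap)
    finally show ?thesis by (simp add: linear_sum[OF odo_linear])
  qed
  then show ?thesis by (simp add: mdo_def vec_eq_iff)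
qed

lemma mdo_mat: "mdo (mat p) f = (\<chi> d. odo p (f $ d))"
proof -
  have "(\<Sum>d\<in>UNIV. odo (mat p $ r $ d) (f $ d)) = (\<Sum>d\<in>UNIV. if d = r then odo p (f $ d) else 0)" for r
    by (intro sum.cong) (simp_all add: mat_def odo_def[of 0])
  then show ?thesis by (simp add: mdo_def vec_eq_iff)
qed

text \<open>Solve \<open>det L\<close> componentwise and apply the adjugate.\<close>

lemma mdo_surjective_measures:
  assumes "mdo_invertible L"
  shows "\<exists>f. mdo L f = mvec \<mu>"
proof -
  have det: "det L \<noteq> 0" using assms by (simp add: mdo_invertible_def)
  obtain M where M: "L ** M = mat (det L)" using right_adjugate by blast
  have "\<forall>d. \<exists>T. odo (det L) T = meas_distr (\<mu> $ d)" using odo_surjective_measures[OF det] by blast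
  from choice[OF this] obtain T where T: "\<And>d. odo (det L) (T d) = meas_distr (\<mu> $ d)" by blast
  have "mdo L (mdo M (\<chi> d. T d)) = mvec \<mu>"
    unfolding mdo_mult[symmetric] M mdo_mat by (simp add: T mvec_def)
  then show ?thesis by blast
qed

lemma null_space_subspace: "subspace (null_space L)"
  unfolding null_space_def by (rule linear_subspace_kernel[OF mdo_linear])

subsection \<open>The Green matrix\<close>

text \<open>The adjugate applied to a causal fundamental solution of \<open>det L\<close> is a causal
  Green matrix. Applying the adjugate to the difference of two of them gives causal solutions of the
  homogeneous scalar equation for \<open>det L\<close>, which vanish.\<close>

lemma green_properties:
  assumes "mdo_invertible L"
  shows "mdo_mat L (green L) = (\<chi> r c. if r = c then dirac 0 else 0)"
    and "supported_in (green L $ r $ c) {0..}"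
proof -
  let ?P = "\<lambda>G. mdo_mat L G = (\<chi> r c. if r = c then dirac 0 else 0) \<and> (\<forall>r c. supported_in (G $ r $ c) {0..})"
  have det: "det L \<noteq> 0" using assms by (simp add: mdo_invertible_def)
  obtain M where M: "L ** M = mat (det L)" "M ** L = mat (det L)" using adjugate[OF det] by blast
  obtain E where E: "odo (det L) E = dirac 0" "supported_in E {0..}" using fundamental_solution[OF det] by blast
  define G where "G = (\<chi> r c. odo (M $ r $ c) E)"
  have ex: "?P G"
  proof
    have "mdo L (column c G) = (\<chi> r. if r = c then dirac 0 else 0)" for c
    proof -
      have "column c G = mdo M (axis c E)"
      proof -
        have "(\<Sum>d\<in>UNIV. odo (M $ r $ d) (axis c E $ d)) = (\<Sum>d\<in>UNIV. if d = c then odo (M $ r $ d) E else 0)" for r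
          by (intro sum.cong) (simp_all add: axis_def linear_0[OF odo_linear])
        then show ?thesis by (simp add: column_def G_def mdo_def vec_eq_iff)
      qed
      then have "mdo L (column c G) = mdo (mat (det L)) (axis c E)" by (simp add: M(1) flip: mdo_mult)
      then show ?thesis by (simp add: mdo_mat vec_eq_iff axis_def E(1) linear_0[OF odo_linear])
    qed
    then show "mdo_mat L G = (\<chi> r c. if r = c then dirac 0 else 0)" by (simp add: mdo_mat_def vec_eq_iff)
    show "\<forall>r c. supported_in (G $ r $ c) {0..}" by (simp add: G_def supported_in_odo[OF E(2)])
  qed
  have uniq: "H = G" if H: "?P H" for H
  proof -
    have "H $ d $ c = G $ d $ c" for d c
    proof -
      let ?q = "column c H - column c G"
      have "mdo L (column c H) = mdo L (column c G)"
      proof -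
        have "mdo_mat L H = mdo_mat L G" using H ex by simp
        then show ?thesis by (simp add: mdo_mat_def vec_eq_iff)
      qed
      then have "mdo L ?q = 0" by (simp add: linear_diff[OF mdo_linear])
      then have "mdo (mat (det L)) ?q = 0" by (simp add: M(2)[symmetric] mdo_mult linear_0[OF mdo_linear])
      then have "odo (det L) (?q $ d) = 0" by (simp add: mdo_mat vec_eq_iff)
      moreover have "supported_in (?q $ d) {0..}"
        using H ex by (simp add: supported_in_def column_def dapply_simps)
      ultimately have "?q $ d = 0" by (rule causal_solution_zero[OF det])
      then show ?thesis by (simp add: column_def)
    qed
    then show ?thesis by (simp add: vec_eq_iff)
  qed
  have "?P (green L)" unfolding green_def by (rule theI[of ?P, OF ex uniq])
  then show "mdo_mat L (green L) = (\<chi> r c. if r = c then dirac 0 else 0)" "supported_in (green L $ r $ c) {0..}"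
    by blast+
qed

lemma conv_scaled_dirac: "conv S (w *\<^sub>R dirac a) = w *\<^sub>R dshift a S"
  unfolding conv_def
proof (rule the_equality)
  have test: "\<psi> = w *\<^sub>R tshift a \<phi>" if "\<And>x. tapply \<psi> x = dapply (w *\<^sub>R dirac a) (tshift x \<phi>)" for \<psi> \<phi>
    by (rule tapply_inject[THEN iffD1])
      (simp add: fun_eq_iff that scaleR_test.rep_eq scaleR_distr.rep_eq dirac.rep_eq tshift.rep_eq add.commute)
  have val: "dapply (w *\<^sub>R dshift a S) \<phi> = dapply S (w *\<^sub>R tshift a \<phi>)" for \<phi>
    by (simp add: scaleR_distr.rep_eq dshift.rep_eq linear_scale[OF dapply_linear])
  have "(\<forall>x. tapply (w *\<^sub>R tshift a \<phi>) x = dapply (w *\<^sub>R dirac a) (tshift x \<phi>))" for \<phi>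
    by (simp add: scaleR_test.rep_eq scaleR_distr.rep_eq dirac.rep_eq tshift.rep_eq add.commute)
  then show "\<forall>\<phi>. \<exists>\<psi>. (\<forall>x. tapply \<psi> x = dapply (w *\<^sub>R dirac a) (tshift x \<phi>)) \<and> dapply (w *\<^sub>R dshift a S) \<phi> = dapply S \<psi>"
    using val by blast
  fix U
  assume U: "\<forall>\<phi>. \<exists>\<psi>. (\<forall>x. tapply \<psi> x = dapply (w *\<^sub>R dirac a) (tshift x \<phi>)) \<and> dapply U \<phi> = dapply S \<psi>"
  show "U = w *\<^sub>R dshift a S"
  proof (rule distr_eqI)
    fix \<phi>
    obtain \<psi> where \<psi>: "\<And>x. tapply \<psi> x = dapply (w *\<^sub>R dirac a) (tshift x \<phi>)" "dapply U \<phi> = dapply S \<psi>"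
      using U by blast
    then show "dapply U \<phi> = dapply (w *\<^sub>R dshift a S) \<phi>" using test[OF \<psi>(1)] val by simp
  qed
qed

lemma dshift_dirac: "dshift a (dirac 0) = dirac a"
  by (rule distr_eqI) (simp add: dshift.rep_eq dirac.rep_eq tshift.rep_eq)

lemma mdo_mconv_green:
  assumes "mdo_invertible L"
  shows "mdo L (mconv (green L) (odot w (diracs x))) = odot w (diracs x)"
proof -
  let ?G = "green L"
  have G: "(\<Sum>d\<in>UNIV. odo (L $ r $ d) (?G $ d $ c)) = (if r = c then dirac 0 else 0)" for r c
    using green_properties(1)[OF assms] by (simp add: mdo_mat_def mdo_def column_def vec_eq_iff)
  have "mdo L (mconv ?G (odot w (diracs x))) $ r = odot w (diracs x) $ r" for r
  proof -
    have "mdo L (mconv ?G (odot w (diracs x))) $ r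
        = (\<Sum>d\<in>UNIV. \<Sum>c\<in>UNIV. w $ c *\<^sub>R dshift (x $ c) (odo (L $ r $ d) (?G $ d $ c)))"
      by (simp add: mdo_def mconv_def odot_def diracs_def conv_scaled_dirac linear_sum[OF odo_linear]
          linear_scale[OF odo_linear] odo_dshift)
    also have "\<dots> = (\<Sum>c\<in>UNIV. w $ c *\<^sub>R dshift (x $ c) (\<Sum>d\<in>UNIV. odo (L $ r $ d) (?G $ d $ c)))"
      by (subst sum.swap) (simp add: linear_sum[OF dshift_linear] scaleR_sum_right)
    also have "\<dots> = (\<Sum>c\<in>UNIV. if c = r then w $ c *\<^sub>R dirac (x $ c) else 0)"
      by (intro sum.cong) (simp_all add: G dshift_dirac linear_0[OF dshift_linear])
    finally show ?thesis by (simp add: odot_def diracs_def)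
  qed
  then show ?thesis by (simp add: vec_eq_iff)
qed

subsection \<open>Test functions orthogonal to the null space\<close>

lemma pairing_mdo:
  "pairing (mdo L f) v = pairing f (\<chi> s. \<Sum>r\<in>UNIV. tad (L $ r $ s) (v $ r))"
proof -
  have "pairing (mdo L f) v = (\<Sum>r\<in>UNIV. \<Sum>s\<in>UNIV. dapply (f $ s) (tad (L $ r $ s) (v $ r)))"
    by (simp add: pairing_def mdo_def dapply_sum dapply_odo)
  also have "\<dots> = (\<Sum>s\<in>UNIV. \<Sum>r\<in>UNIV. dapply (f $ s) (tad (L $ r $ s) (v $ r)))" by (rule sum.swap)
  finally show ?thesis by (simp add: pairing_def linear_sum[OF dapply_linear])
qed

lemma regularisation_test:
  assumes "\<And>x. B \<le> \<bar>x\<bar> \<Longrightarrow> (\<Sum>c\<in>UNIV. dapply (T c) (tshift x (\<phi> c))) = 0"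
  shows "\<exists>v. \<forall>x. tapply v x = (\<Sum>c\<in>(UNIV :: 'd::finite set). dapply (T c) (tshift x (\<phi> c)))"
proof -
  let ?f = "\<lambda>x. \<Sum>c\<in>UNIV. dapply (T c) (tshift x (\<phi> c))"
  have "smooth_fun ?f"
  proof (rule smooth_fun_from_closed_set[of "range (\<lambda>\<phi> x. \<Sum>c\<in>UNIV. dapply (T c) (tshift x (\<phi> c)))"])
    fix g assume "g \<in> range (\<lambda>\<phi> x. \<Sum>c\<in>UNIV. dapply (T c) (tshift x (\<phi> c)))"
    then obtain \<psi> where g: "g = (\<lambda>x. \<Sum>c\<in>UNIV. dapply (T c) (tshift x (\<psi> c)))" by blast
    have "(g has_field_derivative (\<Sum>c\<in>UNIV. dapply (T c) (tshift x (tdiff (\<psi> c))))) (at x)" for x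
      unfolding g by (intro DERIV_sum regularisation_deriv)
    then show "\<exists>g'\<in>range (\<lambda>\<phi> x. \<Sum>c\<in>UNIV. dapply (T c) (tshift x (\<phi> c))). \<forall>x. (g has_field_derivative g' x) (at x)"
      by (intro bexI[of _ "\<lambda>x. \<Sum>c\<in>UNIV. dapply (T c) (tshift x (tdiff (\<psi> c)))"] allI) (simp_all add: image_iff exI[of _ "\<lambda>c. tdiff (\<psi> c)"])
  qed simp
  moreover have "support ?f \<subseteq> {- B..B}"
  proof (rule support_subset)
    fix x assume "x \<notin> {- B..B}"
    then show "?f x = 0" by (intro assms) auto
  qed simp
  then have "compact (support ?f)" by (rule compact_support_mono[OF compact_Icc])
  ultimately have "tapply (Abs_test ?f) = ?f" by (intro Abs_test_inverse) simp
  then show ?thesis by (intro exI[of _ "Abs_test ?f"]) simp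
qed

text \<open>Solve \<open>L\<^sup>* v = \<psi>\<close> with the transposed, hence anticausal, fundamental solution. To the left of
  the support of \<open>\<psi>\<close> the fundamental solution can be replaced by a homogeneous one, so that \<open>v\<close> is a
  pairing of \<open>\<psi>\<close> with null space elements and vanishes there as well.\<close>

lemma orthogonal_imp_adjoint_image:
  fixes L :: "real poly ^ 'd ^ 'd"
  assumes L: "mdo_invertible L" and orth: "\<And>q. q \<in> null_space L \<Longrightarrow> pairing q \<psi> = 0"
  shows "\<exists>v. (\<forall>s. \<psi> $ s = (\<Sum>r\<in>UNIV. tad (L $ r $ s) (v $ r)))"
proof -
  have det: "det L \<noteq> 0" using L by (simp add: mdo_invertible_def)
  obtain M where M: "L ** M = mat (det L)" "M ** L = mat (det L)" using adjugate[OF det] by blast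
  obtain E e where E: "odo (det L) E = dirac 0" "supported_in E {0..}" "odo (det L) e = 0" "supported_in (E - e) {..0}"
    using fundamental_solution[OF det] by blast
  have "\<exists>b. \<forall>d t. t \<in> support (tapply (\<psi> $ d)) \<longrightarrow> \<bar>t\<bar> < b"
  proof -
    have "\<exists>r. \<forall>t. t \<in> support (tapply (\<psi> $ d)) \<longrightarrow> \<bar>t\<bar> < r" for d
      using test_support_bounded[of "\<psi> $ d"] by (metis not_le)
    then have "\<forall>d. \<exists>r. \<forall>t. t \<in> support (tapply (\<psi> $ d)) \<longrightarrow> \<bar>t\<bar> < r" by (rule allI)
    from choice[OF this] obtain r where r: "\<And>d t. t \<in> support (tapply (\<psi> $ d)) \<Longrightarrow> \<bar>t\<bar> < r d" by blast
    have "\<bar>t\<bar> < (\<Sum>d\<in>UNIV. \<bar>r d\<bar>) + 1" if "t \<in> support (tapply (\<psi> $ d))" for d t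
    proof -
      have "\<bar>r d\<bar> \<le> (\<Sum>d\<in>UNIV. \<bar>r d\<bar>)" by (rule member_le_sum) simp_all
      then show ?thesis using r[OF that] by linarith
    qed
    then show ?thesis by blast
  qed
  then obtain b where b: "\<And>d t. t \<in> support (tapply (\<psi> $ d)) \<Longrightarrow> \<bar>t\<bar> < b" by blast
  have sup: "t \<in> support (tapply (tad p (\<psi> $ d))) \<Longrightarrow> \<bar>t\<bar> < b" for p d t using b support_tad by blast
  have zero: "(\<Sum>c\<in>UNIV. dapply E (tshift x (tad (M $ c $ r) (\<psi> $ c)))) = 0" if x: "\<bar>b\<bar> \<le> \<bar>x\<bar>" for x r
  proof (cases "0 \<le> x")
    case True
    have "dapply E (tshift x (tad (M $ c $ r) (\<psi> $ c))) = 0" for c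
    proof (rule regularisation_0[OF E(2)])
      show "t - x \<notin> {0..}" if "t \<in> support (tapply (tad (M $ c $ r) (\<psi> $ c)))" for t
        using sup[OF that] x True by auto
    qed
    then show ?thesis by simp
  next
    case False
    have Ee: "dapply E (tshift x (tad (M $ c $ r) (\<psi> $ c))) = dapply e (tshift x (tad (M $ c $ r) (\<psi> $ c)))" for c
    proof -
      have "dapply (E - e) (tshift x (tad (M $ c $ r) (\<psi> $ c))) = 0"
      proof (rule regularisation_0[OF E(4)])
        show "t - x \<notin> {..0}" if "t \<in> support (tapply (tad (M $ c $ r) (\<psi> $ c)))" for t
          using sup[OF that] x False by auto
      qed
      then show ?thesis by (simp add: minus_distr.rep_eq)
    qed
    define q where "q = (\<chi> c. dshift x (odo (M $ c $ r) e))"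
    have "(\<Sum>d\<in>UNIV. odo (L $ s $ d) (odo (M $ d $ r) e)) = 0" for s
    proof -
      have "(\<Sum>d\<in>UNIV. odo (L $ s $ d) (odo (M $ d $ r) e)) = odo ((L ** M) $ s $ r) e"
        by (simp add: matrix_matrix_mult_def odo_sum odo_mult)
      then show ?thesis by (simp add: M(1) mat_def E(3) odo_def[of 0])
    qed
    then have "mdo L q = 0"
      by (simp add: mdo_def q_def odo_dshift vec_eq_iff linear_sum[OF dshift_linear, symmetric] linear_0[OF dshift_linear])
    then have "pairing q \<psi> = 0" by (intro orth) (simp add: null_space_def)
    then show ?thesis by (simp add: Ee pairing_def q_def dshift.rep_eq dapply_odo tad_tshift)
  qed
  have "\<forall>r. \<exists>v. \<forall>x. tapply v x = (\<Sum>c\<in>UNIV. dapply E (tshift x (tad (M $ c $ r) (\<psi> $ c))))"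
    by (intro allI regularisation_test zero)
  from choice[OF this] obtain v
    where v: "\<And>r x. tapply (v r) x = (\<Sum>c\<in>UNIV. dapply E (tshift x (tad (M $ c $ r) (\<psi> $ c))))" by blast
  have tad_v: "tapply (tad p (v r)) x = (\<Sum>c\<in>UNIV. dapply E (tshift x (tad (p * (M $ c $ r)) (\<psi> $ c))))" for p r x
  proof -
    have Tn: "tapply ((tdiff ^^ n) (v r)) x = (\<Sum>c\<in>UNIV. dapply E (tshift x ((tdiff ^^ n) (tad (M $ c $ r) (\<psi> $ c)))))" for n x
    proof (induction n arbitrary: x)
      case (Suc n)
      have "tapply ((tdiff ^^ n) (v r)) = (\<lambda>x. \<Sum>c\<in>UNIV. dapply E (tshift x ((tdiff ^^ n) (tad (M $ c $ r) (\<psi> $ c)))))"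
        using Suc.IH by (rule ext)
      moreover have "deriv (\<lambda>x. \<Sum>c\<in>UNIV. dapply E (tshift x ((tdiff ^^ n) (tad (M $ c $ r) (\<psi> $ c))))) x
          = (\<Sum>c\<in>UNIV. dapply E (tshift x (tdiff ((tdiff ^^ n) (tad (M $ c $ r) (\<psi> $ c))))))"
        by (intro DERIV_imp_deriv DERIV_sum regularisation_deriv)
      ultimately show ?case by (simp add: tdiff.rep_eq)
    qed (simp add: v)
    have "tapply (tad p (v r)) x = (\<Sum>n\<le>degree p. \<Sum>c\<in>UNIV. coeff p n * ((- 1) ^ n *
        dapply E (tshift x ((tdiff ^^ n) (tad (M $ c $ r) (\<psi> $ c))))))"
      by (simp add: tad_def[of p] tneg_funpow tapply_sum scaleR_test.rep_eq Tn sum_distrib_left mult.assoc)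
    also have "\<dots> = (\<Sum>c\<in>UNIV. \<Sum>n\<le>degree p. coeff p n * ((- 1) ^ n *
        dapply E (tshift x ((tdiff ^^ n) (tad (M $ c $ r) (\<psi> $ c))))))" by (rule sum.swap)
    also have "\<dots> = (\<Sum>c\<in>UNIV. dapply E (tshift x (tad p (tad (M $ c $ r) (\<psi> $ c)))))"
      by (simp add: tad_def[of p] tneg_funpow linear_sum[OF tshift_linear] linear_scale[OF tshift_linear]
          linear_sum[OF dapply_linear] linear_scale[OF dapply_linear] mult.assoc)
    finally show ?thesis by (simp add: tad_mult)
  qed
  have "\<psi> $ s = (\<Sum>r\<in>UNIV. tad (L $ r $ s) (v r))" for s
  proof (rule tapply_inject[THEN iffD1], rule ext)
    fix x
    have "tapply (\<Sum>r\<in>UNIV. tad (L $ r $ s) (v r)) x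
        = (\<Sum>r\<in>UNIV. \<Sum>c\<in>UNIV. dapply E (tshift x (tad (L $ r $ s * M $ c $ r) (\<psi> $ c))))"
      by (simp add: tapply_sum tad_v)
    also have "\<dots> = (\<Sum>c\<in>UNIV. \<Sum>r\<in>UNIV. dapply E (tshift x (tad (L $ r $ s * M $ c $ r) (\<psi> $ c))))" by (rule sum.swap)
    also have "\<dots> = (\<Sum>c\<in>UNIV. dapply E (tshift x (tad (\<Sum>r\<in>UNIV. L $ r $ s * M $ c $ r) (\<psi> $ c))))"
      by (simp add: tad_sum linear_sum[OF tshift_linear] linear_sum[OF dapply_linear])
    also have "\<dots> = (\<Sum>c\<in>UNIV. dapply E (tshift x (tad ((M ** L) $ c $ s) (\<psi> $ c))))"
      by (simp add: matrix_matrix_mult_def mult.commute)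
    also have "\<dots> = (\<Sum>c\<in>UNIV. if c = s then dapply E (tshift x (tad (det L) (\<psi> $ c))) else 0)"
      by (intro sum.cong)
        (simp_all add: M(2) mat_def tad_def[of 0] linear_0[OF tshift_linear] linear_0[OF dapply_linear])
    also have "\<dots> = dapply (odo (det L) E) (tshift x (\<psi> $ s))" by (simp add: dapply_odo tad_tshift)
    also have "\<dots> = tapply (\<psi> $ s) x" by (simp add: E(1) dirac.rep_eq tshift.rep_eq)
    finally show "tapply (\<psi> $ s) x = tapply (\<Sum>r\<in>UNIV. tad (L $ r $ s) (v r)) x" by simp
  qed
  then show ?thesis by (intro exI[of _ "\<chi> r. v r"]) simp
qed

section \<open>Norms on tuples\<close>

lemma tuples_closed:
  shows "(\<lambda>_. 0) \<in> tuples N" and "a \<in> tuples N \<Longrightarrow> b \<in> tuples N \<Longrightarrow> (\<lambda>i. a i + b i) \<in> tuples N"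
    and "a \<in> tuples N \<Longrightarrow> (\<lambda>i. c * a i) \<in> tuples N"
  by (simp_all add: tuples_def)

locale tuple_norm =
  fixes N :: nat and Y :: "(nat \<Rightarrow> real) \<Rightarrow> real"
  assumes Y: "fun_norm_on (tuples N) Y"
begin

lemma Y_props:
  shows "a \<in> tuples N \<Longrightarrow> 0 \<le> Y a" and "a \<in> tuples N \<Longrightarrow> Y a = 0 \<Longrightarrow> a = (\<lambda>_. 0)"
    and "a \<in> tuples N \<Longrightarrow> Y (\<lambda>i. c * a i) = \<bar>c\<bar> * Y a"
    and "a \<in> tuples N \<Longrightarrow> b \<in> tuples N \<Longrightarrow> Y (\<lambda>i. a i + b i) \<le> Y a + Y b"
  using Y unfolding fun_norm_on_def by simp_all

lemma Y_0: "Y (\<lambda>_. 0) = 0"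
  using Y_props(3)[OF tuples_closed(1), of 0] by simp

definition unit :: "nat \<Rightarrow> nat \<Rightarrow> real" where "unit i = (\<lambda>j. if j = i \<and> i < N then 1 else 0)"

lemma unit: "unit i \<in> tuples N"
  by (auto simp: unit_def tuples_def)

lemma tuple_sum:
  assumes add: "\<And>a b. a \<in> tuples N \<Longrightarrow> b \<in> tuples N \<Longrightarrow> \<Phi> (\<lambda>i. a i + b i) = \<Phi> a + \<Phi> b"
    and scale: "\<And>a c. a \<in> tuples N \<Longrightarrow> \<Phi> (\<lambda>i. c * a i) = c * (\<Phi> a :: real)" and a: "a \<in> tuples N"
  shows "\<Phi> a = (\<Sum>i<N. a i * \<Phi> (unit i))"
proof -
  have sum: "(\<lambda>j. \<Sum>i<k. a i * unit i j) \<in> tuples N \<and> \<Phi> (\<lambda>j. \<Sum>i<k. a i * unit i j) = (\<Sum>i<k. a i * \<Phi> (unit i))" for k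
  proof (induction k)
    case 0
    show ?case using scale[OF tuples_closed(1), of 0] by (simp add: tuples_closed(1))
  next
    case (Suc k)
    have u: "(\<lambda>j. a k * unit k j) \<in> tuples N" by (rule tuples_closed(3)[OF unit])
    show ?case using add[OF conjunct1[OF Suc] u] tuples_closed(2)[OF conjunct1[OF Suc] u] Suc scale[OF unit] by simp
  qed
  have "(\<Sum>i<N. a i * unit i j) = a j" for j
  proof (cases "j < N")
    case True
    have "(\<Sum>i<N. a i * unit i j) = (\<Sum>i<N. if i = j then a i else 0)" by (intro sum.cong) (auto simp: unit_def)
    then show ?thesis using True by simp
  next
    case False
    then show ?thesis using a by (auto simp: unit_def tuples_def intro!: sum.neutral)
  qed
  then have "(\<lambda>j. \<Sum>i<N. a i * unit i j) = a" by (rule ext)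
  then show ?thesis using conjunct2[OF sum[of N]] by simp
qed

text \<open>Equivalence of norms in finite dimension, by compactness of the unit ball of the \<open>l1\<close> norm.\<close>

lemma coordinates_bounded: "\<exists>C\<ge>0. \<forall>a\<in>tuples N. (\<Sum>i<N. \<bar>a i\<bar>) \<le> C * Y a"
proof (rule ccontr)
  let ?l = "\<lambda>a :: nat \<Rightarrow> real. \<Sum>i<N. \<bar>a i\<bar>"
  assume "\<not> (\<exists>C\<ge>0. \<forall>a\<in>tuples N. ?l a \<le> C * Y a)"
  then have "\<not> (\<forall>a\<in>tuples N. ?l a \<le> real k * Y a)" for k using of_nat_0_le_iff by blast
  then have "\<forall>k. \<exists>a. a \<in> tuples N \<and> real k * Y a < ?l a" by (meson not_le)
  from choice[OF this] obtain a where a: "\<And>k. a k \<in> tuples N" "\<And>k. real k * Y (a k) < ?l (a k)" by blast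
  have pos: "0 < ?l (a k)" for k
    using le_less_trans[OF mult_nonneg_nonneg[OF of_nat_0_le_iff Y_props(1)[OF a(1)]] a(2)] .
  define b where "b k = (\<lambda>i. (1 / ?l (a k)) * a k i)" for k
  have b: "b k \<in> tuples N" "?l (b k) = 1" "real k * Y (b k) < 1" for k
  proof -
    show "b k \<in> tuples N" unfolding b_def by (rule tuples_closed(3)[OF a(1)])
    show "?l (b k) = 1" using pos[of k] by (simp add: b_def abs_mult sum_divide_distrib[symmetric] del: abs_sum_abs)
    show "real k * Y (b k) < 1"
      using a(2)[of k] pos[of k] by (simp only: b_def Y_props(3)[OF a(1)]) (simp add: field_simps)
  qed
  have "\<exists>l. \<exists>r. strict_mono r \<and> (\<forall>e>0. eventually (\<lambda>k. \<forall>i\<in>{..<N}. dist (b (r k) i) (l i) < e) sequentially)"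
  proof -
    have "\<forall>i\<in>{..<N}. bounded ((\<lambda>x. x i) ` range b)"
    proof
      fix i assume i: "i \<in> {..<N}"
      have "\<bar>b k i\<bar> \<le> 1" for k using member_le_sum[OF i, of "\<lambda>i. \<bar>b k i\<bar>"] b(2)[of k] by simp
      then show "bounded ((\<lambda>x. x i) ` range b)" unfolding bounded_iff by auto
    qed
    then have "\<forall>d\<subseteq>{..<N}. \<exists>l. \<exists>r. strict_mono r \<and> (\<forall>e>0. eventually (\<lambda>k. \<forall>i\<in>d. dist (b (r k) i) (l i) < e) sequentially)"
      by (intro compact_lemma_general[where unproj = "\<lambda>x. x"]) simp_all
    then show ?thesis by simp
  qed
  then obtain l r where r: "strict_mono r"
    and l: "\<And>e. 0 < e \<Longrightarrow> eventually (\<lambda>k. \<forall>i\<in>{..<N}. dist (b (r k) i) (l i) < e) sequentially" by blast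
  define m where "m i = (if i < N then l i else 0)" for i
  have m: "m \<in> tuples N" by (simp add: m_def tuples_def)
  have lim: "(\<lambda>k. b (r k) i) \<longlonglongrightarrow> m i" if "i < N" for i
  proof (rule tendstoI)
    fix e :: real assume "0 < e"
    from l[OF this] show "\<forall>\<^sub>F k in sequentially. dist (b (r k) i) (m i) < e"
      by (rule eventually_mono) (simp add: that m_def)
  qed

  have Ybound: "Y a \<le> (\<Sum>i<N. \<bar>a i\<bar> * Y (unit i))" if a: "a \<in> tuples N" for a
  proof -
    have sum: "(\<lambda>j. \<Sum>i<k. a i * unit i j) \<in> tuples N \<and> Y (\<lambda>j. \<Sum>i<k. a i * unit i j) \<le> (\<Sum>i<k. \<bar>a i\<bar> * Y (unit i))" for k
    proof (induction k)
      case 0 show ?case by (simp add: tuples_closed(1) Y_0)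
    next
      case (Suc k)
      have u: "(\<lambda>j. a k * unit k j) \<in> tuples N" by (rule tuples_closed(3)[OF unit])
      show ?case using Y_props(4)[OF conjunct1[OF Suc] u] tuples_closed(2)[OF conjunct1[OF Suc] u] Suc
          Y_props(3)[OF unit, of "a k" k] by simp
    qed
    have "(\<lambda>j. \<Sum>i<N. a i * unit i j) = a"
    proof
      fix j show "(\<Sum>i<N. a i * unit i j) = a j"
        using tuple_sum[of "\<lambda>a. a j" a] a by simp
    qed
    then show ?thesis using conjunct2[OF sum[of N]] by simp
  qed
  have "Y m \<le> 0"
  proof (rule LIMSEQ_le_const)
    have "(\<lambda>k. (\<Sum>i<N. \<bar>m i + - 1 * b (r (Suc k)) i\<bar> * Y (unit i)) + inverse (real (Suc k)))
        \<longlonglongrightarrow> (\<Sum>i<N. \<bar>m i + - 1 * m i\<bar> * Y (unit i)) + 0"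
      by (intro tendsto_add tendsto_sum tendsto_mult tendsto_rabs tendsto_const
          LIMSEQ_inverse_real_of_nat LIMSEQ_Suc[OF lim]) simp
    then show "(\<lambda>k. (\<Sum>i<N. \<bar>m i + - 1 * b (r (Suc k)) i\<bar> * Y (unit i)) + inverse (real (Suc k))) \<longlonglongrightarrow> 0"
      by simp
    show "\<exists>K. \<forall>k\<ge>K. Y m \<le> (\<Sum>i<N. \<bar>m i + - 1 * b (r (Suc k)) i\<bar> * Y (unit i)) + inverse (real (Suc k))"
    proof (intro exI allI impI)
      fix k
      let ?b = "b (r (Suc k))"
      have d: "(\<lambda>i. m i + - 1 * ?b i) \<in> tuples N" by (intro tuples_closed m b)
      have "Y m = Y (\<lambda>i. (m i + - 1 * ?b i) + ?b i)" by simp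
      also have "\<dots> \<le> Y (\<lambda>i. m i + - 1 * ?b i) + Y ?b" by (rule Y_props(4)[OF d b(1)])
      also have "Y (\<lambda>i. m i + - 1 * ?b i) \<le> (\<Sum>i<N. \<bar>m i + - 1 * ?b i\<bar> * Y (unit i))" by (rule Ybound[OF d])
      also have "Y ?b \<le> inverse (real (Suc k))"
      proof -
        have "real (Suc k) * Y ?b \<le> real (r (Suc k)) * Y ?b"
          using seq_suble[OF r, of "Suc k"] by (intro mult_right_mono Y_props(1) b) (simp only: of_nat_le_iff)
        then have "real (Suc k) * Y ?b \<le> 1" using b(3)[of "r (Suc k)"] by linarith
        then show ?thesis by (simp add: inverse_eq_divide pos_le_divide_eq mult.commute)
      qed
      finally show "Y m \<le> (\<Sum>i<N. \<bar>m i + - 1 * ?b i\<bar> * Y (unit i)) + inverse (real (Suc k))" by simp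
    qed
  qed
  then have m0: "m = (\<lambda>_. 0)" using Y_props(1)[OF m] by (intro Y_props(2)[OF m]) simp
  have "(\<lambda>k. ?l (b (r k))) \<longlonglongrightarrow> ?l m" by (intro tendsto_sum tendsto_rabs lim) simp
  then have "?l m = 1" unfolding b(2) by (simp add: LIMSEQ_const_iff)
  then show False unfolding m0 by simp
qed

definition T :: "(nat \<Rightarrow> real) \<Rightarrow> real" where "T = tuple_dual_norm N Y"

lemma T_bdd: "bdd_above ((\<lambda>a. \<Sum>i<N. b i * a i) ` {a \<in> tuples N. Y a \<le> 1})"
proof -
  obtain C where C: "0 \<le> C" "\<And>a. a \<in> tuples N \<Longrightarrow> (\<Sum>i<N. \<bar>a i\<bar>) \<le> C * Y a" using coordinates_bounded by blast
  define B where "B = (\<Sum>i<N. \<bar>b i\<bar>)"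
  have B: "0 \<le> B" by (simp add: B_def sum_nonneg)
  show ?thesis
  proof (rule bdd_aboveI2)
    fix a assume "a \<in> {a \<in> tuples N. Y a \<le> 1}"
    then have a: "a \<in> tuples N" "Y a \<le> 1" by simp_all
    have "(\<Sum>i<N. \<bar>a i\<bar>) \<le> C" using C(2)[OF a(1)] mult_left_le[OF a(2) C(1)] by linarith
    have "(\<Sum>i<N. b i * a i) \<le> (\<Sum>i<N. B * \<bar>a i\<bar>)"
    proof (rule sum_mono)
      fix i assume i: "i \<in> {..<N}"
      have "b i * a i \<le> \<bar>b i\<bar> * \<bar>a i\<bar>" by (metis abs_ge_self abs_mult)
      also have "\<dots> \<le> B * \<bar>a i\<bar>" unfolding B_def
        by (intro mult_right_mono member_le_sum i) simp_all
      finally show "b i * a i \<le> B * \<bar>a i\<bar>" .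
    qed
    also have "\<dots> = B * (\<Sum>i<N. \<bar>a i\<bar>)" by (simp add: sum_distrib_left)
    also have "\<dots> \<le> B * C" using B \<open>(\<Sum>i<N. \<bar>a i\<bar>) \<le> C\<close> by (rule mult_left_mono[rotated])
    finally show "(\<Sum>i<N. b i * a i) \<le> B * C" .
  qed
qed

lemma T_upper1: "a \<in> tuples N \<Longrightarrow> Y a \<le> 1 \<Longrightarrow> (\<Sum>i<N. b i * a i) \<le> T b"
  unfolding T_def tuple_dual_norm_def by (rule cSUP_upper[OF _ T_bdd]) simp

lemma T_least:
  assumes "\<And>a. a \<in> tuples N \<Longrightarrow> Y a \<le> 1 \<Longrightarrow> (\<Sum>i<N. b i * a i) \<le> c"
  shows "T b \<le> c"
  unfolding T_def tuple_dual_norm_def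
proof (rule cSUP_least)
  have "(\<lambda>_. 0) \<in> {a \<in> tuples N. Y a \<le> 1}" by (simp add: tuples_closed(1) Y_0)
  then show "{a \<in> tuples N. Y a \<le> 1} \<noteq> {}" by blast
  fix a assume "a \<in> {a \<in> tuples N. Y a \<le> 1}"
  then show "(\<Sum>i<N. b i * a i) \<le> c" by (intro assms) blast+
qed

lemma T_near: "0 < e \<Longrightarrow> \<exists>a\<in>tuples N. Y a \<le> 1 \<and> T b - e < (\<Sum>i<N. b i * a i)"
proof (rule ccontr)
  assume e: "0 < e" and no: "\<not> (\<exists>a\<in>tuples N. Y a \<le> 1 \<and> T b - e < (\<Sum>i<N. b i * a i))"
  have "T b \<le> T b - e"
  proof (rule T_least)
    fix a assume "a \<in> tuples N" "Y a \<le> 1"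
    then have "\<not> T b - e < (\<Sum>i<N. b i * a i)" using no by blast
    then show "(\<Sum>i<N. b i * a i) \<le> T b - e" by simp
  qed
  then show False using e by simp
qed

lemma T_nonneg: "0 \<le> T b"
  using T_upper1[OF tuples_closed(1), of b] by (simp add: Y_0)

lemma T_upper: "a \<in> tuples N \<Longrightarrow> (\<Sum>i<N. b i * a i) \<le> T b * Y a"
proof (cases "Y a = 0")
  case True
  assume a: "a \<in> tuples N"
  show ?thesis using Y_props(2)[OF a True] True by simp
next
  case False
  assume a: "a \<in> tuples N"
  have pos: "0 < Y a" using False Y_props(1)[OF a] by simp
  have "(\<Sum>i<N. b i * ((1 / Y a) * a i)) \<le> T b"
    using pos by (intro T_upper1 tuples_closed(3)[OF a]) (simp only: Y_props(3)[OF a], simp)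
  then have "(1 / Y a) * (\<Sum>i<N. b i * a i) \<le> T b" by (simp add: sum_distrib_left mult_ac)
  then show ?thesis using pos by (simp add: pos_divide_le_eq)
qed

lemma T_add: "T (\<lambda>i. b i + c i) \<le> T b + T c"
proof (rule T_least)
  fix a assume "a \<in> tuples N" "Y a \<le> 1"
  from T_upper1[OF this, of b] T_upper1[OF this, of c]
  show "(\<Sum>i<N. (b i + c i) * a i) \<le> T b + T c" by (simp add: distrib_right sum.distrib)
qed

lemma T_scale: "T (\<lambda>i. c * b i) = \<bar>c\<bar> * T b"
proof -
  have le: "T (\<lambda>i. c * b i) \<le> \<bar>c\<bar> * T b" for c b
  proof (rule T_least)
    fix a assume a: "a \<in> tuples N" "Y a \<le> 1"
    have "Y (\<lambda>i. sgn c * a i) \<le> 1"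
      using a Y_props(1)[OF a(1)] by (simp add: Y_props(3)[OF a(1)] abs_sgn_eq)
    from T_upper1[OF tuples_closed(3)[OF a(1)] this, of b]
    have "\<bar>c\<bar> * (\<Sum>i<N. b i * (sgn c * a i)) \<le> \<bar>c\<bar> * T b" by (rule mult_left_mono) simp
    moreover have "\<bar>c\<bar> * (\<Sum>i<N. b i * (sgn c * a i)) = (\<Sum>i<N. (c * b i) * a i)"
    proof -
      have "\<bar>c\<bar> * (b i * (sgn c * a i)) = (c * b i) * a i" for i
        using abs_mult_sgn[of c] by (metis mult.assoc mult.commute)
      then show ?thesis unfolding sum_distrib_left by (intro sum.cong refl)
    qed
    ultimately show "(\<Sum>i<N. (c * b i) * a i) \<le> \<bar>c\<bar> * T b" by simp
  qed
  show ?thesis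
  proof (cases "c = 0")
    case True
    then show ?thesis using le[of 0 b] T_nonneg[of "\<lambda>i. 0 * b i"] by simp
  next
    case False
    have "T b \<le> \<bar>1 / c\<bar> * T (\<lambda>i. c * b i)" using le[of "1 / c" "\<lambda>i. c * b i"] False by simp
    then have "\<bar>c\<bar> * T b \<le> T (\<lambda>i. c * b i)" using False by (simp add: field_simps)
    then show ?thesis using le[of c b] by simp
  qed
qed

lemma T_zero: "b \<in> tuples N \<Longrightarrow> T b = 0 \<Longrightarrow> b = (\<lambda>_. 0)"
proof -
  assume b: "b \<in> tuples N" and T: "T b = 0"
  have "(\<Sum>i<N. b i * b i) \<le> 0" using T_upper[OF b, of b] T by simp
  then have "(\<Sum>i<N. b i * b i) = 0" by (intro antisym sum_nonneg) simp_all
  then have "b i = 0" if "i < N" for i using that by (simp add: sum_nonneg_eq_0_iff)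
  then show ?thesis using b unfolding tuples_def by (intro ext) (metis (mono_tags, lifting) mem_Collect_eq not_le)
qed

end

section \<open>The native space\<close>

lemma pairing_linear: "linear (\<lambda>f. pairing f \<psi>)"
  by (rule linearI) (simp_all add: pairing_def dapply_simps sum.distrib sum_distrib_left)

lemma pairing_linear_test: "linear (pairing f)"
  by (rule linearI) (simp_all add: pairing_def linear_add[OF dapply_linear] linear_scale[OF dapply_linear] sum.distrib sum_distrib_left)

definition mu :: "real poly ^ 'd ^ 'd \<Rightarrow> distr ^ 'd \<Rightarrow> smeasure ^ 'd" where
  "mu L f = meas_of (mdo L f)"

lemma mvec_mu: "f \<in> native_space L \<Longrightarrow> mvec (mu L f) = mdo L f"
  by (auto simp: native_space_def mu_def)

lemma mu_eqI: "mdo L f = mvec \<mu> \<Longrightarrow> f \<in> native_space L \<and> mu L f = \<mu>"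
  by (simp add: native_space_def mu_def)

lemma native_lincomb:
  assumes "f \<in> native_space L" "h \<in> native_space L"
  shows "b *\<^sub>R f + c *\<^sub>R h \<in> native_space L \<and> mu L (b *\<^sub>R f + c *\<^sub>R h) = b *\<^sub>R mu L f + c *\<^sub>R mu L h"
  by (rule mu_eqI)
    (simp add: linear_add[OF mdo_linear] linear_scale[OF mdo_linear] linear_add[OF mvec_linear]
      linear_scale[OF mvec_linear] mvec_mu assms)

lemma native_subspace: "subspace (native_space L)"
proof (rule subspaceI)
  show "0 \<in> native_space L" using mu_eqI[of L 0 0] by (simp add: linear_0[OF mdo_linear] linear_0[OF mvec_linear])
  show "f + h \<in> native_space L" if "f \<in> native_space L" "h \<in> native_space L" for f h
    using native_lincomb[OF that, of 1 1] by simp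
  show "c *\<^sub>R f \<in> native_space L" if "f \<in> native_space L" for f c
    using native_lincomb[OF that that, of c 0] by simp
qed

lemma mu_zero_iff: "f \<in> native_space L \<Longrightarrow> mu L f = 0 \<longleftrightarrow> f \<in> null_space L"
  using mvec_mu[of f L] mu_eqI[of L f 0] by (auto simp: null_space_def linear_0[OF mvec_linear])

lemma null_subset_native: "null_space L \<subseteq> native_space L"
  using mu_eqI[of L _ 0] by (auto simp: null_space_def linear_0[OF mvec_linear])

locale native = tuple_norm "null_dim L" Y for L :: "real poly ^ 'd ^ 'd" and Y +
  fixes p :: "nat \<Rightarrow> distr ^ 'd" and \<phi> :: "nat \<Rightarrow> test ^ 'd"
  assumes inv: "mdo_invertible L" and adm: "admissible L p \<phi>"
begin

abbreviation "N \<equiv> null_dim L"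
abbreviation "V \<equiv> native_space L"

lemma biorthogonal: "n < N \<Longrightarrow> m < N \<Longrightarrow> pairing (p n) (\<phi> m) = (if m = n then 1 else 0)"
  using adm by (simp add: admissible_def)

lemma p_null: "n < N \<Longrightarrow> p n \<in> null_space L"
proof -
  assume "n < N"
  then have "p n \<in> span (p ` {..<N})" by (intro span_base) simp
  then show ?thesis using adm by (simp add: admissible_def)
qed

lemma null_expansion:
  assumes "q \<in> null_space L"
  shows "q = (\<Sum>n<N. pairing q (\<phi> n) *\<^sub>R p n)"
proof -
  have "q \<in> span (p ` {..<N})" and inj: "inj_on p {..<N}" using adm assms by (simp_all add: admissible_def)
  then have "q \<in> range (\<lambda>u. \<Sum>v\<in>p ` {..<N}. u v *\<^sub>R v)" by (simp add: span_finite)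
  then obtain u where "q = (\<Sum>v\<in>p ` {..<N}. u v *\<^sub>R v)" by blast
  then have q: "q = (\<Sum>n<N. u (p n) *\<^sub>R p n)" by (simp add: sum.reindex[OF inj])
  have "pairing q (\<phi> m) = u (p m)" if m: "m < N" for m
  proof -
    have "pairing q (\<phi> m) = (\<Sum>n<N. u (p n) * pairing (p n) (\<phi> m))"
      unfolding q by (simp add: linear_sum[OF pairing_linear] linear_scale[OF pairing_linear])
    also have "\<dots> = (\<Sum>n<N. if n = m then u (p n) else 0)" using m by (intro sum.cong) (simp_all add: biorthogonal)
    finally show ?thesis using m by simp
  qed
  then show ?thesis using q by simp
qed

lemma coords_tuples: "coords L \<phi> f \<in> tuples N"
  by (simp add: coords_def tuples_def)

lemma coords_lincomb: "coords L \<phi> (b *\<^sub>R f + c *\<^sub>R h) = (\<lambda>i. b * coords L \<phi> f i + c * coords L \<phi> h i)"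
  by (simp add: coords_def fun_eq_iff linear_add[OF pairing_linear] linear_scale[OF pairing_linear])

lemma native_eq_0:
  assumes "f \<in> V" "mu L f = 0" "coords L \<phi> f = (\<lambda>_. 0)"
  shows "f = 0"
proof -
  have "pairing f (\<phi> n) = 0" if "n < N" for n
    using assms(3) that unfolding coords_def fun_eq_iff by metis
  moreover have "f \<in> null_space L" using assms mu_zero_iff by blast
  ultimately show ?thesis using null_expansion[of f] by simp
qed

text \<open>A particular solution is corrected by an element of the null space. Together with the
  preceding lemma, this identifies the native space with pairs of a vector measure and a tuple.\<close>

lemma native_surjective:
  assumes b: "b \<in> tuples N"
  shows "\<exists>f\<in>V. mu L f = \<mu> \<and> coords L \<phi> f = b"
proof -
  obtain f0 where f0: "mdo L f0 = mvec \<mu>" using mdo_surjective_measures[OF inv] by blast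
  let ?q = "\<Sum>n<N. (b n - pairing f0 (\<phi> n)) *\<^sub>R p n"
  have "?q \<in> null_space L" by (intro subspace_sum subspace_scale null_space_subspace p_null) simp
  then have "mdo L (f0 + ?q) = mvec \<mu>" using f0 by (simp add: linear_add[OF mdo_linear] null_space_def)
  then have 1: "f0 + ?q \<in> V \<and> mu L (f0 + ?q) = \<mu>" by (rule mu_eqI)
  have "pairing (f0 + ?q) (\<phi> m) = b m" if m: "m < N" for m
  proof -
    have "pairing ?q (\<phi> m) = (\<Sum>n<N. (b n - pairing f0 (\<phi> n)) * pairing (p n) (\<phi> m))"
      by (simp add: linear_sum[OF pairing_linear] linear_scale[OF pairing_linear])
    also have "\<dots> = (\<Sum>n<N. if n = m then b n - pairing f0 (\<phi> n) else 0)"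
      using m by (intro sum.cong) (simp_all add: biorthogonal)
    finally show ?thesis using m by (simp add: linear_add[OF pairing_linear])
  qed
  then have "coords L \<phi> (f0 + ?q) = b" using b by (auto simp: coords_def tuples_def fun_eq_iff)
  then show ?thesis using 1 by blast
qed

text \<open>The value at \<open>f\<close> of the element of the predual with parameters \<open>v\<close> and \<open>a\<close>.\<close>

definition val :: "distr ^ 'd \<Rightarrow> (real \<Rightarrow> real ^ 'd) \<Rightarrow> (nat \<Rightarrow> real) \<Rightarrow> real" where
  "val f v a = meas_pairing (mu L f) v + (\<Sum>n<N. a n * pairing f (\<phi> n))"

lemma val_coords: "val f v a = meas_pairing (mu L f) v + (\<Sum>n<N. coords L \<phi> f n * a n)"
  unfolding val_def coords_def by (simp add: mult.commute)

lemma predual_elem_val: "predual_elem L \<phi> v a f = (if f \<in> V then val f v a else 0)"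
  by (simp add: predual_elem_def val_def mu_def)

lemma val_lincomb:
  assumes "f \<in> V" "h \<in> V" "v \<in> C0"
  shows "val (b *\<^sub>R f + c *\<^sub>R h) v a = b * val f v a + c * val h v a"
  unfolding val_def using native_lincomb[OF assms(1,2), of b c]
  by (simp add: linear_add[OF meas_pairing_linear_measure[OF assms(3)]]
      linear_scale[OF meas_pairing_linear_measure[OF assms(3)]]
      linear_add[OF pairing_linear] linear_scale[OF pairing_linear]
      sum.distrib sum_distrib_left algebra_simps)

lemma val_add: "v \<in> C0 \<Longrightarrow> w \<in> C0 \<Longrightarrow> val f (\<lambda>x. v x + w x) (\<lambda>i. a i + b i) = val f v a + val f w b"
  by (simp add: val_def meas_pairing_add distrib_right sum.distrib)

lemma val_scale: "val f (\<lambda>x. c *\<^sub>R v x) (\<lambda>i. c * a i) = c * val f v a"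
  by (simp add: val_def meas_pairing_scale sum_distrib_left mult_ac distrib_left)

text \<open>Subtracting the right combination of the \<open>\<phi> n\<close> makes a test function orthogonal to the null
  space, hence an image of a test function under the adjoint.\<close>

lemma test_decomposition:
  "\<exists>w a. a \<in> tuples N \<and> (\<forall>s. \<psi> $ s = (\<Sum>r\<in>UNIV. tad (L $ r $ s) (w $ r)) + (\<Sum>n<N. a n *\<^sub>R \<phi> n $ s))"
proof -
  define a where "a n = (if n < N then pairing (p n) \<psi> else 0)" for n
  let ?\<psi> = "\<psi> - (\<Sum>n<N. a n *\<^sub>R \<phi> n)"
  have "pairing q ?\<psi> = 0" if q: "q \<in> null_space L" for q
  proof -
    have "pairing q \<psi> = (\<Sum>n<N. pairing q (\<phi> n) * pairing (p n) \<psi>)"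
      by (subst null_expansion[OF q]) (simp add: linear_sum[OF pairing_linear] linear_scale[OF pairing_linear])
    also have "\<dots> = pairing q (\<Sum>n<N. a n *\<^sub>R \<phi> n)"
      by (simp add: linear_sum[OF pairing_linear_test] linear_scale[OF pairing_linear_test] a_def mult.commute)
    finally show ?thesis by (simp add: linear_diff[OF pairing_linear_test])
  qed
  from orthogonal_imp_adjoint_image[OF inv this]
  obtain w where w: "\<And>s. ?\<psi> $ s = (\<Sum>r\<in>UNIV. tad (L $ r $ s) (w $ r))" by blast
  have "\<psi> $ s = (\<Sum>r\<in>UNIV. tad (L $ r $ s) (w $ r)) + (\<Sum>n<N. a n *\<^sub>R \<phi> n $ s)" for s
    unfolding w[symmetric] by simp
  moreover have "a \<in> tuples N" by (simp add: a_def tuples_def)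
  ultimately show ?thesis by blast
qed

definition tfun :: "test ^ 'd \<Rightarrow> real \<Rightarrow> real ^ 'd" where
  "tfun w x = (\<chi> d. tapply (w $ d) x)"

lemma tfun_C0: "tfun w \<in> C0"
  unfolding C0_iff_components
proof
  fix d
  obtain r where r: "0 < r" "\<And>x. r \<le> \<bar>x\<bar> \<Longrightarrow> x \<notin> support (tapply (w $ d))" using test_support_bounded by blast
  have "(tapply (w $ d) \<longlongrightarrow> 0) at_infinity"
    by (rule vanishing_compact_support[of r]) (rule test_outside, rule r(2), simp)
  then show "(\<lambda>x. tfun w x $ d) \<in> C0_real" by (simp add: tfun_def C0_real_def test_continuous)
qed

lemma val_test:
  assumes w: "\<And>s. \<psi> $ s = (\<Sum>r\<in>UNIV. tad (L $ r $ s) (w $ r)) + (\<Sum>n<N. a n *\<^sub>R \<phi> n $ s)"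
    and f: "f \<in> V"
  shows "val f (tfun w) a = pairing f \<psi>"
proof -
  have "meas_pairing (mu L f) (tfun w) = pairing (mvec (mu L f)) w"
    by (simp add: meas_pairing_def pairing_def mvec_def tfun_def meas_distr_apply)
  also have "\<dots> = pairing f (\<chi> s. \<Sum>r\<in>UNIV. tad (L $ r $ s) (w $ r))" by (simp add: mvec_mu[OF f] pairing_mdo)
  finally have "val f (tfun w) a = pairing f ((\<chi> s. \<Sum>r\<in>UNIV. tad (L $ r $ s) (w $ r)) + (\<Sum>n<N. a n *\<^sub>R \<phi> n))"
    by (simp add: val_def linear_add[OF pairing_linear_test] linear_sum[OF pairing_linear_test] linear_scale[OF pairing_linear_test])
  also have "(\<chi> s. \<Sum>r\<in>UNIV. tad (L $ r $ s) (w $ r)) + (\<Sum>n<N. a n *\<^sub>R \<phi> n) = \<psi>"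
    by (simp add: vec_eq_iff w)
  finally show ?thesis .
qed

end

section \<open>Duality for the native space\<close>

lemma predual_norm_eq:
  assumes inj: "inj_on (\<lambda>(v, a). e v a) (C0 \<times> tuples N)" and v: "v \<in> C0" and a: "a \<in> tuples N"
  shows "predual_norm N e Y s (e v a) = max (s v) (Y a)"
proof -
  have "(THE (v', a'). v' \<in> C0 \<and> a' \<in> tuples N \<and> e v a = e v' a') = (v, a)"
  proof (rule the_equality)
    show "case (v, a) of (v', a') \<Rightarrow> v' \<in> C0 \<and> a' \<in> tuples N \<and> e v a = e v' a'" using v a by simp
    fix x assume "case x of (v', a') \<Rightarrow> v' \<in> C0 \<and> a' \<in> tuples N \<and> e v a = e v' a'"
    then have x: "x \<in> C0 \<times> tuples N" "(\<lambda>(v, a). e v a) (v, a) = (\<lambda>(v, a). e v a) x" by auto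
    show "x = (v, a)" using inj_onD[OF inj x(2)] x(1) v a by simp
  qed
  then show ?thesis by (simp add: predual_norm_def)
qed

lemma vdirac_pairing: "v \<in> C0 \<Longrightarrow> meas_pairing (vdirac w x) v = w \<bullet> v x"
  by (simp add: meas_pairing_def vdirac_def smeas_integral_scale_measure C0_bdd_borel smeas_integral_dirac inner_vec_def)

lemma meas_pairing_separates:
  assumes "v \<in> C0" "w \<in> C0" "\<And>\<mu>. meas_pairing \<mu> v = meas_pairing \<mu> w"
  shows "v = w"
proof
  fix x
  have "u \<bullet> v x = u \<bullet> w x" for u using assms(3)[of "vdirac u x"] by (simp add: vdirac_pairing assms(1,2))
  then show "v x = w x" by (rule vector_eq_ldot[THEN iffD1, OF allI])
qed

text \<open>Norms \<open>n\<close> on measures and \<open>s\<close> on continuous functions that are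
  dual to each other. The inner and the outer norms are both instances.\<close>

locale native_dual = native L Y p \<phi> for L :: "real poly ^ 'd ^ 'd" and Y p \<phi> +
  fixes n :: "smeasure ^ 'd \<Rightarrow> real" and s :: "(real \<Rightarrow> real ^ 'd) \<Rightarrow> real"
  assumes dual: "dual_pair n s"
begin

lemma n_norm: "norm_on UNIV n"
  using dual by (simp add: dual_pair_def)

lemma s_props:
  shows "v \<in> C0 \<Longrightarrow> 0 \<le> s v" and "v \<in> C0 \<Longrightarrow> s v = 0 \<Longrightarrow> v = (\<lambda>_. 0)"
    and "v \<in> C0 \<Longrightarrow> s (\<lambda>x. c *\<^sub>R v x) = \<bar>c\<bar> * s v"
    and "v \<in> C0 \<Longrightarrow> w \<in> C0 \<Longrightarrow> s (\<lambda>x. v x + w x) \<le> s v + s w"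
    and "v \<in> C0 \<Longrightarrow> meas_pairing \<mu> v \<le> n \<mu> * s v"
  using dual unfolding dual_pair_def by simp_all

lemma s_near: "0 < e \<Longrightarrow> \<exists>v\<in>C0. s v \<le> 1 \<and> n \<mu> - e < meas_pairing \<mu> v"
  using dual unfolding dual_pair_def by simp

lemma s_dominated: "\<exists>C. \<forall>v\<in>C0. \<forall>B. (\<forall>x d. \<bar>v x $ d\<bar> \<le> B) \<longrightarrow> s v \<le> C * B"
  using dual unfolding dual_pair_def by simp

lemma s_0: "s (\<lambda>_. 0) = 0"
  using s_props(3)[OF C0_zero, of 0] by simp

definition native :: "distr ^ 'd \<Rightarrow> real" where
  "native = native_norm L \<phi> Y (\<lambda>f. n (mu L f))"

lemma native_eq: "native f = n (mu L f) + T (coords L \<phi> f)"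
  by (simp add: native_def native_norm_def T_def)

lemma native_nonneg: "0 \<le> native f"
  by (simp add: native_eq norm_onD(3)[OF n_norm] T_nonneg)

lemma norm_on_native: "norm_on V native"
  unfolding norm_on_def seminorm_on_def
proof (intro conjI ballI allI impI native_subspace native_nonneg)
  fix f h :: "distr ^ 'd" and c :: real assume f: "f \<in> V"
  show "native (c *\<^sub>R f) = \<bar>c\<bar> * native f"
    using native_lincomb[OF f f, of c 0] coords_lincomb[of c f 0 f]
    by (simp add: native_eq norm_onD(2)[OF n_norm] T_scale distrib_left)
  show "native (f + h) \<le> native f + native h" if h: "h \<in> V"
  proof -
    have 1: "mu L (f + h) = mu L f + mu L h" using native_lincomb[OF f h, of 1 1] by simp
    have 2: "coords L \<phi> (f + h) = (\<lambda>i. coords L \<phi> f i + coords L \<phi> h i)" using coords_lincomb[of 1 f 1 h] by simp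
    show ?thesis
      using norm_onD(1)[OF n_norm, of "mu L f" "mu L h"] T_add[of "coords L \<phi> f" "coords L \<phi> h"]
      unfolding native_eq 1 2 by linarith
  qed
  show "f = 0" if z: "native f = 0"
  proof (rule native_eq_0[OF f])
    have "n (mu L f) = 0" "T (coords L \<phi> f) = 0"
      using z norm_onD(3)[OF n_norm, of "mu L f"] T_nonneg[of "coords L \<phi> f"] unfolding native_eq by linarith+
    then show "mu L f = 0" "coords L \<phi> f = (\<lambda>_. 0)"
      using norm_onD(4)[OF n_norm] T_zero[OF coords_tuples] by blast+
  qed
qed

text \<open>A metric space is required to have a distance that is symmetric on the whole type. Outside
  the native space, the measure of a distribution has the same default value for \<open>f\<close> and
  \<open>- f\<close>.\<close>

lemma native_minus_commute: "native (f - h) = native (h - f)"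
proof -
  have m: "mu L (- f) = - mu L f \<or> mu L (- f) = mu L f" for f :: "distr ^ 'd"
  proof (cases "f \<in> V")
    case True
    then show ?thesis using native_lincomb[OF True True, of "- 1" 0] by simp
  next
    case False
    have no: "mvec \<mu> \<noteq> mdo L g" if "g \<notin> V" for \<mu> g
      using that unfolding native_space_def by (metis mem_Collect_eq rangeI)
    have "- f \<notin> V" using False native_lincomb[of "- f" L "- f" "- 1" 0] by auto
    then have "(\<lambda>\<mu>. mvec \<mu> = mdo L (- f)) = (\<lambda>\<mu>. mvec \<mu> = mdo L f)" using no False by auto
    then show ?thesis by (simp add: mu_def meas_of_def)
  qed
  have "native (- f) = native f" for f
  proof -
    have "coords L \<phi> (- f) = (\<lambda>i. - 1 * coords L \<phi> f i)" using coords_lincomb[of "- 1" f 0 f] by simp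
    then have "T (coords L \<phi> (- f)) = T (coords L \<phi> f)" by (simp only: T_scale abs_minus_cancel abs_one mult_1)
    moreover have "n (mu L (- f)) = n (mu L f)" using m[of f] norm_onD(6)[OF n_norm] by metis
    ultimately show ?thesis by (simp add: native_eq)
  qed
  from this[of "f - h"] show ?thesis by simp
qed

lemma val_le:
  assumes "v \<in> C0" "a \<in> tuples N"
  shows "\<bar>val f v a\<bar> \<le> native f * max (s v) (Y a)"
proof -
  have *: "val f v a \<le> native f * max (s v) (Y a)" if v: "v \<in> C0" and a: "a \<in> tuples N" for v a
  proof -
    have "meas_pairing (mu L f) v \<le> n (mu L f) * max (s v) (Y a)"
      using s_props(5)[OF v] mult_left_mono[OF max.cobounded1 norm_onD(3)[OF n_norm]] by (meson order_trans)
    moreover have "(\<Sum>i<N. coords L \<phi> f i * a i) \<le> T (coords L \<phi> f) * max (s v) (Y a)"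
      using T_upper[OF a] mult_left_mono[OF max.cobounded2 T_nonneg] by (meson order_trans)
    ultimately show ?thesis unfolding val_coords native_eq distrib_right by linarith
  qed
  have "- val f v a \<le> native f * max (s v) (Y a)"
    using *[OF C0_scale[OF assms(1), of "- 1"] tuples_closed(3)[OF assms(2), of "- 1"]]
    unfolding val_scale s_props(3)[OF assms(1)] Y_props(3)[OF assms(2)] by simp
  then show ?thesis using *[OF assms] by (simp add: abs_le_iff)
qed

lemma val_near:
  assumes "0 < e"
  shows "\<exists>v\<in>C0. \<exists>a\<in>tuples N. max (s v) (Y a) \<le> 1 \<and> native f - e < val f v a"
proof -
  have e: "0 < e / 2" using assms by simp
  obtain v where v: "v \<in> C0" "s v \<le> 1" "n (mu L f) - e / 2 < meas_pairing (mu L f) v" using s_near[OF e] by blast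
  obtain a where a: "a \<in> tuples N" "Y a \<le> 1" "T (coords L \<phi> f) - e / 2 < (\<Sum>i<N. coords L \<phi> f i * a i)"
    using T_near[OF e] by blast
  have "native f - e < val f v a" unfolding val_coords native_eq using v(3) a(3) by linarith
  moreover have "max (s v) (Y a) \<le> 1" using v(2) a(2) by simp
  ultimately show ?thesis using v(1) a(1) by blast
qed

text \<open>A functional of the parameters splits into one of \<open>v\<close>, to which the Riesz representation theorem
  applies, and one of \<open>a\<close>, a linear form on tuples. An element of the native space with the resulting
  measure and coordinates represents both.\<close>

lemma representation:
  assumes add: "\<And>v w a b. v \<in> C0 \<Longrightarrow> w \<in> C0 \<Longrightarrow> a \<in> tuples N \<Longrightarrow> b \<in> tuples N \<Longrightarrow>
      \<Phi> (\<lambda>x. v x + w x) (\<lambda>i. a i + b i) = \<Phi> v a + \<Phi> w b"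
    and scale: "\<And>v a c. v \<in> C0 \<Longrightarrow> a \<in> tuples N \<Longrightarrow> \<Phi> (\<lambda>x. c *\<^sub>R v x) (\<lambda>i. c * a i) = c * \<Phi> v a"
    and bound: "\<And>v a. v \<in> C0 \<Longrightarrow> a \<in> tuples N \<Longrightarrow> \<bar>\<Phi> v a\<bar> \<le> C * max (s v) (Y a)"
  shows "\<exists>f\<in>V. \<forall>v\<in>C0. \<forall>a\<in>tuples N. \<Phi> v a = val f v a"
proof -
  let ?o = "\<lambda>_. 0 :: real" and ?z = "\<lambda>_. 0 :: real ^ 'd"
  note z = tuples_closed(1)[of N] and z' = C0_zero
  obtain K where K: "\<And>v B. v \<in> C0 \<Longrightarrow> (\<And>x d. \<bar>v x $ d\<bar> \<le> B) \<Longrightarrow> s v \<le> K * B" using s_dominated by blast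
  have "\<exists>\<mu>. \<forall>v\<in>C0. \<Phi> v ?o = meas_pairing \<mu> v"
  proof (rule riesz_vector)
    show "\<Phi> (\<lambda>x. v x + w x) ?o = \<Phi> v ?o + \<Phi> w ?o" if "v \<in> C0" "w \<in> C0" for v w using add[OF that z z] by simp
    show "\<Phi> (\<lambda>x. c *\<^sub>R v x) ?o = c * \<Phi> v ?o" if "v \<in> C0" for v c using scale[OF that z, of c] by simp
    show "\<bar>\<Phi> v ?o\<bar> \<le> (\<bar>C\<bar> * K) * B" if v: "v \<in> C0" and B: "\<And>x d. \<bar>v x $ d\<bar> \<le> B" for v B
    proof -
      have "\<bar>\<Phi> v ?o\<bar> \<le> C * max (s v) (Y ?o)" by (rule bound[OF v z])
      also have "\<dots> \<le> \<bar>C\<bar> * s v" using s_props(1)[OF v] by (simp add: Y_0 mult_right_mono)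
      also have "\<dots> \<le> \<bar>C\<bar> * (K * B)" using K[OF v B] by (rule mult_left_mono) simp
      finally show ?thesis by simp
    qed
  qed
  then obtain \<mu> where \<mu>: "\<And>v. v \<in> C0 \<Longrightarrow> \<Phi> v ?o = meas_pairing \<mu> v" by blast
  define b where "b i = (if i < N then \<Phi> ?z (unit i) else 0)" for i
  have b: "b \<in> tuples N" by (simp add: b_def tuples_def)
  have \<Phi>b: "\<Phi> ?z a = (\<Sum>i<N. b i * a i)" if a: "a \<in> tuples N" for a
  proof -
    have "\<Phi> ?z a = (\<Sum>i<N. a i * \<Phi> ?z (unit i))"
    proof (rule tuple_sum[OF _ _ a])
      show "\<Phi> ?z (\<lambda>i. a i + b i) = \<Phi> ?z a + \<Phi> ?z b" if "a \<in> tuples N" "b \<in> tuples N" for a b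
        using add[OF z' z' that] by simp
      show "\<Phi> ?z (\<lambda>i. c * a i) = c * \<Phi> ?z a" if "a \<in> tuples N" for a c
        using scale[OF z' that, of c] by simp
    qed
    then show ?thesis by (simp add: b_def mult.commute)
  qed
  obtain f where f: "f \<in> V" "mu L f = \<mu>" "coords L \<phi> f = b" using native_surjective[OF b] by blast
  have "\<Phi> v a = val f v a" if v: "v \<in> C0" and a: "a \<in> tuples N" for v a
    using add[OF v z' z a] by (simp add: val_coords f \<mu>[OF v] \<Phi>b[OF a])
  then show ?thesis using f(1) by blast
qed

lemma val_eq_imp_eq:
  assumes "f \<in> V" "h \<in> V" "\<And>v a. v \<in> C0 \<Longrightarrow> a \<in> tuples N \<Longrightarrow> val f v a = val h v a"
  shows "f = h"
proof -
  have "native (f - h) \<le> 0"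
  proof (rule field_le_epsilon)
    fix e :: real assume "0 < e"
    then obtain v a where va: "v \<in> C0" "a \<in> tuples N" "native (f - h) - e < val (f - h) v a" using val_near by blast
    have "val (f - h) v a = 0"
      using val_lincomb[OF assms(1,2) va(1), of 1 "- 1"] assms(3)[OF va(1,2)] by simp
    then show "native (f - h) \<le> 0 + e" using va(3) by simp
  qed
  then have "native (f - h) = 0" using native_nonneg[of "f - h"] by simp
  moreover have "f - h \<in> V" using assms by (intro subspace_diff native_subspace)
  ultimately have "f - h = 0" using norm_on_native unfolding norm_on_def by blast
  then show ?thesis by simp
qed

text \<open>In both realisations of the predual, evaluation at \<open>f\<close> has the values of
  \<open>val f\<close>, so the dual norm can be computed from the parameters.\<close>

lemma functional_norm_eq:
  assumes inj: "inj_on (\<lambda>(v, a). e v a) (C0 \<times> tuples N)"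
    and G: "\<And>v a. v \<in> C0 \<Longrightarrow> a \<in> tuples N \<Longrightarrow> G (e v a) = val f v a"
  shows "functional_norm (predual_space N e) (predual_norm N e Y s) G = native f"
proof -
  let ?S = "{g \<in> predual_space N e. predual_norm N e Y s g \<le> 1}"
  have elem: "e v a \<in> ?S" if "v \<in> C0" "a \<in> tuples N" "max (s v) (Y a) \<le> 1" for v a
    using that predual_norm_eq[OF inj that(1,2), of Y s] unfolding predual_space_def by auto
  have le: "\<bar>G g\<bar> \<le> native f" if g: "g \<in> ?S" for g
  proof -
    obtain v a where va: "v \<in> C0" "a \<in> tuples N" "g = e v a" using g unfolding predual_space_def by blast
    then have m: "max (s v) (Y a) \<le> 1" using g predual_norm_eq[OF inj va(1,2), of Y s] by simp
    show ?thesis using val_le[OF va(1,2), of f] mult_left_le[OF m native_nonneg[of f]] G[OF va(1,2)] va(3) by simp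
  qed
  have zero: "e (\<lambda>_. 0) (\<lambda>_. 0) \<in> ?S"
    by (rule elem[OF C0_zero tuples_closed(1)]) (simp add: s_0 Y_0)
  show ?thesis unfolding functional_norm_def
  proof (rule antisym)
    show "(SUP g\<in>?S. \<bar>G g\<bar>) \<le> native f" by (rule cSUP_least) (use zero in blast, rule le)
    show "native f \<le> (SUP g\<in>?S. \<bar>G g\<bar>)"
    proof (rule field_le_epsilon)
      fix e' :: real assume "0 < e'"
      then obtain v a where va: "v \<in> C0" "a \<in> tuples N" "max (s v) (Y a) \<le> 1" "native f - e' < val f v a"
        using val_near by blast
      have "bdd_above ((\<lambda>g. \<bar>G g\<bar>) ` ?S)" by (rule bdd_aboveI2) (rule le)
      from cSUP_upper[OF elem[OF va(1-3)] this] have "\<bar>val f v a\<bar> \<le> (SUP g\<in>?S. \<bar>G g\<bar>)" by (simp add: G va)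
      then show "native f \<le> (SUP g\<in>?S. \<bar>G g\<bar>) + e'" using va(4) by linarith
    qed
  qed
qed

text \<open>Completeness is that of a dual space: the values of a Cauchy sequence converge on each element
  of the predual, and the limit functional is represented.\<close>

lemma banach_native: "banach_on V native"
  unfolding banach_on_def
proof
  show "norm_on V native" by (rule norm_on_native)
  note sem = norm_on_native[unfolded norm_on_def seminorm_on_def]
  have diff: "f - h \<in> V" if "f \<in> V" "h \<in> V" for f h using that by (intro subspace_diff native_subspace)
  interpret M: Metric_space V "\<lambda>f h. native (f - h)"
  proof
    show "0 \<le> native (f - h)" for f h by (rule native_nonneg)
    show "native (f - h) = native (h - f)" for f h by (rule native_minus_commute)
    show "native (f - h) = 0 \<longleftrightarrow> f = h" if "f \<in> V" "h \<in> V" for f h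
    proof
      assume "native (f - h) = 0"
      then have "f - h = 0" using sem diff[OF that] by blast
      then show "f = h" by simp
    next
      assume "f = h"
      have "native (0 *\<^sub>R f) = \<bar>0\<bar> * native f" using sem that(1) by blast
      then show "native (f - h) = 0" using \<open>f = h\<close> by simp
    qed
    show "native (f - k) \<le> native (f - h) + native (h - k)" if "f \<in> V" "h \<in> V" "k \<in> V" for f h k
    proof -
      have "native ((f - h) + (h - k)) \<le> native (f - h) + native (h - k)"
        using sem diff[OF that(1,2)] diff[OF that(2,3)] by blast
      then show ?thesis by simp
    qed
  qed
  show "M.mcomplete"
    unfolding M.mcomplete_def
  proof (intro allI impI)
    fix \<sigma> assume cauchy: "M.MCauchy \<sigma>"
    have \<sigma>: "\<sigma> k \<in> V" for k using cauchy unfolding M.MCauchy_def by blast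
    have C: "\<exists>K. \<forall>k l. K \<le> k \<longrightarrow> K \<le> l \<longrightarrow> native (\<sigma> k - \<sigma> l) < e" if "0 < e" for e
      using cauchy that unfolding M.MCauchy_def by blast
    have vd: "val (f - h) v a = val f v a - val h v a" if "f \<in> V" "h \<in> V" "v \<in> C0" for f h v a
      using val_lincomb[OF that, of 1 "- 1"] by simp
    have conv: "convergent (\<lambda>k. val (\<sigma> k) v a)" if v: "v \<in> C0" and a: "a \<in> tuples N" for v a
      unfolding Cauchy_convergent_iff[symmetric]
    proof (rule metric_CauchyI)
      fix e :: real assume e: "0 < e"
      let ?m = "max (s v) (Y a)"
      have m: "0 \<le> ?m" using s_props(1)[OF v] by (simp add: le_max_iff_disj)
      have "0 < e / (?m + 1)" using e m by simp
      from C[OF this] obtain K where K: "\<And>k l. K \<le> k \<Longrightarrow> K \<le> l \<Longrightarrow> native (\<sigma> k - \<sigma> l) < e / (?m + 1)" by blast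
      show "\<exists>K. \<forall>k\<ge>K. \<forall>l\<ge>K. dist (val (\<sigma> k) v a) (val (\<sigma> l) v a) < e"
      proof (intro exI allI impI)
        fix k l assume "K \<le> k" "K \<le> l"
        have "\<bar>val (\<sigma> k - \<sigma> l) v a\<bar> \<le> native (\<sigma> k - \<sigma> l) * ?m" by (rule val_le[OF v a])
        also have "\<dots> \<le> e / (?m + 1) * ?m"
          using K[OF \<open>K \<le> k\<close> \<open>K \<le> l\<close>] m by (intro mult_right_mono) simp_all
        also have "\<dots> < e" using e m by (simp add: field_simps)
        finally show "dist (val (\<sigma> k) v a) (val (\<sigma> l) v a) < e" by (simp add: dist_real_def vd[OF \<sigma> \<sigma> v])
      qed
    qed
    define \<Phi> where "\<Phi> v a = lim (\<lambda>k. val (\<sigma> k) v a)" for v a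
    have \<Phi>: "(\<lambda>k. val (\<sigma> k) v a) \<longlonglongrightarrow> \<Phi> v a" if "v \<in> C0" "a \<in> tuples N" for v a
      using conv[OF that] unfolding \<Phi>_def convergent_LIMSEQ_iff .
    obtain K1 where K1: "\<And>k l. K1 \<le> k \<Longrightarrow> K1 \<le> l \<Longrightarrow> native (\<sigma> k - \<sigma> l) < 1" using C[of 1] by auto
    have "\<exists>f\<in>V. \<forall>v\<in>C0. \<forall>a\<in>tuples N. \<Phi> v a = val f v a"
    proof (rule representation)
      fix v w :: "real \<Rightarrow> real ^ 'd" and a b c assume v: "v \<in> C0" and a: "a \<in> tuples N"
      show "\<Phi> (\<lambda>x. v x + w x) (\<lambda>i. a i + b i) = \<Phi> v a + \<Phi> w b" if w: "w \<in> C0" and b: "b \<in> tuples N"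
      proof (rule LIMSEQ_unique[OF \<Phi>[OF C0_add[OF v w] tuples_closed(2)[OF a b]]])
        show "(\<lambda>k. val (\<sigma> k) (\<lambda>x. v x + w x) (\<lambda>i. a i + b i)) \<longlonglongrightarrow> \<Phi> v a + \<Phi> w b"
          unfolding val_add[OF v w] by (intro tendsto_add \<Phi> v w a b)
      qed
      show "\<Phi> (\<lambda>x. c *\<^sub>R v x) (\<lambda>i. c * a i) = c * \<Phi> v a"
      proof (rule LIMSEQ_unique[OF \<Phi>[OF C0_scale[OF v] tuples_closed(3)[OF a]]])
        show "(\<lambda>k. val (\<sigma> k) (\<lambda>x. c *\<^sub>R v x) (\<lambda>i. c * a i)) \<longlonglongrightarrow> c * \<Phi> v a"
          unfolding val_scale by (intro tendsto_mult_left \<Phi> v a)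
      qed
      show "\<bar>\<Phi> v a\<bar> \<le> (native (\<sigma> K1) + 1) * max (s v) (Y a)"
      proof (rule LIMSEQ_le_const2[OF tendsto_rabs[OF \<Phi>[OF v a]]], intro exI allI impI)
        fix k assume k: "K1 \<le> k"
        have "native (\<sigma> K1 + (\<sigma> k - \<sigma> K1)) \<le> native (\<sigma> K1) + native (\<sigma> k - \<sigma> K1)"
          using sem \<sigma>[of K1] diff[OF \<sigma>[of k] \<sigma>[of K1]] by blast
        then have "native (\<sigma> k) \<le> native (\<sigma> K1) + 1" using K1[OF k order_refl] by simp
        then show "\<bar>val (\<sigma> k) v a\<bar> \<le> (native (\<sigma> K1) + 1) * max (s v) (Y a)"
          using val_le[OF v a, of "\<sigma> k"] mult_right_mono[OF _ max.coboundedI1[OF s_props(1)[OF v], of "Y a"], of "native (\<sigma> k)" "native (\<sigma> K1) + 1"]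
          by linarith
      qed
    qed
    then obtain f where f: "f \<in> V" "\<And>v a. v \<in> C0 \<Longrightarrow> a \<in> tuples N \<Longrightarrow> \<Phi> v a = val f v a" by blast
    have "\<forall>\<^sub>F k in sequentially. \<sigma> k \<in> V \<and> native (\<sigma> k - f) < e" if e: "0 < e" for e
    proof -
      have e4: "0 < e / 4" using e by simp
      from C[OF e4] obtain K where K: "\<And>k l. K \<le> k \<Longrightarrow> K \<le> l \<Longrightarrow> native (\<sigma> k - \<sigma> l) < e / 4" by blast
      have "native (\<sigma> k - f) < e" if k: "K \<le> k" for k
      proof -
        obtain v a where va: "v \<in> C0" "a \<in> tuples N" "max (s v) (Y a) \<le> 1" "native (\<sigma> k - f) - e / 4 < val (\<sigma> k - f) v a"
          using val_near[OF e4] by blast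
        have "val (\<sigma> k - f) v a \<le> e / 4"
        proof (rule LIMSEQ_le_const2)
          show "(\<lambda>l. val (\<sigma> k - \<sigma> l) v a) \<longlonglongrightarrow> val (\<sigma> k - f) v a"
            unfolding vd[OF \<sigma> \<sigma> va(1)] vd[OF \<sigma> f(1) va(1)] f(2)[OF va(1,2), symmetric]
            by (intro tendsto_diff tendsto_const \<Phi> va)
          have "val (\<sigma> k - \<sigma> l) v a \<le> e / 4" if "K \<le> l" for l
            using val_le[OF va(1,2), of "\<sigma> k - \<sigma> l"] mult_left_le[OF va(3) native_nonneg[of "\<sigma> k - \<sigma> l"]] K[OF k that]
            by linarith
          then show "\<exists>K. \<forall>l\<ge>K. val (\<sigma> k - \<sigma> l) v a \<le> e / 4" by blast
        qed
        then show ?thesis using va(4) e by linarith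
      qed
      then show ?thesis using \<sigma> unfolding eventually_sequentially by blast
    qed
    then have "limitin M.mtopology \<sigma> f sequentially" unfolding M.limitin_metric using f(1) by blast
    then show "\<exists>f. limitin M.mtopology \<sigma> f sequentially" by blast
  qed
qed

text \<open>The functionals determine their parameters, since measure and coordinates of an element of
  the native space can be prescribed independently.\<close>

lemma inj_predual_elem: "inj_on (\<lambda>(v, a). predual_elem L \<phi> v a) (C0 \<times> tuples N)"
proof (rule inj_onI, clarify)
  fix v w :: "real \<Rightarrow> real ^ 'd" and a b
  assume v: "v \<in> C0" "a \<in> tuples N" and w: "w \<in> C0" "b \<in> tuples N"
    and eq: "predual_elem L \<phi> v a = predual_elem L \<phi> w b"
  have val: "val f v a = val f w b" if "f \<in> V" for f
    using fun_cong[OF eq, of f] that by (simp add: predual_elem_val)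
  have "v = w"
  proof (rule meas_pairing_separates[OF v(1) w(1)])
    fix \<mu>
    obtain f where f: "f \<in> V" "mu L f = \<mu>" "coords L \<phi> f = (\<lambda>_. 0)" using native_surjective[OF tuples_closed(1)] by blast
    show "meas_pairing \<mu> v = meas_pairing \<mu> w" using val[OF f(1)] by (simp add: val_coords f)
  qed
  moreover have "a i = b i" for i
  proof (cases "i < N")
    case True
    obtain f where f: "f \<in> V" "mu L f = 0" "coords L \<phi> f = unit i" using native_surjective[OF unit] by blast
    have "(\<Sum>j<N. unit i j * c j) = c i" for c :: "nat \<Rightarrow> real"
    proof -
      have "(\<Sum>j<N. unit i j * c j) = (\<Sum>j<N. if j = i then c j else 0)"
        using True by (intro sum.cong) (simp_all add: unit_def)
      then show ?thesis using True by simp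
    qed
    then show ?thesis using val[OF f(1)] \<open>v = w\<close> by (simp add: val_coords f)
  next
    case False then show ?thesis using v(2) w(2) by (simp add: tuples_def)
  qed
  ultimately show "v = w \<and> a = b" by blast
qed

text \<open>Addition and scaling of the functionals are those of the parameters, so the axioms of a norm
  and the representation of functionals are inherited from the parameter space.\<close>

lemma dual_of_functionals:
  "is_dual_of_functionals V native (predual_space N (predual_elem L \<phi>)) (predual_norm N (predual_elem L \<phi>) Y s)"
proof -
  let ?e = "predual_elem L \<phi>" and ?W = "predual_space N (predual_elem L \<phi>)" and ?q = "predual_norm N (predual_elem L \<phi>) Y s"
  have W: "?e v a \<in> ?W" if "v \<in> C0" "a \<in> tuples N" for v a using that unfolding predual_space_def by blast
  have WE: "\<exists>v\<in>C0. \<exists>a\<in>tuples N. g = ?e v a" if "g \<in> ?W" for g using that unfolding predual_space_def by blast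
  have e_add: "(\<lambda>f. ?e v a f + ?e w b f) = ?e (\<lambda>x. v x + w x) (\<lambda>i. a i + b i)" if "v \<in> C0" "w \<in> C0" for v w a b
    using val_add[OF that] by (simp add: fun_eq_iff predual_elem_val)
  have e_scale: "(\<lambda>f. c * ?e v a f) = ?e (\<lambda>x. c *\<^sub>R v x) (\<lambda>i. c * a i)" for v a c
    using val_scale by (simp add: fun_eq_iff predual_elem_val)
  have e_0: "?e (\<lambda>_. 0) (\<lambda>_. 0) = (\<lambda>_. 0)"
    using e_scale[of 0 "\<lambda>_. 0" "\<lambda>_. 0"] by simp
  have q: "?q (?e v a) = max (s v) (Y a)" if "v \<in> C0" "a \<in> tuples N" for v a
    by (rule predual_norm_eq[OF inj_predual_elem that])
  have "fun_norm_on ?W ?q"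
    unfolding fun_norm_on_def
  proof (intro conjI ballI allI impI)
    show "(\<lambda>_. 0) \<in> ?W" using W[OF C0_zero tuples_closed(1)] e_0 by simp
    fix g h c assume g: "g \<in> ?W"
    obtain v a where va: "v \<in> C0" "a \<in> tuples N" "g = ?e v a" using WE[OF g] by blast
    show "(\<lambda>f. c * g f) \<in> ?W" unfolding va(3) e_scale by (intro W C0_scale tuples_closed va)
    show "0 \<le> ?q g" using s_props(1)[OF va(1)] by (simp add: va q le_max_iff_disj)
    show "g = (\<lambda>_. 0)" if "?q g = 0"
    proof -
      have "s v \<le> 0" "Y a \<le> 0" using that by (simp_all add: va q max_def split: if_splits)
      then have "s v = 0" "Y a = 0" using s_props(1)[OF va(1)] Y_props(1)[OF va(2)] by simp_all
      then show ?thesis using s_props(2)[OF va(1)] Y_props(2)[OF va(2)] va(3) e_0 by simp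
    qed
    show "?q (\<lambda>f. c * g f) = \<bar>c\<bar> * ?q g"
      unfolding va(3) e_scale q[OF C0_scale[OF va(1)] tuples_closed(3)[OF va(2)]] q[OF va(1,2)]
      by (simp add: s_props(3)[OF va(1)] Y_props(3)[OF va(2)] max_mult_distrib_left)
    assume h: "h \<in> ?W"
    obtain w b where wb: "w \<in> C0" "b \<in> tuples N" "h = ?e w b" using WE[OF h] by blast
    show "(\<lambda>f. g f + h f) \<in> ?W" unfolding va(3) wb(3) e_add[OF va(1) wb(1)] by (intro W C0_add tuples_closed va wb)
    show "?q (\<lambda>f. g f + h f) \<le> ?q g + ?q h"
      unfolding va(3) wb(3) e_add[OF va(1) wb(1)] q[OF C0_add[OF va(1) wb(1)] tuples_closed(2)[OF va(2) wb(2)]]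
        q[OF va(1,2)] q[OF wb(1,2)]
      using s_props(4)[OF va(1) wb(1)] Y_props(4)[OF va(2) wb(2)] by linarith
  qed
  moreover have "g (b *\<^sub>R f + c *\<^sub>R h) = b * g f + c * g h" if g: "g \<in> ?W" and f: "f \<in> V" and h: "h \<in> V" for g f h b c
  proof -
    obtain v a where va: "v \<in> C0" "a \<in> tuples N" "g = ?e v a" using WE[OF g] by blast
    then show ?thesis using native_lincomb[OF f h] val_lincomb[OF f h va(1)] f h by (simp add: predual_elem_val)
  qed
  moreover have "(\<lambda>f. if f \<in> V then pairing f \<psi> else 0) \<in> ?W" for \<psi>
  proof -
    obtain w a where a: "a \<in> tuples N"
      and w: "\<And>r. \<psi> $ r = (\<Sum>k\<in>UNIV. tad (L $ k $ r) (w $ k)) + (\<Sum>n<N. a n *\<^sub>R \<phi> n $ r)"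
      using test_decomposition by blast
    have "(\<lambda>f. if f \<in> V then pairing f \<psi> else 0) = ?e (tfun w) a"
      by (simp add: fun_eq_iff predual_elem_val val_test[OF w])
    then show ?thesis using W[OF tfun_C0 a] by simp
  qed
  moreover have "bij_betw (\<lambda>f g. if g \<in> ?W then g f else 0) V (fun_top_dual ?W ?q)"
    unfolding bij_betw_def
  proof
    show "inj_on (\<lambda>f g. if g \<in> ?W then g f else 0) V"
    proof (rule inj_onI)
      fix f h assume f: "f \<in> V" and h: "h \<in> V" and eq: "(\<lambda>g. if g \<in> ?W then g f else 0) = (\<lambda>g. if g \<in> ?W then g h else 0)"
      show "f = h"
      proof (rule val_eq_imp_eq[OF f h])
        fix v :: "real \<Rightarrow> real ^ 'd" and a assume va: "v \<in> C0" "a \<in> tuples N"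
        show "val f v a = val h v a"
          using fun_cong[OF eq, of "?e v a"] W[OF va] f h by (simp add: predual_elem_val)
      qed
    qed
    show "(\<lambda>f g. if g \<in> ?W then g f else 0) ` V = fun_top_dual ?W ?q"
    proof (intro equalityI subsetI)
      fix F assume "F \<in> (\<lambda>f g. if g \<in> ?W then g f else 0) ` V"
      then obtain f where f: "f \<in> V" "F = (\<lambda>g. if g \<in> ?W then g f else 0)" by blast
      show "F \<in> fun_top_dual ?W ?q" unfolding fun_top_dual_def mem_Collect_eq
      proof (intro conjI allI impI ballI exI)
        fix g h c
        show "g \<notin> ?W \<Longrightarrow> F g = 0" by (simp add: f)
        assume g: "g \<in> ?W"
        obtain v a where va: "v \<in> C0" "a \<in> tuples N" "g = ?e v a" using WE[OF g] by blast
        have "(\<lambda>f. c * g f) \<in> ?W" unfolding va(3) e_scale by (intro W C0_scale tuples_closed va)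
        then show "F (\<lambda>x. c * g x) = c * F g" using g by (simp add: f)
        show "\<bar>F g\<bar> \<le> native f * ?q g" using val_le[OF va(1,2), of f] g f(1) by (simp add: f(2) va q predual_elem_val)
        assume h: "h \<in> ?W"
        obtain w b where wb: "w \<in> C0" "b \<in> tuples N" "h = ?e w b" using WE[OF h] by blast
        have "(\<lambda>f. g f + h f) \<in> ?W" unfolding va(3) wb(3) e_add[OF va(1) wb(1)] by (intro W C0_add tuples_closed va wb)
        then show "F (\<lambda>x. g x + h x) = F g + F h" using g h by (simp add: f)
      qed
    next
      fix F assume F: "F \<in> fun_top_dual ?W ?q"
      then have F0: "\<And>g. g \<notin> ?W \<Longrightarrow> F g = 0" and Fadd: "\<And>g h. g \<in> ?W \<Longrightarrow> h \<in> ?W \<Longrightarrow> F (\<lambda>x. g x + h x) = F g + F h"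
        and Fscale: "\<And>g c. g \<in> ?W \<Longrightarrow> F (\<lambda>x. c * g x) = c * F g" unfolding fun_top_dual_def by simp_all
      obtain C where C: "\<And>g. g \<in> ?W \<Longrightarrow> \<bar>F g\<bar> \<le> C * ?q g" using F unfolding fun_top_dual_def by blast
      have "\<exists>f\<in>V. \<forall>v\<in>C0. \<forall>a\<in>tuples N. F (?e v a) = val f v a"
      proof (rule representation)
        fix v w :: "real \<Rightarrow> real ^ 'd" and a b c assume va: "v \<in> C0" "a \<in> tuples N"
        show "F (?e (\<lambda>x. v x + w x) (\<lambda>i. a i + b i)) = F (?e v a) + F (?e w b)" if wb: "w \<in> C0" "b \<in> tuples N"
          unfolding e_add[OF va(1) wb(1), symmetric] by (rule Fadd[OF W[OF va] W[OF wb]])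
        show "F (?e (\<lambda>x. c *\<^sub>R v x) (\<lambda>i. c * a i)) = c * F (?e v a)"
          unfolding e_scale[symmetric] by (rule Fscale[OF W[OF va]])
        show "\<bar>F (?e v a)\<bar> \<le> C * max (s v) (Y a)" using C[OF W[OF va]] by (simp add: q[OF va])
      qed
      then obtain f where f: "f \<in> V" "\<And>v a. v \<in> C0 \<Longrightarrow> a \<in> tuples N \<Longrightarrow> F (?e v a) = val f v a" by blast
      have "F = (\<lambda>g. if g \<in> ?W then g f else 0)"
      proof
        fix g show "F g = (if g \<in> ?W then g f else 0)"
        proof (cases "g \<in> ?W")
          case True
          obtain v a where va: "v \<in> C0" "a \<in> tuples N" "g = ?e v a" using WE[OF True] by blast
          then show ?thesis using f True by (simp add: predual_elem_val)
        qed (simp add: F0)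
      qed
      then show "F \<in> (\<lambda>f g. if g \<in> ?W then g f else 0) ` V" using f(1) by blast
    qed
  qed
  moreover have "functional_norm ?W ?q (\<lambda>g. g f) = native f" if "f \<in> V" for f
    by (rule functional_norm_eq[OF inj_predual_elem]) (simp add: predual_elem_val that)
  ultimately show ?thesis unfolding is_dual_of_functionals_def using norm_on_native by blast
qed

end

section \<open>Duality with distributions\<close>

abbreviation tdistr :: "test \<Rightarrow> distr" where "tdistr \<phi> \<equiv> fun_distr (tapply \<phi>)"

lemma fun_distr_lincomb:
  assumes "continuous_on UNIV f" "continuous_on UNIV g"
  shows "fun_distr (\<lambda>x. b * f x + c * g x) = b *\<^sub>R fun_distr f + c *\<^sub>R fun_distr g"
proof (rule distr_eqI)
  fix \<phi>
  note I = cut_distr_integrable[OF closed_UNIV] and A = cut_distr_apply[OF closed_UNIV, unfolded cut_distr_def, simplified]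
  have h: "continuous_on UNIV (\<lambda>x. b * f x + c * g x)" using assms by (intro continuous_intros)
  have "dapply (fun_distr (\<lambda>x. b * f x + c * g x)) \<phi> = (LINT x|lborel. b * (f x * tapply \<phi> x) + c * (g x * tapply \<phi> x))"
    unfolding A[OF h] by (simp add: algebra_simps)
  also have "\<dots> = b * (LINT x|lborel. f x * tapply \<phi> x) + c * (LINT x|lborel. g x * tapply \<phi> x)"
    using I[OF assms(1), of \<phi>] I[OF assms(2), of \<phi>] by simp
  finally show "dapply (fun_distr (\<lambda>x. b * f x + c * g x)) \<phi> = dapply (b *\<^sub>R fun_distr f + c *\<^sub>R fun_distr g) \<phi>"
    by (simp add: dapply_simps A assms)
qed

lemma tdistr_linear: "linear tdistr"
proof (rule linearI)
  show "tdistr (\<phi> + \<psi>) = tdistr \<phi> + tdistr \<psi>" for \<phi> \<psi>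
    using fun_distr_lincomb[OF test_continuous[of _ \<phi>] test_continuous[of _ \<psi>], of 1 1] by (simp add: plus_test.rep_eq)
  show "tdistr (c *\<^sub>R \<phi>) = c *\<^sub>R tdistr \<phi>" for c \<phi>
    using fun_distr_lincomb[OF test_continuous[of _ \<phi>] test_continuous[of _ \<phi>], of c 0] by (simp add: scaleR_test.rep_eq)
qed

lemma ddiff_tdistr: "(ddiff ^^ n) (tdistr \<phi>) = tdistr ((tdiff ^^ n) \<phi>)"
proof (induction n)
  case (Suc n)
  have "ddiff (tdistr \<psi>) = tdistr (tdiff \<psi>)" for \<psi>
  proof -
    have "(tapply \<psi> has_field_derivative tapply (tdiff \<psi>) t) (at t)" for t
      using smooth_fun_DERIV[OF test_smooth, of 0 \<psi> t] by (simp add: tdiff.rep_eq)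
    from ddiff_cut_UNIV[OF this test_continuous] show ?thesis by (simp add: cut_distr_def)
  qed
  then show ?case using Suc by simp
qed simp

text \<open>On test functions, regarded as distributions, the formal adjoint acts as the
  transpose.\<close>

lemma odo_adj_tdistr: "odo (odo_adj p) (tdistr \<phi>) = tdistr (tad p \<phi>)"
proof -
  have c: "coeff (odo_adj p) k = (- 1) ^ k * coeff p k" for k
  proof -
    have "coeff (odo_adj p) k = (\<Sum>n\<le>degree p. if n = k then (- 1) ^ n * coeff p n else 0)"
      by (simp add: odo_adj_def coeff_sum)
    then show ?thesis by (simp add: coeff_eq_0)
  qed
  have "degree (odo_adj p) \<le> degree p" by (rule degree_le) (simp add: c coeff_eq_0)
  then have "odo (odo_adj p) (tdistr \<phi>) = (\<Sum>n\<le>degree p. ((- 1) ^ n * coeff p n) *\<^sub>R tdistr ((tdiff ^^ n) \<phi>))"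
    by (simp add: odo_extend c ddiff_tdistr)
  also have "\<dots> = tdistr (tad p \<phi>)"
    by (simp add: tad_def tneg_funpow linear_sum[OF tdistr_linear] linear_scale[OF tdistr_linear] mult.commute)
  finally show ?thesis .
qed

lemma fvec_lincomb:
  assumes "v \<in> C0" "w \<in> C0"
  shows "fvec (\<lambda>x. b *\<^sub>R v x + c *\<^sub>R w x) = b *\<^sub>R fvec v + c *\<^sub>R fvec w"
  using C0_component[OF assms(1)] C0_component[OF assms(2)]
  by (simp add: fvec_def vec_eq_iff fun_distr_lincomb C0_real_def)

context native_dual
begin

lemma predual_dist_lincomb:
  assumes "v \<in> C0" "w \<in> C0"
  shows "predual_dist L \<phi> (\<lambda>x. b *\<^sub>R v x + c *\<^sub>R w x) (\<lambda>i. b * a i + c * a' i) =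
    b *\<^sub>R predual_dist L \<phi> v a + c *\<^sub>R predual_dist L \<phi> w a'"
  by (simp add: predual_dist_def fvec_lincomb[OF assms] linear_add[OF mdo_linear] linear_scale[OF mdo_linear]
      scaleR_add_left scaleR_add_right sum.distrib scaleR_sum_right)

text \<open>The decomposition of a test function gives its parameters in the space of distributions
  too.\<close>

lemma predual_dist_test:
  assumes "\<And>s. \<psi> $ s = (\<Sum>r\<in>UNIV. tad (L $ r $ s) (w $ r)) + (\<Sum>n<N. a n *\<^sub>R \<phi> n $ s)"
  shows "predual_dist L \<phi> (tfun w) a = tvec \<psi>"
  by (simp add: vec_eq_iff predual_dist_def tvec_def fvec_def tfun_def mdo_def mdo_adj_def odo_adj_tdistr assms
      linear_add[OF tdistr_linear] linear_sum[OF tdistr_linear] linear_scale[OF tdistr_linear])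

text \<open>Injectivity of the parametrisation turns \<open>val\<close> into an evaluation on
  distributions, which on test functions is the duality pairing.\<close>

lemma dual_of_distributions:
  assumes inj: "inj_on (\<lambda>(v, a). predual_dist L \<phi> v a) (C0 \<times> tuples N)"
  shows "is_dual_of_distributions V native (predual_space N (predual_dist L \<phi>)) (predual_norm N (predual_dist L \<phi>) Y s)"
proof -
  let ?e = "predual_dist L \<phi>" and ?W = "predual_space N (predual_dist L \<phi>)" and ?q = "predual_norm N (predual_dist L \<phi>) Y s"
  have W: "?e v a \<in> ?W" if "v \<in> C0" "a \<in> tuples N" for v a using that unfolding predual_space_def by blast
  have WE: "\<exists>v\<in>C0. \<exists>a\<in>tuples N. g = ?e v a" if "g \<in> ?W" for g using that unfolding predual_space_def by blast
  have e_add: "?e v a + ?e w b = ?e (\<lambda>x. v x + w x) (\<lambda>i. a i + b i)" if "v \<in> C0" "w \<in> C0" for v w a b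
    using predual_dist_lincomb[OF that, of 1 1] by simp
  have e_scale: "c *\<^sub>R ?e v a = ?e (\<lambda>x. c *\<^sub>R v x) (\<lambda>i. c * a i)" if "v \<in> C0" for v a c
    using predual_dist_lincomb[OF that that, of c 0] by simp
  have e_0: "?e (\<lambda>_. 0) (\<lambda>_. 0) = 0"
    using e_scale[OF C0_zero, of 0 "\<lambda>_. 0"] by simp
  have q: "?q (?e v a) = max (s v) (Y a)" if "v \<in> C0" "a \<in> tuples N" for v a
    by (rule predual_norm_eq[OF inj that])
  have add_closed: "g + h \<in> ?W" if g: "g \<in> ?W" and h: "h \<in> ?W" for g h
  proof -
    obtain v a where va: "v \<in> C0" "a \<in> tuples N" "g = ?e v a" using WE[OF g] by blast
    obtain w b where wb: "w \<in> C0" "b \<in> tuples N" "h = ?e w b" using WE[OF h] by blast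
    show ?thesis unfolding va(3) wb(3) e_add[OF va(1) wb(1)] by (intro W C0_add tuples_closed va wb)
  qed
  have scale_closed: "c *\<^sub>R g \<in> ?W" if g: "g \<in> ?W" for c g
  proof -
    obtain v a where va: "v \<in> C0" "a \<in> tuples N" "g = ?e v a" using WE[OF g] by blast
    show ?thesis unfolding va(3) e_scale[OF va(1)] by (intro W C0_scale tuples_closed va)
  qed
  have norm: "norm_on ?W ?q"
    unfolding norm_on_def seminorm_on_def
  proof (intro conjI ballI allI impI subspaceI add_closed scale_closed)
    show "0 \<in> ?W" using W[OF C0_zero tuples_closed(1)] e_0 by simp
    fix g c assume g: "g \<in> ?W"
    obtain v a where va: "v \<in> C0" "a \<in> tuples N" "g = ?e v a" using WE[OF g] by blast
    show "0 \<le> ?q g" using s_props(1)[OF va(1)] by (simp add: va q le_max_iff_disj)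
    show "g = 0" if "?q g = 0"
    proof -
      have "s v \<le> 0" "Y a \<le> 0" using that by (simp_all add: va q max_def split: if_splits)
      then have "s v = 0" "Y a = 0" using s_props(1)[OF va(1)] Y_props(1)[OF va(2)] by simp_all
      then show ?thesis using s_props(2)[OF va(1)] Y_props(2)[OF va(2)] va(3) e_0 by simp
    qed
    show "?q (c *\<^sub>R g) = \<bar>c\<bar> * ?q g"
      unfolding va(3) e_scale[OF va(1)] q[OF C0_scale[OF va(1)] tuples_closed(3)[OF va(2)]] q[OF va(1,2)]
      by (simp add: s_props(3)[OF va(1)] Y_props(3)[OF va(2)] max_mult_distrib_left)
    fix h assume h: "h \<in> ?W"
    obtain w b where wb: "w \<in> C0" "b \<in> tuples N" "h = ?e w b" using WE[OF h] by blast
    show "?q (g + h) \<le> ?q g + ?q h"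
      unfolding va(3) wb(3) e_add[OF va(1) wb(1)] q[OF C0_add[OF va(1) wb(1)] tuples_closed(2)[OF va(2) wb(2)]]
        q[OF va(1,2)] q[OF wb(1,2)]
      using s_props(4)[OF va(1) wb(1)] Y_props(4)[OF va(2) wb(2)] by linarith
  qed
  define par where "par = inv_into (C0 \<times> tuples N) (\<lambda>(v, a). ?e v a)"
  have par: "par (?e v a) = (v, a)" if "v \<in> C0" "a \<in> tuples N" for v a
    using inv_into_f_f[OF inj, of "(v, a)"] that by (simp add: par_def)
  define J where "J f h = (if h \<in> ?W then val f (fst (par h)) (snd (par h)) else 0)" for f h
  have J: "J f (?e v a) = val f v a" if "v \<in> C0" "a \<in> tuples N" for f v a
    using W[OF that] by (simp add: J_def par[OF that])
  have J_0: "J f h = 0" if "h \<notin> ?W" for f h using that by (simp add: J_def)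
  have test: "tvec \<psi> \<in> ?W \<and> (\<forall>f\<in>V. J f (tvec \<psi>) = pairing f \<psi>)" for \<psi>
  proof -
    obtain w a where a: "a \<in> tuples N"
      and w: "\<And>r. \<psi> $ r = (\<Sum>k\<in>UNIV. tad (L $ k $ r) (w $ k)) + (\<Sum>n<N. a n *\<^sub>R \<phi> n $ r)"
      using test_decomposition by blast
    show ?thesis using W[OF tfun_C0 a, of w] J[OF tfun_C0 a, of _ w] val_test[OF w] by (simp add: predual_dist_test[OF w])
  qed
  have lin: "J (b *\<^sub>R f + c *\<^sub>R g) = (\<lambda>h. b * J f h + c * J g h)" if f: "f \<in> V" and g: "g \<in> V" for f g b c
  proof
    fix h
    show "J (b *\<^sub>R f + c *\<^sub>R g) h = b * J f h + c * J g h"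
    proof (cases "h \<in> ?W")
      case True
      obtain v a where va: "v \<in> C0" "a \<in> tuples N" "h = ?e v a" using WE[OF True] by blast
      show ?thesis unfolding va(3) J[OF va(1,2)] by (rule val_lincomb[OF f g va(1)])
    qed (simp add: J_0)
  qed
  have "bij_betw J V (top_dual ?W ?q)"
    unfolding bij_betw_def
  proof
    show "inj_on J V"
    proof (rule inj_onI)
      fix f h assume f: "f \<in> V" and h: "h \<in> V" and eq: "J f = J h"
      show "f = h"
      proof (rule val_eq_imp_eq[OF f h])
        fix v :: "real \<Rightarrow> real ^ 'd" and a assume va: "v \<in> C0" "a \<in> tuples N"
        show "val f v a = val h v a" using fun_cong[OF eq, of "?e v a"] by (simp add: J[OF va])
      qed
    qed
    show "J ` V = top_dual ?W ?q"
    proof (intro equalityI subsetI)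
      fix F assume "F \<in> J ` V"
      then obtain f where f: "f \<in> V" "F = J f" by blast
      show "F \<in> top_dual ?W ?q" unfolding top_dual_def mem_Collect_eq f(2)
      proof (intro conjI allI impI ballI exI)
        fix g h c
        show "g \<notin> ?W \<Longrightarrow> J f g = 0" by (rule J_0)
        assume g: "g \<in> ?W"
        obtain v a where va: "v \<in> C0" "a \<in> tuples N" "g = ?e v a" using WE[OF g] by blast
        show "J f (c *\<^sub>R g) = c * J f g"
          unfolding va(3) e_scale[OF va(1)] J[OF va(1,2)] J[OF C0_scale[OF va(1)] tuples_closed(3)[OF va(2)]] by (rule val_scale)
        show "\<bar>J f g\<bar> \<le> native f * ?q g" unfolding va(3) J[OF va(1,2)] q[OF va(1,2)] by (rule val_le[OF va(1,2)])
        assume h: "h \<in> ?W"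
        obtain w b where wb: "w \<in> C0" "b \<in> tuples N" "h = ?e w b" using WE[OF h] by blast
        show "J f (g + h) = J f g + J f h"
          unfolding va(3) wb(3) e_add[OF va(1) wb(1)] J[OF va(1,2)] J[OF wb(1,2)]
            J[OF C0_add[OF va(1) wb(1)] tuples_closed(2)[OF va(2) wb(2)]] by (rule val_add[OF va(1) wb(1)])
      qed
    next
      fix F assume F: "F \<in> top_dual ?W ?q"
      then have F0: "\<And>g. g \<notin> ?W \<Longrightarrow> F g = 0" and Fadd: "\<And>g h. g \<in> ?W \<Longrightarrow> h \<in> ?W \<Longrightarrow> F (g + h) = F g + F h"
        and Fscale: "\<And>g c. g \<in> ?W \<Longrightarrow> F (c *\<^sub>R g) = c * F g" unfolding top_dual_def by simp_all
      obtain C where C: "\<And>g. g \<in> ?W \<Longrightarrow> \<bar>F g\<bar> \<le> C * ?q g" using F unfolding top_dual_def by blast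
      have "\<exists>f\<in>V. \<forall>v\<in>C0. \<forall>a\<in>tuples N. F (?e v a) = val f v a"
      proof (rule representation)
        fix v w :: "real \<Rightarrow> real ^ 'd" and a b c assume va: "v \<in> C0" "a \<in> tuples N"
        show "F (?e (\<lambda>x. v x + w x) (\<lambda>i. a i + b i)) = F (?e v a) + F (?e w b)" if wb: "w \<in> C0" "b \<in> tuples N"
          unfolding e_add[OF va(1) wb(1), symmetric] by (rule Fadd[OF W[OF va] W[OF wb]])
        show "F (?e (\<lambda>x. c *\<^sub>R v x) (\<lambda>i. c * a i)) = c * F (?e v a)"
          unfolding e_scale[OF va(1), symmetric] by (rule Fscale[OF W[OF va]])
        show "\<bar>F (?e v a)\<bar> \<le> C * max (s v) (Y a)" using C[OF W[OF va]] by (simp add: q[OF va])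
      qed
      then obtain f where f: "f \<in> V" "\<And>v a. v \<in> C0 \<Longrightarrow> a \<in> tuples N \<Longrightarrow> F (?e v a) = val f v a" by blast
      have "F = J f"
      proof
        fix g show "F g = J f g"
        proof (cases "g \<in> ?W")
          case True
          obtain v a where va: "v \<in> C0" "a \<in> tuples N" "g = ?e v a" using WE[OF True] by blast
          show ?thesis unfolding va(3) J[OF va(1,2)] by (rule f(2)[OF va(1,2)])
        qed (simp add: F0 J_0)
      qed
      then show "F \<in> J ` V" using f(1) by blast
    qed
  qed
  moreover have "functional_norm ?W ?q (J f) = native f" for f
    by (rule functional_norm_eq[OF inj J])
  ultimately show ?thesis unfolding is_dual_of_distributions_def
    using norm_on_native norm test lin by blast
qed

end

section \<open>Extreme points of balls of measures\<close>

lemma extreme_pointD: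
  assumes "x extreme_point_of S" "a \<in> S" "b \<in> S" "0 < u" "u < 1" "x = (1 - u) *\<^sub>R a + u *\<^sub>R b"
  shows "a = x" and "b = x"
proof -
  have "a = b" using assms unfolding extreme_point_of_def in_segment by blast
  then show "a = x" "b = x" using assms(6) by (simp_all add: scaleR_left_diff_distrib)
qed

lemma extreme_pointI:
  assumes "x \<in> S" "\<And>a b u. a \<in> S \<Longrightarrow> b \<in> S \<Longrightarrow> 0 < u \<Longrightarrow> u < 1 \<Longrightarrow> x = (1 - u) *\<^sub>R a + u *\<^sub>R b \<Longrightarrow> a = b"
  shows "x extreme_point_of S"
  unfolding extreme_point_of_def
proof (intro conjI ballI notI assms(1))
  fix a b assume "a \<in> S" "b \<in> S" and x: "x \<in> open_segment a b"
  then show False using assms(2) unfolding in_segment by blast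
qed

text \<open>A point of norm less than 1 is the midpoint of a segment in the ball, in any direction
  \<open>y\<close>.\<close>

lemma extreme_point_norm:
  fixes x y :: "'a :: real_vector"
  assumes n: "norm_on UNIV n" and x: "x extreme_point_of {x. n x \<le> 1}" and y: "y \<noteq> 0"
  shows "n x = 1"
proof (rule ccontr)
  assume "n x \<noteq> 1"
  moreover have "n x \<le> 1" using x by (simp add: extreme_point_of_def)
  ultimately have lt: "n x < 1" by simp
  have ny: "0 < n y" using norm_onD(3,4)[OF n] y by (metis less_eq_real_def)
  define e where "e = (1 - n x) / n y"
  have e: "0 < e" "e * n y = 1 - n x" using lt ny by (simp_all add: e_def)
  have "n (x + e *\<^sub>R y) \<le> 1" "n (x + (- e) *\<^sub>R y) \<le> 1"
    using norm_onD(1)[OF n, of x "e *\<^sub>R y"] norm_onD(1)[OF n, of x "(- e) *\<^sub>R y"] e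
    by (simp_all only: norm_onD(2)[OF n] abs_minus_cancel abs_of_pos)
  moreover have "x = (1 - 1 / 2) *\<^sub>R (x + e *\<^sub>R y) + (1 / 2) *\<^sub>R (x + (- e) *\<^sub>R y)"
    by (simp add: algebra_simps flip: scaleR_add_left)
  ultimately have "x + e *\<^sub>R y = x"
    by (intro extreme_pointD(1)[OF x, where u = "1 / 2"]) simp_all
  then show False using e y by simp
qed

text \<open>If neither piece is zero, the extreme point is a proper convex combination of the pieces rescaled
  to its own norm, so the rescaled pieces coincide with it.\<close>

lemma extreme_point_split:
  assumes n: "norm_on UNIV n" and x: "x extreme_point_of {x. n x \<le> 1}"
    and sum: "x = a + b" "n x = n a + n b"
  shows "\<exists>c. a = c *\<^sub>R x"
proof (cases "a = 0 \<or> b = 0")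
  case True
  then show ?thesis using sum(1) by (metis add.right_neutral scale_zero_left scaleR_one)
next
  case False
  note N = norm_onD[OF n]
  have pos: "0 < n a" "0 < n b" using False N(3,4) by (metis less_eq_real_def)+
  let ?s = "n a + n b"
  have s: "0 < ?s" "?s \<le> 1" using pos x sum(2) by (simp_all add: extreme_point_of_def)
  let ?a = "(?s / n a) *\<^sub>R a" and ?b = "(?s / n b) *\<^sub>R b" and ?u = "n b / ?s"
  have u: "0 < ?u" "?u < 1" "1 - ?u = n a / ?s" using pos s by (simp_all add: field_simps)
  have ab: "n ?a \<le> 1" "n ?b \<le> 1" using s pos by (simp_all add: N(2))
  have c: "n a / ?s * (?s / n a) = 1" "n b / ?s * (?s / n b) = 1" using pos s by simp_all
  then have eq: "x = (1 - ?u) *\<^sub>R ?a + ?u *\<^sub>R ?b" unfolding u(3) scaleR_scaleR using sum(1) by simp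
  have "a = (n a / ?s) *\<^sub>R ?a" by (simp only: scaleR_scaleR c scaleR_one)
  also have "?a = x"
    by (rule extreme_pointD(1)[OF x _ _ u(1,2) eq]) (simp_all only: mem_Collect_eq ab)
  finally show ?thesis by blast
qed

text \<open>The point is the supremum of the \<open>t\<close> for which \<open>{..t}\<close> is null.\<close>

lemma concentrated_at_point:
  fixes null :: "real set \<Rightarrow> bool"
  assumes mono: "\<And>A B. null A \<Longrightarrow> B \<in> sets borel \<Longrightarrow> B \<subseteq> A \<Longrightarrow> null B"
    and UN: "\<And>A :: nat \<Rightarrow> real set. (\<And>k. null (A k)) \<Longrightarrow> null (\<Union>k. A k)"
    and dich: "\<And>A. A \<in> sets borel \<Longrightarrow> null A \<or> null (- A)"
    and UNIV: "\<not> null UNIV"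
  shows "\<exists>x. null (- {x})"
proof -
  let ?S = "{t. null {..t}}"
  have upper: "null {t<..}" if "t \<notin> ?S" for t
    using dich[of "{..t}"] that by (simp add: Compl_atMost)
  have lower: "null {..r}" if "null {..t}" "r \<le> t" for r t
    by (rule mono[OF that(1)]) (use that(2) in simp_all)
  have ne: "?S \<noteq> {}"
  proof
    assume "?S = {}"
    then have "null {- real k<..}" for k using upper by blast
    then have "null (\<Union>k. {- real k<..})" by (rule UN)
    moreover have "(\<Union>k. {- real k<..}) = UNIV"
    proof (intro equalityI subsetI UNIV_I)
      fix y :: real
      obtain k where "- y < real k" using reals_Archimedean2 by blast
      then show "y \<in> (\<Union>k. {- real k<..})" by (intro UN_I[of k]) simp_all
    qed
    ultimately show False using UNIV by simp
  qed
  have bdd: "bdd_above ?S"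
  proof (rule ccontr)
    assume n: "\<not> bdd_above ?S"
    have "null {..real k}" for k
    proof -
      obtain t where "t \<in> ?S" "real k < t" using n unfolding bdd_above_def by (meson not_le)
      then show ?thesis using lower[of t "real k"] by simp
    qed
    then have "null (\<Union>k. {..real k})" by (rule UN)
    moreover have "(\<Union>k. {..real k}) = UNIV"
      using real_arch_simple by (intro equalityI subsetI UNIV_I) blast
    ultimately show False using UNIV by simp
  qed
  define x where "x = Sup ?S"
  have "null {..x - inverse (real (Suc k))}" for k
  proof -
    have "x - inverse (real (Suc k)) < Sup ?S" by (simp add: x_def)
    then obtain t where "t \<in> ?S" "x - inverse (real (Suc k)) < t" unfolding less_cSup_iff[OF ne bdd] by blast
    then show ?thesis using lower[of t] by simp
  qed
  moreover have "null {x + inverse (real (Suc k))<..}" for k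
  proof (rule upper)
    show "x + inverse (real (Suc k)) \<notin> ?S"
      using cSup_upper[OF _ bdd, of "x + inverse (real (Suc k))"] unfolding x_def by force
  qed
  ultimately have "null (if even k then {..x - inverse (real (Suc k))} else {x + inverse (real (Suc k))<..})" for k
    by (cases "even k") simp_all
  then have "null (\<Union>k. if even k then {..x - inverse (real (Suc k))} else {x + inverse (real (Suc k))<..})" (is "null ?U") by (rule UN)
  moreover have "- {x} \<subseteq> ?U"
  proof
    fix y assume "y \<in> - {x}"
    then have "0 < \<bar>y - x\<bar>" by simp
    then obtain k where k: "inverse (real (Suc k)) < \<bar>y - x\<bar>" using reals_Archimedean by blast
    have le: "inverse (real (Suc j)) \<le> inverse (real (Suc k))" if "k \<le> j" for j
      using that by (intro le_imp_inverse_le) simp_all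
    show "y \<in> ?U"
    proof (cases "y < x")
      case True
      have "inverse (real (Suc (2 * k))) \<le> inverse (real (Suc k))" by (intro le) simp
      then have "y \<le> x - inverse (real (Suc (2 * k)))" using True k by linarith
      then show ?thesis by (intro UN_I[of "2 * k"]) simp_all
    next
      case False
      have "inverse (real (Suc (2 * k + 1))) \<le> inverse (real (Suc k))" by (intro le) simp
      then have "x + inverse (real (Suc (2 * k + 1))) < y" using False k by linarith
      then show ?thesis by (intro UN_I[of "2 * k + 1"]) simp_all
    qed
  qed
  ultimately have "null (- {x})" by - (rule mono, assumption, simp, assumption)
  then show ?thesis by blast
qed

lemma svec_split: "A \<in> sets borel \<Longrightarrow> B \<in> sets borel \<Longrightarrow> svec \<mu> A = svec \<mu> (A \<inter> B) + svec \<mu> (A - B)"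
  by (simp add: vec_eq_iff svec_def flip: smeas_split)

lemma svec_eqI: "(\<And>E. E \<in> sets borel \<Longrightarrow> svec \<mu> E = svec \<nu> E) \<Longrightarrow> \<mu> = \<nu>"
  unfolding vec_eq_iff svec_def by (auto intro!: smeasure_eqI simp: vec_eq_iff)

lemma vdirac_of_null_complement:
  assumes "\<And>B. B \<in> sets borel \<Longrightarrow> x \<notin> B \<Longrightarrow> svec \<mu> B = 0"
  shows "\<mu> = vdirac (svec \<mu> {x}) x"
proof (rule svec_eqI)
  fix E :: "real set" assume E: "E \<in> sets borel"
  have "E \<inter> {x} = (if x \<in> E then {x} else {})" by auto
  then show "svec \<mu> E = svec (vdirac (svec \<mu> {x}) x) E"
    using svec_split[OF E, of "{x}" \<mu>] assms[of "E - {x}"] E by (simp add: svec_vdirac)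
qed

text \<open>If the restriction to \<open>A\<close> is \<open>c\<close> times the measure, then
  \<open>A\<close> is null for \<open>c = 0\<close> and the complement of \<open>A\<close> is null
  otherwise.\<close>

lemma vdirac_of_proportional_restrictions:
  assumes pr: "\<And>A. A \<in> sets borel \<Longrightarrow> \<exists>c. vrestrict A \<mu> = c *\<^sub>R \<mu>"
  shows "\<exists>w x. \<mu> = vdirac w x"
proof -
  define null where "null A \<longleftrightarrow> A \<in> sets borel \<and> (\<forall>B\<in>sets borel. B \<subseteq> A \<longrightarrow> svec \<mu> B = 0)" for A
  show ?thesis
  proof (cases "null UNIV")
    case True
    then have "svec \<mu> B = 0" if "B \<in> sets borel" for B using that by (simp add: null_def)
    then show ?thesis using vdirac_of_null_complement[of 0 \<mu>] by blast
  next
    case False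
    have "\<exists>x. null (- {x})"
    proof (rule concentrated_at_point[where null = null])
      show "\<not> null UNIV" by (rule False)
      show "null B" if "null A" "B \<in> sets borel" "B \<subseteq> A" for A B
        using that unfolding null_def by (meson order_trans)
      show "null (\<Union>k. A k)" if A: "\<And>k. null (A k)" for A :: "nat \<Rightarrow> real set"
        unfolding null_def
      proof (intro conjI ballI impI)
        have Ab: "A k \<in> sets borel" for k using A[of k] by (simp add: null_def)
        then show "(\<Union>k. A k) \<in> sets borel" by blast
        fix B :: "real set" assume B: "B \<in> sets borel" "B \<subseteq> (\<Union>k. A k)"
        let ?C = "\<lambda>k. B \<inter> disjointed A k"
        have C: "?C k \<in> sets borel" for k using sets.range_disjointed_sets[of A borel] Ab B(1) by blast
        have zero: "smeas (\<mu> $ d) (?C k) = 0" for d k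
        proof -
          have "svec \<mu> (?C k) = 0" using A[of k] C[of k] disjointed_subset[of A k] unfolding null_def by blast
          then show ?thesis by (simp add: svec_def vec_eq_iff)
        qed
        have "disjoint_family ?C" using disjoint_family_disjointed[of A] unfolding disjoint_family_on_def by blast
        then have "(\<lambda>k. smeas (\<mu> $ d) (?C k)) sums smeas (\<mu> $ d) (\<Union>k. ?C k)" for d
          using C by (intro smeas_sums) auto
        moreover have "(\<Union>k. ?C k) = B" using B(2) UN_disjointed_eq[of A] by blast
        ultimately have "(\<lambda>_. 0) sums smeas (\<mu> $ d) B" for d by (simp add: zero)
        then have "smeas (\<mu> $ d) B = 0" for d using sums_unique2[OF sums_zero] by metis
        then show "svec \<mu> B = 0" by (simp add: svec_def vec_eq_iff)
      qed
      show "null A \<or> null (- A)" if A: "A \<in> sets borel" for A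
      proof -
        obtain c where c: "vrestrict A \<mu> = c *\<^sub>R \<mu>" using pr[OF A] by blast
        have r: "svec \<mu> (B \<inter> A) = c *\<^sub>R svec \<mu> B" if "B \<in> sets borel" for B
          using svec_vrestrict[OF A that, of \<mu>] by (simp add: c)
        show ?thesis
        proof (cases "c = 0")
          case True
          have "svec \<mu> B = 0" if "B \<in> sets borel" "B \<subseteq> A" for B using r[OF that(1)] that(2) True by (simp add: Int_absorb2)
          then show ?thesis using A by (simp add: null_def)
        next
          case False
          have "svec \<mu> B = 0" if B: "B \<in> sets borel" "B \<subseteq> - A" for B
          proof -
            have "B \<inter> A = {}" using B by blast
            then show ?thesis using r[OF B(1)] False by simp
          qed
          then show ?thesis using A by (simp add: null_def borel_comp)
        qed
      qed
    qed
    then obtain x where "null (- {x})" by blast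
    then have "\<mu> = vdirac (svec \<mu> {x}) x"
      unfolding null_def by (intro vdirac_of_null_complement) blast
    then show ?thesis by blast
  qed
qed

lemma vdirac_linear: "linear (\<lambda>w. vdirac w x)"
  by (rule linearI) (simp_all add: vdirac_def vec_eq_iff scaleR_add_left)

lemma vdirac_inj: "vdirac w x = vdirac u x \<Longrightarrow> w = u"
proof -
  assume "vdirac w x = vdirac u x"
  then have "svec (vdirac w x) {x} = svec (vdirac u x) {x}" by simp
  then show ?thesis by (simp add: svec_vdirac)
qed

lemma inner_norm_vdirac: "norm_on UNIV W \<Longrightarrow> inner_norm W (vdirac w x) = W w"
  using inner_norm_discrete[of W "{()}" "\<lambda>_. x" "\<lambda>_. w"] by simp

text \<open>The norm is additive on complementary sets, so nothing is left for the complement of the point.\<close>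

lemma vdirac_of_inner_norm:
  assumes W: "norm_on UNIV W" and le: "inner_norm W \<mu> \<le> W (svec \<mu> {x})"
  shows "\<mu> = vdirac (svec \<mu> {x}) x"
proof (rule vdirac_of_null_complement)
  fix B :: "real set" assume B: "B \<in> sets borel" "x \<notin> B"
  have "svec (vrestrict {x} \<mu>) {x} = svec \<mu> {x}" by (simp add: svec_vrestrict)
  then have "W (svec \<mu> {x}) \<le> inner_norm W (vrestrict {x} \<mu>)" using inner_norm_ge[OF W, of "{x}" "vrestrict {x} \<mu>"] by simp
  then have "inner_norm W (vrestrict (- {x}) \<mu>) \<le> 0"
    using inner_norm_restrict[OF W, of "{x}" \<mu>] le by simp
  then have "inner_norm W (vrestrict (- {x}) \<mu>) = 0" using inner_norm_nonneg[OF W] by (intro antisym)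
  then have "vrestrict (- {x}) \<mu> = 0" using norm_onD(4)[OF norm_on_inner_norm[OF W]] by blast
  then have "svec \<mu> (B \<inter> - {x}) = svec 0 B" using svec_vrestrict[of "- {x}" B \<mu>] B(1) by (simp add: borel_comp)
  moreover have "B \<inter> - {x} = B" using B(2) by blast
  ultimately show "svec \<mu> B = 0" using B(1) svec_zero_iff[of "0 :: smeasure ^ 'a"] by simp
qed

text \<open>Restrictions of an extreme point to complementary sets have norms that add up, so they are
  proportional to it. For the converse, in a convex combination equal to an atom the values at its
  position agree by extremality of \<open>w\<close>, and they use up the norm.\<close>

theorem extreme_points_inner_ball:
  fixes W :: "real ^ 'd \<Rightarrow> real"
  assumes W: "norm_on UNIV W"
  shows "\<mu> extreme_point_of {\<mu>. inner_norm W \<mu> \<le> 1} \<longleftrightarrow>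
    (\<exists>w x. \<mu> = vdirac w x \<and> w extreme_point_of {u. W u \<le> 1} \<and> W w = 1)"
proof
  assume \<mu>: "\<mu> extreme_point_of {\<mu>. inner_norm W \<mu> \<le> 1}"
  have "\<exists>w x. \<mu> = vdirac w x"
  proof (rule vdirac_of_proportional_restrictions)
    fix A :: "real set" assume A: "A \<in> sets borel"
    show "\<exists>c. vrestrict A \<mu> = c *\<^sub>R \<mu>"
      by (rule extreme_point_split[OF norm_on_inner_norm[OF W] \<mu> vrestrict_add[OF A] inner_norm_restrict[OF W A]])
  qed
  then obtain w x where wx: "\<mu> = vdirac w x" by blast
  have w: "w extreme_point_of {u. W u \<le> 1}"
  proof (rule extreme_pointI)
    show "w \<in> {u. W u \<le> 1}" using \<mu> by (simp add: extreme_point_of_def wx inner_norm_vdirac[OF W])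
    fix a b u assume ab: "a \<in> {u. W u \<le> 1}" "b \<in> {u. W u \<le> 1}" and u: "0 < u" "u < 1" "w = (1 - u) *\<^sub>R a + u *\<^sub>R b"
    have eq: "\<mu> = (1 - u) *\<^sub>R vdirac a x + u *\<^sub>R vdirac b x"
      unfolding wx u(3) by (simp add: linear_add[OF vdirac_linear] linear_scale[OF vdirac_linear])
    have ball: "vdirac a x \<in> {\<mu>. inner_norm W \<mu> \<le> 1}" "vdirac b x \<in> {\<mu>. inner_norm W \<mu> \<le> 1}"
      using ab by (simp_all add: inner_norm_vdirac[OF W])
    have "vdirac a x = vdirac b x" using extreme_pointD[OF \<mu> ball u(1,2) eq] by simp
    then show "a = b" by (rule vdirac_inj)
  qed
  moreover have "W w = 1" by (rule extreme_point_norm[OF W w one_neq_zero])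
  ultimately show "\<exists>w x. \<mu> = vdirac w x \<and> w extreme_point_of {u. W u \<le> 1} \<and> W w = 1" using wx by blast
next
  assume "\<exists>w x. \<mu> = vdirac w x \<and> w extreme_point_of {u. W u \<le> 1} \<and> W w = 1"
  then obtain w x where wx: "\<mu> = vdirac w x" and w: "w extreme_point_of {u. W u \<le> 1}" "W w = 1" by blast
  show "\<mu> extreme_point_of {\<mu>. inner_norm W \<mu> \<le> 1}"
  proof (rule extreme_pointI)
    show "\<mu> \<in> {\<mu>. inner_norm W \<mu> \<le> 1}" by (simp add: wx inner_norm_vdirac[OF W] w(2))
    fix \<alpha> \<beta> u assume ab: "\<alpha> \<in> {\<mu>. inner_norm W \<mu> \<le> 1}" "\<beta> \<in> {\<mu>. inner_norm W \<mu> \<le> 1}"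
      and u: "0 < u" "u < 1" "\<mu> = (1 - u) *\<^sub>R \<alpha> + u *\<^sub>R \<beta>"
    have ball: "svec \<gamma> {x} \<in> {u. W u \<le> 1}" if "\<gamma> \<in> {\<mu>. inner_norm W \<mu> \<le> 1}" for \<gamma>
      using inner_norm_ge[OF W, of "{x}" \<gamma>] that by simp
    have "svec (vdirac w x) {x} = (1 - u) *\<^sub>R svec \<alpha> {x} + u *\<^sub>R svec \<beta> {x}"
      unfolding wx[symmetric] u(3) by simp
    then have "w = (1 - u) *\<^sub>R svec \<alpha> {x} + u *\<^sub>R svec \<beta> {x}" by (simp add: svec_vdirac)
    from extreme_pointD[OF w(1) ball[OF ab(1)] ball[OF ab(2)] u(1,2) this]
    have eq: "svec \<alpha> {x} = w" "svec \<beta> {x} = w" by simp_all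
    have "\<gamma> = vdirac w x" if "\<gamma> \<in> {\<mu>. inner_norm W \<mu> \<le> 1}" "svec \<gamma> {x} = w" for \<gamma>
      using vdirac_of_inner_norm[OF W, of \<gamma> x] that w(2) by simp
    then show "\<alpha> = \<beta>" using ab eq by metis
  qed
qed

text \<open>The atoms for the outer norm: it does not couple the positions of the components.\<close>

definition diag_dirac :: "real ^ 'd \<Rightarrow> real ^ 'd \<Rightarrow> smeasure ^ 'd" where
  "diag_dirac w x = (\<chi> d. w $ d *\<^sub>R sdirac (x $ d))"

lemma mvec_diag_dirac: "mvec (diag_dirac w x) = odot w (diracs x)"
  by (simp add: vec_eq_iff mvec_def diag_dirac_def odot_def diracs_def linear_scale[OF meas_distr_linear] meas_distr_dirac)

lemma smeas_sdirac: "smeas (c *\<^sub>R sdirac x) {x} = c"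
  by (simp add: smeas_simps sdirac.rep_eq)

lemma tv_norm_sdirac: "tv_norm (c *\<^sub>R sdirac x) = \<bar>c\<bar>"
  using tv_norm_discrete[of "{()}" "\<lambda>_. x" "\<lambda>_. c"] by simp

lemma sdirac_of_tv_norm:
  assumes "tv_norm \<sigma> \<le> \<bar>smeas \<sigma> {x}\<bar>"
  shows "\<sigma> = smeas \<sigma> {x} *\<^sub>R sdirac x"
proof -
  have "(\<chi> d :: 1. \<sigma>) = vdirac (svec (\<chi> d. \<sigma>) {x}) x"
    using assms by (intro vdirac_of_inner_norm[OF norm_on_abs_1]) (simp add: tv_norm_inner svec_def)
  from arg_cong[OF this, of "\<lambda>v. v $ 1"] show ?thesis by (simp add: vdirac_def svec_def)
qed

lemma sdirac_of_proportional_restrictions: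
  assumes "\<And>A. A \<in> sets borel \<Longrightarrow> \<exists>c. srestrict A \<sigma> = c *\<^sub>R \<sigma>"
  shows "\<exists>c x. \<sigma> = c *\<^sub>R sdirac x"
proof -
  have "\<exists>w x. (\<chi> d :: 1. \<sigma>) = vdirac w x"
  proof (rule vdirac_of_proportional_restrictions)
    fix A :: "real set" assume "A \<in> sets borel"
    then obtain c where "srestrict A \<sigma> = c *\<^sub>R \<sigma>" using assms by blast
    then have "vrestrict A (\<chi> d :: 1. \<sigma>) = c *\<^sub>R (\<chi> d. \<sigma>)" by (simp add: vrestrict_def vec_eq_iff)
    then show "\<exists>c. vrestrict A (\<chi> d :: 1. \<sigma>) = c *\<^sub>R (\<chi> d. \<sigma>)" ..
  qed
  then obtain w x where "(\<chi> d :: 1. \<sigma>) = vdirac w x" by blast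
  from arg_cong[OF this, of "\<lambda>v. v $ 1"] have "\<sigma> = w $ 1 *\<^sub>R sdirac x" by (simp add: vdirac_def)
  then show ?thesis by blast
qed

lemma outer_norm_diag_dirac: "monotone_norm W \<Longrightarrow> outer_norm W (diag_dirac w x) = W w"
  unfolding outer_norm_def diag_dirac_def by (rule monotone_norm_abs) (simp_all add: tv_norm_sdirac)

lemma diag_dirac_linear: "linear (\<lambda>w. diag_dirac w x)"
  by (rule linearI) (simp_all add: diag_dirac_def vec_eq_iff scaleR_add_left)

lemma diag_dirac_inj: "diag_dirac w x = diag_dirac u x \<Longrightarrow> w = u"
proof -
  assume eq: "diag_dirac w x = diag_dirac u x"
  have "smeas (diag_dirac w x $ d) {x $ d} = smeas (diag_dirac u x $ d) {x $ d}" for d by (simp only: eq)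
  then show ?thesis by (simp add: diag_dirac_def smeas_sdirac vec_eq_iff)
qed

text \<open>Cutting one component of an extreme point and dividing the others in the same proportion cuts it
  into pieces whose outer norms add up.\<close>

lemma extreme_point_outer_component:
  fixes W :: "real ^ 'd \<Rightarrow> real"
  assumes W: "monotone_norm W" and \<mu>: "\<mu> extreme_point_of {\<mu>. outer_norm W \<mu> \<le> 1}" and A: "A \<in> sets borel"
  shows "\<exists>c. srestrict A (\<mu> $ d) = c *\<^sub>R \<mu> $ d"
proof (cases "tv_norm (\<mu> $ d) = 0")
  case True
  then have "tv_norm (srestrict A (\<mu> $ d)) = 0"
    using tv_norm_restrict[OF A, of "\<mu> $ d"] tv_norm_nonneg[of "srestrict A (\<mu> $ d)"] tv_norm_nonneg[of "srestrict (- A) (\<mu> $ d)"]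
    by linarith
  then have "srestrict A (\<mu> $ d) = 0 *\<^sub>R \<mu> $ d" by (simp add: tv_norm_zero_iff)
  then show ?thesis ..
next
  case False
  let ?\<sigma> = "srestrict A (\<mu> $ d)" and ?\<tau> = "srestrict (- A) (\<mu> $ d)"
  define t where "t = tv_norm ?\<sigma> / tv_norm (\<mu> $ d)"
  have pos: "0 < tv_norm (\<mu> $ d)" using False tv_norm_nonneg[of "\<mu> $ d"] by simp
  have t: "0 \<le> t" "t \<le> 1" "tv_norm ?\<sigma> = t * tv_norm (\<mu> $ d)" "tv_norm ?\<tau> = (1 - t) * tv_norm (\<mu> $ d)"
    using pos tv_norm_restrict[OF A, of "\<mu> $ d"] tv_norm_nonneg[of ?\<sigma>] tv_norm_nonneg[of ?\<tau>]
    by (simp_all add: t_def field_simps)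
  let ?a = "\<chi> e. if e = d then ?\<sigma> else t *\<^sub>R \<mu> $ e" and ?b = "\<chi> e. if e = d then ?\<tau> else (1 - t) *\<^sub>R \<mu> $ e"
  have part: "outer_norm W (\<chi> e. if e = d then \<sigma> else r *\<^sub>R \<mu> $ e) = r * outer_norm W \<mu>"
    if "0 \<le> r" "tv_norm \<sigma> = r * tv_norm (\<mu> $ d)" for \<sigma> r
  proof -
    have "(\<chi> e. tv_norm ((\<chi> e. if e = d then \<sigma> else r *\<^sub>R \<mu> $ e) $ e)) = r *\<^sub>R (\<chi> e. tv_norm (\<mu> $ e))"
      using that by (simp add: vec_eq_iff tv_norm_scale)
    then show ?thesis
      using that(1) by (simp add: outer_norm_def norm_onD(2)[OF monotone_norm_norm_on[OF W]])
  qed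
  have "\<exists>c. ?a = c *\<^sub>R \<mu>"
  proof (rule extreme_point_split[OF norm_on_outer_norm[OF W] \<mu>])
    show "\<mu> = ?a + ?b"
      using srestrict_add[OF A, of "\<mu> $ d"] by (simp add: vec_eq_iff flip: scaleR_add_left)
    show "outer_norm W \<mu> = outer_norm W ?a + outer_norm W ?b"
      using part[OF t(1,3)] part[OF _ t(4)] t(2) by (simp add: algebra_simps)
  qed
  then obtain c where "?a = c *\<^sub>R \<mu>" by blast
  then have "?a $ d = (c *\<^sub>R \<mu>) $ d" by (simp only:)
  then have "?\<sigma> = c *\<^sub>R \<mu> $ d" by simp
  then show ?thesis ..
qed

text \<open>The point \<open>w\<close> is the midpoint of two vectors dominated by \<open>t\<close>, which lie in the ball by
  monotonicity: in each component, one has absolute value \<open>t\<close> and the other is its reflection.\<close>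

lemma extreme_point_maximal:
  fixes W :: "real ^ 'd \<Rightarrow> real"
  assumes W: "monotone_norm W" and w: "w extreme_point_of {u. W u \<le> 1}"
    and t: "W t \<le> 1" "\<And>d. \<bar>w $ d\<bar> \<le> t $ d"
  shows "t $ d = \<bar>w $ d\<bar>"
proof -
  define s :: "real ^ 'd" where "s = (\<chi> d. (if w $ d < 0 then - 1 else 1) * (t $ d - \<bar>w $ d\<bar>))"
  have "\<bar>(w + s) $ d\<bar> \<le> \<bar>t $ d\<bar> \<and> \<bar>(w - s) $ d\<bar> \<le> \<bar>t $ d\<bar>" for d
    using t(2)[of d] by (cases "w $ d < 0"; simp add: s_def; linarith)
  then have ball: "w + s \<in> {u. W u \<le> 1}" "w - s \<in> {u. W u \<le> 1}"
    using monotone_norm_mono[OF W, of "w + s" t] monotone_norm_mono[OF W, of "w - s" t] t(1) by auto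
  have "w = (1 - 1 / 2) *\<^sub>R (w + s) + (1 / 2) *\<^sub>R (w - s)"
    by (simp add: algebra_simps flip: scaleR_add_left)
  then have "w + s = w" by (intro extreme_pointD(1)[OF w ball, of "1 / 2"]) simp_all
  then have "s $ d = 0" by simp
  then show ?thesis by (simp add: s_def split: if_splits)
qed

text \<open>In the converse direction only the values at the atoms are controlled at first, and these
  agree by extremality of \<open>w\<close>. The total variations dominate their absolute values, so they
  are equal to them by maximality, and no mass is left elsewhere.\<close>

theorem extreme_points_outer_ball:
  fixes W :: "real ^ 'd \<Rightarrow> real"
  assumes W: "monotone_norm W"
  shows "\<mu> extreme_point_of {\<mu>. outer_norm W \<mu> \<le> 1} \<longleftrightarrow>
    (\<exists>w x. \<mu> = diag_dirac w x \<and> w extreme_point_of {u. W u \<le> 1} \<and> W w = 1)"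
proof
  assume \<mu>: "\<mu> extreme_point_of {\<mu>. outer_norm W \<mu> \<le> 1}"
  have "\<forall>d. \<exists>cx. \<mu> $ d = fst cx *\<^sub>R sdirac (snd cx)"
  proof
    fix d
    have "\<exists>c x. \<mu> $ d = c *\<^sub>R sdirac x"
      by (rule sdirac_of_proportional_restrictions) (rule extreme_point_outer_component[OF W \<mu>])
    then show "\<exists>cx. \<mu> $ d = fst cx *\<^sub>R sdirac (snd cx)" by simp
  qed
  from choice[OF this] obtain cx where cx: "\<And>d. \<mu> $ d = fst (cx d) *\<^sub>R sdirac (snd (cx d))" by blast
  define w where "w = (\<chi> d. fst (cx d))"
  define x where "x = (\<chi> d. snd (cx d))"
  have wx: "\<mu> = diag_dirac w x" by (simp add: vec_eq_iff diag_dirac_def w_def x_def cx)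
  have w: "w extreme_point_of {u. W u \<le> 1}"
  proof (rule extreme_pointI)
    show "w \<in> {u. W u \<le> 1}" using \<mu> by (simp add: extreme_point_of_def wx outer_norm_diag_dirac[OF W])
    fix a b u assume ab: "a \<in> {u. W u \<le> 1}" "b \<in> {u. W u \<le> 1}" and u: "0 < u" "u < 1" "w = (1 - u) *\<^sub>R a + u *\<^sub>R b"
    have eq: "\<mu> = (1 - u) *\<^sub>R diag_dirac a x + u *\<^sub>R diag_dirac b x"
      unfolding wx u(3) by (simp add: linear_add[OF diag_dirac_linear] linear_scale[OF diag_dirac_linear])
    have ball: "diag_dirac a x \<in> {\<mu>. outer_norm W \<mu> \<le> 1}" "diag_dirac b x \<in> {\<mu>. outer_norm W \<mu> \<le> 1}"
      using ab by (simp_all add: outer_norm_diag_dirac[OF W])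
    have "diag_dirac a x = diag_dirac b x" using extreme_pointD[OF \<mu> ball u(1,2) eq] by simp
    then show "a = b" by (rule diag_dirac_inj)
  qed
  moreover have "W w = 1" by (rule extreme_point_norm[OF monotone_norm_norm_on[OF W] w one_neq_zero])
  ultimately show "\<exists>w x. \<mu> = diag_dirac w x \<and> w extreme_point_of {u. W u \<le> 1} \<and> W w = 1" using wx by blast
next
  assume "\<exists>w x. \<mu> = diag_dirac w x \<and> w extreme_point_of {u. W u \<le> 1} \<and> W w = 1"
  then obtain w x where wx: "\<mu> = diag_dirac w x" and w: "w extreme_point_of {u. W u \<le> 1}" "W w = 1" by blast
  let ?ev = "\<lambda>\<gamma> :: smeasure ^ 'd. \<chi> d. smeas (\<gamma> $ d) {x $ d}"
  show "\<mu> extreme_point_of {\<mu>. outer_norm W \<mu> \<le> 1}"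
  proof (rule extreme_pointI)
    show "\<mu> \<in> {\<mu>. outer_norm W \<mu> \<le> 1}" by (simp add: wx outer_norm_diag_dirac[OF W] w(2))
    fix \<alpha> \<beta> u assume ab: "\<alpha> \<in> {\<mu>. outer_norm W \<mu> \<le> 1}" "\<beta> \<in> {\<mu>. outer_norm W \<mu> \<le> 1}"
      and u: "0 < u" "u < 1" "\<mu> = (1 - u) *\<^sub>R \<alpha> + u *\<^sub>R \<beta>"
    have ge: "\<bar>smeas (\<gamma> $ d) {x $ d}\<bar> \<le> tv_norm (\<gamma> $ d)" for \<gamma> :: "smeasure ^ 'd" and d by (rule tv_norm_ge) simp
    have ball: "?ev \<gamma> \<in> {u. W u \<le> 1}" if "\<gamma> \<in> {\<mu>. outer_norm W \<mu> \<le> 1}" for \<gamma>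
    proof -
      have "W (?ev \<gamma>) \<le> outer_norm W \<gamma>"
        unfolding outer_norm_def by (rule monotone_norm_mono[OF W]) (simp add: ge tv_norm_nonneg)
      then show ?thesis using that by simp
    qed
    have "?ev (diag_dirac w x) = (1 - u) *\<^sub>R ?ev \<alpha> + u *\<^sub>R ?ev \<beta>"
      unfolding wx[symmetric] u(3) by (simp add: vec_eq_iff smeas_simps)
    then have "w = (1 - u) *\<^sub>R ?ev \<alpha> + u *\<^sub>R ?ev \<beta>" by (simp add: diag_dirac_def smeas_sdirac)
    from extreme_pointD[OF w(1) ball[OF ab(1)] ball[OF ab(2)] u(1,2) this]
    have eq: "?ev \<alpha> = w" "?ev \<beta> = w" by simp_all
    have "\<gamma> = diag_dirac w x" if \<gamma>: "\<gamma> \<in> {\<mu>. outer_norm W \<mu> \<le> 1}" and ev: "?ev \<gamma> = w" for \<gamma>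
    proof -
      have sm: "smeas (\<gamma> $ d) {x $ d} = w $ d" for d using ev by (simp add: vec_eq_iff)
      have "(\<chi> d. tv_norm (\<gamma> $ d)) $ d = \<bar>w $ d\<bar>" for d
        by (rule extreme_point_maximal[OF W w(1)]) (use \<gamma> ge[of \<gamma>] in \<open>simp_all add: outer_norm_def sm\<close>)
      then have "\<gamma> $ d = smeas (\<gamma> $ d) {x $ d} *\<^sub>R sdirac (x $ d)" for d by (intro sdirac_of_tv_norm) (simp add: sm)
      then show ?thesis by (simp add: vec_eq_iff diag_dirac_def sm)
    qed
    then show "\<alpha> = \<beta>" using ab eq by metis
  qed
qed

section \<open>Extreme points in the quotient\<close>

text \<open>The cosets of the null space in the native space, parametrised by the measures.\<close>

definition fibre :: "real poly ^ 'd ^ 'd \<Rightarrow> smeasure ^ 'd \<Rightarrow> (distr ^ 'd) set" where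
  "fibre L \<mu> = {f \<in> native_space L. mu L f = \<mu>}"

lemma coset_fibre:
  assumes f: "f \<in> native_space L"
  shows "coset f (null_space L) = fibre L (mu L f)"
proof (intro equalityI subsetI)
  fix g assume "g \<in> coset f (null_space L)"
  then obtain q where q: "q \<in> null_space L" "g = f + q" unfolding coset_def by blast
  have "q \<in> native_space L" "mu L q = 0" using q(1) null_subset_native[of L] mu_zero_iff[of q L] by blast+
  then show "g \<in> fibre L (mu L f)" using native_lincomb[OF f, of q 1 1] by (simp add: fibre_def q(2))
next
  fix g assume "g \<in> fibre L (mu L f)"
  then have g: "g \<in> native_space L" "mu L g = mu L f" by (simp_all add: fibre_def)
  have "g - f \<in> native_space L" "mu L (g - f) = 0" using native_lincomb[OF g(1) f, of 1 "- 1"] g(2) by simp_all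
  then have "g - f \<in> null_space L" using mu_zero_iff by blast
  then show "g \<in> coset f (null_space L)" unfolding coset_def by (intro CollectI exI[of _ "g - f"]) simp
qed

lemma fibre_nonempty:
  assumes "mdo_invertible L"
  shows "\<exists>f. f \<in> native_space L \<and> mu L f = \<mu>"
proof -
  obtain f where "mdo L f = mvec \<mu>" using mdo_surjective_measures[OF assms] by blast
  then show ?thesis by (intro exI mu_eqI)
qed

lemma fibre_inj: "mdo_invertible L \<Longrightarrow> fibre L \<mu> = fibre L \<nu> \<Longrightarrow> \<mu> = \<nu>"
  using fibre_nonempty[of L \<mu>] unfolding fibre_def by blast

text \<open>The nontrivial inclusion solves for the second element, which needs \<open>u\<close> to be
  nonzero.\<close>

lemma coset_comb_fibre:
  assumes L: "mdo_invertible L" and u: "0 < u"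
  shows "coset_comb u (fibre L \<alpha>) (fibre L \<beta>) = fibre L ((1 - u) *\<^sub>R \<alpha> + u *\<^sub>R \<beta>)"
proof (intro equalityI subsetI)
  fix h assume "h \<in> coset_comb u (fibre L \<alpha>) (fibre L \<beta>)"
  then obtain a b where ab: "a \<in> fibre L \<alpha>" "b \<in> fibre L \<beta>" "h = (1 - u) *\<^sub>R a + u *\<^sub>R b" unfolding coset_comb_def by blast
  then show "h \<in> fibre L ((1 - u) *\<^sub>R \<alpha> + u *\<^sub>R \<beta>)" using native_lincomb[of a L b "1 - u" u] by (simp add: fibre_def)
next
  fix h assume "h \<in> fibre L ((1 - u) *\<^sub>R \<alpha> + u *\<^sub>R \<beta>)"
  then have h: "h \<in> native_space L" "mu L h = (1 - u) *\<^sub>R \<alpha> + u *\<^sub>R \<beta>" by (simp_all add: fibre_def)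
  obtain a where a: "a \<in> native_space L" "mu L a = \<alpha>" using fibre_nonempty[OF L] by blast
  let ?b = "(1 / u) *\<^sub>R h + (- ((1 - u) / u)) *\<^sub>R a"
  have b: "?b \<in> native_space L" "mu L ?b = (1 / u) *\<^sub>R mu L h + (- ((1 - u) / u)) *\<^sub>R \<alpha>"
    using native_lincomb[OF h(1) a(1), of "1 / u" "- ((1 - u) / u)"] a(2) by simp_all
  have "mu L ?b = (1 / u) *\<^sub>R (mu L h - (1 - u) *\<^sub>R \<alpha>)"
    unfolding b(2) using u by (simp add: scaleR_diff_right)
  then have "?b \<in> fibre L \<beta>" using b(1) u by (simp add: fibre_def h(2))
  moreover have "h = (1 - u) *\<^sub>R a + u *\<^sub>R ?b"
  proof -
    have "u *\<^sub>R ?b = (u * (1 / u)) *\<^sub>R h + (u * (- ((1 - u) / u))) *\<^sub>R a" by (simp only: scaleR_add_right scaleR_scaleR)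
    also have "u * (1 / u) = 1" using u by simp
    also have "u * (- ((1 - u) / u)) = - (1 - u)" using u by simp
    finally have "u *\<^sub>R ?b = h + (- (1 - u)) *\<^sub>R a" by simp
    then show ?thesis by (simp flip: scaleR_add_left)
  qed
  ultimately show "h \<in> coset_comb u (fibre L \<alpha>) (fibre L \<beta>)"
    using a unfolding coset_comb_def fibre_def by blast
qed

text \<open>The operator induces an isomorphism of the quotient with the space of measures.\<close>

lemma extreme_cosets:
  assumes L: "mdo_invertible L" and reg: "\<And>f. reg f = n (mu L f)"
  shows "{E. coset_extreme_point E (quotient_ball L reg)} = fibre L ` {\<mu>. \<mu> extreme_point_of {\<mu>. n \<mu> \<le> 1}}"
proof -
  have ball: "quotient_ball L reg = fibre L ` {\<mu>. n \<mu> \<le> 1}"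
  proof (intro equalityI subsetI)
    fix E assume "E \<in> quotient_ball L reg"
    then obtain f where "E = coset f (null_space L)" "f \<in> native_space L" "reg f \<le> 1" unfolding quotient_ball_def by blast
    then show "E \<in> fibre L ` {\<mu>. n \<mu> \<le> 1}" using coset_fibre[of f L] by (simp add: reg)
  next
    fix E assume "E \<in> fibre L ` {\<mu>. n \<mu> \<le> 1}"
    then obtain \<mu> where \<mu>: "E = fibre L \<mu>" "n \<mu> \<le> 1" by blast
    obtain f where f: "f \<in> native_space L" "mu L f = \<mu>" using fibre_nonempty[OF L] by blast
    then have "E = coset f (null_space L)" "reg f \<le> 1" using coset_fibre[OF f(1)] \<mu> by (simp_all add: reg)
    then show "E \<in> quotient_ball L reg" using f(1) unfolding quotient_ball_def by blast
  qed
  have iff: "coset_extreme_point (fibre L \<mu>) (quotient_ball L reg) \<longleftrightarrow> \<mu> extreme_point_of {\<mu>. n \<mu> \<le> 1}" for \<mu>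
  proof
    assume E: "coset_extreme_point (fibre L \<mu>) (quotient_ball L reg)"
    show "\<mu> extreme_point_of {\<mu>. n \<mu> \<le> 1}"
    proof (rule extreme_pointI)
      have "fibre L \<mu> \<in> fibre L ` {\<mu>. n \<mu> \<le> 1}" using E unfolding coset_extreme_point_def ball by (elim conjE)
      then obtain \<nu> where \<nu>: "fibre L \<mu> = fibre L \<nu>" "\<nu> \<in> {\<mu>. n \<mu> \<le> 1}" by (elim imageE)
      from fibre_inj[OF L \<nu>(1)] \<nu>(2) show "\<mu> \<in> {\<mu>. n \<mu> \<le> 1}" by simp
      fix a b u assume ab: "a \<in> {\<mu>. n \<mu> \<le> 1}" "b \<in> {\<mu>. n \<mu> \<le> 1}" and u: "0 < u" "u < 1" "\<mu> = (1 - u) *\<^sub>R a + u *\<^sub>R b"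
      have "fibre L \<mu> = coset_comb u (fibre L a) (fibre L b)" unfolding u(3) by (rule coset_comb_fibre[OF L u(1), symmetric])
      moreover have "fibre L a \<in> quotient_ball L reg" "fibre L b \<in> quotient_ball L reg" using ab unfolding ball by blast+
      ultimately have "fibre L a = fibre L b" using E u(1,2) unfolding coset_extreme_point_def by blast
      then show "a = b" by (rule fibre_inj[OF L])
    qed
  next
    assume \<mu>: "\<mu> extreme_point_of {\<mu>. n \<mu> \<le> 1}"
    show "coset_extreme_point (fibre L \<mu>) (quotient_ball L reg)"
      unfolding coset_extreme_point_def
    proof (intro conjI ballI notI)
      show "fibre L \<mu> \<in> quotient_ball L reg" using \<mu> unfolding ball extreme_point_of_def by blast
      fix A B assume "A \<in> quotient_ball L reg" "B \<in> quotient_ball L reg"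
      then obtain a b where ab: "a \<in> {\<mu>. n \<mu> \<le> 1}" "b \<in> {\<mu>. n \<mu> \<le> 1}" "A = fibre L a" "B = fibre L b" unfolding ball by blast
      assume "A \<noteq> B \<and> (\<exists>u. 0 < u \<and> u < 1 \<and> fibre L \<mu> = coset_comb u A B)"
      then obtain u where ne: "A \<noteq> B" and u: "0 < u" "u < 1" "fibre L \<mu> = coset_comb u A B" by blast
      have "fibre L \<mu> = fibre L ((1 - u) *\<^sub>R a + u *\<^sub>R b)" using u(3) unfolding ab(3,4) coset_comb_fibre[OF L u(1)] .
      then have eq: "\<mu> = (1 - u) *\<^sub>R a + u *\<^sub>R b" by (rule fibre_inj[OF L])
      show False using extreme_pointD[OF \<mu> ab(1,2) u(1,2) eq] ne ab(3,4) by simp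
    qed
  qed
  show ?thesis
  proof (intro equalityI subsetI)
    fix E assume "E \<in> {E. coset_extreme_point E (quotient_ball L reg)}"
    then have E: "coset_extreme_point E (quotient_ball L reg)" by simp
    then have "E \<in> fibre L ` {\<mu>. n \<mu> \<le> 1}" unfolding coset_extreme_point_def ball by (elim conjE)
    then obtain \<mu> where "E = fibre L \<mu>" by (elim imageE)
    then show "E \<in> fibre L ` {\<mu>. \<mu> extreme_point_of {\<mu>. n \<mu> \<le> 1}}" using E iff[of \<mu>] by simp
  next
    fix E assume "E \<in> fibre L ` {\<mu>. \<mu> extreme_point_of {\<mu>. n \<mu> \<le> 1}}"
    then obtain \<mu> where "E = fibre L \<mu>" "\<mu> extreme_point_of {\<mu>. n \<mu> \<le> 1}" by blast
    then show "E \<in> {E. coset_extreme_point E (quotient_ball L reg)}" using iff[of \<mu>] by simp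
  qed
qed

lemma green_diracs:
  assumes "mdo_invertible L"
  shows "mconv (green L) (odot w (diracs x)) \<in> native_space L \<and> mu L (mconv (green L) (odot w (diracs x))) = diag_dirac w x"
  by (rule mu_eqI) (simp add: mdo_mconv_green[OF assms] mvec_diag_dirac)

lemma green_combination:
  assumes "mdo_invertible L" "q \<in> null_space L"
  shows "(\<Sum>k\<in>K. mconv (green L) (odot (a k) (diracs (x k)))) + q \<in> native_space L \<and>
    mu L ((\<Sum>k\<in>K. mconv (green L) (odot (a k) (diracs (x k)))) + q) = (\<Sum>k\<in>K. diag_dirac (a k) (x k))"
  using assms(2)
  by (intro mu_eqI) (simp add: linear_add[OF mdo_linear] linear_sum[OF mdo_linear] mdo_mconv_green[OF assms(1)]
      linear_sum[OF mvec_linear] mvec_diag_dirac null_space_def)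

lemma vec_dirac_odot: "vec_dirac w x = odot w (diracs (\<chi> d. x))"
  by (simp add: vec_dirac_def odot_def diracs_def)

lemma vdirac_diag: "vdirac w x = diag_dirac w (\<chi> d. x)"
  by (simp add: vdirac_def diag_dirac_def)

section \<open>Regularisers\<close>

lemma inner_reg_mu: "inner_reg L W f = inner_norm W (mu L f)"
  by (simp add: inner_reg_def mu_def)

lemma outer_reg_mu: "outer_reg L W f = outer_norm W (mu L f)"
  by (simp add: outer_reg_def mu_def)

lemma seminorm_on_native:
  assumes n: "norm_on UNIV n"
  shows "seminorm_on (native_space L) (\<lambda>f. n (mu L f))"
  unfolding seminorm_on_def
proof (intro conjI ballI allI native_subspace norm_onD(3)[OF n])
  fix f h :: "distr ^ 'a" and c assume f: "f \<in> native_space L"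
  show "n (mu L (c *\<^sub>R f)) = \<bar>c\<bar> * n (mu L f)"
    using native_lincomb[OF f f, of c 0] by (simp add: norm_onD(2)[OF n])
  assume h: "h \<in> native_space L"
  show "n (mu L (f + h)) \<le> n (mu L f) + n (mu L h)"
    using native_lincomb[OF f h, of 1 1] norm_onD(1)[OF n] by simp
qed

text \<open>All norms are compared with the outer \<open>l1\<close> norm of the measure.\<close>

lemma regularisers_equivalent:
  fixes L :: "real poly ^ 'd ^ 'd"
  defines "R \<equiv> {outer_reg L (dual_norm W) | W. monotone_norm W} \<union> {inner_reg L (dual_norm W) | W. monotone_norm W}"
  shows "r \<in> R \<Longrightarrow> seminorm_on (native_space L) r"
    and "r \<in> R \<Longrightarrow> s \<in> R \<Longrightarrow> equivalent_on (native_space L) r s"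
proof -
  have R: "\<exists>n. r = (\<lambda>f. n (mu L f)) \<and> norm_on UNIV n \<and>
      (\<exists>c>0. \<exists>C>0. \<forall>\<mu>. c * outer_norm l1_norm \<mu> \<le> n \<mu> \<and> n \<mu> \<le> C * outer_norm l1_norm \<mu>)" if r: "r \<in> R" for r
  proof -
    from r obtain W where "monotone_norm W" "r = outer_reg L (dual_norm W) \<or> r = inner_reg L (dual_norm W)"
      unfolding R_def by blast
    then have W: "monotone_norm (dual_norm W)" "r = (\<lambda>f. outer_norm (dual_norm W) (mu L f)) \<or> r = (\<lambda>f. inner_norm (dual_norm W) (mu L f))"
      by (simp_all add: monotone_dual_norm fun_eq_iff outer_reg_mu inner_reg_mu)
    note W' = monotone_norm_norm_on[OF W(1)]
    from W(2) show ?thesis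
    proof
      assume "r = (\<lambda>f. outer_norm (dual_norm W) (mu L f))"
      then show ?thesis using norm_on_outer_norm[OF W(1)] outer_norm_comparable[OF W'] by blast
    next
      assume "r = (\<lambda>f. inner_norm (dual_norm W) (mu L f))"
      then show ?thesis using norm_on_inner_norm[OF W'] inner_norm_comparable[OF W'] by blast
    qed
  qed
  show "seminorm_on (native_space L) r" if "r \<in> R" using R[OF that] seminorm_on_native by blast
  show "equivalent_on (native_space L) r s" if rR: "r \<in> R" and sR: "s \<in> R"
  proof -
    obtain n c C where r: "r = (\<lambda>f. n (mu L f))" "0 < c" "0 < C"
      "\<And>\<mu>. c * outer_norm l1_norm \<mu> \<le> n \<mu>" "\<And>\<mu>. n \<mu> \<le> C * outer_norm l1_norm \<mu>" using R[OF rR] by blast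
    obtain m b B where s: "s = (\<lambda>f. m (mu L f))" "0 < b" "0 < B"
      "\<And>\<mu>. b * outer_norm l1_norm \<mu> \<le> m \<mu>" "\<And>\<mu>. m \<mu> \<le> B * outer_norm l1_norm \<mu>" using R[OF sR] by blast
    have "b / C * n \<mu> \<le> m \<mu>" for \<mu>
    proof -
      have "b / C * n \<mu> \<le> b / C * (C * outer_norm l1_norm \<mu>)" using r s by (intro mult_left_mono) simp_all
      then show ?thesis using s(4)[of \<mu>] r(3) by simp
    qed
    moreover have "m \<mu> \<le> B / c * n \<mu>" for \<mu>
    proof -
      have "B / c * (c * outer_norm l1_norm \<mu>) \<le> B / c * n \<mu>" using r s by (intro mult_left_mono) simp_all
      then show ?thesis using s(5)[of \<mu>] r(2) by simp
    qed
    moreover have "0 < b / C" "0 < B / c" using r s by simp_all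
    ultimately show ?thesis unfolding equivalent_on_def r(1) s(1) by blast
  qed
qed

lemma image_parametrised: "f ` {\<mu>. \<exists>w x. \<mu> = g w x \<and> P w} = {f (g w x) | w x. P w}"
  by blast

lemma native_dual_items:
  assumes "native_dual L Y p \<phi> n s" and reg: "reg = (\<lambda>f. n (mu L f))"
  shows "banach_on (native_space L) (native_norm L \<phi> Y reg)"
    and "is_dual_of_functionals (native_space L) (native_norm L \<phi> Y reg)
      (predual_space (null_dim L) (predual_elem L \<phi>)) (predual_norm (null_dim L) (predual_elem L \<phi>) Y s)"
    and "inj_on (\<lambda>(v, a). predual_dist L \<phi> v a) (C0 \<times> tuples (null_dim L)) \<Longrightarrow>
      is_dual_of_distributions (native_space L) (native_norm L \<phi> Y reg)
      (predual_space (null_dim L) (predual_dist L \<phi>)) (predual_norm (null_dim L) (predual_dist L \<phi>) Y s)"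
proof -
  interpret native_dual L Y p \<phi> n s by (rule assms(1))
  show "banach_on (native_space L) (native_norm L \<phi> Y reg)"
    using banach_native unfolding native_def reg .
  show "is_dual_of_functionals (native_space L) (native_norm L \<phi> Y reg)
      (predual_space (null_dim L) (predual_elem L \<phi>)) (predual_norm (null_dim L) (predual_elem L \<phi>) Y s)"
    using dual_of_functionals unfolding native_def reg .
  show "is_dual_of_distributions (native_space L) (native_norm L \<phi> Y reg)
      (predual_space (null_dim L) (predual_dist L \<phi>)) (predual_norm (null_dim L) (predual_dist L \<phi>) Y s)"
    if "inj_on (\<lambda>(v, a). predual_dist L \<phi> v a) (C0 \<times> tuples (null_dim L))"
    using dual_of_distributions[OF that] unfolding native_def reg .
qed

theorem theorem2:
  fixes L :: "real poly ^ 'd ^ 'd"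
    and Z :: "real ^ 'd \<Rightarrow> real"
    and Y :: "(nat \<Rightarrow> real) \<Rightarrow> real"
    and p :: "nat \<Rightarrow> distr ^ 'd"
    and \<phi> :: "nat \<Rightarrow> test ^ 'd"
  assumes "mdo_invertible L"
    and "monotone_norm Z"
    and "fun_norm_on (tuples (null_dim L)) Y"
    and "admissible L p \<phi>"
  shows
    \<comment> \<open>item 1\<close>
    "(banach_on (native_space L) (native_norm L \<phi> Y (inner_reg L (dual_norm Z))) \<and>
      banach_on (native_space L) (native_norm L \<phi> Y (outer_reg L (dual_norm Z))))
    \<and> \<comment> \<open>item 2\<close>
     (is_dual_of_functionals
        (native_space L) (native_norm L \<phi> Y (inner_reg L (dual_norm Z)))
        (predual_space (null_dim L) (predual_elem L \<phi>))
        (predual_norm (null_dim L) (predual_elem L \<phi>) Y (sup_inner Z)) \<and>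
      is_dual_of_functionals
        (native_space L) (native_norm L \<phi> Y (outer_reg L (dual_norm Z)))
        (predual_space (null_dim L) (predual_elem L \<phi>))
        (predual_norm (null_dim L) (predual_elem L \<phi>) Y (sup_outer Z)) \<and>
      (inj_on (\<lambda>(v, a). predual_dist L \<phi> v a) (C0 \<times> tuples (null_dim L)) \<longrightarrow>
        is_dual_of_distributions
          (native_space L) (native_norm L \<phi> Y (inner_reg L (dual_norm Z)))
          (predual_space (null_dim L) (predual_dist L \<phi>))
          (predual_norm (null_dim L) (predual_dist L \<phi>) Y (sup_inner Z)) \<and>
        is_dual_of_distributions
          (native_space L) (native_norm L \<phi> Y (outer_reg L (dual_norm Z)))
          (predual_space (null_dim L) (predual_dist L \<phi>))
          (predual_norm (null_dim L) (predual_dist L \<phi>) Y (sup_outer Z))))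
    \<and> \<comment> \<open>item 3\<close>
     ((let R = {outer_reg L (dual_norm W) | W. monotone_norm W} \<union>
               {inner_reg L (dual_norm W) | W. monotone_norm W}
       in (\<forall>r\<in>R. seminorm_on (native_space L) r) \<and>
          (\<forall>r\<in>R. \<forall>s\<in>R. equivalent_on (native_space L) r s)) \<and>
      (\<forall>f\<in>native_space L. inner_reg L l1_norm f = outer_reg L l1_norm f))
    \<and> \<comment> \<open>item 4\<close>
     ({E. coset_extreme_point E (quotient_ball L (outer_reg L (dual_norm Z)))} =
        {coset (mconv (green L) (odot w (diracs x))) (null_space L) | w x.
           w extreme_point_of {u. dual_norm Z u \<le> 1} \<and> dual_norm Z w = 1} \<and>
      (\<forall>K a x q f. q \<in> null_space L \<longrightarrow>
         (\<forall>k\<in>{1..K::nat}. \<forall>k'\<in>{1..K}. k \<noteq> k' \<longrightarrow> (\<forall>d. x k $ d \<noteq> x k' $ d)) \<longrightarrow>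
         f = (\<Sum>k=1..K. mconv (green L) (odot (a k) (diracs (x k)))) + q \<longrightarrow>
         f \<in> native_space L \<and>
         outer_reg L (dual_norm Z) f = dual_norm Z (\<chi> d. \<Sum>k=1..K. \<bar>a k $ d\<bar>)))
    \<and> \<comment> \<open>item 5\<close>
     ({E. coset_extreme_point E (quotient_ball L (inner_reg L (dual_norm Z)))} =
        {coset (mconv (green L) (vec_dirac w x)) (null_space L) | w x.
           w extreme_point_of {u. dual_norm Z u \<le> 1} \<and> dual_norm Z w = 1} \<and>
      (\<forall>K a x q f. q \<in> null_space L \<longrightarrow>
         (\<forall>k\<in>{1..K::nat}. \<forall>k'\<in>{1..K}. k \<noteq> k' \<longrightarrow> x k \<noteq> x k') \<longrightarrow>
         f = (\<Sum>k=1..K. mconv (green L) (vec_dirac (a k) (x k))) + q \<longrightarrow>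
         f \<in> native_space L \<and>
         inner_reg L (dual_norm Z) f = (\<Sum>k=1..K. dual_norm Z (a k))))"
proof -
  note Z = monotone_norm_norm_on[OF assms(2)] and W = monotone_dual_norm[OF assms(2)]
  note W' = monotone_norm_norm_on[OF W]
  have nat: "native L Y p \<phi>" using assms by (simp add: native_def native_axioms_def tuple_norm_def)
  have "native_dual L Y p \<phi> (inner_norm (dual_norm Z)) (sup_inner Z)"
    by (intro native_dual.intro native_dual_axioms.intro nat dual_pair_inner Z)
  note inner = native_dual_items[OF this ext[OF inner_reg_mu]]
  have "native_dual L Y p \<phi> (outer_norm (dual_norm Z)) (sup_outer Z)"
    by (intro native_dual.intro native_dual_axioms.intro nat dual_pair_outer assms(2))
  note outer = native_dual_items[OF this ext[OF outer_reg_mu]]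
  note green = green_diracs[OF assms(1)]
  have coset_green: "coset (mconv (green L) (odot w (diracs x))) (null_space L) = fibre L (diag_dirac w x)" for w x
    using coset_fibre[of "mconv (green L) (odot w (diracs x))" L] green[of w x] by simp
  have extreme_outer: "{E. coset_extreme_point E (quotient_ball L (outer_reg L (dual_norm Z)))} =
      {coset (mconv (green L) (odot w (diracs x))) (null_space L) | w x.
         w extreme_point_of {u. dual_norm Z u \<le> 1} \<and> dual_norm Z w = 1}"
    unfolding extreme_cosets[of L "outer_reg L (dual_norm Z)" "outer_norm (dual_norm Z)", OF assms(1) outer_reg_mu]
      extreme_points_outer_ball[OF W] coset_green by (rule image_parametrised)
  have extreme_inner: "{E. coset_extreme_point E (quotient_ball L (inner_reg L (dual_norm Z)))} =
      {coset (mconv (green L) (vec_dirac w x)) (null_space L) | w x.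
         w extreme_point_of {u. dual_norm Z u \<le> 1} \<and> dual_norm Z w = 1}"
    unfolding extreme_cosets[of L "inner_reg L (dual_norm Z)" "inner_norm (dual_norm Z)", OF assms(1) inner_reg_mu]
      extreme_points_inner_ball[OF W'] vec_dirac_odot coset_green vdirac_diag by (rule image_parametrised)
  have distributions: "inj_on (\<lambda>(v, a). predual_dist L \<phi> v a) (C0 \<times> tuples (null_dim L)) \<longrightarrow>
        is_dual_of_distributions
          (native_space L) (native_norm L \<phi> Y (inner_reg L (dual_norm Z)))
          (predual_space (null_dim L) (predual_dist L \<phi>))
          (predual_norm (null_dim L) (predual_dist L \<phi>) Y (sup_inner Z)) \<and>
        is_dual_of_distributions
          (native_space L) (native_norm L \<phi> Y (outer_reg L (dual_norm Z)))
          (predual_space (null_dim L) (predual_dist L \<phi>))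
          (predual_norm (null_dim L) (predual_dist L \<phi>) Y (sup_outer Z))"
    by (intro impI conjI inner(3) outer(3))
  have norm_outer: "\<forall>K a x q f. q \<in> null_space L \<longrightarrow>
         (\<forall>k\<in>{1..K::nat}. \<forall>k'\<in>{1..K}. k \<noteq> k' \<longrightarrow> (\<forall>d. x k $ d \<noteq> x k' $ d)) \<longrightarrow>
         f = (\<Sum>k=1..K. mconv (green L) (odot (a k) (diracs (x k)))) + q \<longrightarrow>
         f \<in> native_space L \<and>
         outer_reg L (dual_norm Z) f = dual_norm Z (\<chi> d. \<Sum>k=1..K. \<bar>a k $ d\<bar>)"
  proof (intro allI impI)
    fix K a x q f
    assume q: "q \<in> null_space L" and x: "\<forall>k\<in>{1..K::nat}. \<forall>k'\<in>{1..K}. k \<noteq> k' \<longrightarrow> (\<forall>d. x k $ d \<noteq> x k' $ d)"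
      and f: "f = (\<Sum>k=1..K. mconv (green L) (odot (a k) (diracs (x k)))) + q"
    note fm = green_combination[OF assms(1) q, where K = "{1..K}" and a = a and x = x, folded f]
    have "inj_on (\<lambda>k. x k $ d) {1..K}" for d using x unfolding inj_on_def by blast
    then have "tv_norm ((\<Sum>k=1..K. diag_dirac (a k) (x k)) $ d) = (\<Sum>k=1..K. \<bar>a k $ d\<bar>)" for d
      by (simp add: diag_dirac_def tv_norm_discrete)
    then show "f \<in> native_space L \<and> outer_reg L (dual_norm Z) f = dual_norm Z (\<chi> d. \<Sum>k=1..K. \<bar>a k $ d\<bar>)"
      using fm by (simp add: outer_reg_mu outer_norm_def)
  qed
  have norm_inner: "\<forall>K a x q f. q \<in> null_space L \<longrightarrow>
         (\<forall>k\<in>{1..K::nat}. \<forall>k'\<in>{1..K}. k \<noteq> k' \<longrightarrow> x k \<noteq> x k') \<longrightarrow>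
         f = (\<Sum>k=1..K. mconv (green L) (vec_dirac (a k) (x k))) + q \<longrightarrow>
         f \<in> native_space L \<and>
         inner_reg L (dual_norm Z) f = (\<Sum>k=1..K. dual_norm Z (a k))"
  proof (intro allI impI)
    fix K a x q f
    assume q: "q \<in> null_space L" and x: "\<forall>k\<in>{1..K::nat}. \<forall>k'\<in>{1..K}. k \<noteq> k' \<longrightarrow> x k \<noteq> x k'"
      and f: "f = (\<Sum>k=1..K. mconv (green L) (vec_dirac (a k) (x k))) + q"
    note fm = green_combination[OF assms(1) q, where K = "{1..K}" and a = a and x = "\<lambda>k. \<chi> d. x k", folded vec_dirac_odot vdirac_diag, folded f]
    have "inj_on x {1..K}" using x unfolding inj_on_def by blast
    then show "f \<in> native_space L \<and> inner_reg L (dual_norm Z) f = (\<Sum>k=1..K. dual_norm Z (a k))"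
      using fm inner_norm_discrete[OF W', of "{1..K}" x a] by (simp add: inner_reg_mu)
  qed
  have equivalent: "let R = {outer_reg L (dual_norm W) | W. monotone_norm W} \<union> {inner_reg L (dual_norm W) | W. monotone_norm W}
      in (\<forall>r\<in>R. seminorm_on (native_space L) r) \<and> (\<forall>r\<in>R. \<forall>s\<in>R. equivalent_on (native_space L) r s)"
    unfolding Let_def by (intro conjI ballI; rule regularisers_equivalent; assumption)
  have l1: "\<forall>f\<in>native_space L. inner_reg L l1_norm f = outer_reg L l1_norm f"
    by (simp add: inner_reg_mu outer_reg_mu inner_norm_l1)
  show ?thesis
    by (intro conjI inner(1,2) outer(1,2) distributions equivalent l1 extreme_outer norm_outer extreme_inner norm_inner)
qed

end
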